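(* Let $\mu\subset\lambda$ and $\nu$ be partitions, and let $r\ge\ell(\lambda)$ and $s\ge\ell(\mu)$ be integers. Then $$s_\nu(x)\,G_{\lambda/\!\!/\mu}(x)\equiv G_{/\!\!/}\bigl(s_\nu(\boldsymbol u_r/\boldsymbol U_s)\cdot(\lambda,\mu)\bigr)\mod I_{r-s}.$$ In other words, for every integer $0\le n\le r-s$, $$s_\nu(x_1,\dots,x_n)\,G_{\lambda/\!\!/\mu}(x_1,\dots,x_n)=G_{/\!\!/}\bigl(s_\nu(\boldsymbol u_r/\boldsymbol U_s)\cdot(\lambda,\mu)\bigr)\Big|_{x_{n+1}=x_{n+2}=\cdots=0}.$$
   Context: Symmetric functions. $k=\mathbb{C}(\beta)$; $\Lambda$ is the $k$-algebra of symmetric functions in $x=(x_1,x_2,\dots)$, with Schur functions $s_\lambda$ and Hall inner product $\langle s_\lambda,s_\mu\rangle=\delta_{\lambda,\mu}$. $I_n=\mathrm{span}_k\{s_\lambda:\ell(\lambda)>n\}$ and $\widehat\Lambda=\varprojlim\Lambda/I_n$; elements of $\widehat\Lambda$ are formal sums $\sum c_\lambda s_\lambda$ such that for every $n$ only finitely many $\lambda$ with $\ell(\lambda)\le n$ have $c_\lambda\neq0$. $I_n$ also denotes its closure in $\widehat\Lambda$, i.e. the set of $f$ with $f(x_1,\dots,x_n,0,0,\dots)=0$ (all of $\widehat\Lambda$ if $n<0$). The Hall product extends to $\widehat\Lambda\times\Lambda\to k$. For $f\in\Lambda$, $f^\perp:\widehat\Lambda\to\widehat\Lambda$ is defined by $\langle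 f^\perp g,h\rangle=\langle g,fh\rangle$ for all $h\in\Lambda$. The stable Grothendieck polynomial $G_\lambda(x)\in\widehat\Lambda$ is the unique element such that for all $n\ge\ell(\lambda)$, $G_\lambda(x_1,\dots,x_n,0,0,\dots)=\det\bigl(x_i^{\lambda_j+n-j}(1+\beta x_i)^{j-1}\bigr)_{1\le i,j\le n}/\prod_{1\le i<j\le n}(x_i-x_j)$. The dual stable Grothendieck polynomials $g_\mu\in\Lambda$ are determined by $\langle G_\lambda,g_\mu\rangle=\delta_{\lambda,\mu}$, and $G_{\lambda/\!\!/\mu}=g_\mu^\perp G_\lambda$. Operators. For a finite integer sequence $n=(n_1,\dots,n_r)$ put $|n|=\sum n_i$, $\overline n_i=\max(n_i,n_{i+1},\dots,n_r)$, $\underline n_i=\min(n_1,\dots,n_i)$. $\mathbf e_i$ is the $i$-th unit vector. On the free $\mathbb Q[\beta]$-module on partitions (padded with zeros as needed) define linear operators $u_i\cdot\lambda=(-\beta)^{|\overline{\lambda+\mathbf e_i}|-|\lambda+\mathbf e_i|}\,\overline{\lambda+\mathbf e_i}$, and $U_i\cdot\mu=(-\beta)^{|\mu-\mathbf e_i|-|\underline{\mu-\mathbf e_i}|}\,\underline{\mu-\mathbf e_i}$ if $\mu_i>0$, $U_i\cdot\mu=0$ if $\mu_i=0$. They act on the module $\bigoplus_{\mu\subset\lambda}\mathbb Q[\beta]\cdot(\lambda,\mu)$ by $u_i\cdot(\lambda,\mu)=(u_i\cdot\lambda,\mu)$, $U_i\cdot(\lambda,\mu)=(\lambda,U_i\cdot\mu)$.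 $G_{/\!\!/}$ is the $\mathbb Q[\beta]$-linear map from this module to $\widehat\Lambda$ with $(\lambda,\mu)\mapsto G_{\lambda/\!\!/\mu}(x)$. Noncommutative Schur functions. The column word of a skew semistandard tableau $T$ (rows weakly increasing left to right, columns strictly increasing top to bottom) is obtained by reading each column bottom to top, columns from left to right. $s_{\kappa/\rho}(\boldsymbol u_m)=\sum_T u_{w_1}u_{w_2}\cdots u_{w_N}$, over skew semistandard tableaux $T$ of shape $\kappa/\rho$ with entries in $\{1<2<\dots<m\}$ and column word $w_1\cdots w_N$. $s_{\kappa/\rho}(\boldsymbol U_n)=\sum_{T'} U_{w_1}\cdots U_{w_N}$, over skew semistandard tableaux $T'$ of shape $\kappa/\rho$ with entries in $\{1',\dots,n'\}$ ordered by $1'>2'>\dots>n'$ and column word $w_1'\cdots w_N'$. Finally $s_\nu(\boldsymbol u_m/\boldsymbol U_n)=\sum_{\kappa\subset\nu}(-1)^{|\nu/\kappa|}\,s_{(\nu/\kappa)'}(\boldsymbol U_n)\,s_\kappa(\boldsymbol u_m)$, where $(\nu/\kappa)'$ is the transposed skew shape. *)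

theory Defs
  imports
    "HOL-Library.Multiset"
    "HOL-Library.FuncSet"
    "HOL-Library.Poly_Mapping"
    "HOL-Computational_Algebra.Polynomial"
    "HOL-Computational_Algebra.Fraction_Field"
    "Jordan_Normal_Form.Determinant"
begin

section \<open>Power series in countably many variables\<close>

text \<open>A monomial \<open>x\<^sub>i \<cdots> x\<^sub>j\<close> is the multiset of the indices of its variables. All indices
  (variables, rows, columns, tableau entries) start at 0, so \<open>i\<close> here is \<open>i + 1\<close> in the
  customary notation.\<close>

typedef 'a mfps = "UNIV :: (nat multiset \<Rightarrow> 'a) set"
  morphisms mcoeff Abs_mfps
  by simp

lemma mcoeff_Abs [simp]: "mcoeff (Abs_mfps f) = f"
  by (simp add: Abs_mfps_inverse)

lemma mfps_eqI: "(\<And>m. mcoeff f m = mcoeff g m) \<Longrightarrow> f = g"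
  by (metis ext mcoeff_inject)

lemma finite_submultisets: "finite {a. a \<subseteq># (m :: 'b multiset)}"
proof (induction m)
  case empty
  then show ?case by simp
next
  case (add x m)
  have "a \<in> {a. a \<subseteq># m} \<union> add_mset x ` {a. a \<subseteq># m}" if "a \<subseteq># add_mset x m" for a
  proof (cases "x \<in># a")
    case True
    then obtain b where b: "a = add_mset x b" by (metis insert_DiffM)
    with that have "b \<subseteq># m" by simp
    with b show ?thesis by blast
  next
    case False
    have "count a y \<le> count m y" for y
      using mset_subset_eq_count[OF that, of y] False by (cases "y = x") (simp_all add: not_in_iff)
    then have "a \<subseteq># m" by (rule mset_subset_eqI)
    then show ?thesis by blast
  qed
  then have "{a. a \<subseteq># add_mset x m} \<subseteq> {a. a \<subseteq># m} \<union> add_mset x ` {a. a \<subseteq># m}"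
    by blast
  with add show ?case by (metis finite_UnI finite_imageI finite_subset)
qed

lemma finite_msplits [simp]: "finite {(a, b). a + b = (m :: 'b multiset)}"
proof (rule finite_subset)
  show "{(a, b). a + b = m} \<subseteq> (\<lambda>a. (a, m - a)) ` {a. a \<subseteq># m}" by auto
  show "finite ((\<lambda>a. (a, m - a)) ` {a. a \<subseteq># m})" by (simp add: finite_submultisets)
qed

instantiation mfps :: (comm_ring_1) comm_ring_1
begin

definition "0 = Abs_mfps (\<lambda>m. 0)"
definition "1 = Abs_mfps (\<lambda>m. if m = {#} then 1 else 0)"
definition "f + g = Abs_mfps (\<lambda>m. mcoeff f m + mcoeff g m)"
definition "- f = Abs_mfps (\<lambda>m. - mcoeff f m)"
definition "f - g = Abs_mfps (\<lambda>m. mcoeff f m - mcoeff g m)"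
definition "f * g = Abs_mfps (\<lambda>m. \<Sum>(a, b) \<in> {(a, b). a + b = m}. mcoeff f a * mcoeff g b)"

instance
proof
  fix f g h :: "'a mfps"
  show "f + g + h = f + (g + h)" "f + g = g + f" "0 + f = f" "- f + f = 0" "f - g = f + - g"
    by (simp_all add: plus_mfps_def zero_mfps_def uminus_mfps_def minus_mfps_def algebra_simps
        mcoeff_inverse)
  show "f * g = g * f"
    unfolding times_mfps_def
    by (intro arg_cong[where f = Abs_mfps] ext sum.reindex_bij_witness[of _ prod.swap prod.swap])
      (auto simp: ac_simps)
  show "(f + g) * h = f * h + g * h"
    by (simp add: times_mfps_def plus_mfps_def distrib_right sum.distrib case_prod_unfold)
  show "1 * f = f"
  proof (rule mfps_eqI)
    fix m
    have "mcoeff (1 * f) m = (\<Sum>p\<in>{(a, b). a + b = m}. if p = ({#}, m) then mcoeff f m else 0)"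
      unfolding times_mfps_def one_mfps_def mcoeff_Abs
      by (rule sum.cong) (auto split: if_splits)
    also have "\<dots> = mcoeff f m" by (subst sum.delta) auto
    finally show "mcoeff (1 * f) m = mcoeff f m" .
  qed
  show "f * g * h = f * (g * h)"
  proof (rule mfps_eqI)
    fix m
    have "mcoeff (f * g * h) m =
        (\<Sum>(p, c)\<in>{(p, c). p + c = m}. \<Sum>(a, b)\<in>{(a, b). a + b = p}.
           mcoeff f a * (mcoeff g b * mcoeff h c))"
      by (simp add: times_mfps_def sum_distrib_right case_prod_unfold mult.assoc)
    also have "\<dots> = (\<Sum>((p, c), (a, b))\<in>Sigma {(p, c). p + c = m} (\<lambda>(p, c). {(a, b). a + b = p}).
           mcoeff f a * (mcoeff g b * mcoeff h c))"
      by (subst sum.Sigma[symmetric]) (use finite_msplits in \<open>auto simp: case_prod_unfold\<close>)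
    also have "\<dots> = (\<Sum>((a, q), (b, c))\<in>Sigma {(a, q). a + q = m} (\<lambda>(a, q). {(b, c). b + c = q}).
           mcoeff f a * (mcoeff g b * mcoeff h c))"
      by (rule sum.reindex_bij_witness[of _
            "\<lambda>((a, q), (b, c)). ((a + b, c), (a, b))" "\<lambda>((p, c), (a, b)). ((a, b + c), (b, c))"])
        (auto simp: add.assoc)
    also have "\<dots> = (\<Sum>(a, q)\<in>{(a, q). a + q = m}. \<Sum>(b, c)\<in>{(b, c). b + c = q}.
           mcoeff f a * (mcoeff g b * mcoeff h c))"
      by (subst sum.Sigma[symmetric]) (use finite_msplits in \<open>auto simp: case_prod_unfold\<close>)
    also have "\<dots> = mcoeff (f * (g * h)) m"
      by (simp add: times_mfps_def sum_distrib_left case_prod_unfold)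
    finally show "mcoeff (f * g * h) m = mcoeff (f * (g * h)) m" .
  qed
  show "(0 :: 'a mfps) \<noteq> 1"
  proof
    assume "(0 :: 'a mfps) = 1"
    then have "mcoeff (0 :: 'a mfps) {#} = mcoeff 1 {#}" by simp
    then show False by (simp add: zero_mfps_def one_mfps_def)
  qed
qed

end

definition mconst :: "'a \<Rightarrow> 'a::comm_ring_1 mfps" where
  "mconst c = Abs_mfps (\<lambda>m. if m = {#} then c else 0)"

definition mvar :: "nat \<Rightarrow> 'a::comm_ring_1 mfps" where
  "mvar i = Abs_mfps (\<lambda>m. if m = {#i#} then 1 else 0)"

text \<open>\<open>f(x\<^sub>1, \<dots>, x\<^sub>n, 0, 0, \<dots>)\<close>\<close>

definition restrict_vars :: "nat \<Rightarrow> 'a::comm_ring_1 mfps \<Rightarrow> 'a mfps" where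
  "restrict_vars n f = Abs_mfps (\<lambda>m. if set_mset m \<subseteq> {..<n} then mcoeff f m else 0)"


section \<open>Partitions\<close>

text \<open>A partition is an infinite, weakly decreasing, eventually zero sequence; in particular it is
  always padded with zeros.\<close>

typedef partition = "{l :: nat \<Rightarrow> nat. antimono l \<and> finite {i. l i \<noteq> 0}}"
  morphisms part Abs_partition
  by (rule exI[of _ "\<lambda>_. 0"]) (simp add: monotone_def)

definition empty_part :: partition where
  "empty_part = Abs_partition (\<lambda>_. 0)"

definition seq_size :: "(nat \<Rightarrow> nat) \<Rightarrow> nat" where
  "seq_size l = (\<Sum>i | l i \<noteq> 0. l i)"

abbreviation part_size :: "partition \<Rightarrow> nat" where
  "part_size lam \<equiv> seq_size (part lam)"

definition part_length :: "partition \<Rightarrow> nat" where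
  "part_length lam = card {i. part lam i \<noteq> 0}"

definition part_le :: "partition \<Rightarrow> partition \<Rightarrow> bool" where
  "part_le \<mu> lam \<longleftrightarrow> (\<forall>i. part \<mu> i \<le> part lam i)"

definition conj_part :: "partition \<Rightarrow> partition" where
  "conj_part lam = Abs_partition (\<lambda>j. card {i. j < part lam i})"

lemma antimono_part: "antimono (part lam)" and finite_part: "finite {i. part lam i \<noteq> 0}"
  using part[of lam] by auto

lemma part_empty_part [simp]: "part empty_part = (\<lambda>_. 0)"
  by (simp add: empty_part_def Abs_partition_inverse monotone_def)

lemma part_conj_part: "part (conj_part lam) = (\<lambda>j. card {i. j < part lam i})"
proof -
  have fin: "finite {i. j < part lam i}" for j
    by (rule finite_subset[OF _ finite_part[of lam]]) auto
  have "antimono (\<lambda>j. card {i. j < part lam i})"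
    by (intro antimonoI card_mono fin) auto
  moreover have "{j. card {i. j < part lam i} \<noteq> 0} \<subseteq> {..<part lam 0}"
  proof
    fix j assume "j \<in> {j. card {i. j < part lam i} \<noteq> 0}"
    then obtain i where "j < part lam i" by (auto simp: card_eq_0_iff)
    also have "part lam i \<le> part lam 0" by (rule antimonoD[OF antimono_part]) simp
    finally show "j \<in> {..<part lam 0}" by simp
  qed
  ultimately show ?thesis
    unfolding conj_part_def
    by (intro Abs_partition_inverse) (auto intro: finite_subset)
qed


section \<open>Skew semistandard tableaux\<close>

definition skew_cells :: "partition \<Rightarrow> partition \<Rightarrow> (nat \<times> nat) set" where
  "skew_cells \<kappa> \<rho> = {(i, j). part \<rho> i \<le> j \<and> j < part \<kappa> i}"

text \<open>Semistandard tableaux with entries in \<open>A\<close> with respect to the strict total order \<open>lt\<close>.\<close>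

definition ssyt ::
  "(nat \<Rightarrow> nat \<Rightarrow> bool) \<Rightarrow> nat set \<Rightarrow> partition \<Rightarrow> partition \<Rightarrow> (nat \<times> nat \<Rightarrow> nat) set" where
  "ssyt lt A \<kappa> \<rho> = {T \<in> skew_cells \<kappa> \<rho> \<rightarrow>\<^sub>E A.
     (\<forall>i j j'. (i, j) \<in> skew_cells \<kappa> \<rho> \<and> (i, j') \<in> skew_cells \<kappa> \<rho> \<and> j < j' \<longrightarrow>
        lt (T (i, j)) (T (i, j')) \<or> T (i, j) = T (i, j')) \<and>
     (\<forall>i i' j. (i, j) \<in> skew_cells \<kappa> \<rho> \<and> (i', j) \<in> skew_cells \<kappa> \<rho> \<and> i < i' \<longrightarrow>
        lt (T (i, j)) (T (i', j)))}"

definition column_word :: "partition \<Rightarrow> partition \<Rightarrow> (nat \<times> nat \<Rightarrow> nat) \<Rightarrow> nat list" where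
  "column_word \<kappa> \<rho> T =
     concat (map (\<lambda>j. map (\<lambda>i. T (i, j))
                        (filter (\<lambda>i. (i, j) \<in> skew_cells \<kappa> \<rho>) (rev [0..<part_length \<kappa>])))
                 [0..<part \<kappa> 0])"


section \<open>Symmetric functions over \<open>\<complex>(\<beta>)\<close> and their completion\<close>

type_synonym ratfun = "complex poly fract"

definition beta :: ratfun where
  "beta = Fract [:0, 1:] 1"

definition schur_fun :: "partition \<Rightarrow> ratfun mfps" where
  "schur_fun lam = Abs_mfps (\<lambda>m. of_nat (card {T \<in> ssyt (<) UNIV lam empty_part.
     image_mset T (mset_set (skew_cells lam empty_part)) = m}))"

definition Sym :: "ratfun mfps set" where
  "Sym = {f. (\<forall>\<pi> m. bij \<pi> \<longrightarrow> mcoeff f (image_mset \<pi> m) = mcoeff f m) \<and>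
             (\<exists>d. \<forall>m. mcoeff f m \<noteq> 0 \<longrightarrow> size m \<le> d)}"

text \<open>\<open>f\<close> is the formal sum of the terms \<open>c lam * schur_fun lam\<close>. As \<open>schur_fun lam\<close> is homogeneous
  of degree \<open>part_size lam\<close>, only the finitely many \<open>lam\<close> of size \<open>size m\<close> contribute to the coefficient
  of the monomial \<open>m\<close>.\<close>

definition schur_expansion :: "ratfun mfps \<Rightarrow> (partition \<Rightarrow> ratfun) \<Rightarrow> bool" where
  "schur_expansion f c \<longleftrightarrow>
     (\<forall>n. finite {lam. part_length lam \<le> n \<and> c lam \<noteq> 0}) \<and>
     (\<forall>m. mcoeff f m = (\<Sum>lam | part_size lam = size m. c lam * mcoeff (schur_fun lam) m))"

definition Sym_hat :: "ratfun mfps set" where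
  "Sym_hat = {f. \<exists>c. schur_expansion f c}"

definition schur_coeff :: "ratfun mfps \<Rightarrow> partition \<Rightarrow> ratfun" where
  "schur_coeff f = (THE c. schur_expansion f c)"

text \<open>The closed ideal \<open>I\<^sub>n\<close> of the completion, for an arbitrary integer \<open>n\<close>.\<close>

definition I_hat :: "int \<Rightarrow> ratfun mfps set" where
  "I_hat n = {f \<in> Sym_hat. 0 \<le> n \<longrightarrow> restrict_vars (nat n) f = 0}"

text \<open>The Hall product, for \<open>f \<in> Sym_hat\<close> and \<open>h \<in> Sym\<close>.\<close>

definition hall :: "ratfun mfps \<Rightarrow> ratfun mfps \<Rightarrow> ratfun" where
  "hall f h = (\<Sum>lam | schur_coeff h lam \<noteq> 0. schur_coeff f lam * schur_coeff h lam)"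

definition perp :: "ratfun mfps \<Rightarrow> ratfun mfps \<Rightarrow> ratfun mfps" where
  "perp f g = (THE p. p \<in> Sym_hat \<and> (\<forall>h\<in>Sym. hall p h = hall g (f * h)))"


section \<open>Grothendieck polynomials\<close>

text \<open>The quotient of alternants is stated in multiplied-out form: both sides are polynomials in
  an integral domain.\<close>

definition Groth :: "partition \<Rightarrow> ratfun mfps" where
  "Groth lam = (THE f. f \<in> Sym_hat \<and>
     (\<forall>n \<ge> part_length lam.
        restrict_vars n f * (\<Prod>j<n. \<Prod>i<j. mvar i - mvar j) =
        det (mat n n (\<lambda>(i, j). mvar i ^ (part lam j + (n - 1 - j)) *
                                  (1 + mconst beta * mvar i) ^ j))))"

definition dual_Groth :: "partition \<Rightarrow> ratfun mfps" where
  "dual_Groth \<mu> = (THE g. g \<in> Sym \<and>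
     (\<forall>lam. hall (Groth lam) g = (if lam = \<mu> then 1 else 0)))"

definition skew_Groth :: "partition \<Rightarrow> partition \<Rightarrow> ratfun mfps" where
  "skew_Groth lam \<mu> = perp (dual_Groth \<mu>) (Groth lam)"


section \<open>The operators\<close>

text \<open>\<open>'b \<Rightarrow>\<^sub>0 rat poly\<close> is the free \<open>\<rat>[\<beta>]\<close>-module with basis \<open>'b\<close>, and \<open>lin_ext f\<close> is the linear
  map with value \<open>f b\<close> at the basis vector \<open>b\<close>.\<close>

definition lin_ext :: "('b \<Rightarrow> ('c \<Rightarrow>\<^sub>0 rat poly)) \<Rightarrow> ('b \<Rightarrow>\<^sub>0 rat poly) \<Rightarrow> ('c \<Rightarrow>\<^sub>0 rat poly)" where
  "lin_ext f v = (\<Sum>b\<in>Poly_Mapping.keys v.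
     Poly_Mapping.map ((*) (Poly_Mapping.lookup v b)) (f b))"

definition basis_vec :: "'b \<Rightarrow> ('b \<Rightarrow>\<^sub>0 rat poly)" where
  "basis_vec b = Poly_Mapping.single b 1"

definition beta0 :: "rat poly" where
  "beta0 = [:0, 1:]"

text \<open>For eventually zero sequences the tail maxima are those of the finite sequence, and the
  prefix minima are zero beyond it.\<close>

definition tail_max :: "(nat \<Rightarrow> nat) \<Rightarrow> nat \<Rightarrow> nat" where
  "tail_max l i = Max (l ` {i..})"

definition prefix_min :: "(nat \<Rightarrow> nat) \<Rightarrow> nat \<Rightarrow> nat" where
  "prefix_min l i = Min (l ` {..i})"

definition u_op :: "nat \<Rightarrow> (partition \<Rightarrow>\<^sub>0 rat poly) \<Rightarrow> (partition \<Rightarrow>\<^sub>0 rat poly)" where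
  "u_op i = lin_ext (\<lambda>lam. let l = (part lam)(i := part lam i + 1) in
     Poly_Mapping.single (Abs_partition (tail_max l)) ((- beta0) ^ (seq_size (tail_max l) - seq_size l)))"

definition U_op :: "nat \<Rightarrow> (partition \<Rightarrow>\<^sub>0 rat poly) \<Rightarrow> (partition \<Rightarrow>\<^sub>0 rat poly)" where
  "U_op i = lin_ext (\<lambda>\<mu>. if part \<mu> i = 0 then 0 else let l = (part \<mu>)(i := part \<mu> i - 1) in
     Poly_Mapping.single (Abs_partition (prefix_min l)) ((- beta0) ^ (seq_size l - seq_size (prefix_min l))))"

text \<open>The exponents above and the applications of \<open>Abs_partition\<close> are not junk:\<close>

lemma part_tail_max:
  fixes l :: "nat \<Rightarrow> nat"
  assumes fin: "finite {i. l i \<noteq> 0}"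
  shows "part (Abs_partition (tail_max l)) = tail_max l" "l i \<le> tail_max l i"
    "seq_size l \<le> seq_size (tail_max l)"
proof -
  have "range l \<subseteq> insert 0 (l ` {i. l i \<noteq> 0})" by auto
  then have "finite (range l)" using fin by (meson finite_imageI finite_insert finite_subset)
  then have fin': "finite (l ` A)" for A by (meson finite_subset image_mono subset_UNIV)
  obtain N where N: "\<And>i. l i \<noteq> 0 \<Longrightarrow> i < N"
    using finite_nat_set_iff_bounded fin by auto
  have ge: "l i \<le> tail_max l i" for i
    unfolding tail_max_def by (rule Max_ge) (auto simp: fin')
  then show "l i \<le> tail_max l i" .
  have anti: "antimono (tail_max l)"
    unfolding tail_max_def by (intro antimonoI Max_mono) (auto simp: fin')
  have sub: "{i. tail_max l i \<noteq> 0} \<subseteq> {..<N}"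
  proof
    fix i assume "i \<in> {i. tail_max l i \<noteq> 0}"
    moreover have "tail_max l i \<in> l ` {i..}"
      unfolding tail_max_def by (rule Max_in) (auto simp: fin')
    ultimately obtain j where "j \<ge> i" "l j \<noteq> 0" by auto
    with N[of j] show "i \<in> {..<N}" by simp
  qed
  then have fin_max: "finite {i. tail_max l i \<noteq> 0}" by (rule finite_subset) simp
  with anti show "part (Abs_partition (tail_max l)) = tail_max l"
    by (intro Abs_partition_inverse) simp
  have "seq_size l \<le> (\<Sum>i | l i \<noteq> 0. tail_max l i)"
    unfolding seq_size_def by (intro sum_mono ge)
  also have "\<dots> \<le> seq_size (tail_max l)"
    unfolding seq_size_def
    by (rule sum_mono2[OF fin_max]) (use ge in \<open>metis (mono_tags) Collect_mono le_zero_eq, simp\<close>)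
  finally show "seq_size l \<le> seq_size (tail_max l)" .
qed

lemma part_prefix_min:
  fixes l :: "nat \<Rightarrow> nat"
  assumes fin: "finite {i. l i \<noteq> 0}"
  shows "part (Abs_partition (prefix_min l)) = prefix_min l" "prefix_min l i \<le> l i"
    "seq_size (prefix_min l) \<le> seq_size l"
proof -
  have le: "prefix_min l i \<le> l i" for i
    unfolding prefix_min_def by (rule Min_le) auto
  then show "prefix_min l i \<le> l i" .
  have anti: "antimono (prefix_min l)"
    unfolding prefix_min_def by (intro antimonoI Min_antimono) auto
  have sub: "{i. prefix_min l i \<noteq> 0} \<subseteq> {i. l i \<noteq> 0}"
    using le by (metis (mono_tags) Collect_mono le_zero_eq)
  then have fin_min: "finite {i. prefix_min l i \<noteq> 0}" using fin by (rule finite_subset)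
  with anti show "part (Abs_partition (prefix_min l)) = prefix_min l"
    by (intro Abs_partition_inverse) simp
  have "seq_size (prefix_min l) \<le> (\<Sum>i | prefix_min l i \<noteq> 0. l i)"
    unfolding seq_size_def by (intro sum_mono le)
  also have "\<dots> \<le> seq_size l"
    unfolding seq_size_def by (rule sum_mono2[OF fin sub]) simp
  finally show "seq_size (prefix_min l) \<le> seq_size l" .
qed

text \<open>The operators on pairs. They preserve the submodule spanned by the pairs \<open>(lam, \<mu>)\<close> with
  \<open>part_le \<mu> lam\<close>, since \<open>u\<^sub>i\<close> enlarges \<open>lam\<close> and \<open>U\<^sub>i\<close> shrinks \<open>\<mu>\<close> (lemmas
  \<open>u_pair_nested\<close> and \<open>U_pair_nested\<close> below); the values on other pairs play no role.\<close>

type_synonym pair_module = "(partition \<times> partition) \<Rightarrow>\<^sub>0 rat poly"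

definition u_pair :: "nat \<Rightarrow> pair_module \<Rightarrow> pair_module" where
  "u_pair i = lin_ext (\<lambda>(lam, \<mu>). lin_ext (\<lambda>\<kappa>. basis_vec (\<kappa>, \<mu>)) (u_op i (basis_vec lam)))"

definition U_pair :: "nat \<Rightarrow> pair_module \<Rightarrow> pair_module" where
  "U_pair i = lin_ext (\<lambda>(lam, \<mu>). lin_ext (\<lambda>\<kappa>. basis_vec (lam, \<kappa>)) (U_op i (basis_vec \<mu>)))"

definition nested_pairs :: "(partition \<times> partition) set" where
  "nested_pairs = {(lam, \<mu>). part_le \<mu> lam}"

lemma keys_lin_ext:
  fixes f :: "'b \<Rightarrow> ('c \<Rightarrow>\<^sub>0 rat poly)"
  shows "Poly_Mapping.keys (lin_ext f v) \<subseteq> (\<Union>b\<in>Poly_Mapping.keys v. Poly_Mapping.keys (f b))"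
proof -
  have "Poly_Mapping.keys (Poly_Mapping.map ((*) c) w) \<subseteq> Poly_Mapping.keys w"
    for c and w :: "'c \<Rightarrow>\<^sub>0 rat poly"
    by transfer auto
  then show ?thesis
    unfolding lin_ext_def by (intro order_trans[OF Poly_Mapping.keys_sum] UN_mono) auto
qed

lemma u_pair_nested:
  assumes "Poly_Mapping.keys v \<subseteq> nested_pairs"
  shows "Poly_Mapping.keys (u_pair i v) \<subseteq> nested_pairs"
proof
  fix p assume "p \<in> Poly_Mapping.keys (u_pair i v)"
  then obtain lam \<mu> \<kappa> where lm: "(lam, \<mu>) \<in> Poly_Mapping.keys v"
    and k: "\<kappa> \<in> Poly_Mapping.keys (u_op i (basis_vec lam))" and p: "p = (\<kappa>, \<mu>)"
  proof -
    from \<open>p \<in> Poly_Mapping.keys (u_pair i v)\<close> obtain b where b: "b \<in> Poly_Mapping.keys v"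
      and p: "p \<in> Poly_Mapping.keys
        ((\<lambda>(lam, \<mu>). lin_ext (\<lambda>\<kappa>. basis_vec (\<kappa>, \<mu>)) (u_op i (basis_vec lam))) b)"
      unfolding u_pair_def by (blast dest: subsetD[OF keys_lin_ext])
    obtain lam \<mu> where [simp]: "b = (lam, \<mu>)" by (cases b)
    from p have "p \<in> Poly_Mapping.keys (lin_ext (\<lambda>\<kappa>. basis_vec (\<kappa>, \<mu>)) (u_op i (basis_vec lam)))"
      by simp
    then obtain \<kappa> where "\<kappa> \<in> Poly_Mapping.keys (u_op i (basis_vec lam))"
      and "p \<in> Poly_Mapping.keys (basis_vec (\<kappa>, \<mu>) :: pair_module)"
      by (blast dest: subsetD[OF keys_lin_ext])
    with that[of lam \<mu> \<kappa>] b show ?thesis by (simp add: basis_vec_def)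
  qed
  define l where "l = (part lam)(i := part lam i + 1)"
  from k have \<kappa>: "\<kappa> = Abs_partition (tail_max l)"
    unfolding u_op_def
    by (auto dest!: subsetD[OF keys_lin_ext] simp: basis_vec_def l_def Let_def split: if_splits)
  have "{j. l j \<noteq> 0} \<subseteq> insert i {j. part lam j \<noteq> 0}" by (auto simp: l_def)
  then have fin: "finite {j. l j \<noteq> 0}" by (rule finite_subset) (use finite_part in \<open>simp del: neq0_conv\<close>)
  have "part_le \<mu> lam" using assms lm by (auto simp: nested_pairs_def)
  moreover have "part lam j \<le> part \<kappa> j" for j
  proof -
    have "part lam j \<le> l j" by (simp add: l_def)
    also have "l j \<le> part \<kappa> j"
      using part_tail_max(2)[OF fin, of j] by (simp add: \<kappa> part_tail_max(1)[OF fin])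
    finally show ?thesis .
  qed
  ultimately show "p \<in> nested_pairs"
    by (auto simp: p nested_pairs_def part_le_def intro: order_trans)
qed

lemma U_pair_nested:
  assumes "Poly_Mapping.keys v \<subseteq> nested_pairs"
  shows "Poly_Mapping.keys (U_pair i v) \<subseteq> nested_pairs"
proof
  fix p assume "p \<in> Poly_Mapping.keys (U_pair i v)"
  then obtain lam \<mu> \<kappa> where lm: "(lam, \<mu>) \<in> Poly_Mapping.keys v"
    and k: "\<kappa> \<in> Poly_Mapping.keys (U_op i (basis_vec \<mu>))" and p: "p = (lam, \<kappa>)"
  proof -
    from \<open>p \<in> Poly_Mapping.keys (U_pair i v)\<close> obtain b where b: "b \<in> Poly_Mapping.keys v"
      and p: "p \<in> Poly_Mapping.keys
        ((\<lambda>(lam, \<mu>). lin_ext (\<lambda>\<kappa>. basis_vec (lam, \<kappa>)) (U_op i (basis_vec \<mu>))) b)"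
      unfolding U_pair_def by (blast dest: subsetD[OF keys_lin_ext])
    obtain lam \<mu> where [simp]: "b = (lam, \<mu>)" by (cases b)
    from p have "p \<in> Poly_Mapping.keys (lin_ext (\<lambda>\<kappa>. basis_vec (lam, \<kappa>)) (U_op i (basis_vec \<mu>)))"
      by simp
    then obtain \<kappa> where "\<kappa> \<in> Poly_Mapping.keys (U_op i (basis_vec \<mu>))"
      and "p \<in> Poly_Mapping.keys (basis_vec (lam, \<kappa>) :: pair_module)"
      by (blast dest: subsetD[OF keys_lin_ext])
    with that[of lam \<mu> \<kappa>] b show ?thesis by (simp add: basis_vec_def)
  qed
  define l where "l = (part \<mu>)(i := part \<mu> i - 1)"
  from k have \<kappa>: "\<kappa> = Abs_partition (prefix_min l)"
    unfolding U_op_def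
    by (auto dest!: subsetD[OF keys_lin_ext] simp: basis_vec_def l_def Let_def split: if_splits)
  have "{j. l j \<noteq> 0} \<subseteq> {j. part \<mu> j \<noteq> 0}" by (auto simp: l_def)
  then have fin: "finite {j. l j \<noteq> 0}" by (rule finite_subset) (use finite_part in \<open>simp del: neq0_conv\<close>)
  have "part_le \<mu> lam" using assms lm by (auto simp: nested_pairs_def)
  moreover have "part \<kappa> j \<le> part \<mu> j" for j
  proof -
    have "part \<kappa> j \<le> l j"
      using part_prefix_min(2)[OF fin, of j] by (simp add: \<kappa> part_prefix_min(1)[OF fin])
    also have "l j \<le> part \<mu> j" by (simp add: l_def)
    finally show ?thesis .
  qed
  ultimately show "p \<in> nested_pairs"
    by (auto simp: p nested_pairs_def part_le_def intro: order_trans)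
qed

text \<open>The operator \<open>X\<^bsub>w\<^sub>1\<^esub> \<cdots> X\<^bsub>w\<^sub>N\<^esub>\<close>; the rightmost factor acts first.\<close>

definition word_op :: "(nat \<Rightarrow> pair_module \<Rightarrow> pair_module) \<Rightarrow> nat list \<Rightarrow> pair_module \<Rightarrow> pair_module" where
  "word_op X w = foldr (\<lambda>i. (\<circ>) (X i)) w id"

definition nc_schur_u :: "nat \<Rightarrow> partition \<Rightarrow> partition \<Rightarrow> pair_module \<Rightarrow> pair_module" where
  "nc_schur_u m \<kappa> \<rho> v = (\<Sum>T\<in>ssyt (<) {..<m} \<kappa> \<rho>. word_op u_pair (column_word \<kappa> \<rho> T) v)"

definition nc_schur_U :: "nat \<Rightarrow> partition \<Rightarrow> partition \<Rightarrow> pair_module \<Rightarrow> pair_module" where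
  "nc_schur_U n \<kappa> \<rho> v = (\<Sum>T\<in>ssyt (>) {..<n} \<kappa> \<rho>. word_op U_pair (column_word \<kappa> \<rho> T) v)"

definition nc_super_schur :: "nat \<Rightarrow> nat \<Rightarrow> partition \<Rightarrow> pair_module \<Rightarrow> pair_module" where
  "nc_super_schur m n \<nu> v = (\<Sum>\<kappa> | part_le \<kappa> \<nu>.
     Poly_Mapping.map ((*) ((-1) ^ (part_size \<nu> - part_size \<kappa>)))
       (nc_schur_U n (conj_part \<nu>) (conj_part \<kappa>) (nc_schur_u m \<kappa> empty_part v)))"

definition rat_poly_embed :: "rat poly \<Rightarrow> ratfun" where
  "rat_poly_embed p = Fract (map_poly of_rat p) 1"

text \<open>The \<open>\<rat>[\<beta>]\<close>-linear map with \<open>(lam, \<mu>) \<mapsto> skew_Groth lam \<mu>\<close>.\<close>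

definition skew_Groth_map :: "pair_module \<Rightarrow> ratfun mfps" where
  "skew_Groth_map v = (\<Sum>(lam, \<mu>)\<in>Poly_Mapping.keys v.
     mconst (rat_poly_embed (Poly_Mapping.lookup v (lam, \<mu>))) * skew_Groth lam \<mu>)"

end

theory Submission
  imports Defs
begin

text \<open>
  The coefficient functional of \<open>g\<^sub>\<mu>\<close> is explicit: splitting the variables of \<open>G\<^sub>\<lambda>\<close> into \<open>x\<close>
  (\<open>n\<close> of them) and \<open>y\<close> (\<open>s\<close> of them), the coefficient of \<open>y\<^sup>\<mu>\<^sup>+\<^sup>\<delta>\<close> in
  \<open>G\<^sub>\<lambda>(x, y) \<Prod>\<^sub>i\<^sub><\<^sub>j (y\<^sub>i - y\<^sub>j) \<Prod>\<^sub>i (1 + \<beta> y\<^sub>i)\<^sup>1\<^sup>-\<^sup>i\<close> is \<open>G\<^sub>\<lambda>\<^sub>/\<^sub>/\<^sub>\<mu>(x)\<close>.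
  Expand \<open>s\<^sub>\<nu>(x)\<close> supersymmetrically as \<open>s\<^sub>\<nu>[(x + y) - y]\<close>. The factors \<open>s\<^sub>\<kappa>(x, y)\<close> multiply the
  alternants that define \<open>G\<^sub>\<lambda>(x, y)\<close>, the factors \<open>s\<^bsub>(\<nu>/\<kappa>)'\<^esub>(y)\<close> shift the extracted exponent. In
  both situations the resulting exponents need not be partitions, but a functional on integer
  sequences that satisfies the two-term straightening relation of the alternants turns a sum over
  tableaux into the action of the operators \<open>u\<^sub>i\<close> along column words; Bender-Knuth involutions on
  prefixes of the tableaux cancel the unwanted terms.
\<close>

section \<open>Coefficients of power series\<close>

text \<open>The modulus is a count of variables. Multiplication by a Schur function is described by
  the first r operators \<open>u\<close> only in exactly r variables; s of them are spent as y, and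
  r - s remain for x.

  Products of complete homogeneous functions are dual to monomials, so extracting a coefficient is a
  Hall product with an element of \<open>Sym\<close>. This is how the y-functional is recognised as
  \<open>dual_Groth\<close>: the powers of 1/(1 + \<beta> y) in its kernel leave no transversal but
  the diagonal in the pairing with the alternants.

  G, its dual, \<open>perp\<close> and the Schur coefficients are definite descriptions, so
  existence and uniqueness precede any computation. Both rest on one fact: an alternating series in
  n variables is determined by its coefficients at the monomials x^(\<theta> + \<delta>).

  Straightening goes column by column from the right, because the rightmost letter of a column word
  acts first. The columns not yet read keep a Bender-Knuth symmetry in the letters k, k + 1
  precisely when the column being read contains no k, and these are the places where its vertical
  strip may need straightening.\<close>

lemma mcoeff_zero [simp]: "mcoeff 0 m = 0"
  by (simp add: zero_mfps_def)

lemma mcoeff_one: "mcoeff 1 m = (if m = {#} then 1 else 0)"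
  by (simp add: one_mfps_def)

lemma mcoeff_add [simp]: "mcoeff (f + g) m = mcoeff f m + mcoeff g m"
  by (simp add: plus_mfps_def)

lemma mcoeff_uminus [simp]: "mcoeff (- f) m = - mcoeff f m"
  by (simp add: uminus_mfps_def)

lemma mcoeff_diff [simp]: "mcoeff (f - g) m = mcoeff f m - mcoeff g m"
  by (simp add: minus_mfps_def)

lemma mcoeff_sum [simp]: "mcoeff (sum f A) m = (\<Sum>a\<in>A. mcoeff (f a) m)"
  by (induction A rule: infinite_finite_induct) simp_all

lemma mcoeff_mult:
  "mcoeff (f * g) m = (\<Sum>a\<in>{a. a \<subseteq># m}. mcoeff f a * mcoeff g (m - a))"
proof -
  have "mcoeff (f * g) m = (\<Sum>(a, b) \<in> {(a, b). a + b = m}. mcoeff f a * mcoeff g b)"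
    by (simp add: times_mfps_def)
  also have "\<dots> = (\<Sum>a\<in>{a. a \<subseteq># m}. mcoeff f a * mcoeff g (m - a))"
    by (rule sum.reindex_bij_witness[of _ "\<lambda>a. (a, m - a)" fst]) auto
  finally show ?thesis .
qed

lemma mcoeff_mult_nz:
  assumes "mcoeff (f * g) m \<noteq> 0"
  obtains a b where "m = a + b" "mcoeff f a \<noteq> 0" "mcoeff g b \<noteq> 0"
proof -
  from assms obtain a where "a \<subseteq># m" "mcoeff f a * mcoeff g (m - a) \<noteq> 0"
    unfolding mcoeff_mult by (elim sum.not_neutral_contains_not_neutral) simp
  then show ?thesis by (intro that[of a "m - a"]) auto
qed

definition mmon :: "nat multiset \<Rightarrow> 'a::comm_ring_1 mfps" where
  "mmon a = Abs_mfps (\<lambda>m. if m = a then 1 else 0)"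

lemma mcoeff_mmon: "mcoeff (mmon a) m = (if m = a then 1 else 0)"
  by (simp add: mmon_def)

lemma mcoeff_mmon_mult:
  "mcoeff (mmon a * f) m = (if a \<subseteq># m then mcoeff f (m - a) else 0)"
proof -
  have "mcoeff (mmon a * f) m = (\<Sum>c\<in>{c. c \<subseteq># m}. if c = a then mcoeff f (m - a) else 0)"
    unfolding mcoeff_mult by (rule sum.cong) (auto simp: mcoeff_mmon)
  also have "\<dots> = (if a \<subseteq># m then mcoeff f (m - a) else 0)"
    by (subst sum.delta) (auto simp: finite_submultisets)
  finally show ?thesis .
qed

lemma mmon_mult: "mmon a * mmon b = mmon (a + b)"
  by (rule mfps_eqI) (auto simp: mcoeff_mmon_mult mcoeff_mmon)

lemma mmon_empty [simp]: "mmon {#} = 1"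
  by (rule mfps_eqI) (simp add: mcoeff_mmon mcoeff_one)

lemma mvar_eq_mmon: "mvar i = mmon {#i#}"
  by (simp add: mvar_def mmon_def)

lemma mvar_power_eq_mmon: "mvar i ^ k = mmon (replicate_mset k i)"
  by (induction k) (simp_all add: mvar_eq_mmon mmon_mult)

lemma prod_mmon: "(\<Prod>i\<in>A. mmon (f i)) = mmon (\<Sum>i\<in>A. f i)"
  by (induction A rule: infinite_finite_induct) (simp_all add: mmon_mult)

lemma mcoeff_mconst: "mcoeff (mconst c) m = (if m = {#} then c else 0)"
  by (simp add: mconst_def)

lemma mcoeff_mconst_mult [simp]: "mcoeff (mconst c * f) m = c * mcoeff f m"
proof -
  have "mcoeff (mconst c * f) m = (\<Sum>a\<in>{a. a \<subseteq># m}. if a = {#} then c * mcoeff f m else 0)"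
    unfolding mcoeff_mult by (rule sum.cong) (auto simp: mcoeff_mconst)
  also have "\<dots> = c * mcoeff f m"
    by (subst sum.delta) (auto simp: finite_submultisets)
  finally show ?thesis .
qed

lemma mconst_mult: "mconst (a * b) = mconst a * mconst b"
  by (rule mfps_eqI) (simp add: mcoeff_mconst)

lemma mconst_add: "mconst (a + b) = mconst a + mconst b"
  by (rule mfps_eqI) (simp add: mcoeff_mconst)

lemma mconst_uminus: "mconst (- a) = - mconst a"
  by (rule mfps_eqI) (simp add: mcoeff_mconst)

lemma mconst_0 [simp]: "mconst 0 = 0"
  by (rule mfps_eqI) (simp add: mcoeff_mconst)

lemma mconst_1 [simp]: "mconst 1 = 1"
  by (rule mfps_eqI) (simp add: mcoeff_mconst mcoeff_one)

lemma mconst_power: "mconst (a ^ k) = mconst a ^ k"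
  by (induction k) (simp_all add: mconst_mult)

lemma mcoeff_of_int_mult [simp]: "mcoeff (of_int c * f) m = of_int c * mcoeff f m"
proof (induction c rule: int_induct[where k = 0])
  case base
  then show ?case by simp
next
  case (step1 i)
  then show ?case by (simp add: distrib_right)
next
  case (step2 i)
  then show ?case by (simp add: left_diff_distrib)
qed

text \<open>A submultiset of \<open>M + m\<close> with all elements in \<open>A\<close> avoids
  \<open>M\<close>, so only the splittings of \<open>m\<close> survive. This separates a block of
  variables from a monomial in the other ones.\<close>

lemma mult_disjoint_vars:
  assumes f: "\<And>a. mcoeff f a \<noteq> 0 \<Longrightarrow> set_mset a \<subseteq> A"
    and M: "set_mset M \<inter> A = {}"
  shows "mcoeff (f * g) (M + m) = (\<Sum>a\<in>{a. a \<subseteq># m}. mcoeff f a * mcoeff g (M + (m - a)))"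
proof -
  have "mcoeff (f * g) (M + m) = (\<Sum>a\<in>{a. a \<subseteq># m}. mcoeff f a * mcoeff g (M + m - a))"
    unfolding mcoeff_mult
  proof (rule sum.mono_neutral_right)
    show "{a. a \<subseteq># m} \<subseteq> {a. a \<subseteq># M + m}" by (auto intro: subset_mset.order_trans)
    show "\<forall>a\<in>{a. a \<subseteq># M + m} - {a. a \<subseteq># m}. mcoeff f a * mcoeff g (M + m - a) = 0"
    proof
      fix a assume a: "a \<in> {a. a \<subseteq># M + m} - {a. a \<subseteq># m}"
      have "mcoeff f a = 0"
      proof (rule ccontr)
        assume "mcoeff f a \<noteq> 0"
        then have s: "set_mset a \<subseteq> A" by (rule f)
        have "count a x \<le> count m x" for x
        proof (cases "x \<in># a")
          case True
          then have "count M x = 0" using s M by (auto simp: count_eq_zero_iff)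
          then show ?thesis using a mset_subset_eq_count[of a "M + m" x] by simp
        qed (simp add: not_in_iff)
        then have "a \<subseteq># m" by (rule mset_subset_eqI)
        then show False using a by simp
      qed
      then show "mcoeff f a * mcoeff g (M + m - a) = 0" by simp
    qed
  qed (rule finite_submultisets)
  also have "\<dots> = (\<Sum>a\<in>{a. a \<subseteq># m}. mcoeff f a * mcoeff g (M + (m - a)))"
    by (rule sum.cong) auto
  finally show ?thesis .
qed

section \<open>Setting all variables outside an arbitrary set to zero\<close>

definition restr :: "nat set \<Rightarrow> 'a::comm_ring_1 mfps \<Rightarrow> 'a mfps" where
  "restr A f = Abs_mfps (\<lambda>m. if set_mset m \<subseteq> A then mcoeff f m else 0)"

lemma mcoeff_restr: "mcoeff (restr A f) m = (if set_mset m \<subseteq> A then mcoeff f m else 0)"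
  by (simp add: restr_def)

lemma restrict_vars_eq: "restrict_vars n f = restr {..<n} f"
  by (simp add: restrict_vars_def restr_def)

lemma restr_add: "restr A (f + g) = restr A f + restr A g"
  and restr_diff: "restr A (f - g) = restr A f - restr A g"
  and restr_uminus: "restr A (- f) = - restr A f"
  and restr_0 [simp]: "restr A 0 = 0"
  and restr_1 [simp]: "restr A 1 = 1"
  and restr_mconst [simp]: "restr A (mconst c) = mconst c"
  by (rule mfps_eqI, auto simp: mcoeff_restr mcoeff_one mcoeff_mconst)+

lemma restr_mmon: "restr A (mmon a) = (if set_mset a \<subseteq> A then mmon a else 0)"
  by (rule mfps_eqI) (auto simp: mcoeff_restr mcoeff_mmon)

lemma restr_mvar: "restr A (mvar i) = (if i \<in> A then mvar i else 0)"
  by (simp add: mvar_eq_mmon restr_mmon)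

lemma restr_mult: "restr A (f * g) = restr A f * restr A g"
proof (rule mfps_eqI)
  fix m
  show "mcoeff (restr A (f * g)) m = mcoeff (restr A f * restr A g) m"
  proof (cases "set_mset m \<subseteq> A")
    case True
    then have "set_mset a \<subseteq> A \<and> set_mset (m - a) \<subseteq> A" if "a \<subseteq># m" for a
      using that set_mset_mono[of a m] set_mset_mono[of "m - a" m] by auto
    then show ?thesis
      unfolding mcoeff_restr mcoeff_mult by (auto simp: mcoeff_restr True intro!: sum.cong)
  next
    case False
    have "mcoeff (restr A f) a * mcoeff (restr A g) (m - a) = 0" if "a \<subseteq># m" for a
    proof -
      have "m = a + (m - a)" using that by simp
      then have "set_mset m = set_mset a \<union> set_mset (m - a)" by (metis set_mset_union)
      then show ?thesis using False by (auto simp: mcoeff_restr)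
    qed
    then have "mcoeff (restr A f * restr A g) m = 0"
      unfolding mcoeff_mult by (intro sum.neutral) simp
    then show ?thesis using False by (simp add: mcoeff_restr)
  qed
qed

lemma restr_sum: "restr A (sum f B) = (\<Sum>b\<in>B. restr A (f b))"
  by (induction B rule: infinite_finite_induct) (simp_all add: restr_add)

lemma restr_prod: "restr A (prod f B) = (\<Prod>b\<in>B. restr A (f b))"
  by (induction B rule: infinite_finite_induct) (simp_all add: restr_mult)

lemma restr_power: "restr A (f ^ k) = restr A f ^ k"
  by (induction k) (simp_all add: restr_mult)

lemma restr_restr: "restr A (restr B f) = restr (A \<inter> B) f"
  by (rule mfps_eqI) (auto simp: mcoeff_restr)

section \<open>Permuting the variables\<close>

definition perm_vars :: "(nat \<Rightarrow> nat) \<Rightarrow> 'a::comm_ring_1 mfps \<Rightarrow> 'a mfps" where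
  "perm_vars \<pi> f = Abs_mfps (\<lambda>m. mcoeff f (image_mset \<pi> m))"

lemma mcoeff_perm_vars: "mcoeff (perm_vars \<pi> f) m = mcoeff f (image_mset \<pi> m)"
  by (simp add: perm_vars_def)

lemma perm_vars_add: "perm_vars \<pi> (f + g) = perm_vars \<pi> f + perm_vars \<pi> g"
  and perm_vars_diff: "perm_vars \<pi> (f - g) = perm_vars \<pi> f - perm_vars \<pi> g"
  and perm_vars_uminus: "perm_vars \<pi> (- f) = - perm_vars \<pi> f"
  and perm_vars_0 [simp]: "perm_vars \<pi> 0 = 0"
  and perm_vars_1 [simp]: "perm_vars \<pi> 1 = 1"
  and perm_vars_mconst [simp]: "perm_vars \<pi> (mconst c) = mconst c"
  by (rule mfps_eqI, auto simp: mcoeff_perm_vars mcoeff_one mcoeff_mconst)+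

lemma image_mset_inv_cancel:
  assumes "bij \<pi>"
  shows "image_mset (inv_into UNIV \<pi>) (image_mset \<pi> m) = m" "image_mset \<pi> (image_mset (inv_into UNIV \<pi>) m) = m"
  using assms by (simp_all add: multiset.map_comp o_def bij_is_inj bij_is_surj surj_f_inv_f)

lemma image_mset_eq_iff_bij:
  fixes \<pi> :: "'b \<Rightarrow> 'b"
  assumes "bij \<pi>"
  shows "image_mset \<pi> a = b \<longleftrightarrow> a = image_mset (inv_into UNIV \<pi>) b"
  using image_mset_inv_cancel[OF assms] by metis

text \<open>\<open>perm_vars\<close> precomposes with \<open>\<pi>\<close> on monomials, hence the
  inverse here and the reversed order of composition in \<open>perm_vars_perm_vars\<close>.\<close>

lemma perm_vars_mmon: "bij \<pi> \<Longrightarrow> perm_vars \<pi> (mmon a) = mmon (image_mset (inv_into UNIV \<pi>) a)"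
  by (rule mfps_eqI) (simp add: mcoeff_perm_vars mcoeff_mmon image_mset_eq_iff_bij)

lemma perm_vars_mvar: "bij \<pi> \<Longrightarrow> perm_vars \<pi> (mvar i) = mvar (inv_into UNIV \<pi> i)"
  by (simp add: mvar_eq_mmon perm_vars_mmon)

lemma perm_vars_mult:
  assumes "bij \<pi>"
  shows "perm_vars \<pi> (f * g) = perm_vars \<pi> f * perm_vars \<pi> g"
proof (rule mfps_eqI)
  fix m
  note [simp] = image_mset_inv_cancel[OF assms]
  have "mcoeff (perm_vars \<pi> (f * g)) m
      = (\<Sum>a\<in>{a. a \<subseteq># image_mset \<pi> m}. mcoeff f a * mcoeff g (image_mset \<pi> m - a))"
    by (simp add: mcoeff_perm_vars mcoeff_mult)
  also have "\<dots> = (\<Sum>a\<in>{a. a \<subseteq># m}.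
      mcoeff f (image_mset \<pi> a) * mcoeff g (image_mset \<pi> (m - a)))"
  proof (rule sum.reindex_bij_witness[of _ "image_mset \<pi>" "image_mset (inv_into UNIV \<pi>)"])
    fix a assume "a \<in> {a. a \<subseteq># image_mset \<pi> m}"
    then have "a \<subseteq># image_mset \<pi> m" by simp
    from image_mset_subseteq_mono[OF this, of "inv_into UNIV \<pi>"]
    have *: "image_mset (inv_into UNIV \<pi>) a \<subseteq># m" by simp
    then show "image_mset (inv_into UNIV \<pi>) a \<in> {a. a \<subseteq># m}" by simp
    show "mcoeff f (image_mset \<pi> (image_mset (inv_into UNIV \<pi>) a)) * mcoeff g (image_mset \<pi> (m - image_mset (inv_into UNIV \<pi>) a)) =
         mcoeff f a * mcoeff g (image_mset \<pi> m - a)"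
      using * by (simp add: image_mset_Diff)
  qed (auto intro: image_mset_subseteq_mono)
  also have "\<dots> = mcoeff (perm_vars \<pi> f * perm_vars \<pi> g) m"
    by (simp add: mcoeff_mult mcoeff_perm_vars)
  finally show "mcoeff (perm_vars \<pi> (f * g)) m = mcoeff (perm_vars \<pi> f * perm_vars \<pi> g) m" .
qed

lemma perm_vars_sum: "perm_vars \<pi> (sum f B) = (\<Sum>b\<in>B. perm_vars \<pi> (f b))"
  by (induction B rule: infinite_finite_induct) (simp_all add: perm_vars_add)

lemma perm_vars_prod: "bij \<pi> \<Longrightarrow> perm_vars \<pi> (prod f B) = (\<Prod>b\<in>B. perm_vars \<pi> (f b))"
  by (induction B rule: infinite_finite_induct) (simp_all add: perm_vars_mult)

lemma perm_vars_power: "bij \<pi> \<Longrightarrow> perm_vars \<pi> (f ^ k) = perm_vars \<pi> f ^ k"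
  by (induction k) (simp_all add: perm_vars_mult)

lemma perm_vars_of_int [simp]: "bij \<pi> \<Longrightarrow> perm_vars \<pi> (of_int c) = of_int c"
  by (induction c rule: int_induct[where k = 0]) (simp_all add: perm_vars_add perm_vars_diff)

lemma perm_vars_perm_vars: "perm_vars \<pi> (perm_vars \<sigma> f) = perm_vars (\<sigma> \<circ> \<pi>) f"
  by (rule mfps_eqI) (simp add: mcoeff_perm_vars multiset.map_comp)

definition mhom :: "nat \<Rightarrow> 'a::comm_ring_1 mfps \<Rightarrow> bool" where
  "mhom d f \<longleftrightarrow> (\<forall>m. mcoeff f m \<noteq> 0 \<longrightarrow> size m = d)"

lemma mhom_mult: "mhom d f \<Longrightarrow> mhom e g \<Longrightarrow> mhom (d + e) (f * g)"
  unfolding mhom_def by (metis mcoeff_mult_nz size_union)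

lemma mhom_prod: "(\<And>b. b \<in> B \<Longrightarrow> mhom (d b) (f b)) \<Longrightarrow> mhom (sum d B) (prod f B)"
  by (induction B rule: infinite_finite_induct) (simp_all add: mhom_mult, simp_all add: mhom_def mcoeff_one)

lemma mcoeff_var_mult:
  "mcoeff (mvar i * f) m = (if i \<in># m then mcoeff f (m - {#i#}) else 0)"
  by (simp add: mvar_eq_mmon mcoeff_mmon_mult)

text \<open>Comparing coefficients at x_i m shows that the coefficient of f at m equals the one
  where an x_j of m is replaced by x_i, and is 0 if there is no x_j; the x_j run out. Only this
  cancellation is used later, so the power series need not be shown to form a domain.\<close>

lemma var_diff_cancel:
  assumes "i \<noteq> j" and "(mvar i - mvar j) * f = 0"
  shows "f = 0"
proof (rule mfps_eqI)
  have eq: "mcoeff f m = (if j \<in># m then mcoeff f (add_mset i (m - {#j#})) else 0)" for m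
  proof -
    have "mcoeff (mvar i * f - mvar j * f) (add_mset i m) = 0"
      using assms(2) by (simp add: left_diff_distrib)
    then show ?thesis using assms(1) by (auto simp: mcoeff_var_mult split: if_splits)
  qed
  fix m
  show "mcoeff f m = mcoeff 0 m"
  proof (induction "count m j" arbitrary: m)
    case 0
    then have "j \<notin># m" by (simp add: not_in_iff)
    then show ?case by (subst eq) simp
  next
    case (Suc k)
    then have "j \<in># m" by (metis count_eq_zero_iff nat.distinct(1))
    moreover have "mcoeff f (add_mset i (m - {#j#})) = mcoeff 0 (add_mset i (m - {#j#}))"
      by (rule Suc.hyps(1)) (use Suc(2) assms(1) in simp)
    ultimately show ?case by (subst eq) simp
  qed
qed

text \<open>The sign-reversing involutions below may have fixed points and only yield x = - x;
  concluding x = 0 takes this.\<close>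

lemma two_neq_zero_ratfun: "(2 :: ratfun) \<noteq> 0"
proof -
  have "(1 + 1 :: ratfun) = Fract (1 + 1) 1"
    by (simp only: One_fract_def add_fract) simp
  moreover have "Fract (1 + 1) 1 \<noteq> (Fract 0 1 :: ratfun)"
    by (subst eq_fract(1)) simp_all
  ultimately show ?thesis by (metis Zero_fract_def one_add_one)
qed

lemma double_eq_zero_ratfun: "x + x = 0 \<Longrightarrow> x = (0 :: ratfun)"
  using two_neq_zero_ratfun by (metis mult_2 mult_eq_0_iff)

lemma double_eq_zero_mfps: "x + x = 0 \<Longrightarrow> x = (0 :: ratfun mfps)"
  by (rule mfps_eqI) (metis double_eq_zero_ratfun mcoeff_add mcoeff_zero)

section \<open>Bender--Knuth involutions\<close>

lemma part_pos_iff: "0 < part lam i \<longleftrightarrow> i < part_length lam"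
proof -
  let ?S = "{i. part lam i \<noteq> 0}"
  have down: "j \<in> ?S" if "i \<in> ?S" "j \<le> i" for i j
    using that antimonoD[OF antimono_part, of j i lam] by auto
  have "?S = {..<card ?S}"
  proof (cases "?S = {}")
    case True
    then show ?thesis by simp
  next
    case False
    have "?S = {..Max ?S}"
    proof (intro equalityI subsetI)
      fix i assume "i \<in> ?S"
      then show "i \<in> {..Max ?S}" using Max_ge[OF finite_part] by blast
    next
      fix i assume "i \<in> {..Max ?S}"
      then show "i \<in> ?S" using down[OF Max_in[OF finite_part False]] by blast
    qed
    moreover have "card {..Max ?S} = Suc (Max ?S)" by simp
    ultimately show ?thesis by (metis lessThan_Suc_atMost)
  qed
  then have "i \<in> ?S \<longleftrightarrow> i \<in> {..<part_length lam}" unfolding part_length_def by blast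
  then show ?thesis by auto
qed

lemma part_eq_0: "part_length lam \<le> i \<Longrightarrow> part lam i = 0"
  using part_pos_iff[of lam i] by simp

lemma part_antimono: "i \<le> j \<Longrightarrow> part lam j \<le> part lam i"
  by (rule antimonoD[OF antimono_part])

lemma partition_eqI: "(\<And>i. part a i = part b i) \<Longrightarrow> a = b"
  by (metis ext part_inject)

lemma skew_cells_bounded: "(i, j) \<in> skew_cells \<kappa> \<rho> \<Longrightarrow> i < part_length \<kappa> \<and> j < part \<kappa> 0"
  using part_pos_iff[of \<kappa> i] part_antimono[of 0 i \<kappa>] by (auto simp: skew_cells_def)

lemma finite_skew_cells [simp]: "finite (skew_cells \<kappa> \<rho>)"
  by (rule finite_subset[of _ "{..<part_length \<kappa>} \<times> {..<part \<kappa> 0}"])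
    (auto dest: skew_cells_bounded)

lemma finite_ssyt [simp]: "finite A \<Longrightarrow> finite (ssyt lt A \<kappa> \<rho>)"
  unfolding ssyt_def by (rule finite_subset[OF _ finite_PiE[of "skew_cells \<kappa> \<rho>" "\<lambda>_. A"]]) auto

lemma ssyt_row:
  fixes T :: "nat \<times> nat \<Rightarrow> nat"
  assumes "T \<in> ssyt (<) A \<kappa> \<rho>" "(i, j) \<in> skew_cells \<kappa> \<rho>" "(i, j') \<in> skew_cells \<kappa> \<rho>" "j \<le> j'"
  shows "T (i, j) \<le> T (i, j')"
proof (cases "j = j'")
  case False
  then have "j < j'" using assms(4) by simp
  then have "T (i, j) < T (i, j') \<or> T (i, j) = T (i, j')"
    using assms unfolding ssyt_def by blast
  then show ?thesis by auto
qed simp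

lemma ssyt_col:
  assumes "T \<in> ssyt lt A \<kappa> \<rho>" "(i, j) \<in> skew_cells \<kappa> \<rho>" "(i', j) \<in> skew_cells \<kappa> \<rho>" "i < i'"
  shows "lt (T (i, j)) (T (i', j))"
  using assms unfolding ssyt_def by blast

lemma ssyt_entry: "T \<in> ssyt lt A \<kappa> \<rho> \<Longrightarrow> p \<in> skew_cells \<kappa> \<rho> \<Longrightarrow> T p \<in> A"
  by (auto simp: ssyt_def)

text \<open>Neighbouring rows suffice for column strictness because the cells of a skew shape in one
  column form an interval.\<close>

lemma ssytI:
  fixes T :: "nat \<times> nat \<Rightarrow> nat"
  assumes "T \<in> skew_cells \<kappa> \<rho> \<rightarrow>\<^sub>E A"
    and row: "\<And>i j j'. (i, j) \<in> skew_cells \<kappa> \<rho> \<Longrightarrow> (i, j') \<in> skew_cells \<kappa> \<rho> \<Longrightarrow> j < j' \<Longrightarrow>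
      T (i, j) \<le> T (i, j')"
    and col: "\<And>i j. (i, j) \<in> skew_cells \<kappa> \<rho> \<Longrightarrow> (Suc i, j) \<in> skew_cells \<kappa> \<rho> \<Longrightarrow>
      T (i, j) < T (Suc i, j)"
  shows "T \<in> ssyt (<) A \<kappa> \<rho>"
proof -
  have "T (i, j) < T (i', j)"
    if "i < i'" "(i, j) \<in> skew_cells \<kappa> \<rho>" "(i', j) \<in> skew_cells \<kappa> \<rho>" for i i' j
    using that
  proof (induction i' rule: less_Suc_induct)
    case (1 i)
    then show ?case by (rule col)
  next
    case (2 i j' k)
    then have "(j', j) \<in> skew_cells \<kappa> \<rho>"
      using part_antimono[of i j' \<rho>] part_antimono[of j' k \<kappa>] by (auto simp: skew_cells_def)
    with 2 show ?case by force
  qed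
  then show ?thesis using assms(1) row unfolding ssyt_def by (auto simp: le_less)
qed

lemma initial_segment:
  fixes J :: "nat set"
  assumes fin: "finite J" and lb: "\<And>j. j \<in> J \<Longrightarrow> a \<le> j"
    and down: "\<And>i j. j \<in> J \<Longrightarrow> a \<le> i \<Longrightarrow> i \<le> j \<Longrightarrow> i \<in> J"
  shows "J = {a..<a + card J}"
proof (cases "J = {}")
  case False
  have "J = {a..Max J}"
  proof (intro equalityI subsetI)
    fix i assume "i \<in> J"
    then show "i \<in> {a..Max J}" using Max_ge[OF fin] lb by simp
  next
    fix i assume "i \<in> {a..Max J}"
    then show "i \<in> J" using down[OF Max_in[OF fin False]] by simp
  qed
  moreover have "{a..Max J} = {a..<a + card {a..Max J}}"
    using lb[OF Max_in[OF fin False]] by auto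
  ultimately show ?thesis by metis
qed simp

text \<open>For the part of row \<open>i\<close> in the columns \<open>< c\<close>: the first column whose entry is \<open>\<ge> t\<close>.\<close>

definition row_bnd :: "partition \<Rightarrow> partition \<Rightarrow> nat \<Rightarrow> (nat \<times> nat \<Rightarrow> nat) \<Rightarrow> nat \<Rightarrow> nat \<Rightarrow> nat" where
  "row_bnd \<kappa> \<rho> c T t i =
     min (part \<rho> i) c + card {j. j < c \<and> (i, j) \<in> skew_cells \<kappa> \<rho> \<and> T (i, j) < t}"

definition col_weight :: "partition \<Rightarrow> partition \<Rightarrow> nat \<Rightarrow> (nat \<times> nat \<Rightarrow> nat) \<Rightarrow> nat \<Rightarrow> nat" where
  "col_weight \<kappa> \<rho> c T t = card {p \<in> skew_cells \<kappa> \<rho>. snd p < c \<and> T p = t}"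

lemma row_bnd_iff:
  assumes T: "T \<in> ssyt (<) A \<kappa> \<rho>" and ij: "(i, j) \<in> skew_cells \<kappa> \<rho>" "j < c"
  shows "T (i, j) < t \<longleftrightarrow> j < row_bnd \<kappa> \<rho> c T t i"
proof -
  let ?J = "{j. j < c \<and> (i, j) \<in> skew_cells \<kappa> \<rho> \<and> T (i, j) < t}"
  have r: "part \<rho> i \<le> j" using ij by (simp add: skew_cells_def)
  then have m: "min (part \<rho> i) c = part \<rho> i" using ij(2) by simp
  have "?J = {part \<rho> i..<part \<rho> i + card ?J}"
  proof (rule initial_segment)
    show "finite ?J" by simp
    fix j' assume "j' \<in> ?J"
    then show "part \<rho> i \<le> j'" by (simp add: skew_cells_def)
  next
    fix i' j' assume j': "j' \<in> ?J" and i': "part \<rho> i \<le> i'" "i' \<le> j'"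
    then have "(i, i') \<in> skew_cells \<kappa> \<rho>" by (auto simp: skew_cells_def)
    moreover from this j' i' have "T (i, i') \<le> T (i, j')" by (intro ssyt_row[OF T]) auto
    ultimately show "i' \<in> ?J" using j' i' by auto
  qed
  then have "j \<in> ?J \<longleftrightarrow> j \<in> {part \<rho> i..<part \<rho> i + card ?J}" by (rule arg_cong)
  then show ?thesis using ij r by (simp add: row_bnd_def m)
qed

lemma row_bnd_eqI:
  assumes "\<And>j. (i, j) \<in> skew_cells \<kappa> \<rho> \<Longrightarrow> j < c \<Longrightarrow> T (i, j) < t \<longleftrightarrow> j < b"
    and lb: "min (part \<rho> i) c \<le> b" and ub: "b \<le> min (part \<kappa> i) c"
  shows "row_bnd \<kappa> \<rho> c T t i = b"
proof -
  have "{j. j < c \<and> (i, j) \<in> skew_cells \<kappa> \<rho> \<and> T (i, j) < t} = {min (part \<rho> i) c..<b}"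
    using assms by (auto simp: skew_cells_def)
  then show ?thesis using lb by (simp add: row_bnd_def)
qed

lemma row_bnd_le:
  assumes "part_le \<rho> \<kappa>"
  shows "row_bnd \<kappa> \<rho> c T t i \<le> min (part \<kappa> i) c"
proof -
  have "card {j. j < c \<and> (i, j) \<in> skew_cells \<kappa> \<rho> \<and> T (i, j) < t}
      \<le> card {min (part \<rho> i) c..<min (part \<kappa> i) c}"
    by (rule card_mono) (auto simp: skew_cells_def)
  moreover have "part \<rho> i \<le> part \<kappa> i" using assms by (simp add: part_le_def)
  ultimately show ?thesis by (auto simp: row_bnd_def)
qed

lemma row_bnd_mono: "t \<le> t' \<Longrightarrow> row_bnd \<kappa> \<rho> c T t i \<le> row_bnd \<kappa> \<rho> c T t' i"
  unfolding row_bnd_def by (intro add_left_mono card_mono) auto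

text \<open>In the column numbered \<open>row_bnd \<kappa> \<rho> c T t i\<close>, a failure would
  put an entry \<ge> t in row i above an entry \<le> t in row i + 1.\<close>

lemma row_bnd_interlace:
  assumes le: "part_le \<rho> \<kappa>" and T: "T \<in> ssyt (<) A \<kappa> \<rho>"
  shows "row_bnd \<kappa> \<rho> c T (Suc t) (Suc i) \<le> row_bnd \<kappa> \<rho> c T t i"
proof (rule ccontr)
  let ?a = "row_bnd \<kappa> \<rho> c T t i"
  assume "\<not> ?thesis"
  then have a: "?a < row_bnd \<kappa> \<rho> c T (Suc t) (Suc i)" by simp
  also have "\<dots> \<le> min (part \<kappa> (Suc i)) c" by (rule row_bnd_le[OF le])
  finally have b: "?a < part \<kappa> (Suc i)" "?a < c" by auto
  have "min (part \<rho> i) c \<le> ?a" by (simp add: row_bnd_def)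
  with b have r: "part \<rho> i \<le> ?a" by auto
  have 1: "(i, ?a) \<in> skew_cells \<kappa> \<rho>" "(Suc i, ?a) \<in> skew_cells \<kappa> \<rho>"
    using r b part_antimono[of i "Suc i" \<kappa>] part_antimono[of i "Suc i" \<rho>]
    by (auto simp: skew_cells_def)
  have "T (Suc i, ?a) < Suc t" using row_bnd_iff[OF T 1(2) b(2)] a by blast
  moreover have "T (i, ?a) < T (Suc i, ?a)" using ssyt_col[OF T 1] by simp
  ultimately have "T (i, ?a) < t" by simp
  then show False using row_bnd_iff[OF T 1(1) b(2)] by blast
qed

lemma row_bnd_Suc:
  "row_bnd \<kappa> \<rho> c T (Suc t) i =
     row_bnd \<kappa> \<rho> c T t i + card {j. j < c \<and> (i, j) \<in> skew_cells \<kappa> \<rho> \<and> T (i, j) = t}"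
proof -
  have "{j. j < c \<and> (i, j) \<in> skew_cells \<kappa> \<rho> \<and> T (i, j) < Suc t} =
     {j. j < c \<and> (i, j) \<in> skew_cells \<kappa> \<rho> \<and> T (i, j) < t} \<union>
     {j. j < c \<and> (i, j) \<in> skew_cells \<kappa> \<rho> \<and> T (i, j) = t}" by auto
  then show ?thesis by (simp add: row_bnd_def, subst card_Un_disjoint) auto
qed

lemma col_weight_rows:
  "col_weight \<kappa> \<rho> c T t =
     (\<Sum>i<part_length \<kappa>. card {j. j < c \<and> (i, j) \<in> skew_cells \<kappa> \<rho> \<and> T (i, j) = t})"
proof -
  have "{p \<in> skew_cells \<kappa> \<rho>. snd p < c \<and> T p = t} =
     Sigma {..<part_length \<kappa>} (\<lambda>i. {j. j < c \<and> (i, j) \<in> skew_cells \<kappa> \<rho> \<and> T (i, j) = t})"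
    by (auto dest: skew_cells_bounded)
  then show ?thesis unfolding col_weight_def by (simp add: card_SigmaI)
qed

lemma col_weight_row_bnd:
  "col_weight \<kappa> \<rho> c T t + (\<Sum>i<part_length \<kappa>. row_bnd \<kappa> \<rho> c T t i) =
     (\<Sum>i<part_length \<kappa>. row_bnd \<kappa> \<rho> c T (Suc t) i)"
  by (simp add: col_weight_rows row_bnd_Suc sum.distrib)

text \<open>The new thresholds \<open>bk_bnd\<close> between the entries \<open>k\<close> and \<open>k + 1\<close> are the old ones reflected in
  the interval that semistandardness allows for them.\<close>

definition bk_bnd :: "(nat \<Rightarrow> nat) \<Rightarrow> (nat \<Rightarrow> nat) \<Rightarrow> (nat \<Rightarrow> nat) \<Rightarrow> nat \<Rightarrow> nat" where
  "bk_bnd \<alpha> \<gamma> \<delta> i = max (\<alpha> i) (\<delta> (Suc i)) + (if i = 0 then \<delta> 0 else min (\<delta> i) (\<alpha> (i - 1))) - \<gamma> i"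

definition bk :: "partition \<Rightarrow> partition \<Rightarrow> nat \<Rightarrow> nat \<Rightarrow> (nat \<times> nat \<Rightarrow> nat) \<Rightarrow> (nat \<times> nat \<Rightarrow> nat)" where
  "bk \<kappa> \<rho> c k T = (\<lambda>p. if p \<in> skew_cells \<kappa> \<rho> \<and> snd p < c \<and> T p \<in> {k, Suc k}
     then (if snd p < bk_bnd (row_bnd \<kappa> \<rho> c T k) (row_bnd \<kappa> \<rho> c T (Suc k))
                        (row_bnd \<kappa> \<rho> c T (Suc (Suc k))) (fst p) then k else Suc k)
     else T p)"

context
  fixes \<kappa> \<rho> :: partition and c k r :: nat and T :: "nat \<times> nat \<Rightarrow> nat"
  assumes le: "part_le \<rho> \<kappa>" and T: "T \<in> ssyt (<) {..<r} \<kappa> \<rho>" and k: "Suc k < r"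
    and col: "\<And>i. (i, c) \<in> skew_cells \<kappa> \<rho> \<Longrightarrow> T (i, c) \<noteq> k"
begin

private abbreviation (input) "X \<equiv> skew_cells \<kappa> \<rho>"
private abbreviation (input) "B \<equiv> row_bnd \<kappa> \<rho> c T"
private abbreviation (input) "g \<equiv> bk_bnd (B k) (B (Suc k)) (B (Suc (Suc k)))"
private abbreviation (input) "T' \<equiv> bk \<kappa> \<rho> c k T"

text \<open>In row i, the columns from \<open>B k i\<close> up to
  \<open>B (Suc (Suc k)) (Suc i)\<close> hold a k lying over a k + 1, and those from
  \<open>B k (i - 1)\<close> up to \<open>B (Suc (Suc k)) i\<close> hold a k + 1 lying under a k.
  These pairs are locked; the threshold can move only between them.\<close>

lemma bk_lo_hi:
  "max (B k i) (B (Suc (Suc k)) (Suc i)) \<le> B (Suc k) i"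
  "B (Suc k) i \<le> (if i = 0 then B (Suc (Suc k)) 0 else min (B (Suc (Suc k)) i) (B k (i - 1)))"
proof -
  have m: "B k i \<le> B (Suc k) i" "B (Suc k) i \<le> B (Suc (Suc k)) i" for i
    by (rule row_bnd_mono, simp)+
  note il = row_bnd_interlace[OF le T]
  show "max (B k i) (B (Suc (Suc k)) (Suc i)) \<le> B (Suc k) i" using m il by simp
  show "B (Suc k) i \<le> (if i = 0 then B (Suc (Suc k)) 0 else min (B (Suc (Suc k)) i) (B k (i - 1)))"
    using m il[of c k "i - 1"] by (cases i) simp_all
qed

lemma bk_bnd_bounds:
  "max (B k i) (B (Suc (Suc k)) (Suc i)) \<le> g i"
  "g i \<le> (if i = 0 then B (Suc (Suc k)) 0 else min (B (Suc (Suc k)) i) (B k (i - 1)))"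
  "g i + B (Suc k) i = max (B k i) (B (Suc (Suc k)) (Suc i)) +
     (if i = 0 then B (Suc (Suc k)) 0 else min (B (Suc (Suc k)) i) (B k (i - 1)))"
  using bk_lo_hi[of i] unfolding bk_bnd_def by linarith+

lemma bk_iff:
  assumes ij: "(i, j) \<in> X" "j < c"
  shows "T' (i, j) < t \<longleftrightarrow> j < (B(Suc k := g)) t i"
proof -
  note b = row_bnd_iff[OF T ij]
  have 1: "B k i \<le> g i" "g i \<le> B (Suc (Suc k)) i"
    using bk_bnd_bounds(1,2)[of i] by (auto split: if_splits)
  consider "t \<le> k" | "t = Suc k" | "t \<ge> Suc (Suc k)" by linarith
  then show ?thesis
  proof cases
    case 1
    then have "T' (i, j) < t \<longleftrightarrow> T (i, j) < t" by (auto simp: bk_def)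
    with 1 b show ?thesis by simp
  next
    case 2
    consider "T (i, j) < k" | "T (i, j) \<in> {k, Suc k}" | "T (i, j) \<ge> Suc (Suc k)" by fastforce
    then show ?thesis
    proof cases
      case 1
      then have "j < B k i" using b by blast
      then have "j < g i" using \<open>B k i \<le> g i\<close> by simp
      then show ?thesis using 1 2 by (simp add: bk_def)
    next
      case b: 2
      then show ?thesis using ij by (simp add: bk_def 2)
    next
      case 3
      then have "\<not> j < B (Suc (Suc k)) i" using b[of "Suc (Suc k)"] by simp
      then have "\<not> j < g i" using \<open>g i \<le> B (Suc (Suc k)) i\<close> by simp
      then show ?thesis using 3 2 by (simp add: bk_def)
    qed
  next
    case 3
    then have "T' (i, j) < t \<longleftrightarrow> T (i, j) < t" by (auto simp: bk_def)
    with 3 b show ?thesis by simp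
  qed
qed

lemma row_bnd_bk: "row_bnd \<kappa> \<rho> c T' t i = (B(Suc k := g)) t i"
proof (rule row_bnd_eqI)
  have lb: "min (part \<rho> i) c \<le> B t i" for t by (simp add: row_bnd_def)
  have ub: "B t i \<le> min (part \<kappa> i) c" for t by (rule row_bnd_le[OF le])
  have 1: "B k i \<le> g i" "g i \<le> B (Suc (Suc k)) i"
    using bk_bnd_bounds(1,2)[of i] by (auto split: if_splits)
  show "min (part \<rho> i) c \<le> (B(Suc k := g)) t i"
    using lb[of t] order_trans[OF lb[of k] 1(1)] by simp
  show "(B(Suc k := g)) t i \<le> min (part \<kappa> i) c"
    using ub[of t] order_trans[OF 1(2) ub] by simp
qed (rule bk_iff)

lemma bk_in_ssyt: "T' \<in> ssyt (<) {..<r} \<kappa> \<rho>"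
proof (rule ssytI)
  show "T' \<in> X \<rightarrow>\<^sub>E {..<r}"
    using T k unfolding ssyt_def bk_def by (fastforce simp: PiE_iff extensional_def)
next
  fix i j j' assume ij: "(i, j) \<in> X" "(i, j') \<in> X" "j < j'"
  show "T' (i, j) \<le> T' (i, j')"
  proof (cases "j' < c")
    case True
    have "j' < (B(Suc k := g)) (Suc (T' (i, j'))) i" using bk_iff[OF ij(2) True] by blast
    then have "j < (B(Suc k := g)) (Suc (T' (i, j'))) i" using ij(3) by simp
    then have "T' (i, j) < Suc (T' (i, j'))" using bk_iff[OF ij(1)] ij(3) True by simp
    then show ?thesis by simp
  next
    case False
    then have 1: "T' (i, j') = T (i, j')" by (simp add: bk_def)
    have 2: "T (i, j) \<le> T (i, j')" by (rule ssyt_row[OF T]) (use ij in auto)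
    show ?thesis
    proof (cases "j < c \<and> T (i, j) \<in> {k, Suc k}")
      case True
      then have "T' (i, j) \<le> Suc k" using ij(1) by (simp add: bk_def)
      \<comment> \<open>A k turned into \<open>Suc k\<close> on the left would break the row if an
        untouched k followed. Such a k would force a k in column \<open>c\<close> of the same row,
        which \<open>col\<close> excludes.\<close>
      moreover have "T (i, j') \<noteq> k"
      proof
        assume a: "T (i, j') = k"
        have c: "(i, c) \<in> X" using ij True False by (auto simp: skew_cells_def)
        have "T (i, j) \<le> T (i, c)" "T (i, c) \<le> T (i, j')"
          by (rule ssyt_row[OF T]; use ij c True False in auto)+
        then have "T (i, c) = k" using a True by auto
        then show False using col[OF c] by simp
      qed
      ultimately show ?thesis using 1 2 True by auto
    next
      case False
      then show ?thesis using 1 2 by (auto simp: bk_def)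
    qed
  qed
next
  fix i j assume ij: "(i, j) \<in> X" "(Suc i, j) \<in> X"
  show "T' (i, j) < T' (Suc i, j)"
  proof (cases "j < c")
    case True
    let ?t = "T' (Suc i, j)"
    have "j < (B(Suc k := g)) (Suc ?t) (Suc i)" using bk_iff[OF ij(2) True] by blast
    \<comment> \<open>Column strictness is the interlacing of consecutive thresholds. The two
      inequalities that involve \<open>g\<close>, at t = k and t = Suc k, are the bounds built into
      \<open>bk_bnd\<close>.\<close>
    moreover have "(B(Suc k := g)) (Suc t) (Suc i) \<le> (B(Suc k := g)) t i" for t
      using row_bnd_interlace[OF le T, of c t i] bk_bnd_bounds(1)[of i] bk_bnd_bounds(2)[of "Suc i"]
      by auto
    ultimately have "j < (B(Suc k := g)) ?t i" by (meson less_le_trans)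
    then show ?thesis using bk_iff[OF ij(1) True] by blast
  next
    case False
    then show ?thesis using ssyt_col[OF T ij] by (simp add: bk_def)
  qed
qed

text \<open>The outer thresholds do not move, so the second reflection takes place in the same
  interval as the first.\<close>

lemma bk_bk: "bk \<kappa> \<rho> c k T' = T"
proof
  fix p :: "nat \<times> nat"
  obtain i j where p: "p = (i, j)" by (cases p)
  have rb: "row_bnd \<kappa> \<rho> c T' k = B k" "row_bnd \<kappa> \<rho> c T' (Suc (Suc k)) = B (Suc (Suc k))"
    "row_bnd \<kappa> \<rho> c T' (Suc k) = g"
    by (rule ext, simp add: row_bnd_bk)+
  have "bk_bnd (B k) g (B (Suc (Suc k))) i = B (Suc k) i"
    using bk_bnd_bounds(3)[of i] unfolding bk_bnd_def[of "B k" g] by simp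
  then show "bk \<kappa> \<rho> c k T' p = T p"
    using row_bnd_iff[OF T, of i j c "Suc k"]
    unfolding bk_def[of \<kappa> \<rho> c k T'] rb p by (auto simp: bk_def split: if_splits)
qed

text \<open>The lower end for row i and the upper end for row i + 1 are the maximum and the minimum
  of the same two thresholds. Hence the sum of all ends is the sum of the outer thresholds, and
  reflecting the middle ones exchanges the total numbers of k and k + 1. Row
  \<open>part_length \<kappa>\<close> has thresholds 0, which closes the telescoping.\<close>

lemma bk_col_weight: "col_weight \<kappa> \<rho> c T' t = col_weight \<kappa> \<rho> c T (transpose k (Suc k) t)"
proof -
  let ?L = "part_length \<kappa>"
  let ?lo = "\<lambda>i. max (B k i) (B (Suc (Suc k)) (Suc i))"
  let ?hi = "\<lambda>i. if i = 0 then B (Suc (Suc k)) 0 else min (B (Suc (Suc k)) i) (B k (i - 1))"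
  have z: "B t ?L = 0" for t
    using row_bnd_le[OF le, of c T t ?L] part_eq_0[of \<kappa> ?L] by simp
  have "(\<Sum>i<Suc ?L. ?hi i) = B (Suc (Suc k)) 0 + (\<Sum>i<?L. min (B (Suc (Suc k)) (Suc i)) (B k i))"
    by (subst sum.lessThan_Suc_shift) simp
  then have "(\<Sum>i<?L. ?lo i) + (\<Sum>i<Suc ?L. ?hi i) =
     B (Suc (Suc k)) 0 + (\<Sum>i<?L. ?lo i + min (B (Suc (Suc k)) (Suc i)) (B k i))"
    by (simp add: sum.distrib)
  also have "(\<Sum>i<?L. ?lo i + min (B (Suc (Suc k)) (Suc i)) (B k i)) =
     (\<Sum>i<?L. B k i + B (Suc (Suc k)) (Suc i))" by (rule sum.cong) auto
  also have "B (Suc (Suc k)) 0 + \<dots> = (\<Sum>i<?L. B k i) + (\<Sum>i<Suc ?L. B (Suc (Suc k)) i)"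
    by (subst sum.lessThan_Suc_shift) (simp add: sum.distrib)
  also have "\<dots> = (\<Sum>i<?L. B k i) + (\<Sum>i<?L. B (Suc (Suc k)) i)" by (simp add: z)
  also have "(\<Sum>i<Suc ?L. ?hi i) = (\<Sum>i<?L. ?hi i)"
    using z[of "Suc (Suc k)"] by auto
  finally have "(\<Sum>i<?L. g i) + (\<Sum>i<?L. B (Suc k) i) =
     (\<Sum>i<?L. B k i) + (\<Sum>i<?L. B (Suc (Suc k)) i)"
    by (simp only: sum.distrib[symmetric] bk_bnd_bounds(3))
  moreover have w: "col_weight \<kappa> \<rho> c T t + (\<Sum>i<?L. B t i) = (\<Sum>i<?L. B (Suc t) i)" for t
    by (rule col_weight_row_bnd)
  note w[of k] w[of "Suc k"]
  moreover have w': "col_weight \<kappa> \<rho> c T' t + (\<Sum>i<?L. (B(Suc k := g)) t i) =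
      (\<Sum>i<?L. (B(Suc k := g)) (Suc t) i)" for t
    using col_weight_row_bnd[of \<kappa> \<rho> c T' t] by (simp only: row_bnd_bk)
  note w'[of k] w'[of "Suc k"]
  ultimately have "col_weight \<kappa> \<rho> c T' k = col_weight \<kappa> \<rho> c T (Suc k)" "col_weight \<kappa> \<rho> c T' (Suc k) = col_weight \<kappa> \<rho> c T k"
    by simp_all
  moreover have "col_weight \<kappa> \<rho> c T' t = col_weight \<kappa> \<rho> c T t" if "t \<noteq> k" "t \<noteq> Suc k"
    using that w[of t] w'[of t] by simp
  ultimately show ?thesis by (cases "t = k \<or> t = Suc k") (auto simp: transpose_def)
qed

end

section \<open>Noncommutative Schur functions acting by straightening\<close>

lemma seq_size_eq_sum:
  assumes "\<And>i. N \<le> i \<Longrightarrow> l i = 0"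
  shows "seq_size l = (\<Sum>i<N. l i)"
  unfolding seq_size_def
proof (rule sum.mono_neutral_left)
  show "{i. l i \<noteq> 0} \<subseteq> {..<N}" using assms not_less by auto
qed auto

lemma finite_support_iff: "finite {i. l i \<noteq> 0} \<longleftrightarrow> (\<exists>N. \<forall>i\<ge>N. l i = 0)" for l :: "nat \<Rightarrow> nat"
proof
  assume "finite {i. l i \<noteq> 0}"
  then obtain N where "\<forall>i\<in>{i. l i \<noteq> 0}. i < N" using finite_nat_set_iff_bounded by auto
  then show "\<exists>N. \<forall>i\<ge>N. l i = 0" by (intro exI[of _ N]) (meson mem_Collect_eq not_less)
next
  assume "\<exists>N. \<forall>i\<ge>N. l i = 0"
  then obtain N where "\<And>i. N \<le> i \<Longrightarrow> l i = 0" by auto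
  then have "{i. l i \<noteq> 0} \<subseteq> {..<N}" using not_less by auto
  then show "finite {i. l i \<noteq> 0}" by (rule finite_subset) simp
qed

lemma seq_size_upd:
  assumes "finite {i. l i \<noteq> 0}"
  shows "seq_size (l(i := x)) + l i = seq_size l + x"
proof -
  from assms obtain N where N: "\<And>i. N \<le> i \<Longrightarrow> l i = 0" unfolding finite_support_iff by auto
  define M where "M = max N (Suc i)"
  have "seq_size (l(i := x)) = (\<Sum>j<M. (l(i := x)) j)"
    by (rule seq_size_eq_sum) (use N in \<open>auto simp: M_def\<close>)
  also have "\<dots> = x + (\<Sum>j\<in>{..<M} - {i}. l j)"
    by (subst sum.remove[of _ i]) (auto simp: M_def)
  moreover have "seq_size l = (\<Sum>j<M. l j)"
    by (rule seq_size_eq_sum) (use N in \<open>auto simp: M_def\<close>)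
  moreover have "\<dots> = l i + (\<Sum>j\<in>{..<M} - {i}. l j)"
    by (subst sum.remove[of _ i]) (auto simp: M_def)
  ultimately show ?thesis by simp
qed

lemma seq_size_mono:
  assumes "\<And>i. l i \<le> m i" "finite {i. m i \<noteq> 0}"
  shows "seq_size l \<le> seq_size m"
proof -
  from assms(2) obtain N where N: "\<And>i. N \<le> i \<Longrightarrow> m i = 0" unfolding finite_support_iff by auto
  then have N': "\<And>i. N \<le> i \<Longrightarrow> l i = 0" using assms(1) by (metis le_zero_eq)
  have "seq_size l = (\<Sum>i<N. l i)" by (rule seq_size_eq_sum) (rule N')
  also have "\<dots> \<le> (\<Sum>i<N. m i)" by (rule sum_mono) (rule assms)
  also have "\<dots> = seq_size m" by (rule seq_size_eq_sum[symmetric]) (rule N)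
  finally show ?thesis .
qed

lemma finite_range_seq:
  fixes l :: "nat \<Rightarrow> nat"
  assumes "finite {i. l i \<noteq> 0}"
  shows "finite (l ` A)"
proof -
  have "l ` A \<subseteq> insert 0 (l ` {i. l i \<noteq> 0})" by auto
  then show ?thesis using assms by (meson finite_imageI finite_insert finite_subset)
qed

lemma tail_max_le_iff:
  assumes "finite {i. l i \<noteq> 0}"
  shows "tail_max l i \<le> x \<longleftrightarrow> (\<forall>j\<ge>i. l j \<le> x)"
  unfolding tail_max_def by (subst Max_le_iff) (auto simp: finite_range_seq[OF assms])

lemma tail_max_ge: "finite {i. l i \<noteq> 0} \<Longrightarrow> i \<le> j \<Longrightarrow> l j \<le> tail_max l i"
  using tail_max_le_iff[of l i "tail_max l i"] by blast

lemma antimono_tail_max: "finite {i. l i \<noteq> 0} \<Longrightarrow> antimono (tail_max l)"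
  by (intro antimonoI) (simp add: tail_max_le_iff tail_max_ge)

text \<open>With \<open>tail_max_ge\<close> and \<open>antimono_tail_max\<close> this is the
  universal property by which all equalities between tail maxima are proved.\<close>

lemma tail_max_least:
  assumes "finite {i. l i \<noteq> 0}" "antimono m" "\<And>i. l i \<le> m i"
  shows "tail_max l i \<le> m i"
  using assms by (metis antimonoD order_trans tail_max_le_iff)

lemma tail_max_antimono: "finite {i. l i \<noteq> 0} \<Longrightarrow> antimono l \<Longrightarrow> tail_max l = l"
  by (intro ext antisym tail_max_least tail_max_ge) auto

lemma tail_max_zero:
  assumes "\<And>i. N \<le> i \<Longrightarrow> l i = 0"
  shows "N \<le> i \<Longrightarrow> tail_max l i = 0"
proof -
  assume "N \<le> i"
  then have "l ` {i..} = {0}" using assms by auto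
  then show ?thesis by (simp add: tail_max_def)
qed

lemma finite_support_tail_max: "finite {i. l i \<noteq> 0} \<Longrightarrow> finite {i. tail_max l i \<noteq> 0}"
  unfolding finite_support_iff using tail_max_zero by metis

lemma finite_support_upd: "finite {i. l i \<noteq> (0::nat)} \<Longrightarrow> finite {i. (l(j := x)) i \<noteq> 0}"
  by (rule finite_subset[of _ "insert j {i. l i \<noteq> 0}"]) auto

lemma seq_size_tail_max_ge: "finite {i. l i \<noteq> 0} \<Longrightarrow> seq_size l \<le> seq_size (tail_max l)"
  by (intro seq_size_mono tail_max_ge finite_support_tail_max) auto

definition bump :: "nat \<Rightarrow> (nat \<Rightarrow> nat) \<Rightarrow> (nat \<Rightarrow> nat)" where
  "bump i l = l(i := l i + 1)"

text \<open>\<open>uact w l\<close> is the sequence and \<open>uexp w l\<close> the exponent of \<open>- \<beta>\<close> produced by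
  \<open>u\<^bsub>w\<^sub>1\<^esub> \<cdots> u\<^bsub>w\<^sub>N\<^esub>\<close>.\<close>

primrec uact :: "nat list \<Rightarrow> (nat \<Rightarrow> nat) \<Rightarrow> (nat \<Rightarrow> nat)" where
  "uact [] l = l"
| "uact (i # w) l = tail_max (bump i (uact w l))"

primrec uexp :: "nat list \<Rightarrow> (nat \<Rightarrow> nat) \<Rightarrow> nat" where
  "uexp [] l = 0"
| "uexp (i # w) l =
     uexp w l + (seq_size (tail_max (bump i (uact w l))) - seq_size (bump i (uact w l)))"

lemma uact_append: "uact (w @ w') l = uact w (uact w' l)"
  by (induction w) simp_all

lemma uexp_append: "uexp (w @ w') l = uexp w (uact w' l) + uexp w' l"
  by (induction w) (simp_all add: uact_append)

lemma finite_support_bump: "finite {i. l i \<noteq> 0} \<Longrightarrow> finite {i. bump j l i \<noteq> 0}"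
  unfolding bump_def by (rule finite_support_upd)

lemma finite_support_uact: "finite {i. l i \<noteq> 0} \<Longrightarrow> finite {i. uact w l i \<noteq> 0}"
proof (induction w)
  case (Cons a w)
  then show ?case using finite_support_tail_max[OF finite_support_bump] by simp
qed simp

lemma antimono_uact: "finite {i. l i \<noteq> 0} \<Longrightarrow> antimono l \<Longrightarrow> antimono (uact w l)"
  by (cases w) (auto intro!: antimono_tail_max finite_support_bump finite_support_uact)

lemma uact_zero:
  assumes "\<And>i. r \<le> i \<Longrightarrow> l i = 0" "set w \<subseteq> {..<r}"
  shows "r \<le> i \<Longrightarrow> uact w l i = 0"
  using assms(2)
proof (induction w arbitrary: i)
  case Nil
  then show ?case using assms(1) by simp
next
  case (Cons a w)
  then show ?case by (simp, intro tail_max_zero[of r]) (auto simp: bump_def)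
qed

definition add_set :: "nat set \<Rightarrow> (nat \<Rightarrow> nat) \<Rightarrow> (nat \<Rightarrow> nat)" where
  "add_set S l = (\<lambda>i. l i + of_bool (i \<in> S))"

lemma finite_support_add_set:
  "finite {i. l i \<noteq> 0} \<Longrightarrow> finite S \<Longrightarrow> finite {i. add_set S l i \<noteq> 0}"
  by (rule finite_subset[of _ "S \<union> {i. l i \<noteq> 0}"]) (auto simp: add_set_def split: if_splits)

text \<open>A strictly decreasing word adds one vertical strip, and this may be straightened in one go.\<close>

lemma uact_strict_column:
  assumes fin: "finite {i. l i \<noteq> 0}" and anti: "antimono l" and w: "sorted_wrt (>) w"
  shows "uact w l = tail_max (add_set (set w) l)"
    and "uexp w l + seq_size (add_set (set w) l) = seq_size (tail_max (add_set (set w) l))"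
proof -
  have "uact w l = tail_max (add_set (set w) l) \<and>
    uexp w l + seq_size (add_set (set w) l) = seq_size (tail_max (add_set (set w) l))"
    using w
  proof (induction w)
    case Nil
    have "add_set {} l = l" by (simp add: add_set_def)
    then show ?case using fin anti by (simp add: tail_max_antimono)
  next
    case (Cons j w)
    define m where "m = add_set (set w) l"
    define b where "b = add_set (set (j # w)) l"
    define a where "a = bump j (uact w l)"
    have IH: "uact w l = tail_max m" "uexp w l + seq_size m = seq_size (tail_max m)"
      using Cons unfolding m_def by simp_all
    have lt: "\<And>i. i \<in> set w \<Longrightarrow> i < j" using Cons.prems by simp
    have finm: "finite {i. m i \<noteq> 0}" and finb: "finite {i. b i \<noteq> 0}"
      unfolding m_def b_def by (rule finite_support_add_set[OF fin], simp)+
    have fintm: "finite {i. tail_max m i \<noteq> 0}" by (rule finite_support_tail_max[OF finm])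
    have b: "b = m(j := m j + 1)" using lt by (auto simp: b_def m_def add_set_def)
    \<comment> \<open>\<open>j\<close> exceeds every letter of \<open>w\<close>, so nothing has been
      added at or beyond \<open>j\<close> yet, and straightening the earlier letters does not
      disturb the place that \<open>j\<close> is about to raise.\<close>
    have "m i = l i" if "j \<le> i" for i
      using that lt[of i] by (auto simp: m_def add_set_def)
    then have "tail_max m j = m j"
      by (intro antisym tail_max_ge[OF finm]) (use anti in \<open>auto simp: tail_max_le_iff[OF finm] antimonoD\<close>)
    then have a: "a = (tail_max m)(j := m j + 1)" by (simp add: a_def IH bump_def)
    have fina: "finite {i. a i \<noteq> 0}" unfolding a by (rule finite_support_upd[OF fintm])
    \<comment> \<open>\<open>a\<close> is squeezed between \<open>b\<close> and
      \<open>tail_max b\<close>, which makes the tail maxima of \<open>a\<close> and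
      \<open>b\<close> agree.\<close>
    have mb: "m i \<le> b i" and ba: "b i \<le> a i" for i
      by (simp_all add: b a tail_max_ge[OF finm])
    have ab: "a i \<le> tail_max b i" for i
    proof (cases "i = j")
      case True
      then show ?thesis using tail_max_ge[OF finb, of j j] unfolding a b by (simp only: fun_upd_same Suc_eq_plus1 True order_refl simp_thms)
    next
      case False
      have "tail_max m i \<le> tail_max b i"
        by (rule tail_max_least[OF finm antimono_tail_max[OF finb]])
          (meson mb order_trans tail_max_ge[OF finb] order_refl)
      then show ?thesis using False by (simp add: a)
    qed
    have eq: "tail_max a = tail_max b"
    proof (intro ext antisym)
      fix i
      show "tail_max a i \<le> tail_max b i"
        by (rule tail_max_least[OF fina antimono_tail_max[OF finb] ab])
      show "tail_max b i \<le> tail_max a i"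
        by (rule tail_max_least[OF finb antimono_tail_max[OF fina]])
          (meson ba order_trans tail_max_ge[OF fina] order_refl)
    qed
    have "seq_size a + tail_max m j = seq_size (tail_max m) + (m j + 1)"
      unfolding a by (rule seq_size_upd[OF fintm])
    moreover have "seq_size b + m j = seq_size m + (m j + 1)"
      unfolding b by (rule seq_size_upd[OF finm])
    moreover have "seq_size a \<le> seq_size (tail_max a)" by (rule seq_size_tail_max_ge[OF fina])
    ultimately have "uexp (j # w) l + seq_size b = seq_size (tail_max b)"
      using IH(2) \<open>tail_max m j = m j\<close> unfolding uexp.simps a_def[symmetric] eq[symmetric] by linarith
    then show ?case unfolding b_def[symmetric] by (simp only: uact.simps a_def[symmetric] eq)
  qed
  then show "uact w l = tail_max (add_set (set w) l)"
    and "uexp w l + seq_size (add_set (set w) l) = seq_size (tail_max (add_set (set w) l))" by auto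
qed

text \<open>As \<alpha> differs from the weakly decreasing \<open>l\<close> by at most one
  everywhere, an ascent at k has height exactly one and occurs only where \<alpha> k = l k, hence
  outside \<open>S\<close>. Raising \<alpha> k removes it, keeps the tail maximum and brings the
  size one step closer to that of the tail maximum; each step costs one factor
  \<open>b\<close>.\<close>

lemma straighten_induct:
  fixes f :: "(nat \<Rightarrow> nat) \<Rightarrow> 'a::comm_ring_1"
  assumes step: "\<And>\<alpha> k. \<alpha> (Suc k) = Suc (\<alpha> k) \<Longrightarrow> k \<notin> S \<Longrightarrow> (\<And>i. r \<le> i \<Longrightarrow> \<alpha> i = 0) \<Longrightarrow>
      f \<alpha> = b * f (\<alpha>(k := Suc (\<alpha> k)))"
    and l: "antimono l"
    and "\<And>i. l i \<le> \<alpha> i" "\<And>i. \<alpha> i \<le> Suc (l i)" "\<And>i. i \<in> S \<Longrightarrow> \<alpha> i = Suc (l i)"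
    and "\<And>i. r \<le> i \<Longrightarrow> \<alpha> i = 0"
  shows "f \<alpha> = b ^ (seq_size (tail_max \<alpha>) - seq_size \<alpha>) * f (tail_max \<alpha>)"
  using assms(3-)
proof (induction "seq_size (tail_max \<alpha>) - seq_size \<alpha>" arbitrary: \<alpha> rule: less_induct)
  case (less \<alpha>)
  have fin: "finite {i. \<alpha> i \<noteq> 0}" unfolding finite_support_iff using less.prems(4) by auto
  show ?case
  proof (cases "antimono \<alpha>")
    case True
    then show ?thesis using tail_max_antimono[OF fin] by simp
  next
    case False
    then obtain k where k: "\<alpha> k < \<alpha> (Suc k)"
      unfolding decseq_def monotone_def using lift_Suc_antimono_le[of \<alpha>] by (metis not_less)
    have "\<alpha> (Suc k) \<le> Suc (l (Suc k))" "l (Suc k) \<le> l k" "l k \<le> \<alpha> k"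
      using less.prems l by (auto intro: antimonoD)
    with k have eq: "\<alpha> (Suc k) = Suc (\<alpha> k)" "\<alpha> k = l k" by auto
    then have kS: "k \<notin> S" using less.prems(3)[of k] by auto
    let ?a = "\<alpha>(k := Suc (\<alpha> k))"
    have fina: "finite {i. ?a i \<noteq> 0}" by (rule finite_support_upd[OF fin])
    have kr: "Suc k < r" using less.prems(4)[of "Suc k"] eq by (cases "r \<le> Suc k") auto
    have tm: "tail_max ?a = tail_max \<alpha>"
    proof (intro ext antisym)
      fix i
      show "tail_max ?a i \<le> tail_max \<alpha> i"
      proof (rule tail_max_least[OF fina antimono_tail_max[OF fin]])
        fix j
        have "\<alpha> (Suc k) \<le> tail_max \<alpha> k" by (rule tail_max_ge[OF fin]) simp
        then show "?a j \<le> tail_max \<alpha> j" using eq tail_max_ge[OF fin, of j j] by auto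
      qed
      show "tail_max \<alpha> i \<le> tail_max ?a i"
      proof (rule tail_max_least[OF fin antimono_tail_max[OF fina]])
        fix j
        have "\<alpha> j \<le> ?a j" by simp
        also have "?a j \<le> tail_max ?a j" by (rule tail_max_ge[OF fina]) simp
        finally show "\<alpha> j \<le> tail_max ?a j" .
      qed
    qed
    have sz: "seq_size ?a = Suc (seq_size \<alpha>)" using seq_size_upd[OF fin, of k "Suc (\<alpha> k)"] by simp
    have le: "seq_size ?a \<le> seq_size (tail_max \<alpha>)" using seq_size_tail_max_ge[OF fina] by (simp only: tm)
    have "f \<alpha> = b * f ?a" by (rule step) (use eq kS less.prems(4) in auto)
    also have "f ?a = b ^ (seq_size (tail_max ?a) - seq_size ?a) * f (tail_max ?a)"
    proof (rule less.hyps)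
      show "seq_size (tail_max ?a) - seq_size ?a < seq_size (tail_max \<alpha>) - seq_size \<alpha>"
        using sz le tm by simp
    qed (use less.prems eq kS kr in \<open>auto simp: not_less_eq_eq\<close>)
    also have "b * (b ^ (seq_size (tail_max ?a) - seq_size ?a) * f (tail_max ?a)) =
        b ^ (seq_size (tail_max \<alpha>) - seq_size \<alpha>) * f (tail_max \<alpha>)"
    proof -
      have "seq_size (tail_max \<alpha>) - seq_size \<alpha> = Suc (seq_size (tail_max \<alpha>) - seq_size ?a)"
        using sz le by simp
      then show ?thesis by (simp add: tm mult.assoc)
    qed
    finally show ?thesis .
  qed
qed

section \<open>Column words and their suffixes\<close>

definition col_list :: "partition \<Rightarrow> partition \<Rightarrow> (nat \<times> nat \<Rightarrow> nat) \<Rightarrow> nat \<Rightarrow> nat list" where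
  "col_list \<kappa> \<rho> T j = map (\<lambda>i. T (i, j))
     (filter (\<lambda>i. (i, j) \<in> skew_cells \<kappa> \<rho>) (rev [0..<part_length \<kappa>]))"

definition cols_from :: "partition \<Rightarrow> partition \<Rightarrow> (nat \<times> nat \<Rightarrow> nat) \<Rightarrow> nat \<Rightarrow> nat list" where
  "cols_from \<kappa> \<rho> T c = concat (map (col_list \<kappa> \<rho> T) [c..<part \<kappa> 0])"

lemma column_word_eq: "column_word \<kappa> \<rho> T = cols_from \<kappa> \<rho> T 0"
  unfolding column_word_def cols_from_def col_list_def ..

lemma cols_from_step:
  "c < part \<kappa> 0 \<Longrightarrow> cols_from \<kappa> \<rho> T c = col_list \<kappa> \<rho> T c @ cols_from \<kappa> \<rho> T (Suc c)"
  by (simp add: cols_from_def upt_conv_Cons)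

lemma set_col_list: "set (col_list \<kappa> \<rho> T j) = {T (i, j) | i. (i, j) \<in> skew_cells \<kappa> \<rho>}"
  by (auto simp: col_list_def dest: skew_cells_bounded)

lemma set_cols_from: "set (cols_from \<kappa> \<rho> T c) \<subseteq> T ` skew_cells \<kappa> \<rho>"
  by (auto simp: cols_from_def set_col_list)

lemma sorted_wrt_filter': "sorted_wrt P xs \<Longrightarrow> sorted_wrt P (filter Q xs)"
  by (induction xs) auto

lemma sorted_col_list:
  assumes T: "T \<in> ssyt (<) A \<kappa> \<rho>"
  shows "sorted_wrt (>) (col_list \<kappa> \<rho> T j)"
proof -
  let ?xs = "filter (\<lambda>i. (i, j) \<in> skew_cells \<kappa> \<rho>) (rev [0..<part_length \<kappa>])"
  have "sorted_wrt (>) ?xs"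
    by (rule sorted_wrt_filter') (simp add: sorted_wrt_rev)
  then have "sorted_wrt (\<lambda>a b. T (a, j) > T (b, j)) ?xs"
    by (rule sorted_wrt_mono_rel[rotated]) (use ssyt_col[OF T] in auto)
  then show ?thesis by (simp add: col_list_def sorted_wrt_map)
qed

lemma col_list_cong:
  "(\<And>i. (i, j) \<in> skew_cells \<kappa> \<rho> \<Longrightarrow> T (i, j) = T' (i, j)) \<Longrightarrow> col_list \<kappa> \<rho> T j = col_list \<kappa> \<rho> T' j"
  by (simp add: col_list_def)

lemma cols_from_cong:
  "(\<And>i j. (i, j) \<in> skew_cells \<kappa> \<rho> \<Longrightarrow> c \<le> j \<Longrightarrow> T (i, j) = T' (i, j)) \<Longrightarrow>
     cols_from \<kappa> \<rho> T c = cols_from \<kappa> \<rho> T' c"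
  unfolding cols_from_def by (intro arg_cong[of _ _ concat] map_cong refl col_list_cong) auto

lemma col_weight_Suc:
  assumes T: "T \<in> ssyt (<) A \<kappa> \<rho>"
  shows "col_weight \<kappa> \<rho> (Suc c) T t = col_weight \<kappa> \<rho> c T t + of_bool (t \<in> set (col_list \<kappa> \<rho> T c))"
proof -
  let ?C = "{p \<in> skew_cells \<kappa> \<rho>. snd p = c \<and> T p = t}"
  have "{p \<in> skew_cells \<kappa> \<rho>. snd p < Suc c \<and> T p = t} =
      {p \<in> skew_cells \<kappa> \<rho>. snd p < c \<and> T p = t} \<union> ?C" by auto
  then have "col_weight \<kappa> \<rho> (Suc c) T t = card ({p \<in> skew_cells \<kappa> \<rho>. snd p < c \<and> T p = t} \<union> ?C)"
    unfolding col_weight_def by (rule arg_cong)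
  also have "\<dots> = col_weight \<kappa> \<rho> c T t + card ?C"
    unfolding col_weight_def by (rule card_Un_disjoint) (simp_all, fastforce)
  also have "card ?C = of_bool (t \<in> set (col_list \<kappa> \<rho> T c))"
  proof (cases "t \<in> set (col_list \<kappa> \<rho> T c)")
    case True
    then obtain i where i: "(i, c) \<in> skew_cells \<kappa> \<rho>" "T (i, c) = t" by (auto simp: set_col_list)
    have "?C = {(i, c)}"
    proof -
      have uniq: "i' = i" if "(i', c) \<in> skew_cells \<kappa> \<rho>" "T (i', c) = t" for i'
        using ssyt_col[OF T i(1) that(1)] ssyt_col[OF T that(1) i(1)] i(2) that(2)
        by (metis less_irrefl linorder_neqE_nat)
      have "p = (i, c)" if "p \<in> ?C" for p
        using uniq[of "fst p"] that by (metis (mono_tags, lifting) mem_Collect_eq prod.collapse)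
      moreover have "(i, c) \<in> ?C" using i by simp
      ultimately show ?thesis by blast
    qed
    then show ?thesis using True by simp
  next
    case False
    then have "?C = {}" by (auto simp: set_col_list)
    then show ?thesis using False by simp
  qed
  finally show ?thesis .
qed

text \<open>The two sides are the ends of the chain \<open>F\<close>: in \<open>F c\<close> the
  columns from c on act through their word, while the columns before c enter only through their
  content. From \<open>Suc c\<close> to c, column c first joins as an unstraightened vertical strip.
  Its straightening is not valid tableau by tableau but only for the sum over all fillings of the
  earlier columns, where \<open>rel\<close> pairs each filling with its Bender-Knuth image.\<close>

theorem straightening_nc_schur:
  fixes v :: "(nat \<Rightarrow> nat) \<Rightarrow> 'a::comm_ring_1"
  assumes rel: "\<And>\<alpha> k. Suc k < r \<Longrightarrow> 1 \<le> \<alpha> (Suc k) \<Longrightarrow> (\<And>i. r \<le> i \<Longrightarrow> \<alpha> i = 0) \<Longrightarrow>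
      v \<alpha> + v (\<alpha>(k := \<alpha> (Suc k) - 1, Suc k := \<alpha> k + 1)) =
      b * (v (\<alpha>(k := \<alpha> k + 1)) + v (\<alpha>(k := \<alpha> (Suc k), Suc k := \<alpha> k + 1)))"
    and torsion: "\<And>x :: 'a. x + x = 0 \<Longrightarrow> x = 0"
    and le: "part_le \<rho> \<kappa>"
    and l: "antimono l" "\<And>i. r \<le> i \<Longrightarrow> l i = 0"
  shows "(\<Sum>T\<in>ssyt (<) {..<r} \<kappa> \<rho>. v (\<lambda>t. l t + col_weight \<kappa> \<rho> (part \<kappa> 0) T t)) =
    (\<Sum>T\<in>ssyt (<) {..<r} \<kappa> \<rho>. b ^ uexp (column_word \<kappa> \<rho> T) l * v (uact (column_word \<kappa> \<rho> T) l))"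
proof -
  let ?X = "ssyt (<) {..<r} \<kappa> \<rho>"
  let ?w = "cols_from \<kappa> \<rho>"
  define F where "F c = (\<Sum>T\<in>?X. b ^ uexp (?w T c) l * v (\<lambda>t. uact (?w T c) l t + col_weight \<kappa> \<rho> c T t))" for c
  have finl: "finite {i. l i \<noteq> 0}" unfolding finite_support_iff using l(2) by auto
  have wt0: "col_weight \<kappa> \<rho> c T t = 0" if "r \<le> t" "T \<in> ?X" for c T t
    using that ssyt_entry[OF that(2)] unfolding col_weight_def by (fastforce simp: card_eq_0_iff)
  have step: "F (Suc c) = F c" if c: "c < part \<kappa> 0" for c
  proof -
    \<comment> \<open>On a fibre of \<open>res\<close> the columns from c on are frozen, so the
      sequence \<open>L\<close>, the exponent \<open>E\<close> and the strip \<open>S\<close> are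
      the same for all its tableaux.\<close>
    define res where "res T = restrict T {p \<in> skew_cells \<kappa> \<rho>. c \<le> snd p}" for T :: "nat \<times> nat \<Rightarrow> nat"
    define h where "h c T = b ^ uexp (?w T c) l * v (\<lambda>t. uact (?w T c) l t + col_weight \<kappa> \<rho> c T t)" for c T
    have fib: "sum (h (Suc c)) {T\<in>?X. res T = R} = sum (h c) {T\<in>?X. res T = R}"
      if "R \<in> res ` ?X" for R
    proof -
      from that obtain T0 where T0: "T0 \<in> ?X" and R: "R = res T0" by auto
      define Y where "Y = {T\<in>?X. res T = R}"
      define L where "L = uact (?w T0 (Suc c)) l"
      define E where "E = uexp (?w T0 (Suc c)) l"
      define C where "C = col_list \<kappa> \<rho> T0 c"
      define S where "S = set C"
      have ag: "T (i, j) = T0 (i, j)" if "T \<in> Y" "(i, j) \<in> skew_cells \<kappa> \<rho>" "c \<le> j" for T i j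
      proof -
        have "res T (i, j) = res T0 (i, j)" using that R by (simp add: Y_def)
        then show ?thesis using that by (simp add: res_def)
      qed
      have wY: "?w T (Suc c) = ?w T0 (Suc c)" "col_list \<kappa> \<rho> T c = C" if "T \<in> Y" for T
        unfolding C_def using ag[OF that] by (intro cols_from_cong col_list_cong; simp)+
      have T0r: "T0 ` skew_cells \<kappa> \<rho> \<subseteq> {..<r}" using ssyt_entry[OF T0] by auto
      have S: "S \<subseteq> {..<r}" using T0r by (auto simp: S_def C_def set_col_list)
      have L: "antimono L" "finite {i. L i \<noteq> 0}" "\<And>i. r \<le> i \<Longrightarrow> L i = 0"
        unfolding L_def using antimono_uact[OF finl l(1)] finite_support_uact[OF finl]
          uact_zero[of r l, OF l(2) order_trans[OF set_cols_from T0r]] by auto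
      have sorted: "sorted_wrt (>) C" unfolding C_def by (rule sorted_col_list[OF T0])
      define f where "f \<alpha> = (\<Sum>T\<in>Y. v (\<lambda>t. \<alpha> t + col_weight \<kappa> \<rho> c T t))" for \<alpha>
      \<comment> \<open>\<open>k \<notin> S\<close> says that column c has no entry k, which is what
        \<open>bk\<close> requires in order to act on the columns before c alone and so to preserve
        the fibre.\<close>
      have f_step: "f \<alpha> = b * f (\<alpha>(k := Suc (\<alpha> k)))"
        if a: "\<alpha> (Suc k) = Suc (\<alpha> k)" and kS: "k \<notin> S" and a0: "\<And>i. r \<le> i \<Longrightarrow> \<alpha> i = 0" for \<alpha> k
      proof -
        have kr: "Suc k < r" using a0[of "Suc k"] a by (cases "r \<le> Suc k") auto
        let ?\<phi> = "bk \<kappa> \<rho> c k"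
        define D where "D T = v (\<lambda>t. \<alpha> t + col_weight \<kappa> \<rho> c T t) -
           b * v (\<lambda>t. (\<alpha>(k := Suc (\<alpha> k))) t + col_weight \<kappa> \<rho> c T t)" for T
        have colk: "T (i, c) \<noteq> k" if "T \<in> Y" "(i, c) \<in> skew_cells \<kappa> \<rho>" for T i
          using kS ag[OF that] that(2) by (auto simp: S_def C_def set_col_list)
        have phi: "?\<phi> T \<in> Y" "?\<phi> (?\<phi> T) = T" "col_weight \<kappa> \<rho> c (?\<phi> T) t = col_weight \<kappa> \<rho> c T (transpose k (Suc k) t)"
          if T: "T \<in> Y" for T t
        proof -
          have TX: "T \<in> ?X" using T by (simp add: Y_def)
          have "res (?\<phi> T) = res T" by (auto simp: res_def bk_def)
          then show "?\<phi> T \<in> Y"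
            using T bk_in_ssyt[OF le TX kr colk[OF T]] by (simp add: Y_def)
          show "?\<phi> (?\<phi> T) = T" by (rule bk_bk[OF le TX kr colk[OF T]])
          show "col_weight \<kappa> \<rho> c (?\<phi> T) t = col_weight \<kappa> \<rho> c T (transpose k (Suc k) t)"
            by (rule bk_col_weight[OF le TX kr colk[OF T]])
        qed
        have DD: "D T + D (?\<phi> T) = 0" if T: "T \<in> Y" for T
        proof -
          define \<beta> where "\<beta> = (\<lambda>t. \<alpha> t + col_weight \<kappa> \<rho> c T t)"
          have TX: "T \<in> ?X" using T by (simp add: Y_def)
          have "\<beta> i = 0" if "r \<le> i" for i using a0[OF that] wt0[OF that TX] by (simp add: \<beta>_def)
          moreover have "1 \<le> \<beta> (Suc k)" by (simp add: \<beta>_def a)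
          ultimately have r: "v \<beta> + v (\<beta>(k := \<beta> (Suc k) - 1, Suc k := \<beta> k + 1)) =
              b * (v (\<beta>(k := \<beta> k + 1)) + v (\<beta>(k := \<beta> (Suc k), Suc k := \<beta> k + 1)))"
            by (intro rel kr)
          \<comment> \<open>Because \<alpha> (Suc k) is one more than \<alpha> k, exchanging the two
            weights is the shifted transposition that occurs in \<open>rel\<close>.\<close>
          have "(\<lambda>t. \<alpha> t + col_weight \<kappa> \<rho> c (?\<phi> T) t) = \<beta>(k := \<beta> (Suc k) - 1, Suc k := \<beta> k + 1)"
            by (rule ext) (simp add: phi(3)[OF T] \<beta>_def transpose_def a)
          moreover have "(\<lambda>t. (\<alpha>(k := Suc (\<alpha> k))) t + col_weight \<kappa> \<rho> c T t) = \<beta>(k := \<beta> k + 1)"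
            by (rule ext) (simp add: \<beta>_def)
          moreover have "(\<lambda>t. (\<alpha>(k := Suc (\<alpha> k))) t + col_weight \<kappa> \<rho> c (?\<phi> T) t) =
              \<beta>(k := \<beta> (Suc k), Suc k := \<beta> k + 1)"
            by (rule ext) (simp add: phi(3)[OF T] \<beta>_def transpose_def a)
          ultimately show ?thesis using r unfolding D_def \<beta>_def[symmetric] by (simp add: algebra_simps)
        qed
        have "sum D Y = (\<Sum>T\<in>Y. D (?\<phi> T))"
          by (rule sum.reindex_bij_witness[of _ ?\<phi> ?\<phi>]) (auto simp: phi)
        then have "sum D Y + sum D Y = (\<Sum>T\<in>Y. D T + D (?\<phi> T))" by (simp add: sum.distrib)
        also have "\<dots> = 0" by (rule sum.neutral) (simp add: DD)
        \<comment> \<open>\<open>rel\<close> gives only D T + D (\<phi> T) = 0, so each term has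
          been counted twice.\<close>
        finally have "sum D Y = 0" by (rule torsion)
        then show ?thesis unfolding D_def f_def by (simp add: sum_subtractf sum_distrib_left)
      qed
      have "(\<Sum>T\<in>Y. b ^ uexp (?w T (Suc c)) l * v (\<lambda>t. uact (?w T (Suc c)) l t + col_weight \<kappa> \<rho> (Suc c) T t)) =
          b ^ E * f (add_set S L)"
        unfolding f_def sum_distrib_left
      proof (rule sum.cong[OF refl])
        fix T assume T: "T \<in> Y"
        then have TX: "T \<in> ?X" by (simp add: Y_def)
        have "(\<lambda>t. L t + col_weight \<kappa> \<rho> (Suc c) T t) = (\<lambda>t. add_set S L t + col_weight \<kappa> \<rho> c T t)"
          by (rule ext) (simp add: col_weight_Suc[OF TX] wY(2)[OF T] add_set_def S_def)
        then show "b ^ uexp (?w T (Suc c)) l * v (\<lambda>t. uact (?w T (Suc c)) l t + col_weight \<kappa> \<rho> (Suc c) T t) =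
            b ^ E * v (\<lambda>t. add_set S L t + col_weight \<kappa> \<rho> c T t)"
          by (simp add: wY(1)[OF T] L_def E_def)
      qed
      also have "f (add_set S L) =
          b ^ (seq_size (tail_max (add_set S L)) - seq_size (add_set S L)) * f (tail_max (add_set S L))"
        by (rule straighten_induct[where r = r and S = S and l = L, OF f_step L(1)])
          (use L(3) S in \<open>auto simp: add_set_def\<close>)
      also have "seq_size (tail_max (add_set S L)) - seq_size (add_set S L) = uexp C L"
        using uact_strict_column(2)[OF L(2,1) sorted] by (simp add: S_def)
      also have "tail_max (add_set S L) = uact C L"
        using uact_strict_column(1)[OF L(2,1) sorted] by (simp add: S_def)
      also have "b ^ E * (b ^ uexp C L * f (uact C L)) =
          (\<Sum>T\<in>Y. b ^ uexp (?w T c) l * v (\<lambda>t. uact (?w T c) l t + col_weight \<kappa> \<rho> c T t))"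
        unfolding f_def sum_distrib_left
      proof (rule sum.cong[OF refl])
        fix T assume T: "T \<in> Y"
        have "?w T c = C @ ?w T0 (Suc c)" using cols_from_step[OF c, of \<rho> T] wY[OF T] by simp
        then show "b ^ E * (b ^ uexp C L * v (\<lambda>t. uact C L t + col_weight \<kappa> \<rho> c T t)) =
            b ^ uexp (?w T c) l * v (\<lambda>t. uact (?w T c) l t + col_weight \<kappa> \<rho> c T t)"
          by (simp add: uact_append uexp_append L_def E_def power_add mult_ac)
      qed
      finally show ?thesis by (simp only: Y_def h_def[abs_def])
    qed
    have fin: "finite ?X" by simp
    have "sum (h (Suc c)) ?X = (\<Sum>R\<in>res ` ?X. sum (h (Suc c)) {T\<in>?X. res T = R})"
      by (rule sum.image_gen[OF fin])
    also have "\<dots> = (\<Sum>R\<in>res ` ?X. sum (h c) {T\<in>?X. res T = R})"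
      by (rule sum.cong[OF refl fib])
    also have "\<dots> = sum (h c) ?X" by (rule sum.image_gen[OF fin, symmetric])
    finally show ?thesis by (simp only: F_def h_def[abs_def])
  qed
  have "F (part \<kappa> 0) = F 0"
  proof -
    have "F c = F 0" if "c \<le> part \<kappa> 0" for c
      using that
    proof (induction c)
      case (Suc c)
      then have "F (Suc c) = F c" "F c = F 0" by (intro step, simp, intro Suc.IH, simp)
      then show ?case by (rule trans)
    qed (rule refl)
    from this[OF order_refl] show ?thesis .
  qed
  moreover have "F 0 = (\<Sum>T\<in>?X. b ^ uexp (column_word \<kappa> \<rho> T) l * v (uact (column_word \<kappa> \<rho> T) l))"
    unfolding F_def column_word_eq by (rule sum.cong[OF refl]) (simp add: col_weight_def)
  moreover have "F (part \<kappa> 0) = (\<Sum>T\<in>?X. v (\<lambda>t. l t + col_weight \<kappa> \<rho> (part \<kappa> 0) T t))"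
    unfolding F_def by (rule sum.cong[OF refl]) (simp add: cols_from_def)
  ultimately show ?thesis by (simp only:)
qed

section \<open>Tableau generating functions\<close>

definition cont :: "partition \<Rightarrow> partition \<Rightarrow> (nat \<times> nat \<Rightarrow> nat) \<Rightarrow> nat multiset" where
  "cont \<kappa> \<rho> T = image_mset T (mset_set (skew_cells \<kappa> \<rho>))"

lemma set_mset_cont: "set_mset (cont \<kappa> \<rho> T) = T ` skew_cells \<kappa> \<rho>"
  by (simp add: cont_def)

lemma count_cont: "count (cont \<kappa> \<rho> T) t = col_weight \<kappa> \<rho> (part \<kappa> 0) T t"
proof -
  have "{p \<in> skew_cells \<kappa> \<rho>. snd p < part \<kappa> 0 \<and> T p = t} = {p \<in> skew_cells \<kappa> \<rho>. T p = t}"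
    by (auto dest: skew_cells_bounded)
  moreover have "count (cont \<kappa> \<rho> T) t = card {p \<in> skew_cells \<kappa> \<rho>. T p = t}"
    unfolding cont_def
    by (simp add: count_image_mset vimage_def Int_def conj_commute)
  ultimately show ?thesis by (simp add: col_weight_def)
qed

lemma card_skew_cells:
  assumes "part_le \<rho> \<kappa>"
  shows "card (skew_cells \<kappa> \<rho>) + part_size \<rho> = part_size \<kappa>"
proof -
  let ?L = "part_length \<kappa>"
  have z: "part \<kappa> i = 0" if "?L \<le> i" for i using part_eq_0[OF that] .
  then have z': "part \<rho> i = 0" if "?L \<le> i" for i
    using that assms unfolding part_le_def by (metis le_zero_eq)
  have "skew_cells \<kappa> \<rho> = Sigma {..<?L} (\<lambda>i. {part \<rho> i..<part \<kappa> i})"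
    using skew_cells_bounded by (auto simp: skew_cells_def)
  then have "card (skew_cells \<kappa> \<rho>) = (\<Sum>i<?L. part \<kappa> i - part \<rho> i)"
    by (simp add: card_SigmaI)
  moreover have "(\<Sum>i<?L. part \<kappa> i - part \<rho> i) + (\<Sum>i<?L. part \<rho> i) = (\<Sum>i<?L. part \<kappa> i)"
    unfolding sum.distrib[symmetric] using assms by (intro sum.cong) (auto simp: part_le_def)
  ultimately show ?thesis
    using seq_size_eq_sum[of ?L "part \<kappa>", OF z] seq_size_eq_sum[of ?L "part \<rho>", OF z'] by simp
qed

lemma part_le_empty [simp]: "part_le empty_part \<kappa>"
  by (simp add: part_le_def)

lemma part_size_empty [simp]: "part_size empty_part = 0"
  by (simp add: seq_size_def)

lemma finite_part_le: "finite {\<theta>. part_le \<theta> \<kappa>}"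
proof (rule finite_imageD)
  let ?f = "\<lambda>\<theta>. restrict (part \<theta>) {..<part_length \<kappa>}"
  have "?f ` {\<theta>. part_le \<theta> \<kappa>} \<subseteq> {..<part_length \<kappa>} \<rightarrow>\<^sub>E {..part \<kappa> 0}"
  proof (intro image_subsetI)
    fix \<theta> assume "\<theta> \<in> {\<theta>. part_le \<theta> \<kappa>}"
    then have "part \<theta> i \<le> part \<kappa> i" for i by (simp add: part_le_def)
    then have "part \<theta> i \<le> part \<kappa> 0" for i by (rule order_trans) (rule part_antimono[OF le0])
    then show "?f \<theta> \<in> {..<part_length \<kappa>} \<rightarrow>\<^sub>E {..part \<kappa> 0}" by auto
  qed
  then show "finite (?f ` {\<theta>. part_le \<theta> \<kappa>})" by (rule finite_subset) (simp add: finite_PiE)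
  show "inj_on ?f {\<theta>. part_le \<theta> \<kappa>}"
  proof (rule inj_onI)
    fix a b assume a: "a \<in> {\<theta>. part_le \<theta> \<kappa>}" and b: "b \<in> {\<theta>. part_le \<theta> \<kappa>}" and eq: "?f a = ?f b"
    show "a = b"
    proof (rule partition_eqI)
      fix i
      show "part a i = part b i"
      proof (cases "i < part_length \<kappa>")
        case True
        then show ?thesis using fun_cong[OF eq, of i] by simp
      next
        case False
        then have "part \<kappa> i = 0" by (simp add: part_eq_0)
        then show ?thesis using a b by (simp add: part_le_def) (metis le_zero_eq)
      qed
    qed
  qed
qed

text \<open>A skew Schur polynomial as an honest finite sum, hence meant for finite alphabets. The
  order stays a parameter because the letters of the \<open>U\<close> operators are ordered by
  \<open>>\<close>.\<close>

definition spoly :: "(nat \<Rightarrow> nat \<Rightarrow> bool) \<Rightarrow> nat set \<Rightarrow> partition \<Rightarrow> partition \<Rightarrow> 'a::comm_ring_1 mfps" where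
  "spoly lt A \<kappa> \<rho> = (\<Sum>T\<in>ssyt lt A \<kappa> \<rho>. mmon (cont \<kappa> \<rho> T))"

lemma mcoeff_spoly:
  "finite A \<Longrightarrow> mcoeff (spoly lt A \<kappa> \<rho>) m = of_nat (card {T \<in> ssyt lt A \<kappa> \<rho>. cont \<kappa> \<rho> T = m})"
  by (simp add: spoly_def mcoeff_mmon sum.If_cases Int_def conj_commute eq_commute[of m])

lemma ssyt_content_subset:
  assumes "set_mset m \<subseteq> A"
  shows "{T \<in> ssyt lt B \<kappa> \<rho>. cont \<kappa> \<rho> T = m} = {T \<in> ssyt lt (A \<inter> B) \<kappa> \<rho>. cont \<kappa> \<rho> T = m}"
proof -
  have "T \<in> ssyt lt B \<kappa> \<rho> \<longleftrightarrow> T \<in> ssyt lt (A \<inter> B) \<kappa> \<rho>" if "cont \<kappa> \<rho> T = m" for T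
  proof -
    have "T ` skew_cells \<kappa> \<rho> \<subseteq> A" using assms that set_mset_cont[of \<kappa> \<rho> T] by simp
    then have "T \<in> skew_cells \<kappa> \<rho> \<rightarrow>\<^sub>E B \<longleftrightarrow> T \<in> skew_cells \<kappa> \<rho> \<rightarrow>\<^sub>E (A \<inter> B)" by (auto simp: PiE_iff)
    then show ?thesis unfolding ssyt_def by blast
  qed
  then show ?thesis by blast
qed

lemma restr_schur_fun:
  assumes "finite A"
  shows "restr A (schur_fun \<kappa>) = spoly (<) A \<kappa> empty_part"
proof (rule mfps_eqI)
  fix m
  show "mcoeff (restr A (schur_fun \<kappa>)) m = mcoeff (spoly (<) A \<kappa> empty_part) m"
  proof (cases "set_mset m \<subseteq> A")
    case True
    then show ?thesis
      using ssyt_content_subset[OF True, of "(<)" UNIV \<kappa> empty_part]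
      by (simp add: mcoeff_restr mcoeff_spoly[OF assms] schur_fun_def cont_def)
  next
    case False
    have "cont \<kappa> empty_part T \<noteq> m" if T: "T \<in> ssyt (<) A \<kappa> empty_part" for T
    proof
      assume "cont \<kappa> empty_part T = m"
      then have "set_mset m = T ` skew_cells \<kappa> empty_part"
        using set_mset_cont[of \<kappa> empty_part T] by simp
      moreover have "T ` skew_cells \<kappa> empty_part \<subseteq> A"
        using ssyt_entry[OF T] by (rule image_subsetI)
      ultimately show False using False by simp
    qed
    then have "{T \<in> ssyt (<) A \<kappa> empty_part. cont \<kappa> empty_part T = m} = {}" by blast
    then have "mcoeff (spoly (<) A \<kappa> empty_part :: ratfun mfps) m = 0"
      unfolding mcoeff_spoly[OF assms] by (simp only: card.empty of_nat_0)
    then show ?thesis using False by (simp add: mcoeff_restr)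
  qed
qed

text \<open>The involution is used on all columns: with c = \<open>part \<kappa> 0\<close> there is
  no cell in column c, so the condition on that column is vacuous.\<close>

lemma spoly_adj_sym:
  assumes le: "part_le \<rho> \<kappa>" and k: "Suc k < r"
  shows "mcoeff (spoly (<) {..<r} \<kappa> \<rho>) (image_mset (transpose k (Suc k)) m) =
     mcoeff (spoly (<) {..<r} \<kappa> \<rho>) m"
proof -
  let ?c = "part \<kappa> 0" and ?\<tau> = "transpose k (Suc k)"
  let ?\<phi> = "bk \<kappa> \<rho> ?c k"
  have c: "cont \<kappa> \<rho> (?\<phi> T) = image_mset ?\<tau> (cont \<kappa> \<rho> T)" if "T \<in> ssyt (<) {..<r} \<kappa> \<rho>" for T
  proof (rule multiset_eqI)
    fix t
    have count: "count (image_mset ?\<tau> M) t = count M (?\<tau> t)" for M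
      by (induction M) (auto simp: transpose_def)
    show "count (cont \<kappa> \<rho> (?\<phi> T)) t = count (image_mset ?\<tau> (cont \<kappa> \<rho> T)) t"
      unfolding count unfolding count_cont
      by (rule bk_col_weight[OF le that k]) (use skew_cells_bounded[of _ ?c \<kappa> \<rho>] in blast)
  qed
  have tt: "image_mset ?\<tau> (image_mset ?\<tau> M) = M" for M
    by (simp add: multiset.map_comp o_def)
  have phi: "?\<phi> T \<in> ssyt (<) {..<r} \<kappa> \<rho>" "?\<phi> (?\<phi> T) = T" if "T \<in> ssyt (<) {..<r} \<kappa> \<rho>" for T
    by (rule bk_in_ssyt[OF le that k] bk_bk[OF le that k], use skew_cells_bounded[of _ ?c \<kappa> \<rho>] in blast)+
  have "bij_betw ?\<phi> {T \<in> ssyt (<) {..<r} \<kappa> \<rho>. cont \<kappa> \<rho> T = m}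
      {T \<in> ssyt (<) {..<r} \<kappa> \<rho>. cont \<kappa> \<rho> T = image_mset ?\<tau> m}"
    by (rule bij_betw_byWitness[of _ ?\<phi>])
      (auto simp: c tt phi)
  then show ?thesis by (simp add: mcoeff_spoly bij_betw_same_card)
qed

lemma schur_fun_adj_sym:
  "mcoeff (schur_fun \<kappa>) (image_mset (transpose k (Suc k)) m) = mcoeff (schur_fun \<kappa>) m"
proof -
  obtain N where N: "set_mset m \<subseteq> {..<N}"
    using finite_nat_set_iff_bounded[of "set_mset m"] by auto
  define r where "r = max N (Suc (Suc k))"
  have r: "set_mset m \<subseteq> {..<r}" "Suc k < r" using N by (auto simp: r_def)
  then have r': "set_mset (image_mset (transpose k (Suc k)) m) \<subseteq> {..<r}"
    by (auto simp: transpose_def)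
  have "mcoeff (schur_fun \<kappa>) m' = mcoeff (spoly (<) {..<r} \<kappa> empty_part) m'"
    if "set_mset m' \<subseteq> {..<r}" for m'
    using that arg_cong[OF restr_schur_fun[of "{..<r}" \<kappa>], of "\<lambda>f. mcoeff f m'"]
    by (simp add: mcoeff_restr)
  then show ?thesis using spoly_adj_sym[OF _ r(2), of empty_part \<kappa> m] r r' by simp
qed

section \<open>From adjacent transpositions to arbitrary injections\<close>

lemma finite_inj_extends_permutes:
  assumes "finite S" "D \<subseteq> S" "inj_on f D" "f ` D \<subseteq> S"
  obtains p where "p permutes S" "\<And>x. x \<in> D \<Longrightarrow> p x = f x"
proof -
  have "card (S - D) = card (S - f ` D)"
    using assms by (simp add: card_Diff_subset finite_subset card_image)
  then obtain h where h: "bij_betw h (S - D) (S - f ` D)"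
    using finite_same_card_bij[of "S - D" "S - f ` D"] assms(1) by auto
  define p where "p x = (if x \<in> D then f x else if x \<in> S then h x else x)" for x
  have "bij_betw p D (f ` D)" using assms(3) by (auto simp: p_def bij_betw_def inj_on_def)
  moreover have "bij_betw p (S - D) (S - f ` D)"
    using h by (rule iffD1[OF bij_betw_cong, rotated]) (auto simp: p_def)
  ultimately have "bij_betw p (D \<union> (S - D)) (f ` D \<union> (S - f ` D))"
    by (rule bij_betw_combine) auto
  moreover have "D \<union> (S - D) = S" "f ` D \<union> (S - f ` D) = S" using assms by auto
  ultimately have "p permutes S"
    using assms(2) by (intro bij_imp_permutes) (auto simp: p_def)
  then show ?thesis by (rule that) (simp add: p_def)
qed

lemma adj_sym_imp_transpose:
  fixes f :: "nat multiset \<Rightarrow> 'b"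
  assumes adj: "\<And>k m. f (image_mset (transpose k (Suc k)) m) = f m"
  shows "f (image_mset (transpose a b) m) = f m"
proof -
  have "f (image_mset (transpose a (a + d)) m) = f m" for a d m
  proof (induction d arbitrary: m)
    case 0
    then show ?case by simp
  next
    case (Suc d)
    have eq: "transpose a (a + Suc d) =
        transpose (a + d) (Suc (a + d)) \<circ> transpose a (a + d) \<circ> transpose (a + d) (Suc (a + d))"
      if "d \<noteq> 0" using that by (auto simp: fun_eq_iff transpose_def)
    show ?case
    proof (cases "d = 0")
      case True
      then show ?thesis using adj by simp
    next
      case False
      then show ?thesis
        unfolding eq[OF False] multiset.map_comp[symmetric] by (simp only: adj Suc)
    qed
  qed
  from this[of "min a b" "max a b - min a b"] show ?thesis
    by (cases "a \<le> b") (simp_all add: transpose_commute)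
qed

text \<open>Only the values on the finitely many indices in m matter, so \<open>\<pi>\<close> may be
  replaced by a permutation of a finite interval, a product of transpositions.\<close>

lemma adj_sym_imp_sym:
  fixes f :: "nat multiset \<Rightarrow> 'b"
  assumes adj: "\<And>k m. f (image_mset (transpose k (Suc k)) m) = f m"
    and inj: "inj_on \<pi> (set_mset m)"
  shows "f (image_mset \<pi> m) = f m"
proof -
  obtain N where "set_mset m \<union> \<pi> ` set_mset m \<subseteq> {..<N}"
    using finite_nat_set_iff_bounded[of "set_mset m \<union> \<pi> ` set_mset m"] by auto
  then obtain p where p: "p permutes {..<N}" "\<And>x. x \<in> set_mset m \<Longrightarrow> p x = \<pi> x"
    using finite_inj_extends_permutes[of "{..<N}" "set_mset m" \<pi>] inj by auto
  have "f (image_mset p m) = f m" for m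
    using p(1) finite_lessThan
  proof (induction arbitrary: m rule: permutes_induct)
    case id
    then show ?case by simp
  next
    case (swap a b p)
    have "f (image_mset (transpose a b \<circ> p) m) = f (image_mset (transpose a b) (image_mset p m))"
      by (simp only: multiset.map_comp)
    also have "\<dots> = f (image_mset p m)" by (rule adj_sym_imp_transpose) (rule adj)
    also have "\<dots> = f m" by (rule swap)
    finally show ?case .
  qed
  moreover have "image_mset \<pi> m = image_mset p m" using p(2) by (intro image_mset_cong) simp
  ultimately show ?thesis by simp
qed

lemma schur_fun_sym:
  "inj_on \<pi> (set_mset m) \<Longrightarrow> mcoeff (schur_fun \<kappa>) (image_mset \<pi> m) = mcoeff (schur_fun \<kappa>) m"
  by (rule adj_sym_imp_sym[of "mcoeff (schur_fun \<kappa>)"]) (rule schur_fun_adj_sym)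

subsection \<open>Splitting a tableau at a threshold\<close>

definition split_part :: "partition \<Rightarrow> partition \<Rightarrow> nat set \<Rightarrow> (nat \<times> nat \<Rightarrow> nat) \<Rightarrow> partition" where
  "split_part \<kappa> \<rho> B T = Abs_partition (\<lambda>i. part \<rho> i + card {j. (i, j) \<in> skew_cells \<kappa> \<rho> \<and> T (i, j) \<in> B})"

lemma skew_cells_split:
  "part_le \<rho> \<theta> \<Longrightarrow> part_le \<theta> \<kappa> \<Longrightarrow> skew_cells \<kappa> \<rho> = skew_cells \<theta> \<rho> \<union> skew_cells \<kappa> \<theta>"
  "skew_cells \<theta> \<rho> \<inter> skew_cells \<kappa> \<theta> = {}"
  unfolding skew_cells_def part_le_def by (auto intro: order_trans less_le_trans)

lemma part_le_trans: "part_le a b \<Longrightarrow> part_le b c \<Longrightarrow> part_le a c"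
  unfolding part_le_def by (meson order_trans)

context
  fixes lt :: "nat \<Rightarrow> nat \<Rightarrow> bool" and B C :: "nat set"
  assumes BC: "\<And>b c. b \<in> B \<Longrightarrow> c \<in> C \<Longrightarrow> lt b c \<and> \<not> lt c b \<and> b \<noteq> c"
begin

text \<open>All letters of \<open>B\<close> precede all letters of \<open>C\<close>. Row weakness
  makes the \<open>B\<close> cells an initial piece of each row, and column strictness puts a
  \<open>B\<close> cell above every \<open>B\<close> cell in the shape, so the piece lengths form a
  partition.\<close>

lemma split_part_props:
  assumes le: "part_le \<rho> \<kappa>" and T: "T \<in> ssyt lt (B \<union> C) \<kappa> \<rho>"
  defines "\<theta> \<equiv> split_part \<kappa> \<rho> B T"
  shows "part_le \<rho> \<theta>" "part_le \<theta> \<kappa>"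
    "(i, j) \<in> skew_cells \<kappa> \<rho> \<Longrightarrow> T (i, j) \<in> B \<longleftrightarrow> j < part \<theta> i"
proof -
  let ?J = "\<lambda>i. {j. (i, j) \<in> skew_cells \<kappa> \<rho> \<and> T (i, j) \<in> B}"
  let ?t = "\<lambda>i. part \<rho> i + card (?J i)"
  have J: "?J i \<subseteq> {part \<rho> i..<part \<kappa> i}" for i by (auto simp: skew_cells_def)
  have fin: "finite (?J i)" for i by (rule finite_subset[OF J]) simp
  have ent: "T p \<in> B \<or> T p \<in> C" if "p \<in> skew_cells \<kappa> \<rho>" for p
    using ssyt_entry[OF T that] by simp
  have J': "?J i = {part \<rho> i..<?t i}" for i
  proof (rule initial_segment[OF fin])
    fix i' j' assume j': "j' \<in> ?J i" and i': "part \<rho> i \<le> i'" "i' \<le> j'"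
    then have c: "(i, i') \<in> skew_cells \<kappa> \<rho>" by (auto simp: skew_cells_def)
    have "T (i, i') \<in> B"
    proof (rule ccontr)
      assume n: "T (i, i') \<notin> B"
      then have C: "T (i, i') \<in> C" using ent[OF c] by simp
      have "i' < j'" using n j' i' by (cases "i' = j'") auto
      then have "lt (T (i, i')) (T (i, j')) \<or> T (i, i') = T (i, j')"
        using T c j' unfolding ssyt_def by blast
      then show False using BC[OF _ C, of "T (i, j')"] j' by auto
    qed
    then show "i' \<in> ?J i" using c by simp
  qed (auto simp: skew_cells_def)
  have mem: "T (i, j) \<in> B \<longleftrightarrow> j < ?t i" if "(i, j) \<in> skew_cells \<kappa> \<rho>" for i j
  proof -
    have "j \<in> ?J i \<longleftrightarrow> j \<in> {part \<rho> i..<?t i}" using J'[of i] by (rule arg_cong)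
    then show ?thesis using that by (auto simp: skew_cells_def)
  qed
  have tk: "?t i \<le> part \<kappa> i" for i
    using card_mono[OF _ J[of i]] le[unfolded part_le_def, rule_format, of i] by simp
  have "?t (Suc i) \<le> ?t i" for i
  proof (rule ccontr)
    assume "\<not> ?thesis"
    then have a: "?t i < ?t (Suc i)" by simp
    have "?t i < part \<kappa> (Suc i)" using a tk[of "Suc i"] by simp
    then have 1: "(i, ?t i) \<in> skew_cells \<kappa> \<rho>" "(Suc i, ?t i) \<in> skew_cells \<kappa> \<rho>"
      using part_antimono[of i "Suc i" \<kappa>] part_antimono[of i "Suc i" \<rho>] by (auto simp: skew_cells_def)
    have b: "T (Suc i, ?t i) \<in> B" using mem[OF 1(2)] a by blast
    have "T (i, ?t i) \<notin> B" using mem[OF 1(1)] by blast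
    then have "T (i, ?t i) \<in> C" using ent[OF 1(1)] by simp
    then show False using ssyt_col[OF T 1] BC[OF b] by auto
  qed
  then have "antimono ?t" by (intro decseq_SucI)
  moreover have "finite {i. ?t i \<noteq> 0}"
  proof (rule finite_subset[OF _ finite_part[of \<kappa>]])
    show "{i. ?t i \<noteq> 0} \<subseteq> {i. part \<kappa> i \<noteq> 0}"
    proof
      fix i assume "i \<in> {i. ?t i \<noteq> 0}"
      then have "0 < ?t i" by (simp only: mem_Collect_eq neq0_conv)
      then have "0 < part \<kappa> i" using tk[of i] by (rule less_le_trans)
      then show "i \<in> {i. part \<kappa> i \<noteq> 0}" by simp
    qed
  qed
  ultimately have pt: "part \<theta> = ?t"
    unfolding \<theta>_def split_part_def by (intro Abs_partition_inverse) simp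
  show "part_le \<rho> \<theta>" "part_le \<theta> \<kappa>" using tk by (simp_all add: part_le_def pt)
  show "(i, j) \<in> skew_cells \<kappa> \<rho> \<Longrightarrow> T (i, j) \<in> B \<longleftrightarrow> j < part \<theta> i" using mem pt by simp
qed

text \<open>\<open>cut\<close> and \<open>glue\<close> are mutually inverse. An arbitrary
  \<open>lt\<close> is allowed so that the lemma applies to both orders of the alphabet.\<close>

lemma spoly_split:
  assumes le: "part_le \<rho> \<kappa>" and fin: "finite B" "finite C"
  shows "spoly lt (B \<union> C) \<kappa> \<rho> =
    (\<Sum>\<theta> | part_le \<rho> \<theta> \<and> part_le \<theta> \<kappa>. spoly lt B \<theta> \<rho> * spoly lt C \<kappa> \<theta>)"
proof -
  let ?\<Theta> = "{\<theta>. part_le \<rho> \<theta> \<and> part_le \<theta> \<kappa>}"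
  let ?P = "Sigma ?\<Theta> (\<lambda>\<theta>. ssyt lt B \<theta> \<rho> \<times> ssyt lt C \<kappa> \<theta>)"
  let ?X = "skew_cells \<kappa> \<rho>"
  define glue where "glue = (\<lambda>(\<theta>, T1, T2) p. if p \<in> skew_cells \<theta> \<rho> then T1 p
      else if p \<in> skew_cells \<kappa> \<theta> then T2 p else (undefined :: nat))"
  define cut where "cut T = (let \<theta> = split_part \<kappa> \<rho> B T in
      (\<theta>, restrict T (skew_cells \<theta> \<rho>), restrict T (skew_cells \<kappa> \<theta>)))" for T
  have fin\<Theta>: "finite ?\<Theta>" by (rule finite_subset[OF _ finite_part_le[of \<kappa>]]) auto
  have "(\<Sum>\<theta>\<in>?\<Theta>. spoly lt B \<theta> \<rho> * spoly lt C \<kappa> \<theta>) =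
     (\<Sum>\<theta>\<in>?\<Theta>. \<Sum>(T1, T2)\<in>ssyt lt B \<theta> \<rho> \<times> ssyt lt C \<kappa> \<theta>. mmon (cont \<theta> \<rho> T1 + cont \<kappa> \<theta> T2))"
    by (simp add: spoly_def sum_product sum.cartesian_product mmon_mult)
  also have "\<dots> = (\<Sum>(\<theta>, T1, T2)\<in>?P. mmon (cont \<theta> \<rho> T1 + cont \<kappa> \<theta> T2))"
    by (subst sum.Sigma[OF fin\<Theta>]) (simp_all add: fin)
  also have "\<dots> = (\<Sum>T\<in>ssyt lt (B \<union> C) \<kappa> \<rho>. mmon (cont \<kappa> \<rho> T))"
  proof (rule sum.reindex_bij_witness[of _ cut glue])
    fix P assume P: "P \<in> ?P"
    obtain \<theta> T1 T2 where Peq: "P = (\<theta>, T1, T2)" by (cases P)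
    from P have th: "part_le \<rho> \<theta>" "part_le \<theta> \<kappa>" and T1: "T1 \<in> ssyt lt B \<theta> \<rho>" and T2: "T2 \<in> ssyt lt C \<kappa> \<theta>"
      by (auto simp: Peq)
    note X = skew_cells_split(1)[OF th] and dis = skew_cells_split(2)[of \<theta> \<rho> \<kappa>]
    have g1: "glue P p = T1 p" if "p \<in> skew_cells \<theta> \<rho>" for p using that by (simp add: glue_def Peq)
    have g2: "glue P p = T2 p" if "p \<in> skew_cells \<kappa> \<theta>" for p
      using that dis by (auto simp: glue_def Peq)
    have e1: "glue P p \<in> B" if "p \<in> skew_cells \<theta> \<rho>" for p
      using ssyt_entry[OF T1 that] g1[OF that] by simp
    have e2: "glue P p \<in> C" if "p \<in> skew_cells \<kappa> \<theta>" for p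
      using ssyt_entry[OF T2 that] g2[OF that] by simp
    have lt12: "lt (glue P p) (glue P q)" if "p \<in> skew_cells \<theta> \<rho>" "q \<in> skew_cells \<kappa> \<theta>" for p q
      using BC[OF e1[OF that(1)] e2[OF that(2)]] by simp
    show G: "glue P \<in> ssyt lt (B \<union> C) \<kappa> \<rho>"
      unfolding ssyt_def
    proof (intro CollectI conjI allI impI)
      show "glue P \<in> ?X \<rightarrow>\<^sub>E B \<union> C"
      proof (rule PiE_I)
        fix p assume "p \<in> ?X"
        then show "glue P p \<in> B \<union> C" using e1 e2 X by blast
      next
        fix p assume "p \<notin> ?X"
        then show "glue P p = undefined" using X by (simp add: glue_def Peq)
      qed
    next
      fix i j j' assume a: "(i, j) \<in> ?X \<and> (i, j') \<in> ?X \<and> j < j'"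
      consider "(i, j) \<in> skew_cells \<theta> \<rho>" "(i, j') \<in> skew_cells \<theta> \<rho>"
        | "(i, j) \<in> skew_cells \<theta> \<rho>" "(i, j') \<in> skew_cells \<kappa> \<theta>"
        | "(i, j) \<in> skew_cells \<kappa> \<theta>" "(i, j') \<in> skew_cells \<kappa> \<theta>"
        using a X by (auto simp: skew_cells_def)
      then show "lt (glue P (i, j)) (glue P (i, j')) \<or> glue P (i, j) = glue P (i, j')"
      proof cases
        case 1
        then show ?thesis using T1 a unfolding g1[OF 1(1)] g1[OF 1(2)] ssyt_def by blast
      next
        case 2
        then show ?thesis using lt12 by blast
      next
        case 3
        then show ?thesis using T2 a unfolding g2[OF 3(1)] g2[OF 3(2)] ssyt_def by blast
      qed
    next
      fix i i' j assume a: "(i, j) \<in> ?X \<and> (i', j) \<in> ?X \<and> i < i'"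
      consider "(i, j) \<in> skew_cells \<theta> \<rho>" "(i', j) \<in> skew_cells \<theta> \<rho>"
        | "(i, j) \<in> skew_cells \<theta> \<rho>" "(i', j) \<in> skew_cells \<kappa> \<theta>"
        | "(i, j) \<in> skew_cells \<kappa> \<theta>" "(i', j) \<in> skew_cells \<kappa> \<theta>"
        using a X part_antimono[of i i' \<theta>] by (auto simp: skew_cells_def)
      then show "lt (glue P (i, j)) (glue P (i', j))"
      proof cases
        case 1
        then show ?thesis using ssyt_col[OF T1 1] a g1 by simp
      next
        case 2
        then show ?thesis using lt12 by blast
      next
        case 3
        then show ?thesis using ssyt_col[OF T2 3] a g2 by simp
      qed
    qed
    have "part (split_part \<kappa> \<rho> B (glue P)) i = part \<theta> i" for i
    proof -
      have "glue P (i, j) \<in> B \<longleftrightarrow> j < part \<theta> i" if "(i, j) \<in> ?X" for j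
        using that e1[of "(i, j)"] e2[of "(i, j)"] BC[of "glue P (i, j)" "glue P (i, j)"]
        by (cases "j < part \<theta> i") (auto simp: skew_cells_def)
      then have eq: "j < part (split_part \<kappa> \<rho> B (glue P)) i \<longleftrightarrow> j < part \<theta> i" if "(i, j) \<in> ?X" for j
        using split_part_props(3)[OF le G that] that by blast
      note b = split_part_props(1,2)[OF le G]
      show ?thesis
      proof (rule ccontr)
        let ?s = "part (split_part \<kappa> \<rho> B (glue P)) i"
        assume ne: "?s \<noteq> part \<theta> i"
        \<comment> \<open>Both lengths lie between those of \<open>\<rho>\<close> and
          \<open>\<kappa>\<close>; if they differed, this cell would count as a \<open>B\<close>
          cell for one of them and not for the other.\<close>
        have "(i, min ?s (part \<theta> i)) \<in> ?X"
          using b th ne unfolding part_le_def skew_cells_def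
          by (auto simp: min_def) (meson le_less_trans less_le_trans linorder_not_le nat_less_le)+
        from eq[OF this] show False using ne by auto
      qed
    qed
    then have sp: "split_part \<kappa> \<rho> B (glue P) = \<theta>" by (rule partition_eqI)
    have "restrict (glue P) (skew_cells \<theta> \<rho>) = T1"
      using T1 g1 by (intro ext) (auto simp: ssyt_def restrict_def PiE_iff extensional_def)
    moreover have "restrict (glue P) (skew_cells \<kappa> \<theta>) = T2"
      using T2 g2 by (intro ext) (auto simp: ssyt_def restrict_def PiE_iff extensional_def)
    ultimately show "cut (glue P) = P" unfolding cut_def Let_def sp by (simp add: Peq)
    have "cont \<kappa> \<rho> (glue P) = cont \<theta> \<rho> (glue P) + cont \<kappa> \<theta> (glue P)"
      unfolding cont_def X using dis by (subst mset_set_Union) simp_all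
    also have "cont \<theta> \<rho> (glue P) = cont \<theta> \<rho> T1"
      unfolding cont_def by (rule image_mset_cong) (simp add: g1)
    also have "cont \<kappa> \<theta> (glue P) = cont \<kappa> \<theta> T2"
      unfolding cont_def by (rule image_mset_cong) (simp add: g2)
    finally show "mmon (cont \<kappa> \<rho> (glue P)) = (case P of (\<theta>, T1, T2) \<Rightarrow> mmon (cont \<theta> \<rho> T1 + cont \<kappa> \<theta> T2))"
      by (simp add: Peq)
  next
    fix T assume T: "T \<in> ssyt lt (B \<union> C) \<kappa> \<rho>"
    define \<theta> where "\<theta> = split_part \<kappa> \<rho> B T"
    note th = split_part_props[OF le T, folded \<theta>_def]
    note X = skew_cells_split(1)[OF th(1,2)]
    have TE: "T \<in> ?X \<rightarrow>\<^sub>E B \<union> C" using T by (simp add: ssyt_def)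
    show "glue (cut T) = T"
    proof
      fix p
      show "glue (cut T) p = T p"
        using TE X by (cases p) (auto simp: glue_def cut_def Let_def \<theta>_def[symmetric] PiE_iff extensional_def)
    qed
    have c1: "T p \<in> B" if "p \<in> skew_cells \<theta> \<rho>" for p
      using that X th(3)[of "fst p" "snd p"] by (auto simp: skew_cells_def)
    have c2: "T p \<in> C" if "p \<in> skew_cells \<kappa> \<theta>" for p
    proof -
      have "p \<in> ?X" using that X by blast
      moreover have "T p \<notin> B" using th(3)[of "fst p" "snd p"] \<open>p \<in> ?X\<close> that by (auto simp: skew_cells_def)
      ultimately show ?thesis using TE by auto
    qed
    have "restrict T (skew_cells \<theta> \<rho>) \<in> ssyt lt B \<theta> \<rho>"
      using T c1 X unfolding ssyt_def by auto
    moreover have "restrict T (skew_cells \<kappa> \<theta>) \<in> ssyt lt C \<kappa> \<theta>"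
      using T c2 X unfolding ssyt_def by auto
    ultimately show "cut T \<in> ?P" using th by (simp add: cut_def Let_def \<theta>_def[symmetric])
  qed
  finally show ?thesis unfolding spoly_def by (rule sym)
qed

end

text \<open>Only the half of the horizontal strip condition that forbids two cells in a column;
  containment is always stated separately by \<open>part_le\<close>.\<close>

definition hstrip :: "partition \<Rightarrow> partition \<Rightarrow> bool" where
  "hstrip \<kappa> \<theta> \<longleftrightarrow> (\<forall>i. part \<kappa> (Suc i) \<le> part \<theta> i)"

lemma spoly_single:
  assumes le: "part_le \<theta> \<kappa>" and irr: "\<not> lt a a"
  shows "spoly lt {a} \<kappa> \<theta> =
    (if hstrip \<kappa> \<theta> then mmon (replicate_mset (part_size \<kappa> - part_size \<theta>) a) else 0)"
proof (cases "hstrip \<kappa> \<theta>")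
  case True
  have nocol: "i = i'" if "(i, j) \<in> skew_cells \<kappa> \<theta>" "(i', j) \<in> skew_cells \<kappa> \<theta>" for i i' j
  proof -
    have "\<not> i < i'" if "(i, j) \<in> skew_cells \<kappa> \<theta>" "(i', j) \<in> skew_cells \<kappa> \<theta>" for i i' j
    proof
      assume "i < i'"
      then have "part \<kappa> i' \<le> part \<kappa> (Suc i)" by (intro part_antimono) simp
      also have "\<dots> \<le> part \<theta> i" using True by (simp add: hstrip_def)
      finally show False using that by (auto simp: skew_cells_def)
    qed
    then show ?thesis using that by (meson linorder_neqE_nat)
  qed
  have "ssyt lt {a} \<kappa> \<theta> = {restrict (\<lambda>_. a) (skew_cells \<kappa> \<theta>)}"
  proof (intro equalityI subsetI)
    fix T assume "T \<in> ssyt lt {a} \<kappa> \<theta>"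
    then show "T \<in> {restrict (\<lambda>_. a) (skew_cells \<kappa> \<theta>)}"
      by (auto simp: ssyt_def fun_eq_iff PiE_iff extensional_def)
  next
    fix T assume "T \<in> {restrict (\<lambda>_. a) (skew_cells \<kappa> \<theta>)}"
    then have T: "T = restrict (\<lambda>_. a) (skew_cells \<kappa> \<theta>)" by simp
    show "T \<in> ssyt lt {a} \<kappa> \<theta>"
      unfolding ssyt_def T
    proof (intro CollectI conjI allI impI)
      fix i i' j assume "(i, j) \<in> skew_cells \<kappa> \<theta> \<and> (i', j) \<in> skew_cells \<kappa> \<theta> \<and> i < i'"
      then have False using nocol[of i j i'] by simp
      then show "lt (restrict (\<lambda>_. a) (skew_cells \<kappa> \<theta>) (i, j)) (restrict (\<lambda>_. a) (skew_cells \<kappa> \<theta>) (i', j))" ..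
    qed simp_all
  qed
  moreover have "cont \<kappa> \<theta> (restrict (\<lambda>_. a) (skew_cells \<kappa> \<theta>)) = replicate_mset (card (skew_cells \<kappa> \<theta>)) a"
    unfolding cont_def
    by (subst image_mset_cong[of _ _ "\<lambda>_. a"]) (simp_all add: image_mset_const_eq)
  ultimately show ?thesis
    using True card_skew_cells[OF le] by (simp add: spoly_def) (metis add_diff_cancel_right')
next
  case False
  then obtain i where i: "part \<theta> i < part \<kappa> (Suc i)" by (auto simp: hstrip_def not_le)
  have c: "(i, part \<theta> i) \<in> skew_cells \<kappa> \<theta>" "(Suc i, part \<theta> i) \<in> skew_cells \<kappa> \<theta>"
    using i part_antimono[of i "Suc i" \<kappa>] part_antimono[of i "Suc i" \<theta>] by (auto simp: skew_cells_def)
  have "ssyt lt {a} \<kappa> \<theta> = {}"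
  proof (rule ccontr)
    assume "ssyt lt {a} \<kappa> \<theta> \<noteq> {}"
    then obtain T where T: "T \<in> ssyt lt {a} \<kappa> \<theta>" by auto
    from ssyt_col[OF T c] ssyt_entry[OF T c(1)] ssyt_entry[OF T c(2)] irr show False by simp
  qed
  then show ?thesis using False by (simp add: spoly_def)
qed

lemma spoly_empty:
  assumes le: "part_le \<rho> \<kappa>"
  shows "spoly lt {} \<kappa> \<rho> = (if \<kappa> = \<rho> then 1 else 0)"
proof (cases "\<kappa> = \<rho>")
  case True
  have "skew_cells \<rho> \<rho> = {}" by (auto simp: skew_cells_def)
  then have "ssyt lt {} \<rho> \<rho> = {\<lambda>_. undefined}" "cont \<rho> \<rho> T = {#}" for T
    by (auto simp: ssyt_def cont_def)
  then show ?thesis using True by (simp add: spoly_def)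
next
  case False
  then obtain i where "part \<rho> i < part \<kappa> i"
    using le partition_eqI[of \<kappa> \<rho>] unfolding part_le_def by (metis le_neq_implies_less)
  then have "(i, part \<rho> i) \<in> skew_cells \<kappa> \<rho>" by (simp add: skew_cells_def)
  then have "ssyt lt {} \<kappa> \<rho> = {}" using ssyt_entry[of _ lt "{}"] by blast
  then show ?thesis using False by (simp add: spoly_def)
qed

section \<open>Conjugate partitions and the supersymmetric cancellation\<close>

lemma conj_part_iff: "i < part (conj_part lam) j \<longleftrightarrow> j < part lam i"
proof -
  have fin: "finite {i. j < part lam i}"
    by (rule finite_subset[OF _ finite_part[of lam]]) auto
  have "{i. j < part lam i} = {0..<0 + card {i. j < part lam i}}"
    by (rule initial_segment[OF fin]) (use part_antimono in \<open>auto intro: less_le_trans\<close>)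
  then have "i \<in> {i. j < part lam i} \<longleftrightarrow> i \<in> {0..<0 + card {i. j < part lam i}}" by (rule arg_cong)
  then show ?thesis by (simp add: part_conj_part)
qed

lemma nat_eqI_less: "(\<And>k. k < a \<longleftrightarrow> k < b) \<Longrightarrow> a = (b :: nat)"
proof -
  assume *: "\<And>k. k < a \<longleftrightarrow> k < b"
  show "a = b" using *[of a] *[of b] by simp
qed

lemma nat_leI_less: "(\<And>k. k < a \<Longrightarrow> k < b) \<Longrightarrow> a \<le> (b :: nat)"
  by (meson less_irrefl not_le)

lemma conj_conj [simp]: "conj_part (conj_part lam) = lam"
  by (intro partition_eqI nat_eqI_less) (simp add: conj_part_iff)

lemma conj_le_iff [simp]: "part_le (conj_part a) (conj_part b) \<longleftrightarrow> part_le a b"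
proof -
  have "part_le (conj_part a) (conj_part b)" if "part_le a b" for a b
    unfolding part_le_def
  proof (intro allI nat_leI_less)
    fix j k assume "k < part (conj_part a) j"
    then have "j < part a k" by (simp add: conj_part_iff)
    also have "\<dots> \<le> part b k" using that by (simp add: part_le_def)
    finally show "k < part (conj_part b) j" by (simp add: conj_part_iff)
  qed
  from this[of a b] this[of "conj_part a" "conj_part b"] show ?thesis by auto
qed

lemma part_size_mono: "part_le a b \<Longrightarrow> part_size a \<le> part_size b"
  using card_skew_cells[of a b] by simp

lemma seq_size_zero [simp]: "seq_size (\<lambda>_. 0) = 0"
  by (simp add: seq_size_def)

lemma part_size_eq_card: "part_size \<kappa> = card (skew_cells \<kappa> empty_part)"
  using card_skew_cells[of empty_part \<kappa>] by simp

lemma part_size_conj [simp]: "part_size (conj_part \<kappa>) = part_size \<kappa>"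
proof -
  have "bij_betw prod.swap (skew_cells (conj_part \<kappa>) empty_part) (skew_cells \<kappa> empty_part)"
    by (rule bij_betw_byWitness[of _ prod.swap]) (auto simp: skew_cells_def conj_part_iff)
  then show ?thesis by (simp add: part_size_eq_card bij_betw_same_card)
qed

lemma part_le_refl [simp]: "part_le a a"
  by (simp add: part_le_def)

lemma part_le_antisym: "part_le a b \<Longrightarrow> part_le b a \<Longrightarrow> a = b"
  by (intro partition_eqI antisym) (auto simp: part_le_def)

lemma part_size_eqD: "part_le a b \<Longrightarrow> part_size a = part_size b \<Longrightarrow> a = b"
proof -
  assume le: "part_le a b" and eq: "part_size a = part_size b"
  then have "card (skew_cells b a) = 0" using card_skew_cells[OF le] by simp
  then have e: "skew_cells b a = {}" by simp
  have "part b i \<le> part a i" for i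
  proof (rule ccontr)
    assume "\<not> ?thesis"
    then have "(i, part a i) \<in> skew_cells b a" by (simp add: skew_cells_def)
    then show False using e by simp
  qed
  then show "a = b" using le by (intro part_le_antisym) (auto simp: part_le_def)
qed

text \<open>The vertical strip condition, at most one cell per row, without mention of
  conjugates.\<close>

lemma hstrip_conj_iff:
  "hstrip (conj_part \<zeta>) (conj_part \<kappa>) \<longleftrightarrow> (\<forall>i. part \<zeta> i \<le> Suc (part \<kappa> i))"
proof
  assume h: "hstrip (conj_part \<zeta>) (conj_part \<kappa>)"
  show "\<forall>i. part \<zeta> i \<le> Suc (part \<kappa> i)"
  proof (intro allI, rule ccontr)
    fix i assume "\<not> part \<zeta> i \<le> Suc (part \<kappa> i)"
    then have "i < part (conj_part \<zeta>) (Suc (part \<kappa> i))" by (simp add: conj_part_iff)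
    also have "\<dots> \<le> part (conj_part \<kappa>) (part \<kappa> i)" using h by (simp add: hstrip_def)
    finally show False by (simp add: conj_part_iff)
  qed
next
  assume v: "\<forall>i. part \<zeta> i \<le> Suc (part \<kappa> i)"
  show "hstrip (conj_part \<zeta>) (conj_part \<kappa>)"
    unfolding hstrip_def
  proof (intro allI nat_leI_less)
    fix j i assume "i < part (conj_part \<zeta>) (Suc j)"
    then have "Suc j < part \<zeta> i" by (simp add: conj_part_iff)
    also have "\<dots> \<le> Suc (part \<kappa> i)" using v by simp
    finally show "i < part (conj_part \<kappa>) j" by (simp add: conj_part_iff)
  qed
qed

lemma hstrip_refl: "hstrip \<kappa> \<kappa>"
  by (simp add: hstrip_def part_antimono)

lemma conj_le_swap: "part_le (conj_part a) b \<longleftrightarrow> part_le a (conj_part b)"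
  using conj_le_iff[of a "conj_part b"] by simp

lemma part_Abs_upd:
  assumes "i = 0 \<or> x \<le> part \<kappa> (i - 1)" "part \<kappa> (Suc i) \<le> x"
  shows "part (Abs_partition ((part \<kappa>)(i := x))) = (part \<kappa>)(i := x)"
proof (rule Abs_partition_inverse)
  have "antimono ((part \<kappa>)(i := x))"
    by (rule decseq_SucI) (use assms part_antimono[of _ "Suc _" \<kappa>] in \<open>auto simp: le_Suc_eq\<close>)
  then show "(part \<kappa>)(i := x) \<in> {l. antimono l \<and> finite {i. l i \<noteq> 0}}"
    using finite_support_upd[OF finite_part, of \<kappa> i x] by simp
qed

text \<open>For one variable: the complete homogeneous and the signed elementary generating functions are
  inverse to each other. The involution toggles the last cell of the first nonempty row of
  \<open>\<zeta> / \<eta>\<close>.\<close>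

lemma strip_cancellation:
  assumes le: "part_le \<eta> \<zeta>"
  shows "(\<Sum>\<kappa> | part_le \<eta> \<kappa> \<and> part_le \<kappa> \<zeta> \<and> hstrip \<kappa> \<eta> \<and> hstrip (conj_part \<zeta>) (conj_part \<kappa>).
      (-1 :: int) ^ (part_size \<zeta> - part_size \<kappa>)) = (if \<eta> = \<zeta> then 1 else 0)"
proof (cases "\<eta> = \<zeta>")
  case True
  have "{\<kappa>. part_le \<eta> \<kappa> \<and> part_le \<kappa> \<zeta> \<and> hstrip \<kappa> \<eta> \<and> hstrip (conj_part \<zeta>) (conj_part \<kappa>)} = {\<eta>}"
    using True hstrip_refl by (auto intro: part_le_antisym)
  then show ?thesis using True by simp
next
  case False
  let ?K = "{\<kappa>. part_le \<eta> \<kappa> \<and> part_le \<kappa> \<zeta> \<and> hstrip \<kappa> \<eta> \<and> hstrip (conj_part \<zeta>) (conj_part \<kappa>)}"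
  define i where "i = (LEAST i. part \<eta> i \<noteq> part \<zeta> i)"
  have ex: "\<exists>i. part \<eta> i \<noteq> part \<zeta> i" using False partition_eqI by blast
  have "part \<eta> i \<noteq> part \<zeta> i" unfolding i_def by (rule LeastI_ex[OF ex])
  then have i: "part \<eta> i < part \<zeta> i" using le by (simp add: part_le_def le_neq_implies_less)
  have above: "part \<eta> j = part \<zeta> j" if "j < i" for j
    using not_less_Least[of j "\<lambda>i. part \<eta> i \<noteq> part \<zeta> i"] that unfolding i_def by blast
  \<comment> \<open>The vertical strip condition leaves just these two values for row i of
    \<open>\<kappa>\<close>; both are at least the part of \<open>\<eta>\<close>, since
    \<open>\<zeta>\<close> is longer there.\<close>
  define x where "x \<kappa> = (if part \<kappa> i = part \<zeta> i then part \<zeta> i - 1 else part \<zeta> i)" for \<kappa>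
  define tg where "tg \<kappa> = Abs_partition ((part \<kappa>)(i := x \<kappa>))" for \<kappa>
  have main: "part (tg \<kappa>) = (part \<kappa>)(i := x \<kappa>)" "tg \<kappa> \<in> ?K" "tg (tg \<kappa>) = \<kappa>"
    "(-1 :: int) ^ (part_size \<zeta> - part_size (tg \<kappa>)) = - ((-1) ^ (part_size \<zeta> - part_size \<kappa>))"
    if K: "\<kappa> \<in> ?K" for \<kappa>
  proof -
    have e: "part \<eta> j \<le> part \<kappa> j" and z: "part \<kappa> j \<le> part \<zeta> j" and h: "part \<kappa> (Suc j) \<le> part \<eta> j"
      and v: "part \<zeta> j \<le> Suc (part \<kappa> j)" for j
      using K hstrip_conj_iff[of \<zeta> \<kappa>] by (simp_all add: part_le_def hstrip_def)
    have xx: "x \<kappa> \<le> part \<zeta> i" "part \<zeta> i \<le> Suc (x \<kappa>)" "part \<eta> i \<le> x \<kappa>"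
      using i by (auto simp: x_def)
    \<comment> \<open>Choosing the first row where \<open>\<eta>\<close> and \<open>\<zeta>\<close>
      differ pays off here: the row above agrees, so the toggled row never violates the horizontal
      strip condition.\<close>
    have pre: "part \<zeta> i \<le> part \<eta> (i - 1)" if "i \<noteq> 0"
      using above[of "i - 1"] part_antimono[of "i - 1" i \<zeta>] that by simp
    show p: "part (tg \<kappa>) = (part \<kappa>)(i := x \<kappa>)"
      unfolding tg_def
    proof (rule part_Abs_upd)
      show "i = 0 \<or> x \<kappa> \<le> part \<kappa> (i - 1)"
        using pre e[of "i - 1"] xx(1) by (cases "i = 0") auto
      show "part \<kappa> (Suc i) \<le> x \<kappa>" using h[of i] xx(3) by simp
    qed
    have "part \<kappa> (Suc j) \<le> part \<eta> j \<and> x \<kappa> \<le> part \<eta> j" if "Suc j = i" for j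
      using pre xx(1) h[of j] that by auto
    then have "hstrip (tg \<kappa>) \<eta>" using h by (auto simp: hstrip_def p)
    moreover have "part_le \<eta> (tg \<kappa>)" "part_le (tg \<kappa>) \<zeta>" using e z xx by (auto simp: part_le_def p)
    moreover have "hstrip (conj_part \<zeta>) (conj_part (tg \<kappa>))" using v xx by (auto simp: hstrip_conj_iff p)
    ultimately show tgK: "tg \<kappa> \<in> ?K" by simp
    have xtg: "x (tg \<kappa>) = part \<kappa> i" using v[of i] z[of i] i by (auto simp: x_def p)
    show "tg (tg \<kappa>) = \<kappa>"
      unfolding tg_def[of "tg \<kappa>"] p xtg by (simp add: part_inverse)
    have "part_size (tg \<kappa>) + part \<kappa> i = part_size \<kappa> + x \<kappa>"
      unfolding p by (rule seq_size_upd[OF finite_part])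
    moreover have "x \<kappa> = Suc (part \<kappa> i) \<or> part \<kappa> i = Suc (x \<kappa>)"
      using v[of i] z[of i] i by (auto simp: x_def)
    moreover have "part_size (tg \<kappa>) \<le> part_size \<zeta>" "part_size \<kappa> \<le> part_size \<zeta>"
      using tgK K by (auto intro: part_size_mono)
    ultimately have "part_size \<zeta> - part_size (tg \<kappa>) = Suc (part_size \<zeta> - part_size \<kappa>) \<or>
        part_size \<zeta> - part_size \<kappa> = Suc (part_size \<zeta> - part_size (tg \<kappa>))" by linarith
    then show "(-1 :: int) ^ (part_size \<zeta> - part_size (tg \<kappa>)) = - ((-1) ^ (part_size \<zeta> - part_size \<kappa>))"
      by auto
  qed
  have "(\<Sum>\<kappa>\<in>?K. (-1 :: int) ^ (part_size \<zeta> - part_size \<kappa>)) =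
     (\<Sum>\<kappa>\<in>?K. - ((-1) ^ (part_size \<zeta> - part_size \<kappa>)))"
    by (rule sum.reindex_bij_witness[of _ tg tg]) (use main in auto)
  then have "(\<Sum>\<kappa>\<in>?K. (-1 :: int) ^ (part_size \<zeta> - part_size \<kappa>)) = 0" by (simp add: sum_negf)
  then show ?thesis using False by simp
qed

text \<open>\<open>skew_cells\<close> is also defined for shapes that are not nested, where
  \<open>spoly\<close> has no meaning. With the value 0 there, all sums can run over the same index
  set of partitions inside \<open>\<nu>\<close> and be interchanged freely.\<close>

definition sp :: "(nat \<Rightarrow> nat \<Rightarrow> bool) \<Rightarrow> nat set \<Rightarrow> partition \<Rightarrow> partition \<Rightarrow> 'a::comm_ring_1 mfps" where
  "sp lt A \<kappa> \<rho> = (if part_le \<rho> \<kappa> then spoly lt A \<kappa> \<rho> else 0)"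

lemma sp_split:
  assumes BC: "\<And>b c. b \<in> B \<Longrightarrow> c \<in> C \<Longrightarrow> lt b c \<and> \<not> lt c b \<and> b \<noteq> c"
    and fin: "finite B" "finite C" and \<kappa>: "part_le \<kappa> \<nu>"
  shows "sp lt (B \<union> C) \<kappa> \<rho> = (\<Sum>\<theta> | part_le \<theta> \<nu>. sp lt B \<theta> \<rho> * sp lt C \<kappa> \<theta>)"
proof -
  have "(\<Sum>\<theta> | part_le \<theta> \<nu>. sp lt B \<theta> \<rho> * sp lt C \<kappa> \<theta>) =
      (\<Sum>\<theta> | part_le \<rho> \<theta> \<and> part_le \<theta> \<kappa>. sp lt B \<theta> \<rho> * sp lt C \<kappa> \<theta>)"
    by (rule sum.mono_neutral_right[OF finite_part_le])
      (use part_le_trans[OF _ \<kappa>] in \<open>auto simp: sp_def\<close>)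
  also have "\<dots> = sp lt (B \<union> C) \<kappa> \<rho>"
  proof (cases "part_le \<rho> \<kappa>")
    case True
    then show ?thesis by (simp add: sp_def spoly_split[OF BC True fin])
  next
    case False
    then have "{\<theta>. part_le \<rho> \<theta> \<and> part_le \<theta> \<kappa>} = {}" using part_le_trans by blast
    then show ?thesis using False by (simp only: sp_def sum.empty if_False)
  qed
  finally show ?thesis ..
qed

lemma sum_conj_part:
  "(\<Sum>\<theta> | part_le \<theta> (conj_part \<nu>). f \<theta>) = (\<Sum>\<theta> | part_le \<theta> \<nu>. f (conj_part \<theta>))"
  by (rule sum.reindex_bij_witness[of _ conj_part conj_part])
    (auto simp: conj_le_swap)

lemma sp_single:
  "\<not> lt a a \<Longrightarrow> sp lt {a} \<kappa> \<theta> = (if part_le \<theta> \<kappa> \<and> hstrip \<kappa> \<theta>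
     then mmon (replicate_mset (part_size \<kappa> - part_size \<theta>) a) else 0)"
  by (simp add: sp_def spoly_single)

text \<open>All nonzero terms carry the same power of the variable, of degree |\<zeta>| - |\<eta>|;
  what remains is the signed count of \<open>strip_cancellation\<close>.\<close>

lemma super_single:
  fixes \<eta> \<zeta> \<nu> :: partition
  assumes z: "part_le \<zeta> \<nu>"
  shows "(\<Sum>\<kappa> | part_le \<kappa> \<nu>. (-1) ^ (part_size \<nu> - part_size \<kappa>) *
       (sp (>) {a} (conj_part \<zeta>) (conj_part \<kappa>) * sp (<) {a} \<kappa> \<eta>)) =
     (if \<eta> = \<zeta> then (-1) ^ (part_size \<nu> - part_size \<zeta>) else (0 :: 'a::comm_ring_1 mfps))"
proof -
  let ?K = "{\<kappa>. part_le \<eta> \<kappa> \<and> part_le \<kappa> \<zeta> \<and> hstrip \<kappa> \<eta> \<and> hstrip (conj_part \<zeta>) (conj_part \<kappa>)}"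
  let ?c = "(-1) ^ (part_size \<nu> - part_size \<zeta>) * mmon (replicate_mset (part_size \<zeta> - part_size \<eta>) a) :: 'a mfps"
  have "(\<Sum>\<kappa> | part_le \<kappa> \<nu>. (-1) ^ (part_size \<nu> - part_size \<kappa>) *
       (sp (>) {a} (conj_part \<zeta>) (conj_part \<kappa>) * sp (<) {a} \<kappa> \<eta>)) =
     (\<Sum>\<kappa>\<in>?K. (-1) ^ (part_size \<nu> - part_size \<kappa>) *
       (sp (>) {a} (conj_part \<zeta>) (conj_part \<kappa>) * sp (<) {a} \<kappa> \<eta>))"
    by (rule sum.mono_neutral_right[OF finite_part_le])
      (use part_le_trans[OF _ z] in \<open>auto simp: sp_single\<close>)
  also have "\<dots> = (\<Sum>\<kappa>\<in>?K. ?c * of_int ((-1) ^ (part_size \<zeta> - part_size \<kappa>)))"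
  proof (rule sum.cong[OF refl])
    fix \<kappa> assume K: "\<kappa> \<in> ?K"
    then have s: "part_size \<eta> \<le> part_size \<kappa>" "part_size \<kappa> \<le> part_size \<zeta>" "part_size \<zeta> \<le> part_size \<nu>"
      using z by (auto intro: part_size_mono)
    have "(-1 :: 'a mfps) ^ (part_size \<nu> - part_size \<kappa>) =
        (-1) ^ (part_size \<nu> - part_size \<zeta>) * (-1) ^ (part_size \<zeta> - part_size \<kappa>)"
      unfolding power_add[symmetric] using s by simp
    moreover have "mmon (replicate_mset (part_size \<zeta> - part_size \<kappa>) a) * mmon (replicate_mset (part_size \<kappa> - part_size \<eta>) a) =
        (mmon (replicate_mset (part_size \<zeta> - part_size \<eta>) a) :: 'a mfps)"
      unfolding mmon_mult using s by (intro arg_cong[where f = mmon] multiset_eqI) simp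
    ultimately show "(-1) ^ (part_size \<nu> - part_size \<kappa>) *
       (sp (>) {a} (conj_part \<zeta>) (conj_part \<kappa>) * sp (<) {a} \<kappa> \<eta>) =
        ?c * of_int ((-1) ^ (part_size \<zeta> - part_size \<kappa>))"
      using K by (simp add: sp_single ac_simps)
  qed
  also have "\<dots> = ?c * of_int (\<Sum>\<kappa>\<in>?K. (-1) ^ (part_size \<zeta> - part_size \<kappa>))"
    by (simp only: of_int_sum sum_distrib_left)
  also have "\<dots> = (if \<eta> = \<zeta> then (-1) ^ (part_size \<nu> - part_size \<zeta>) else 0)"
  proof (cases "part_le \<eta> \<zeta>")
    case True
    then show ?thesis by (simp add: strip_cancellation)
  next
    case False
    then have e: "?K = {}" using part_le_trans by blast
    have "\<eta> \<noteq> \<zeta>" using False by auto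
    then show ?thesis by (simp only: e sum.empty of_int_0 mult_zero_right if_False)
  qed
  finally show ?thesis .
qed

lemma sum_product_regroup:
  "c * ((\<Sum>i\<in>I. P i * Q i) * (\<Sum>j\<in>J. R j * S j)) =
     (\<Sum>i\<in>I. \<Sum>j\<in>J. (Q i * R j) * (c * (P i * S j :: 'a::comm_ring_1)))"
  by (unfold sum_product, unfold sum_distrib_left) (intro sum.cong refl, simp only: ac_simps)

text \<open>Induction on the number of variables. The last variable is the largest letter for
  \<open><\<close> but the first one for \<open>>\<close>, so its two strips meet at
  \<open>\<kappa>\<close> and cancel by \<open>super_single\<close>, leaving the same identity for
  the other variables.\<close>

lemma super_cancel:
  assumes "part_le \<theta> \<nu>"
  shows "(\<Sum>\<kappa> | part_le \<kappa> \<nu>. (-1) ^ (part_size \<nu> - part_size \<kappa>) *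
       (sp (>) {n..<n + s} (conj_part \<nu>) (conj_part \<kappa>) * sp (<) {n..<n + s} \<kappa> \<theta>)) =
     (if \<theta> = \<nu> then 1 else (0 :: 'a::comm_ring_1 mfps))"
proof (induction s)
  case 0
  have "(\<Sum>\<kappa> | part_le \<kappa> \<nu>. (-1) ^ (part_size \<nu> - part_size \<kappa>) *
       (sp (>) {} (conj_part \<nu>) (conj_part \<kappa>) * sp (<) {} \<kappa> \<theta>)) =
       (\<Sum>\<kappa> | part_le \<kappa> \<nu>. if \<kappa> = \<nu> then (if \<theta> = \<nu> then 1 else 0) else (0 :: 'a mfps))"
    by (rule sum.cong[OF refl]) (auto simp: sp_def spoly_empty, metis conj_conj)
  also have "\<dots> = (if \<theta> = \<nu> then 1 else 0)" by (subst sum.delta) (simp_all add: finite_part_le)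
  finally show ?case by simp
next
  case (Suc s)
  let ?N = "{\<kappa>. part_le \<kappa> \<nu>}" and ?A = "{n..<n + s}" and ?a = "n + s"
  let ?sg = "\<lambda>\<kappa>. (-1 :: 'a mfps) ^ (part_size \<nu> - part_size \<kappa>)"
  have A1: "{n..<n + Suc s} = ?A \<union> {?a}" and A2: "{n..<n + Suc s} = {?a} \<union> ?A" by auto
  have s1: "sp (<) {n..<n + Suc s} \<kappa> \<theta> = (\<Sum>\<eta>\<in>?N. sp (<) ?A \<eta> \<theta> * sp (<) {?a} \<kappa> \<eta> :: 'a mfps)"
    if "\<kappa> \<in> ?N" for \<kappa>
    unfolding A1 by (rule sp_split) (use that in auto)
  have s2: "sp (>) {n..<n + Suc s} (conj_part \<nu>) (conj_part \<kappa>) =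
      (\<Sum>\<zeta>\<in>?N. sp (>) {?a} (conj_part \<zeta>) (conj_part \<kappa>) * sp (>) ?A (conj_part \<nu>) (conj_part \<zeta>) :: 'a mfps)" for \<kappa>
    unfolding A2 by (subst sp_split[where \<nu> = "conj_part \<nu>"]) (auto simp: sum_conj_part)
  have "(\<Sum>\<kappa>\<in>?N. ?sg \<kappa> * (sp (>) {n..<n + Suc s} (conj_part \<nu>) (conj_part \<kappa>) * sp (<) {n..<n + Suc s} \<kappa> \<theta>)) =
     (\<Sum>\<kappa>\<in>?N. \<Sum>\<zeta>\<in>?N. \<Sum>\<eta>\<in>?N. (sp (>) ?A (conj_part \<nu>) (conj_part \<zeta>) * sp (<) ?A \<eta> \<theta>) *
        (?sg \<kappa> * (sp (>) {?a} (conj_part \<zeta>) (conj_part \<kappa>) * sp (<) {?a} \<kappa> \<eta>)))"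
    by (rule sum.cong[OF refl]) (simp only: s1 s2 sum_product_regroup)
  also have "\<dots> = (\<Sum>\<zeta>\<in>?N. \<Sum>\<eta>\<in>?N. \<Sum>\<kappa>\<in>?N. (sp (>) ?A (conj_part \<nu>) (conj_part \<zeta>) * sp (<) ?A \<eta> \<theta>) *
        (?sg \<kappa> * (sp (>) {?a} (conj_part \<zeta>) (conj_part \<kappa>) * sp (<) {?a} \<kappa> \<eta>)))"
    by (subst sum.swap, rule sum.cong[OF refl], subst sum.swap, rule refl)
  also have "\<dots> = (\<Sum>\<zeta>\<in>?N. \<Sum>\<eta>\<in>?N. (sp (>) ?A (conj_part \<nu>) (conj_part \<zeta>) * sp (<) ?A \<eta> \<theta>) *
        (if \<eta> = \<zeta> then ?sg \<zeta> else 0))"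
    unfolding sum_distrib_left[symmetric]
    by (intro sum.cong refl arg_cong2[where f = "(*)"] super_single) simp
  also have "\<dots> = (\<Sum>\<zeta>\<in>?N. ?sg \<zeta> * (sp (>) ?A (conj_part \<nu>) (conj_part \<zeta>) * sp (<) ?A \<zeta> \<theta>))"
  proof (rule sum.cong[OF refl])
    fix \<zeta> assume z: "\<zeta> \<in> ?N"
    have "(\<Sum>\<eta>\<in>?N. (sp (>) ?A (conj_part \<nu>) (conj_part \<zeta>) * sp (<) ?A \<eta> \<theta>) * (if \<eta> = \<zeta> then ?sg \<zeta> else 0)) =
      (\<Sum>\<eta>\<in>?N. if \<eta> = \<zeta> then ?sg \<zeta> * (sp (>) ?A (conj_part \<nu>) (conj_part \<zeta>) * sp (<) ?A \<zeta> \<theta>) else 0)"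
      by (rule sum.cong[OF refl]) (simp add: ac_simps)
    also have "\<dots> = ?sg \<zeta> * (sp (>) ?A (conj_part \<nu>) (conj_part \<zeta>) * sp (<) ?A \<zeta> \<theta>)"
      using z by (subst sum.delta) (simp_all add: finite_part_le)
    finally show "(\<Sum>\<eta>\<in>?N. (sp (>) ?A (conj_part \<nu>) (conj_part \<zeta>) * sp (<) ?A \<eta> \<theta>) * (if \<eta> = \<zeta> then ?sg \<zeta> else 0)) =
      ?sg \<zeta> * (sp (>) ?A (conj_part \<nu>) (conj_part \<zeta>) * sp (<) ?A \<zeta> \<theta>)" .
  qed
  also have "\<dots> = (if \<theta> = \<nu> then 1 else 0)" by (rule Suc.IH)
  finally show ?case .
qed

text \<open>Each Schur polynomial in x and y splits into a straight shape \<theta> in x and a skew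
  shape \<kappa>/\<theta> in y. For fixed \<theta> the y-factors form the sum in
  \<open>super_cancel\<close>, so only \<theta> = \<nu> is left.\<close>

lemma schur_super_expansion:
  "restr {..<n} (schur_fun \<nu>) =
    (\<Sum>\<kappa> | part_le \<kappa> \<nu>. (-1) ^ (part_size \<nu> - part_size \<kappa>) *
       (spoly (>) {n..<n + s} (conj_part \<nu>) (conj_part \<kappa>) * restr {..<n + s} (schur_fun \<kappa>)))"
proof -
  let ?N = "{\<kappa>. part_le \<kappa> \<nu>}"
  let ?sg = "\<lambda>\<kappa>. (-1 :: ratfun mfps) ^ (part_size \<nu> - part_size \<kappa>)"
  have A: "{..<n + s} = {..<n} \<union> {n..<n + s}" by auto
  have s1: "restr {..<n + s} (schur_fun \<kappa>) =
      (\<Sum>\<theta>\<in>?N. sp (<) {..<n} \<theta> empty_part * sp (<) {n..<n + s} \<kappa> \<theta>)" if "\<kappa> \<in> ?N" for \<kappa>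
  proof -
    have "restr {..<n + s} (schur_fun \<kappa>) = sp (<) ({..<n} \<union> {n..<n + s}) \<kappa> empty_part"
      by (simp add: restr_schur_fun sp_def A[symmetric])
    also have "\<dots> = (\<Sum>\<theta>\<in>?N. sp (<) {..<n} \<theta> empty_part * sp (<) {n..<n + s} \<kappa> \<theta>)"
      by (rule sp_split) (use that in auto)
    finally show ?thesis .
  qed
  have "(\<Sum>\<kappa>\<in>?N. ?sg \<kappa> * (spoly (>) {n..<n + s} (conj_part \<nu>) (conj_part \<kappa>) * restr {..<n + s} (schur_fun \<kappa>)))
    = (\<Sum>\<kappa>\<in>?N. \<Sum>\<theta>\<in>?N. sp (<) {..<n} \<theta> empty_part *
       (?sg \<kappa> * (sp (>) {n..<n + s} (conj_part \<nu>) (conj_part \<kappa>) * sp (<) {n..<n + s} \<kappa> \<theta>)))"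
  proof (rule sum.cong[OF refl])
    fix \<kappa> assume K: "\<kappa> \<in> ?N"
    have "spoly (>) {n..<n + s} (conj_part \<nu>) (conj_part \<kappa>) = (sp (>) {n..<n + s} (conj_part \<nu>) (conj_part \<kappa>) :: ratfun mfps)"
      using K by (simp add: sp_def)
    then show "?sg \<kappa> * (spoly (>) {n..<n + s} (conj_part \<nu>) (conj_part \<kappa>) * restr {..<n + s} (schur_fun \<kappa>)) =
       (\<Sum>\<theta>\<in>?N. sp (<) {..<n} \<theta> empty_part *
       (?sg \<kappa> * (sp (>) {n..<n + s} (conj_part \<nu>) (conj_part \<kappa>) * sp (<) {n..<n + s} \<kappa> \<theta>)))"
      by (simp only: s1[OF K] sum_distrib_left) (intro sum.cong refl, simp only: ac_simps)
  qed
  also have "\<dots> = (\<Sum>\<theta>\<in>?N. sp (<) {..<n} \<theta> empty_part * (if \<theta> = \<nu> then 1 else 0))"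
    by (subst sum.swap, unfold sum_distrib_left[symmetric])
      (intro sum.cong refl arg_cong2[where f = "(*)"] super_cancel, simp)
  also have "\<dots> = (\<Sum>\<theta>\<in>?N. if \<theta> = \<nu> then sp (<) {..<n} \<nu> empty_part else 0)"
    by (rule sum.cong) auto
  also have "\<dots> = restr {..<n} (schur_fun \<nu>)"
    by (subst sum.delta) (simp_all add: finite_part_le sp_def restr_schur_fun)
  finally show ?thesis ..
qed

section \<open>Alternants\<close>

text \<open>The embedding \<open>v\<close> of indices serves the first variables
  (\<open>id\<close>), the block of y variables, and that block in reversed order.\<close>

definition vmon :: "(nat \<Rightarrow> nat) \<Rightarrow> nat \<Rightarrow> (nat \<Rightarrow> nat) \<Rightarrow> nat multiset" where
  "vmon v n a = (\<Sum>i<n. replicate_mset (a i) (v i))"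

lemma set_mset_vmon: "set_mset (vmon v n a) \<subseteq> v ` {..<n}"
  by (induction n) (auto simp: vmon_def lessThan_Suc split: if_splits)

lemma count_vmon:
  assumes "inj_on v {..<n}" "i < n"
  shows "count (vmon v n a) (v i) = a i"
proof -
  have "count (vmon v n a) (v i) = (\<Sum>j<n. if j = i then a i else 0)"
    unfolding vmon_def count_sum
    by (rule sum.cong) (use assms in \<open>auto simp: inj_on_def\<close>)
  also have "\<dots> = a i" using assms(2) by simp
  finally show ?thesis .
qed

lemma count_vmon_id [simp]: "count (vmon id n a) i = (if i < n then a i else 0)"
proof (cases "i < n")
  case True
  then show ?thesis using count_vmon[of id n i a] by simp
next
  case False
  then have "i \<notin># vmon id n a" using set_mset_vmon[of id n a] by auto
  then show ?thesis using False by (simp add: not_in_iff)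
qed

lemma size_vmon: "size (vmon v n a) = (\<Sum>i<n. a i)"
  by (simp add: vmon_def size_multiset_sum)

lemma prod_mvar_power: "(\<Prod>i<n. mvar (v i) ^ a i) = mmon (vmon v n a)"
  by (simp add: mvar_power_eq_mmon prod_mmon vmon_def)

text \<open>The dominant monomial x^(\<theta> + \<delta>) of the classical alternant, \<delta> = (n
  - 1, ..., 1, 0).\<close>

definition dmon :: "nat \<Rightarrow> partition \<Rightarrow> nat multiset" where
  "dmon n \<theta> = vmon id n (\<lambda>i. part \<theta> i + (n - 1 - i))"

definition alternating :: "nat \<Rightarrow> 'a::comm_ring_1 mfps \<Rightarrow> bool" where
  "alternating n F \<longleftrightarrow> (\<forall>k. Suc k < n \<longrightarrow> perm_vars (transpose k (Suc k)) F = - F)"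

definition supp :: "nat set \<Rightarrow> 'a::comm_ring_1 mfps \<Rightarrow> bool" where
  "supp A F \<longleftrightarrow> (\<forall>m. mcoeff F m \<noteq> 0 \<longrightarrow> set_mset m \<subseteq> A)"

lemma supp_iff_restr: "supp A F \<longleftrightarrow> restr A F = F"
proof
  assume "supp A F"
  then show "restr A F = F" by (intro mfps_eqI) (auto simp: supp_def mcoeff_restr)
next
  assume "restr A F = F"
  then show "supp A F" unfolding supp_def by (metis mcoeff_restr)
qed

lemma supp_restr: "supp A (restr A F)"
  by (simp add: supp_def mcoeff_restr)

lemma supp_mult: "supp A f \<Longrightarrow> supp A g \<Longrightarrow> supp A (f * g)"
  by (simp add: supp_iff_restr restr_mult)

lemma strict_counts_imp_dmon:
  assumes strict: "\<And>k. Suc k < n \<Longrightarrow> count m (Suc k) < count m k" and supp: "set_mset m \<subseteq> {..<n}"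
  shows "\<exists>\<theta>. part_length \<theta> \<le> n \<and> m = dmon n \<theta>"
proof -
  define l where "l i = (if i < n then count m i - (n - 1 - i) else 0)" for i
  have lb: "n - 1 - i \<le> count m i" if "i < n" for i
  proof -
    have "d \<le> count m i" if "i + d = n - 1" "i < n" for d i
      using that
    proof (induction d arbitrary: i)
      case (Suc d)
      have "d \<le> count m (Suc i)" using Suc by auto
      moreover have "count m (Suc i) < count m i" using Suc.prems by (intro strict) auto
      ultimately show ?case by simp
    qed simp
    from this[of i "n - 1 - i"] show ?thesis using that by simp
  qed
  have "antimono l"
  proof (rule decseq_SucI)
    fix i
    show "l (Suc i) \<le> l i"
      using strict[of i] by (auto simp: l_def)
  qed
  moreover have "finite {i. l i \<noteq> 0}"
    by (rule finite_subset[of _ "{..<n}"]) (auto simp: l_def split: if_splits)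
  ultimately have p: "part (Abs_partition l) = l" by (intro Abs_partition_inverse) simp
  have "part_length (Abs_partition l) \<le> n"
    using part_pos_iff[of "Abs_partition l" n] by (simp add: p l_def)
  moreover have "m = dmon n (Abs_partition l)"
  proof (rule multiset_eqI)
    fix i
    show "count m i = count (dmon n (Abs_partition l)) i"
    proof (cases "i < n")
      case True
      then show ?thesis using lb[of i] by (simp add: dmon_def p l_def)
    next
      case False
      then have "i \<notin># m" using subsetD[OF supp, of i] by auto
      then have "count m i = 0" by (simp only: not_in_iff)
      then show ?thesis using False by (simp add: dmon_def)
    qed
  qed
  ultimately show ?thesis by blast
qed

lemma sum_transpose_less:
  fixes f :: "nat \<Rightarrow> nat"
  assumes "f k < f (Suc k)" "Suc k < n"
  shows "(\<Sum>i<n. i * f (transpose k (Suc k) i)) < (\<Sum>i<n. i * f i)"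
proof -
  have e: "(\<Sum>i<n. i * g i) = k * g k + (Suc k * g (Suc k) + (\<Sum>i\<in>{..<n} - {k} - {Suc k}. i * g i))" for g :: "nat \<Rightarrow> nat"
    using assms(2) by (subst sum.remove[of _ k], simp, simp, subst sum.remove[of _ "Suc k"]) auto
  have "(\<Sum>i\<in>{..<n} - {k} - {Suc k}. i * f (transpose k (Suc k) i)) = (\<Sum>i\<in>{..<n} - {k} - {Suc k}. i * f i)"
    by (rule sum.cong) auto
  then show ?thesis unfolding e using assms(1) by simp
qed

lemma count_image_transpose:
  "count (image_mset (transpose a b) m) i = count m (transpose a b i)"
  by (induction m) (auto simp: transpose_def)

text \<open>Adjacent transpositions sort the exponents, and each one that exchanges an ascent lowers
  the sum of i times the i-th exponent. Equal neighbouring exponents force a coefficient to be its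
  own negative; strictly decreasing ones are those of some \<open>dmon n \<theta>\<close>.\<close>

lemma alternating_eq_zero:
  fixes F :: "ratfun mfps"
  assumes anti: "alternating n F" and supp: "supp {..<n} F"
    and zero: "\<And>\<theta>. part_length \<theta> \<le> n \<Longrightarrow> mcoeff F (dmon n \<theta>) = 0"
  shows "F = 0"
proof (rule mfps_eqI)
  fix m
  show "mcoeff F m = mcoeff 0 m"
  proof (induction "\<Sum>i<n. i * count m i" arbitrary: m rule: less_induct)
    case less
    show ?case
    proof (cases "set_mset m \<subseteq> {..<n}")
      case False
      then show ?thesis using supp by (auto simp: supp_def)
    next
      case s: True
      show ?thesis
      proof (cases "\<forall>k. Suc k < n \<longrightarrow> count m (Suc k) < count m k")
        case True
        then obtain \<theta> where "part_length \<theta> \<le> n" "m = dmon n \<theta>"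
          using strict_counts_imp_dmon[of n m] s by blast
        then show ?thesis using zero by simp
      next
        case False
        then obtain k where k: "Suc k < n" "count m k \<le> count m (Suc k)" by (auto simp: not_less)
        let ?m = "image_mset (transpose k (Suc k)) m"
        have "mcoeff (perm_vars (transpose k (Suc k)) F) m = mcoeff (- F) m"
          using anti k(1) by (simp add: alternating_def)
        then have neg: "mcoeff F ?m = - mcoeff F m" by (simp add: mcoeff_perm_vars)
        show ?thesis
        proof (cases "count m k = count m (Suc k)")
          case True
          then have "?m = m" by (intro multiset_eqI) (auto simp: count_image_transpose transpose_def)
          then have "mcoeff F m + mcoeff F m = 0" using neg by simp
          then have "mcoeff F m = 0" by (rule double_eq_zero_ratfun)
          then show ?thesis by simp
        next
          case False
          then have "count m k < count m (Suc k)" using k by simp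
          then have "(\<Sum>i<n. i * count ?m i) < (\<Sum>i<n. i * count m i)"
            unfolding count_image_transpose using k(1) by (rule sum_transpose_less)
          then have "mcoeff F ?m = 0" using less by simp
          then show ?thesis using neg by simp
        qed
      qed
    qed
  qed
qed

lemma alternating_ext:
  fixes F G :: "ratfun mfps"
  assumes "alternating n F" "alternating n G" "supp {..<n} F" "supp {..<n} G"
    and "\<And>\<theta>. part_length \<theta> \<le> n \<Longrightarrow> mcoeff F (dmon n \<theta>) = mcoeff G (dmon n \<theta>)"
  shows "F = G"
proof -
  have "F - G = 0"
    by (rule alternating_eq_zero[of n])
      (use assms in \<open>auto simp: alternating_def perm_vars_diff supp_iff_restr restr_diff\<close>)
  then show ?thesis by simp
qed

definition Vd :: "(nat \<Rightarrow> nat) \<Rightarrow> nat \<Rightarrow> 'a::comm_ring_1 mfps" where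
  "Vd v n = (\<Prod>j<n. \<Prod>i<j. mvar (v i) - mvar (v j))"

text \<open>The transposition permutes the pairs i < j other than (k, k + 1), whose factor changes
  its sign.\<close>

lemma perm_vars_Vd:
  assumes inj: "inj_on v {..<n}" and k: "Suc k < n"
  shows "perm_vars (transpose (v k) (v (Suc k))) (Vd v n) = - Vd v n"
proof -
  let ?\<tau> = "transpose (v k) (v (Suc k))" and ?t = "transpose k (Suc k)"
  let ?P = "{(i, j). i < j \<and> j < n}"
  let ?D = "\<lambda>(i, j). mvar (v i) - mvar (v j) :: 'a mfps"
  have finP: "finite ?P" by (rule finite_subset[of _ "{..<n} \<times> {..<n}"]) auto
  have VP: "(\<Prod>j<n. \<Prod>i<j. f i j) = (\<Prod>(i, j)\<in>?P. f i j)" for f :: "nat \<Rightarrow> nat \<Rightarrow> 'a mfps"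
  proof -
    have "(\<Prod>j<n. \<Prod>i<j. f i j) = (\<Prod>(j, i)\<in>Sigma {..<n} (\<lambda>j. {..<j}). f i j)"
      by (rule prod.Sigma) auto
    also have "\<dots> = (\<Prod>(i, j)\<in>?P. f i j)"
      by (rule prod.reindex_bij_witness[of _ prod.swap prod.swap]) auto
    finally show ?thesis .
  qed
  have tv: "?\<tau> (v i) = v (?t i)" if "i < n" for i
    using inj_onD[OF inj, of i k] inj_onD[OF inj, of i "Suc k"] that k by (auto simp: transpose_def)
  have tn: "?t i < n" if "i < n" for i using that k by (auto simp: transpose_def)
  have "perm_vars ?\<tau> (Vd v n) = (\<Prod>j<n. \<Prod>i<j. mvar (v (?t i)) - mvar (v (?t j)))"
    unfolding Vd_def
    by (simp add: perm_vars_prod perm_vars_diff perm_vars_mvar inv_transpose_eq tv)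
  also have "\<dots> = (\<Prod>(i, j)\<in>?P. ?D (?t i, ?t j))" by (simp add: VP)
  also have "\<dots> = ?D (?t k, ?t (Suc k)) * (\<Prod>(i, j)\<in>?P - {(k, Suc k)}. ?D (?t i, ?t j))"
    using k by (subst prod.remove[OF finP, of "(k, Suc k)"]) auto
  also have "(\<Prod>(i, j)\<in>?P - {(k, Suc k)}. ?D (?t i, ?t j)) = (\<Prod>p\<in>?P - {(k, Suc k)}. ?D p)"
    by (rule prod.reindex_bij_witness[of _ "\<lambda>(i, j). (?t i, ?t j)" "\<lambda>(i, j). (?t i, ?t j)"])
      (use k in \<open>auto simp: transpose_def split: if_splits\<close>)
  also have "?D (?t k, ?t (Suc k)) = - ?D (k, Suc k)" by simp
  also have "- ?D (k, Suc k) * (\<Prod>p\<in>?P - {(k, Suc k)}. ?D p) = - (\<Prod>p\<in>?P. ?D p)"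
  proof -
    have "(k, Suc k) \<in> ?P" using k by simp
    then show ?thesis by (simp only: prod.remove[OF finP] mult_minus_left)
  qed
  also have "(\<Prod>p\<in>?P. ?D p) = Vd v n" by (simp add: Vd_def VP)
  finally show ?thesis .
qed

lemma supp_Vd: "v ` {..<n} \<subseteq> A \<Longrightarrow> supp A (Vd v n)"
  unfolding supp_iff_restr Vd_def restr_prod
proof (intro prod.cong refl)
  fix i j assume "v ` {..<n} \<subseteq> A" "j \<in> {..<n}" "i \<in> {..<j}"
  then have "v i \<in> A" "v j \<in> A" by auto
  then show "restr A (mvar (v i) - mvar (v j)) = mvar (v i) - mvar (v j)"
    by (simp add: restr_diff restr_mvar)
qed

lemma mhom_Vd: "mhom (\<Sum>i<n. i) (Vd v n)"
proof -
  have "mhom 1 (mvar a - mvar b :: 'a::comm_ring_1 mfps)" for a b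
    by (auto simp: mhom_def mvar_eq_mmon mcoeff_mmon split: if_splits)
  then have "mhom (\<Sum>i<j. 1) (\<Prod>i<j. mvar (v i) - mvar (v j) :: 'a mfps)" for j
    by (intro mhom_prod) blast
  then show ?thesis unfolding Vd_def by (intro mhom_prod) simp
qed

lemma Vd_cancel:
  fixes f :: "'a::comm_ring_1 mfps"
  assumes "inj_on v {..<n}" "Vd v n * f = 0"
  shows "f = 0"
proof -
  have 1: "f = 0" if "finite I" "j \<notin> v ` I" "(\<Prod>i\<in>I. mvar (v i) - mvar j) * f = 0" for I j and f :: "'a mfps"
    using that
  proof (induction I arbitrary: f rule: finite_induct)
    case (insert i I)
    have "(mvar (v i) - mvar j) * ((\<Prod>i\<in>I. mvar (v i) - mvar j) * f) = 0"
      using insert by (simp add: mult.assoc)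
    then have "(\<Prod>i\<in>I. mvar (v i) - mvar j) * f = 0"
      by (rule var_diff_cancel[rotated]) (use insert in auto)
    then show ?case using insert by auto
  qed simp
  show ?thesis
    using assms
  proof (induction n arbitrary: f)
    case (Suc n)
    have inj: "inj_on v {..<n}" by (rule inj_on_subset[OF Suc.prems(1)]) auto
    have "Vd v n * ((\<Prod>i<n. mvar (v i) - mvar (v n)) * f) = 0"
      using Suc.prems(2) by (simp add: Vd_def mult.assoc)
    then have "(\<Prod>i<n. mvar (v i) - mvar (v n)) * f = 0" by (rule Suc.IH[OF inj])
    then show ?case
    proof (rule 1[rotated 2])
      show "v n \<notin> v ` {..<n}"
      proof
        assume "v n \<in> v ` {..<n}"
        then obtain i where "i < n" "v n = v i" by auto
        then show False using inj_onD[OF Suc.prems(1), of n i] by simp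
      qed
    qed simp
  qed (simp add: Vd_def)
qed

text \<open>The extra monomial is exactly the quotient of \<open>dmon (Suc n) \<theta>\<close> by
  \<open>dmon n \<theta>\<close>. Hence coefficients at dominant monomials do not depend on the
  number of variables.\<close>

lemma restr_Vd_Suc:
  "restr {..<n} (Vd id (Suc n)) = Vd id n * mmon (vmon id n (\<lambda>_. 1))"
proof -
  have "restr {..<n} (Vd id (Suc n)) =
     (\<Prod>j<n. \<Prod>i<j. restr {..<n} (mvar i - mvar j)) * (\<Prod>i<n. restr {..<n} (mvar i - mvar n))"
    by (simp add: Vd_def restr_prod restr_mult)
  also have "(\<Prod>j<n. \<Prod>i<j. restr {..<n} (mvar i - mvar j)) = (Vd id n :: 'a mfps)"
    unfolding Vd_def by (intro prod.cong refl) (simp add: restr_diff restr_mvar)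
  also have "(\<Prod>i<n. restr {..<n} (mvar i - mvar n)) = (\<Prod>i<n. mvar i ^ 1 :: 'a mfps)"
    by (intro prod.cong refl) (simp add: restr_diff restr_mvar)
  also have "\<dots> = mmon (vmon id n (\<lambda>_. 1))" using prod_mvar_power[of id "\<lambda>_. 1" n] by simp
  finally show ?thesis .
qed

text \<open>The parameter \<open>bt\<close> covers two cases at once: \<open>beta\<close> gives the
  numerator of G, and 0 the classical alternant, from which the bialternant formula for Schur
  functions is derived. The exponents need not decrease.\<close>

definition Alt :: "ratfun \<Rightarrow> nat \<Rightarrow> (nat \<Rightarrow> nat) \<Rightarrow> ratfun mfps" where
  "Alt bt n \<alpha> = det (mat n n (\<lambda>(i, j). mvar i ^ (\<alpha> j + (n - 1 - j)) * (1 + mconst bt * mvar i) ^ j))"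

definition antisymmetrize :: "nat \<Rightarrow> ratfun mfps \<Rightarrow> ratfun mfps" where
  "antisymmetrize n f = (\<Sum>p | p permutes {..<n}. of_int (sign p) * perm_vars p f)"

definition altm :: "ratfun \<Rightarrow> nat \<Rightarrow> (nat \<Rightarrow> nat) \<Rightarrow> ratfun mfps" where
  "altm bt n \<alpha> = (\<Prod>j<n. mvar j ^ (\<alpha> j + (n - 1 - j)) * (1 + mconst bt * mvar j) ^ j)"

text \<open>A symmetric factor can now be moved inside and multiplied into a single product of
  powers.\<close>

lemma Alt_eq_antisymmetrize: "Alt bt n \<alpha> = antisymmetrize n (altm bt n \<alpha>)"
proof -
  let ?e = "\<lambda>i j. mvar i ^ (\<alpha> j + (n - 1 - j)) * (1 + mconst bt * mvar i) ^ j :: ratfun mfps"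
  have "Alt bt n \<alpha> = (\<Sum>p | p permutes {0..<n}. of_int (sign p) *
      (\<Prod>i = 0..<n. mat n n (\<lambda>(i, j). ?e i j) $$ (i, p i)))"
    unfolding Alt_def by (rule det_def') simp
  also have "\<dots> = (\<Sum>p | p permutes {..<n}. of_int (sign p) * perm_vars p (altm bt n \<alpha>))"
    unfolding atLeast0LessThan
  proof (rule sum.cong[OF refl])
    fix p assume "p \<in> {p. p permutes {..<n}}"
    then have p: "p permutes {..<n}" by simp
    have b: "bij p" by (rule permutes_bij[OF p])
    have pn: "p i < n" if "i < n" for i using permutes_in_image[OF p, of i] that by simp
    have "(\<Prod>i<n. mat n n (\<lambda>(i, j). ?e i j) $$ (i, p i)) = (\<Prod>i<n. ?e i (p i))"
      by (rule prod.cong) (simp_all add: pn)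
    also have "\<dots> = (\<Prod>j<n. ?e (inv_into UNIV p j) j)"
      by (rule prod.reindex_bij_witness[of _ "inv_into UNIV p" p])
        (use pn permutes_in_image[OF permutes_inv[OF p]] permutes_inverses[OF p] in auto)
    also have "\<dots> = perm_vars p (altm bt n \<alpha>)"
      unfolding altm_def by (simp add: perm_vars_prod perm_vars_mult perm_vars_power perm_vars_add perm_vars_mvar b)
    finally show "of_int (sign p) * (\<Prod>i<n. mat n n (\<lambda>(i, j). ?e i j) $$ (i, p i)) =
        of_int (sign p) * perm_vars p (altm bt n \<alpha>)" by simp
  qed
  finally show ?thesis by (simp add: antisymmetrize_def)
qed

lemma antisymmetrize_add: "antisymmetrize n (f + g) = antisymmetrize n f + antisymmetrize n g"
  by (simp add: antisymmetrize_def perm_vars_add distrib_left sum.distrib)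

lemma antisymmetrize_sum: "antisymmetrize n (sum f A) = (\<Sum>a\<in>A. antisymmetrize n (f a))"
  by (induction A rule: infinite_finite_induct) (simp_all add: antisymmetrize_add, simp_all add: antisymmetrize_def)

lemma antisymmetrize_sym_mult:
  assumes "\<And>p. p permutes {..<n} \<Longrightarrow> perm_vars p h = h"
  shows "antisymmetrize n (h * f) = h * antisymmetrize n f"
  unfolding antisymmetrize_def sum_distrib_left
proof (rule sum.cong[OF refl])
  fix p assume "p \<in> {p. p permutes {..<n}}"
  then show "of_int (sign p) * perm_vars p (h * f) = h * (of_int (sign p) * perm_vars p f)"
    by (simp add: perm_vars_mult[OF permutes_bij] assms mult.left_commute)
qed

lemma antisymmetrize_const: "antisymmetrize n (mconst c * f) = mconst c * antisymmetrize n f"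
  by (rule antisymmetrize_sym_mult) simp

lemma sign_transpose_comp:
  fixes n :: nat
  assumes "p permutes {..<n}" "k < n" "k' < n" "k \<noteq> k'"
  shows "transpose k k' \<circ> p permutes {..<n}" "sign (transpose k k' \<circ> p) = - sign p"
    "p \<circ> transpose k k' permutes {..<n}" "sign (p \<circ> transpose k k') = - sign p"
proof -
  have t: "transpose k k' permutes {..<n}" using assms by (intro permutes_swap_id) auto
  have per: "permutation p" "permutation (transpose k k')"
    unfolding permutation_permutes
    by (intro exI[of _ "{..<n}"] conjI finite_lessThan assms(1) t)+
  show "transpose k k' \<circ> p permutes {..<n}" "p \<circ> transpose k k' permutes {..<n}"
    using permutes_compose assms(1) t by blast+
  show "sign (transpose k k' \<circ> p) = - sign p" "sign (p \<circ> transpose k k') = - sign p"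
    using per assms(4) by (simp_all add: sign_compose sign_swap_id)
qed

lemma antisymmetrize_perm_vars:
  assumes k: "Suc k < n"
  shows "antisymmetrize n (perm_vars (transpose k (Suc k)) f) = - antisymmetrize n f"
proof -
  let ?\<tau> = "transpose k (Suc k)"
  have "antisymmetrize n (perm_vars ?\<tau> f) = (\<Sum>p | p permutes {..<n}. of_int (sign p) * perm_vars (?\<tau> \<circ> p) f)"
    by (simp add: antisymmetrize_def perm_vars_perm_vars)
  also have "\<dots> = (\<Sum>p | p permutes {..<n}. of_int (- sign p) * perm_vars p f)"
    by (rule sum.reindex_bij_witness[of _ "\<lambda>p. ?\<tau> \<circ> p" "\<lambda>p. ?\<tau> \<circ> p"])
      (use sign_transpose_comp[of _ n k "Suc k"] k in \<open>auto simp: o_assoc[symmetric] comp_assoc[symmetric]\<close>)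
  finally show ?thesis by (simp add: antisymmetrize_def sum_negf)
qed

lemma alternating_antisymmetrize: "alternating n (antisymmetrize n f)"
  unfolding alternating_def
proof (intro allI impI)
  fix k assume k: "Suc k < n"
  let ?\<tau> = "transpose k (Suc k)"
  have "perm_vars ?\<tau> (antisymmetrize n f) = (\<Sum>p | p permutes {..<n}. of_int (sign p) * perm_vars (p \<circ> ?\<tau>) f)"
    by (simp add: antisymmetrize_def perm_vars_sum perm_vars_mult perm_vars_perm_vars)
  also have "\<dots> = (\<Sum>p | p permutes {..<n}. of_int (- sign p) * perm_vars p f)"
    by (rule sum.reindex_bij_witness[of _ "\<lambda>p. p \<circ> ?\<tau>" "\<lambda>p. p \<circ> ?\<tau>"])
      (use sign_transpose_comp[of _ n k "Suc k"] k in \<open>auto simp: comp_assoc\<close>)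
  finally show "perm_vars ?\<tau> (antisymmetrize n f) = - antisymmetrize n f" by (simp add: antisymmetrize_def sum_negf)
qed

lemma supp_antisymmetrize:
  assumes "supp {..<n} f"
  shows "supp {..<n} (antisymmetrize n f)"
  unfolding supp_def
proof (intro allI impI)
  fix m assume "mcoeff (antisymmetrize n f) m \<noteq> 0"
  then obtain p where p: "p permutes {..<n}" and "of_int (sign p) * mcoeff (perm_vars p f) m \<noteq> 0"
    unfolding antisymmetrize_def mcoeff_sum mcoeff_of_int_mult by (elim sum.not_neutral_contains_not_neutral) auto
  then have "mcoeff f (image_mset p m) \<noteq> 0" by (auto simp: mcoeff_perm_vars)
  then have "set_mset (image_mset p m) \<subseteq> {..<n}" using assms unfolding supp_def by blast
  then have "p ` set_mset m \<subseteq> {..<n}" by simp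
  then show "set_mset m \<subseteq> {..<n}" using permutes_in_image[OF p] by blast
qed

lemma supp_altm: "supp {..<n} (altm bt n \<alpha>)"
  unfolding supp_iff_restr altm_def restr_prod
  by (intro prod.cong refl) (simp add: restr_mult restr_power restr_add restr_mvar)

lemma alternating_Alt: "alternating n (Alt bt n \<alpha>)" and supp_Alt: "supp {..<n} (Alt bt n \<alpha>)"
  by (simp_all add: Alt_eq_antisymmetrize alternating_antisymmetrize supp_antisymmetrize supp_altm)

lemma prod_two:
  assumes "Suc k < n"
  shows "(\<Prod>j<n. f j) = f k * f (Suc k) * (\<Prod>j\<in>{..<n} - {k, Suc k}. f j :: 'a::comm_monoid_mult)"
proof -
  have "(\<Prod>j<n. f j) = f k * (\<Prod>j\<in>{..<n} - {k}. f j)" using assms by (intro prod.remove) auto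
  also have "(\<Prod>j\<in>{..<n} - {k}. f j) = f (Suc k) * (\<Prod>j\<in>{..<n} - {k} - {Suc k}. f j)"
    using assms by (intro prod.remove) auto
  also have "{..<n} - {k} - {Suc k} = {..<n} - {k, Suc k}" by auto
  finally show ?thesis by (simp add: mult.assoc)
qed

text \<open>Column k + 1 has one factor 1 + \<beta> x more than column k. Splitting it off leaves a
  part symmetric in the two variables times x_k^A x_(k+1)^B, that is, N(A, B) + \<beta> N(A, B + 1),
  and antisymmetrization is odd under exchanging A and B. The four alternants are paired so that the
  eight terms cancel.\<close>

lemma Alt_relation:
  assumes k: "Suc k < n" and pos: "1 \<le> \<alpha> (Suc k)"
  shows "Alt bt n \<alpha> + Alt bt n (\<alpha>(k := \<alpha> (Suc k) - 1, Suc k := \<alpha> k + 1)) =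
    - mconst bt * (Alt bt n (\<alpha>(k := \<alpha> k + 1)) + Alt bt n (\<alpha>(k := \<alpha> (Suc k), Suc k := \<alpha> k + 1)))"
proof -
  let ?b = "mconst bt :: ratfun mfps" and ?\<tau> = "transpose k (Suc k)"
  define R where "R = (\<Prod>j\<in>{..<n} - {k, Suc k}. mvar j ^ (\<alpha> j + (n - 1 - j)) * (1 + ?b * mvar j) ^ j)"
  define N where "N A B = R * ((1 + ?b * mvar k) * (1 + ?b * mvar (Suc k))) ^ k * (mvar k ^ A * mvar (Suc k) ^ B)"
    for A B
  have M: "altm bt n \<gamma> = N (\<gamma> k + (n - 1 - k)) (\<gamma> (Suc k) + (n - 1 - Suc k)) +
      ?b * N (\<gamma> k + (n - 1 - k)) (Suc (\<gamma> (Suc k) + (n - 1 - Suc k)))"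
    if "\<And>j. j \<noteq> k \<Longrightarrow> j \<noteq> Suc k \<Longrightarrow> \<gamma> j = \<alpha> j" for \<gamma>
  proof -
    have R: "R = (\<Prod>j\<in>{..<n} - {k, Suc k}. mvar j ^ (\<gamma> j + (n - 1 - j)) * (1 + ?b * mvar j) ^ j)"
      unfolding R_def by (rule prod.cong) (use that in auto)
    have ring: "x ^ A * P ^ k * (y ^ B * Q ^ Suc k) * R =
        R * (P * Q) ^ k * (x ^ A * y ^ B) + ?b * (R * (P * Q) ^ k * (x ^ A * y ^ Suc B))"
      if "Q = 1 + ?b * y" for x y P Q A B
    proof -
      have "x ^ A * P ^ k * (y ^ B * Q ^ Suc k) * R = R * (P * Q) ^ k * (x ^ A * y ^ B) * Q"
        by (simp add: power_mult_distrib ac_simps)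
      also have "R * (P * Q) ^ k * (x ^ A * y ^ B) * (1 + ?b * y) =
          R * (P * Q) ^ k * (x ^ A * y ^ B) + ?b * (R * (P * Q) ^ k * (x ^ A * y ^ Suc B))"
        by (simp add: distrib_left ac_simps)
      ultimately show ?thesis using that by simp
    qed
    show ?thesis
      unfolding altm_def prod_two[OF k] R[symmetric] N_def by (intro ring refl)
  qed
  have "perm_vars ?\<tau> R = R"
    unfolding R_def
    by (simp add: perm_vars_prod perm_vars_mult perm_vars_power perm_vars_add perm_vars_mvar inv_transpose_eq)
  then have "perm_vars ?\<tau> (N A B) = N B A" for A B
    unfolding N_def by (simp add: perm_vars_mult perm_vars_power perm_vars_add perm_vars_mvar inv_transpose_eq mult.commute mult.left_commute)
  then have anti: "antisymmetrize n (N B A) = - antisymmetrize n (N A B)" for A B using antisymmetrize_perm_vars[OF k] by metis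
  then have "antisymmetrize n (N A A) = 0" for A using double_eq_zero_mfps[of "antisymmetrize n (N A A)"] by (metis add.right_inverse)
  note anti = this anti
  \<comment> \<open>The entries of \<delta> at k and k + 1 differ by one, which is why exchanging
    full exponents shifts the entries of \<alpha> by one.\<close>
  have A: "\<alpha> (Suc k) - 1 + (n - 1 - k) = \<alpha> (Suc k) + (n - 1 - Suc k)"
    "\<alpha> k + 1 + (n - 1 - Suc k) = \<alpha> k + (n - 1 - k)"
    "\<alpha> k + 1 + (n - 1 - k) = Suc (\<alpha> k + (n - 1 - k))"
    "\<alpha> (Suc k) + (n - 1 - k) = Suc (\<alpha> (Suc k) + (n - 1 - Suc k))"
    using k pos by auto
  define a b where "a = \<alpha> k + (n - 1 - k)" and "b = \<alpha> (Suc k) + (n - 1 - Suc k)"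
  have "altm bt n \<alpha> = N a b + ?b * N a (Suc b)"
    using M[of \<alpha>] by (simp add: a_def b_def)
  moreover have "altm bt n (\<alpha>(k := \<alpha> (Suc k) - 1, Suc k := \<alpha> k + 1)) = N b a + ?b * N b (Suc a)"
    by (subst M) (simp_all only: A fun_upd_same fun_upd_other n_not_Suc_n not_False_eq_True a_def b_def)
  moreover have "altm bt n (\<alpha>(k := \<alpha> k + 1)) = N (Suc a) b + ?b * N (Suc a) (Suc b)"
    by (subst M) (simp_all only: A fun_upd_same fun_upd_other n_not_Suc_n n_not_Suc_n[symmetric] not_False_eq_True a_def b_def)
  moreover have "altm bt n (\<alpha>(k := \<alpha> (Suc k), Suc k := \<alpha> k + 1)) = N (Suc b) a + ?b * N (Suc b) (Suc a)"
    by (subst M) (simp_all only: A fun_upd_same fun_upd_other n_not_Suc_n not_False_eq_True a_def b_def)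
  ultimately show ?thesis
    unfolding Alt_eq_antisymmetrize antisymmetrize_add antisymmetrize_const
    by (simp only: antisymmetrize_add antisymmetrize_const anti(2)[of a b] anti(2)[of "Suc b" a] anti(2)[of "Suc a" b] anti(2)[of "Suc a" "Suc b"])
      (simp add: algebra_simps)
qed

lemma perm_vars_restr_schur:
  assumes p: "p permutes {..<n}"
  shows "perm_vars p (restr {..<n} (schur_fun \<kappa>)) = restr {..<n} (schur_fun \<kappa>)"
proof (rule mfps_eqI)
  fix m
  have "p ` set_mset m \<subseteq> {..<n} \<longleftrightarrow> set_mset m \<subseteq> {..<n}" using permutes_in_image[OF p] by blast
  then show "mcoeff (perm_vars p (restr {..<n} (schur_fun \<kappa>))) m = mcoeff (restr {..<n} (schur_fun \<kappa>)) m"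
    by (simp add: mcoeff_perm_vars mcoeff_restr schur_fun_sym permutes_inj_on[OF p])
qed

lemma altm_mult_cont:
  assumes "T \<in> ssyt lt {..<n} \<kappa> \<rho>"
  shows "mmon (cont \<kappa> \<rho> T) * altm bt n \<alpha> = altm bt n (\<lambda>t. \<alpha> t + col_weight \<kappa> \<rho> (part \<kappa> 0) T t)"
proof -
  have "set_mset (cont \<kappa> \<rho> T) \<subseteq> {..<n}"
    using ssyt_entry[OF assms] by (auto simp: set_mset_cont)
  then have "cont \<kappa> \<rho> T = vmon id n (\<lambda>t. col_weight \<kappa> \<rho> (part \<kappa> 0) T t)"
    by (intro multiset_eqI) (auto simp: count_cont[symmetric] not_in_iff[symmetric])
  then have "mmon (cont \<kappa> \<rho> T) = (\<Prod>j<n. mvar j ^ col_weight \<kappa> \<rho> (part \<kappa> 0) T j :: ratfun mfps)"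
    by (simp add: prod_mvar_power[of id, simplified])
  then show ?thesis
    by (simp only: altm_def prod.distrib[symmetric] power_add mult_ac)
qed

text \<open>Inside the antisymmetrizer a tableau merely adds its content to the exponents, and
  \<open>Alt_relation\<close> is the relation that \<open>straightening_nc_schur\<close> asks for,
  with b = - \<beta>.\<close>

theorem schur_mult_Alt:
  assumes "part_length lam \<le> n"
  shows "restr {..<n} (schur_fun \<kappa>) * Alt bt n (part lam) =
    (\<Sum>T\<in>ssyt (<) {..<n} \<kappa> empty_part. (- mconst bt) ^ uexp (column_word \<kappa> empty_part T) (part lam) *
       Alt bt n (uact (column_word \<kappa> empty_part T) (part lam)))"
proof -
  have "restr {..<n} (schur_fun \<kappa>) * Alt bt n (part lam) =
      antisymmetrize n (restr {..<n} (schur_fun \<kappa>) * altm bt n (part lam))"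
    unfolding Alt_eq_antisymmetrize by (rule antisymmetrize_sym_mult[symmetric]) (rule perm_vars_restr_schur)
  also have "\<dots> = (\<Sum>T\<in>ssyt (<) {..<n} \<kappa> empty_part.
      Alt bt n (\<lambda>t. part lam t + col_weight \<kappa> empty_part (part \<kappa> 0) T t))"
    by (simp add: restr_schur_fun spoly_def sum_distrib_right antisymmetrize_sum altm_mult_cont Alt_eq_antisymmetrize)
  also have "\<dots> = (\<Sum>T\<in>ssyt (<) {..<n} \<kappa> empty_part. (- mconst bt) ^ uexp (column_word \<kappa> empty_part T) (part lam) *
       Alt bt n (uact (column_word \<kappa> empty_part T) (part lam)))"
  proof (rule straightening_nc_schur)
    show "part lam i = 0" if "n \<le> i" for i using that assms by (simp add: part_eq_0)
  qed (rule Alt_relation double_eq_zero_mfps part_le_empty antimono_part; assumption)+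
  finally show ?thesis .
qed

section \<open>The bialternant formula\<close>

lemma size_dmon: "part_length \<theta> \<le> n \<Longrightarrow> size (dmon n \<theta>) = part_size \<theta> + (\<Sum>i<n. i)"
proof -
  assume "part_length \<theta> \<le> n"
  then have "part_size \<theta> = (\<Sum>i<n. part \<theta> i)" by (intro seq_size_eq_sum) (simp add: part_eq_0)
  moreover have "(\<Sum>i<n. n - 1 - i) = (\<Sum>i<n. i)"
    by (rule sum.reindex_bij_witness[of _ "\<lambda>i. n - 1 - i" "\<lambda>i. n - 1 - i"]) auto
  ultimately show ?thesis by (simp only: dmon_def size_vmon sum.distrib)
qed

lemma count_dmon: "i < n \<Longrightarrow> count (dmon n \<theta>) i = part \<theta> i + (n - 1 - i)"
  by (simp add: dmon_def)

lemma set_mset_dmon: "set_mset (dmon n \<theta>) \<subseteq> {..<n}"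
  using set_mset_vmon[of id n] by (simp add: dmon_def)

lemma dmon_inj:
  assumes "dmon n \<kappa> = dmon n \<theta>" "part_length \<kappa> \<le> n" "part_length \<theta> \<le> n"
  shows "\<kappa> = \<theta>"
proof (rule partition_eqI)
  fix i
  show "part \<kappa> i = part \<theta> i"
  proof (cases "i < n")
    case True
    then show ?thesis using arg_cong[OF assms(1), of "\<lambda>m. count m i"] by (simp add: count_dmon)
  next
    case False
    then show ?thesis using assms by (simp add: part_eq_0)
  qed
qed

text \<open>Both monomials have strictly decreasing exponents, so p is increasing on an initial
  segment.\<close>

lemma image_dmon_eq:
  assumes p: "p permutes {..<n}" and eq: "image_mset p (dmon n \<theta>) = dmon n \<kappa>"
  shows "p = id"
proof -
  have pn: "p i < n" if "i < n" for i using permutes_in_image[OF p, of i] that by simp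
  have c: "part \<kappa> (p i) + (n - 1 - p i) = part \<theta> i + (n - 1 - i)" if "i < n" for i
  proof -
    have "count (image_mset p M) (p i) = count M i" for M
      using permutes_inj[OF p] by (induction M) (auto simp: inj_def)
    from this[of "dmon n \<theta>"] show ?thesis using that pn[OF that] eq by (simp add: count_dmon)
  qed
  have str: "p i < p j" if "i < j" "j < n" for i j
  proof (rule ccontr)
    assume "\<not> p i < p j"
    then have "part \<kappa> (p i) + (n - 1 - p i) \<le> part \<kappa> (p j) + (n - 1 - p j)"
      using part_antimono[of "p j" "p i" \<kappa>] by simp
    moreover have "part \<theta> j + (n - 1 - j) < part \<theta> i + (n - 1 - i)"
      using part_antimono[of i j \<theta>] that by simp
    ultimately show False using c[of i] c[of j] that by simp
  qed
  have "i \<le> p i" if "i < n" for i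
    using that
  proof (induction i)
    case (Suc i)
    then show ?case using str[of i "Suc i"] by simp
  qed simp
  then show ?thesis by (intro permutes_natset_ge[OF p]) simp
qed

lemma mcoeff_mult_empty: "mcoeff (f * g) {#} = mcoeff f {#} * mcoeff g {#}"
  by (simp add: mcoeff_mult)

lemma mcoeff_power_empty: "mcoeff (f ^ k) {#} = mcoeff f {#} ^ k"
  by (induction k) (simp_all add: mcoeff_mult_empty mcoeff_one)

lemma mcoeff_prod_empty: "mcoeff (prod f A) {#} = (\<Prod>a\<in>A. mcoeff (f a) {#})"
  by (induction A rule: infinite_finite_induct) (simp_all add: mcoeff_mult_empty mcoeff_one)

lemma altm_part:
  "altm bt n (part \<kappa>) = mmon (dmon n \<kappa>) * (\<Prod>j<n. (1 + mconst bt * mvar j) ^ j)"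
proof -
  have "(\<Prod>j<n. mvar j ^ (part \<kappa> j + (n - 1 - j))) = (mmon (dmon n \<kappa>) :: ratfun mfps)"
    using prod_mvar_power[of id "\<lambda>j. part \<kappa> j + (n - 1 - j)" n] by (simp add: dmon_def)
  then show ?thesis by (simp add: altm_def prod.distrib)
qed

text \<open>The factors (1 + bt x)^j have constant term 1 and otherwise raise the degree. Up to the
  degree of \<open>dmon n \<kappa>\<close> only the permutations of that monomial contribute, and
  only the identity keeps the exponents decreasing. For bt = 0 there is nothing of higher
  degree.\<close>

lemma mcoeff_Alt_dmon:
  assumes l: "part_length \<kappa> \<le> n" "part_length \<theta> \<le> n" and d: "bt = 0 \<or> part_size \<theta> \<le> part_size \<kappa>"
  shows "mcoeff (Alt bt n (part \<kappa>)) (dmon n \<theta>) = (if \<kappa> = \<theta> then 1 else 0)"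
proof -
  define P where "P = (\<Prod>j<n. (1 + mconst bt * mvar j) ^ j :: ratfun mfps)"
  have P1: "mcoeff P {#} = 1"
    unfolding P_def mcoeff_prod_empty mcoeff_power_empty by (simp add: mcoeff_one mvar_eq_mmon mcoeff_mmon)
  have M: "mcoeff (mmon (dmon n \<kappa>) * P) m = (if m = dmon n \<kappa> then 1 else 0)" if "size m = size (dmon n \<theta>)" for m
  proof (cases "bt = 0")
    case True
    then have "P = 1" by (simp add: P_def)
    then show ?thesis by (simp add: mcoeff_mmon)
  next
    case False
    then have "part_size \<theta> \<le> part_size \<kappa>" using d by simp
    then have "size m \<le> size (dmon n \<kappa>)" using that l by (simp add: size_dmon)
    then have "dmon n \<kappa> \<subseteq># m \<longleftrightarrow> m = dmon n \<kappa>"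
      by (metis mset_subset_size not_less subset_mset.le_less)
    then show ?thesis using P1 by (simp add: mcoeff_mmon_mult)
  qed
  have "mcoeff (Alt bt n (part \<kappa>)) (dmon n \<theta>) = (\<Sum>p | p permutes {..<n}.
      of_int (sign p) * mcoeff (mmon (dmon n \<kappa>) * P) (image_mset p (dmon n \<theta>)))"
    by (simp add: Alt_eq_antisymmetrize antisymmetrize_def altm_part P_def mcoeff_perm_vars)
  also have "\<dots> = (\<Sum>p | p permutes {..<n}. if p = id then (if \<kappa> = \<theta> then 1 else 0) else 0)"
  proof (rule sum.cong[OF refl])
    fix p assume "p \<in> {p. p permutes {..<n}}"
    then have "image_mset p (dmon n \<theta>) = dmon n \<kappa> \<longleftrightarrow> p = id \<and> \<kappa> = \<theta>"
      using image_dmon_eq[of p n \<theta> \<kappa>] dmon_inj[of n \<kappa> \<theta>] l by auto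
    then show "of_int (sign p) * mcoeff (mmon (dmon n \<kappa>) * P) (image_mset p (dmon n \<theta>)) =
        (if p = id then (if \<kappa> = \<theta> then 1 else 0) else 0)"
      by (auto simp: M)
  qed
  also have "\<dots> = (if \<kappa> = \<theta> then 1 else 0)"
    by (subst sum.delta) (simp_all add: permutes_id finite_permutations)
  finally show ?thesis .
qed

lemma dmon_Suc: "part_length \<theta> \<le> n \<Longrightarrow> dmon (Suc n) \<theta> = vmon id n (\<lambda>_. 1) + dmon n \<theta>"
proof (rule multiset_eqI)
  fix i assume "part_length \<theta> \<le> n"
  then show "count (dmon (Suc n) \<theta>) i = count (vmon id n (\<lambda>_. 1) + dmon n \<theta>) i"
    by (cases "i < n") (auto simp: dmon_def part_eq_0)
qed

lemma part_size_0D: "part_size \<theta> = 0 \<Longrightarrow> \<theta> = empty_part"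
  using part_size_eqD[of empty_part \<theta>] by simp

lemma part_length_empty [simp]: "part_length empty_part = 0"
  by (simp add: part_length_def)

lemma restr_Vd [simp]: "restr {..<n} (Vd id n) = Vd id n"
  using supp_Vd[of id n "{..<n}"] by (simp add: supp_iff_restr)

lemma mcoeff_mult_Vd_Suc:
  assumes "part_length \<kappa> \<le> n"
  shows "mcoeff (F * Vd id (Suc n)) (dmon (Suc n) \<kappa>) = mcoeff (F * Vd id n) (dmon n \<kappa>)"
proof -
  have s: "set_mset (dmon (Suc n) \<kappa>) \<subseteq> {..<n}"
    using set_mset_vmon[of id n "\<lambda>_. 1"] set_mset_dmon[of n \<kappa>] by (simp add: dmon_Suc[OF assms])
  have "mcoeff (F * Vd id (Suc n)) (dmon (Suc n) \<kappa>) =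
      mcoeff (restr {..<n} (F * Vd id (Suc n))) (dmon (Suc n) \<kappa>)" using s by (simp add: mcoeff_restr)
  also have "restr {..<n} (F * Vd id (Suc n)) = mmon (vmon id n (\<lambda>_. 1)) * restr {..<n} (F * Vd id n)"
    by (simp only: restr_mult restr_Vd_Suc restr_Vd mult_ac)
  also have "mcoeff \<dots> (dmon (Suc n) \<kappa>) = mcoeff (restr {..<n} (F * Vd id n)) (dmon n \<kappa>)"
    by (simp add: mcoeff_mmon_mult dmon_Suc[OF assms])
  finally show ?thesis using set_mset_dmon[of n \<kappa>] by (simp only: mcoeff_restr if_True)
qed

lemma mcoeff_Vd: "mcoeff (Vd id n :: 'a::comm_ring_1 mfps) (dmon n empty_part) = 1"
proof (induction n)
  case 0
  then show ?case by (simp add: Vd_def dmon_def vmon_def mcoeff_one)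
next
  case (Suc n)
  then show ?case
    using mcoeff_mult_Vd_Suc[of empty_part n "1 :: 'a mfps"]
    by (simp only: mult_1_left part_length_empty le0 simp_thms)
qed

lemma alternating_Vd: "alternating n (Vd id n)"
  unfolding alternating_def by (simp add: perm_vars_Vd[of id n, simplified])

text \<open>Both sides are alternating; by homogeneity the product can have a nonzero coefficient at
  a dominant monomial only for the empty partition.\<close>

lemma vandermonde: "Alt 0 n (part empty_part) = Vd id n"
proof (rule alternating_ext[of n])
  fix \<theta> assume l: "part_length \<theta> \<le> n"
  show "mcoeff (Alt 0 n (part empty_part)) (dmon n \<theta>) = mcoeff (Vd id n) (dmon n \<theta>)"
  proof (cases "\<theta> = empty_part")
    case True
    then show ?thesis by (simp only: mcoeff_Vd mcoeff_Alt_dmon part_length_empty le0 simp_thms if_True)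
  next
    case False
    then have "part_size \<theta> \<noteq> 0" using part_size_0D by blast
    then have "mcoeff (Vd id n :: ratfun mfps) (dmon n \<theta>) = 0"
      using mhom_Vd[of n id] l by (auto simp: mhom_def size_dmon)
    moreover have "mcoeff (Alt 0 n (part empty_part)) (dmon n \<theta>) = 0"
      using mcoeff_Alt_dmon[of empty_part n \<theta> 0] l False by (simp del: part_empty_part)
    ultimately show ?thesis by simp
  qed
qed (simp_all add: alternating_Alt supp_Alt alternating_Vd supp_Vd del: part_empty_part)

section \<open>The superstandard tableau and the bialternant formula\<close>

lemma seq_size_eqD:
  assumes le: "\<And>i. l i \<le> m i" and fin: "finite {i. m i \<noteq> 0}" and eq: "seq_size l = seq_size m"
  shows "l = m"
proof (rule ccontr)
  assume "l \<noteq> m"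
  then obtain i where "l i \<noteq> m i" by auto
  then have i: "l i < m i" using le[of i] by simp
  have "seq_size l \<le> seq_size (m(i := m i - 1))"
    by (rule seq_size_mono) (use le i finite_support_upd[OF fin] in auto)
  then show False using seq_size_upd[OF fin, of i "m i - 1"] i eq by linarith
qed

lemma straight_ssyt_ge:
  assumes T: "T \<in> ssyt (<) A \<kappa> empty_part"
  shows "(i, j) \<in> skew_cells \<kappa> empty_part \<Longrightarrow> i \<le> T (i, j)"
proof (induction i)
  case (Suc i)
  then have c: "(i, j) \<in> skew_cells \<kappa> empty_part"
    using part_antimono[of i "Suc i" \<kappa>] by (auto simp: skew_cells_def)
  then show ?case using Suc.IH ssyt_col[OF T c Suc.prems] by simp
qed simp

lemma antimono_part_diff: "antimono (\<lambda>i. part \<kappa> i - c)"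
  by (intro antimonoI diff_le_mono part_antimono)

lemma add_set_part_diff:
  "add_set {i. c < part \<kappa> i} (\<lambda>i. part \<kappa> i - Suc c) = (\<lambda>i. part \<kappa> i - c)"
  by (rule ext) (auto simp: add_set_def)

lemma finite_part_diff: "finite {i. part \<kappa> i - c \<noteq> 0}"
  by (rule finite_subset[OF _ finite_part[of \<kappa>]]) auto

text \<open>Read from the right, each column adds a vertical strip that already gives a partition,
  namely \<open>\<kappa>\<close> without its first c columns, so nothing is ever
  straightened.\<close>

lemma superstandard_word:
  assumes T: "T \<in> ssyt (<) A \<kappa> empty_part"
    and T0: "\<And>i j. (i, j) \<in> skew_cells \<kappa> empty_part \<Longrightarrow> c \<le> j \<Longrightarrow> T (i, j) = i"
  shows "uexp (cols_from \<kappa> empty_part T c) (\<lambda>_. 0) = 0 \<and>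
    uact (cols_from \<kappa> empty_part T c) (\<lambda>_. 0) = (\<lambda>i. part \<kappa> i - c)"
  using T0
proof (induction "part \<kappa> 0 - c" arbitrary: c)
  case 0
  then have "part \<kappa> i \<le> c" for i using part_antimono[of 0 i \<kappa>] by simp
  then show ?case using 0 by (auto simp: cols_from_def)
next
  case (Suc d)
  have c: "c < part \<kappa> 0" using Suc.hyps(2) by simp
  have IH: "uexp (cols_from \<kappa> empty_part T (Suc c)) (\<lambda>_. 0) = 0"
    "uact (cols_from \<kappa> empty_part T (Suc c)) (\<lambda>_. 0) = (\<lambda>i. part \<kappa> i - Suc c)"
    using Suc.hyps(1)[of "Suc c"] Suc.hyps(2) Suc.prems by simp_all
  have S: "set (col_list \<kappa> empty_part T c) = {i. c < part \<kappa> i}"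
    using Suc.prems by (force simp: set_col_list skew_cells_def)
  note col = uact_strict_column[OF finite_part_diff antimono_part_diff sorted_col_list[OF T, of c],
      of \<kappa> "Suc c", unfolded S add_set_part_diff tail_max_antimono[OF finite_part_diff antimono_part_diff]]
  show ?case using col by (simp add: cols_from_step[OF c] uact_append uexp_append IH)
qed

text \<open>Exponent 0 means that no column needed straightening. By induction the columns to the
  right are superstandard. In column c, an entry with a right neighbour is squeezed to its row
  number; for the other rows a gap would leave a zero before a positive entry.\<close>

lemma superstandard_unique:
  assumes T: "T \<in> ssyt (<) A \<kappa> empty_part"
    and e: "uexp (cols_from \<kappa> empty_part T c) (\<lambda>_. 0) = 0"
  shows "(i, j) \<in> skew_cells \<kappa> empty_part \<Longrightarrow> c \<le> j \<Longrightarrow> T (i, j) = i"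
  using e
proof (induction "part \<kappa> 0 - c" arbitrary: c i j)
  case 0
  then show ?case using skew_cells_bounded by fastforce
next
  case (Suc d)
  let ?X = "skew_cells \<kappa> empty_part"
  have c: "c < part \<kappa> 0" using Suc.hyps(2) by simp
  define L where "L = uact (cols_from \<kappa> empty_part T (Suc c)) (\<lambda>_. 0)"
  define S where "S = set (col_list \<kappa> empty_part T c)"
  have e: "uexp (cols_from \<kappa> empty_part T (Suc c)) (\<lambda>_. 0) = 0" "uexp (col_list \<kappa> empty_part T c) L = 0"
    using Suc.prems(3) by (simp_all add: cols_from_step[OF c] uexp_append L_def)
  have right: "T (i, j) = i" if "(i, j) \<in> ?X" "Suc c \<le> j" for i j
    using Suc.hyps(1)[of "Suc c" i j] Suc.hyps(2) that e(1) by simp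
  have L: "L = (\<lambda>i. part \<kappa> i - Suc c)"
    unfolding L_def using superstandard_word[OF T right] by simp
  have finL: "finite {i. L i \<noteq> 0}" and antiL: "antimono L"
    unfolding L by (rule finite_part_diff antimono_part_diff)+
  have finS: "finite {i. add_set S L i \<noteq> 0}"
    unfolding S_def by (rule finite_support_add_set[OF finL]) simp
  have "seq_size (add_set S L) = seq_size (tail_max (add_set S L))"
    using uact_strict_column(2)[OF finL antiL sorted_col_list[OF T, of c]] e(2) by (simp add: S_def)
  then have "add_set S L = tail_max (add_set S L)"
    by (intro seq_size_eqD tail_max_ge[OF finS] finite_support_tail_max[OF finS]) auto
  then have anti: "antimono (add_set S L)" using antimono_tail_max[OF finS] by simp
  have col: "T (i, c) = i" if "(i, c) \<in> ?X" for i
    using that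
  proof (induction i rule: less_induct)
    case (less i)
    have ge: "i \<le> T (i, c)" by (rule straight_ssyt_ge[OF T less.prems])
    show ?case
    proof (cases "Suc c < part \<kappa> i")
      case True
      then have 1: "(i, Suc c) \<in> ?X" by (simp add: skew_cells_def)
      have "T (i, c) \<le> T (i, Suc c)" by (rule ssyt_row[OF T less.prems 1]) simp
      then show ?thesis using right[OF 1] ge by simp
    next
      case False
      show ?thesis
      proof (rule ccontr)
        assume ne: "T (i, c) \<noteq> i"
        have "i \<notin> S"
        proof
          assume "i \<in> S"
          then obtain i' where i': "(i', c) \<in> ?X" "i = T (i', c)" by (auto simp: S_def set_col_list)
          show False
          proof (cases i' i rule: linorder_cases)
            case less
            then show ?thesis using less.IH[OF less i'(1)] i'(2) by simp
          next
            case equal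
            then show ?thesis using i'(2) ne by simp
          next
            case greater
            then show ?thesis using ssyt_col[OF T less.prems i'(1) greater] i'(2) ge by simp
          qed
        qed
        \<comment> \<open>Row i ends in column c, so nothing to its right has contributed to the
          i-th entry.\<close>
        then have "add_set S L i = 0" using False by (simp add: add_set_def L)
        moreover have "T (i, c) \<in> S" using less.prems by (auto simp: S_def set_col_list)
        then have "0 < add_set S L (T (i, c))" by (simp add: add_set_def)
        ultimately show False using antimonoD[OF anti ge] by simp
      qed
    qed
  qed
  show ?case
    using right[OF Suc.prems(1)] col[of i] Suc.prems(1,2) by (cases "j = c") auto
qed

text \<open>The case of the empty partition and bt = 0 in \<open>schur_mult_Alt\<close>: powers of
  zero remove every tableau that needs straightening, and only the superstandard one does
  not.\<close>

lemma restr_schur_mult_Vd: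
  assumes l: "part_length \<kappa> \<le> n"
  shows "restr {..<n} (schur_fun \<kappa>) * Vd id n = Alt 0 n (part \<kappa>)"
proof -
  let ?X = "skew_cells \<kappa> empty_part" and ?S = "ssyt (<) {..<n} \<kappa> empty_part"
  let ?w = "column_word \<kappa> empty_part"
  define T0 where "T0 = restrict fst ?X"
  have T0: "T0 \<in> ?S"
    unfolding T0_def
    by (rule ssytI) (use l in \<open>auto dest: skew_cells_bounded\<close>)
  have w0: "uexp (?w T0) (\<lambda>_. 0) = 0" "uact (?w T0) (\<lambda>_. 0) = part \<kappa>"
    using superstandard_word[OF T0, of 0] by (auto simp: T0_def column_word_eq)
  have uniq: "T = T0" if T: "T \<in> ?S" and e: "uexp (?w T) (\<lambda>_. 0) = 0" for T
  proof (rule ext)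
    fix p :: "nat \<times> nat"
    have "T p = fst p" if "p \<in> ?X"
      using superstandard_unique[OF T e[unfolded column_word_eq], of "fst p" "snd p"] that by simp
    moreover have "T p = undefined" if "p \<notin> ?X"
      using T that unfolding ssyt_def PiE_iff extensional_def by blast
    ultimately show "T p = T0 p" by (simp add: T0_def)
  qed
  have "restr {..<n} (schur_fun \<kappa>) * Vd id n =
     (\<Sum>T\<in>?S. (- mconst 0) ^ uexp (?w T) (\<lambda>_. 0) * Alt 0 n (uact (?w T) (\<lambda>_. 0)))"
    using schur_mult_Alt[of empty_part n \<kappa> 0] by (simp add: vandermonde[simplified])
  also have "\<dots> = (\<Sum>T\<in>?S. if T = T0 then Alt 0 n (part \<kappa>) else 0)"
  proof (rule sum.cong[OF refl])
    fix T assume T: "T \<in> ?S"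
    show "(- mconst 0) ^ uexp (?w T) (\<lambda>_. 0) * Alt 0 n (uact (?w T) (\<lambda>_. 0)) =
       (if T = T0 then Alt 0 n (part \<kappa>) else 0)"
    proof (cases "T = T0")
      case True
      then show ?thesis by (simp add: w0)
    next
      case False
      then have "uexp (?w T) (\<lambda>_. 0) \<noteq> 0" using uniq[OF T] by blast
      then show ?thesis using False by (simp add: power_0_left)
    qed
  qed
  also have "\<dots> = Alt 0 n (part \<kappa>)" using T0 by (subst sum.delta) simp_all
  finally show ?thesis .
qed

lemma restr_schur_eq_0:
  assumes "n < part_length \<kappa>"
  shows "restr {..<n} (schur_fun \<kappa>) = 0"
proof -
  have c: "(n, 0) \<in> skew_cells \<kappa> empty_part"
    using part_pos_iff[of \<kappa> n] assms by (simp add: skew_cells_def)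
  have "ssyt (<) {..<n} \<kappa> empty_part = {}"
  proof (rule ccontr)
    assume "\<not> ?thesis"
    then obtain T where T: "T \<in> ssyt (<) {..<n} \<kappa> empty_part" by auto
    then show False using straight_ssyt_ge[OF T c] ssyt_entry[OF T c] by simp
  qed
  then show ?thesis by (simp add: restr_schur_fun spoly_def)
qed

section \<open>Schur coefficients\<close>

text \<open>By the bialternant formula this reads off the coefficient of the Schur function of
  \<open>\<kappa>\<close>, without reference to any expansion.\<close>

definition vd_coeff :: "nat \<Rightarrow> partition \<Rightarrow> ratfun mfps \<Rightarrow> ratfun" where
  "vd_coeff n \<kappa> F = mcoeff (F * Vd id n) (dmon n \<kappa>)"

lemma vd_coeff_add: "vd_coeff n \<kappa> (F + G) = vd_coeff n \<kappa> F + vd_coeff n \<kappa> G"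
  and vd_coeff_const: "vd_coeff n \<kappa> (mconst c * F) = c * vd_coeff n \<kappa> F"
  by (simp_all add: vd_coeff_def distrib_right mult.assoc)

lemma vd_coeff_sum: "vd_coeff n \<kappa> (sum f A) = (\<Sum>a\<in>A. vd_coeff n \<kappa> (f a))"
  by (simp add: vd_coeff_def sum_distrib_right)

lemma vd_coeff_restr: "vd_coeff n \<kappa> F = mcoeff (restr {..<n} F * Vd id n) (dmon n \<kappa>)"
proof -
  have "vd_coeff n \<kappa> F = mcoeff (restr {..<n} (F * Vd id n)) (dmon n \<kappa>)"
    using set_mset_dmon[of n \<kappa>] by (simp add: vd_coeff_def mcoeff_restr)
  then show ?thesis by (simp add: restr_mult)
qed

lemma vd_coeff_stable: "part_length \<kappa> \<le> n \<Longrightarrow> vd_coeff n \<kappa> F = vd_coeff (part_length \<kappa>) \<kappa> F"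
proof (induction n)
  case (Suc n)
  then show ?case
    using mcoeff_mult_Vd_Suc[of \<kappa> n F] unfolding vd_coeff_def by (cases "part_length \<kappa> = Suc n") auto
qed simp

lemma vd_coeff_schur:
  assumes "part_length \<kappa> \<le> n"
  shows "vd_coeff n \<kappa> (schur_fun \<rho>) = (if \<rho> = \<kappa> then 1 else 0)"
proof (cases "part_length \<rho> \<le> n")
  case True
  then show ?thesis using mcoeff_Alt_dmon[of \<rho> n \<kappa> 0] assms by (simp add: vd_coeff_restr restr_schur_mult_Vd)
next
  case False
  then show ?thesis using assms by (auto simp: vd_coeff_restr restr_schur_eq_0)
qed

lemma vd_coeff_nz:
  assumes "vd_coeff n \<kappa> F \<noteq> 0" "part_length \<kappa> \<le> n"
  obtains a where "mcoeff F a \<noteq> 0" "size a = part_size \<kappa>" "set_mset a \<subseteq> {..<n}"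
proof -
  from assms(1) obtain a b where ab: "dmon n \<kappa> = a + b" "mcoeff F a \<noteq> 0" "mcoeff (Vd id n :: ratfun mfps) b \<noteq> 0"
    unfolding vd_coeff_def by (rule mcoeff_mult_nz)
  have "size b = (\<Sum>i<n. i)" using ab(3) mhom_Vd[of n id] by (auto simp: mhom_def)
  then have "size a = part_size \<kappa>" using size_dmon[OF assms(2)] ab(1) by simp
  moreover have "set_mset a \<subseteq> {..<n}" using set_mset_dmon[of n \<kappa>] ab(1) by simp
  ultimately show ?thesis using ab(2) by (intro that)
qed

lemma finite_part_size: "finite {\<kappa>. part_size \<kappa> = d}"
proof -
  \<comment> \<open>Every partition of d fits into the square of side d.\<close>
  define R where "R = Abs_partition (\<lambda>i. if i < d then d else 0)"
  have R: "part R = (\<lambda>i. if i < d then d else 0)"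
    unfolding R_def by (rule Abs_partition_inverse) (auto simp: monotone_def intro: finite_subset[of _ "{..<d}"])
  have "part_le \<kappa> R" if k: "part_size \<kappa> = d" for \<kappa>
    unfolding part_le_def
  proof
    fix i
    have s: "part_size \<kappa> = (\<Sum>j<part_length \<kappa>. part \<kappa> j)"
      by (rule seq_size_eq_sum) (rule part_eq_0)
    show "part \<kappa> i \<le> part R i"
    proof (cases "i < part_length \<kappa>")
      case True
      have "part_length \<kappa> = (\<Sum>j<part_length \<kappa>. 1)" by simp
      also have "\<dots> \<le> (\<Sum>j<part_length \<kappa>. part \<kappa> j)"
        by (rule sum_mono) (use part_pos_iff[of \<kappa>] in \<open>simp add: Suc_le_eq\<close>)
      finally have "i < d" using True s k by simp
      moreover have "part \<kappa> i \<le> d" unfolding k[symmetric] s by (rule member_le_sum) (use True in auto)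
      ultimately show ?thesis by (simp add: R)
    qed (simp add: part_eq_0)
  qed
  then show ?thesis by (intro finite_subset[OF _ finite_part_le[of R]]) auto
qed

lemma finite_part_size_le: "finite {\<kappa>. part_size \<kappa> \<le> d}"
proof -
  have "{\<kappa>. part_size \<kappa> \<le> d} = (\<Union>e\<le>d. {\<kappa>. part_size \<kappa> = e})" by auto
  then show ?thesis using finite_part_size by simp
qed

lemma schur_fun_hom: "mcoeff (schur_fun \<kappa>) m \<noteq> 0 \<Longrightarrow> size m = part_size \<kappa>"
proof -
  assume nz: "mcoeff (schur_fun \<kappa>) m \<noteq> 0"
  then have "{T \<in> ssyt (<) UNIV \<kappa> empty_part. image_mset T (mset_set (skew_cells \<kappa> empty_part)) = m} \<noteq> {}"
    unfolding schur_fun_def mcoeff_Abs by (metis card.empty of_nat_0)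
  then show ?thesis by (auto simp: part_size_eq_card)
qed

text \<open>The Vandermonde product is homogeneous, so only the part of F of degree |\<kappa>|
  matters; there the possibly infinite expansion is a finite sum.\<close>

lemma vd_coeff_of_expansion:
  assumes F: "\<And>m. mcoeff F m = (\<Sum>\<rho> | part_size \<rho> = size m. c \<rho> * mcoeff (schur_fun \<rho>) m)"
    and l: "part_length \<kappa> \<le> n"
  shows "c \<kappa> = vd_coeff n \<kappa> F"
proof -
  let ?d = "part_size \<kappa>"
  define G where "G = (\<Sum>\<rho> | part_size \<rho> = ?d. mconst (c \<rho>) * schur_fun \<rho>)"
  have FG: "mcoeff F a = mcoeff G a" if "size a = ?d" for a
    using that by (simp add: F G_def)
  have "vd_coeff n \<kappa> F = vd_coeff n \<kappa> G"
    unfolding vd_coeff_def mcoeff_mult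
  proof (rule sum.cong[OF refl])
    fix a assume "a \<in> {a. a \<subseteq># dmon n \<kappa>}"
    then have a: "size (dmon n \<kappa> - a) = size (dmon n \<kappa>) - size a" "size a \<le> size (dmon n \<kappa>)"
      by (auto simp: size_Diff_submset size_mset_mono)
    show "mcoeff F a * mcoeff (Vd id n) (dmon n \<kappa> - a) = mcoeff G a * mcoeff (Vd id n) (dmon n \<kappa> - a)"
    proof (cases "mcoeff (Vd id n :: ratfun mfps) (dmon n \<kappa> - a) = 0")
      case False
      then have "size (dmon n \<kappa> - a) = (\<Sum>i<n. i)" using mhom_Vd[of n id] by (auto simp: mhom_def)
      then have "size a = ?d" using a size_dmon[OF l] by simp
      then show ?thesis using FG by simp
    qed simp
  qed
  also have "\<dots> = (\<Sum>\<rho> | part_size \<rho> = ?d. if \<rho> = \<kappa> then c \<kappa> else 0)"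
    unfolding G_def vd_coeff_sum vd_coeff_const vd_coeff_schur[OF l] by (rule sum.cong) auto
  also have "\<dots> = c \<kappa>" by (subst sum.delta) (simp_all add: finite_part_size)
  finally show ?thesis ..
qed

lemma schur_expansion_coeff:
  "schur_expansion F c \<Longrightarrow> part_length \<kappa> \<le> n \<Longrightarrow> c \<kappa> = vd_coeff n \<kappa> F"
  by (rule vd_coeff_of_expansion) (simp_all add: schur_expansion_def)

definition symm :: "'a::comm_ring_1 mfps \<Rightarrow> bool" where
  "symm F \<longleftrightarrow> (\<forall>k. perm_vars (transpose k (Suc k)) F = F)"

text \<open>Says that F becomes a polynomial whenever it is restricted to finitely many
  variables.\<close>

definition levelwise_bounded :: "'a::comm_ring_1 mfps \<Rightarrow> bool" where
  "levelwise_bounded F \<longleftrightarrow> (\<forall>n. \<exists>d. \<forall>m. set_mset m \<subseteq> {..<n} \<longrightarrow> mcoeff F m \<noteq> 0 \<longrightarrow> size m \<le> d)"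

lemma symmD:
  assumes "symm F" "inj_on f (set_mset m)"
  shows "mcoeff F (image_mset f m) = mcoeff F m"
proof (rule adj_sym_imp_sym)
  fix k m
  show "mcoeff F (image_mset (transpose k (Suc k)) m) = mcoeff F m"
    using assms(1) unfolding symm_def by (metis mcoeff_perm_vars)
qed (rule assms(2))

lemma symm_schur_fun: "symm (schur_fun \<kappa>)"
  unfolding symm_def by (intro allI mfps_eqI) (simp add: mcoeff_perm_vars schur_fun_adj_sym)

lemma alternating_restr_symm:
  fixes F :: "ratfun mfps"
  assumes sym: "symm F"
  shows "alternating n (restr {..<n} F * Vd id n)"
proof -
  have "perm_vars (transpose k (Suc k)) (restr {..<n} F) = restr {..<n} F" if "Suc k < n" for k
  proof (rule mfps_eqI)
    fix m
    have p: "transpose k (Suc k) permutes {..<n}" using that by (intro permutes_swap_id) auto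
    have "transpose k (Suc k) ` set_mset m \<subseteq> {..<n} \<longleftrightarrow> set_mset m \<subseteq> {..<n}"
      using permutes_in_image[OF p] by blast
    then show "mcoeff (perm_vars (transpose k (Suc k)) (restr {..<n} F)) m = mcoeff (restr {..<n} F) m"
      using symmD[OF sym, of "transpose k (Suc k)" m] by (simp add: mcoeff_perm_vars mcoeff_restr)
  qed
  then show ?thesis
    using alternating_Vd[where 'a = ratfun, of n] by (simp add: alternating_def perm_vars_mult)
qed

text \<open>In n variables, F times the Vandermonde product is alternating of bounded degree, hence
  a finite combination of classical alternants. Replacing these by Schur polynomials and cancelling
  the Vandermonde product gives the expansion for all monomials in these variables.\<close>

lemma symm_levelwise_bounded_expansion:
  assumes sym: "symm F" and levelwise_bounded: "levelwise_bounded F"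
  shows "schur_expansion F (\<lambda>\<kappa>. vd_coeff (part_length \<kappa>) \<kappa> F)"
proof -
  define c where "c \<kappa> = vd_coeff (part_length \<kappa>) \<kappa> F" for \<kappa>
  have c: "vd_coeff n \<kappa> F = c \<kappa>" if "part_length \<kappa> \<le> n" for n \<kappa>
    using vd_coeff_stable[OF that] by (simp add: c_def)
  have bound: "\<exists>d. \<forall>\<kappa>. part_length \<kappa> \<le> n \<longrightarrow> c \<kappa> \<noteq> 0 \<longrightarrow> part_size \<kappa> \<le> d" for n
  proof -
    from levelwise_bounded obtain d where d: "\<And>m. set_mset m \<subseteq> {..<n} \<Longrightarrow> mcoeff F m \<noteq> 0 \<Longrightarrow> size m \<le> d"
      unfolding levelwise_bounded_def by metis
    have "part_size \<kappa> \<le> d" if "part_length \<kappa> \<le> n" "c \<kappa> \<noteq> 0" for \<kappa>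
    proof -
      have l: "part_length \<kappa> \<le> n" by (rule that)
      have "vd_coeff n \<kappa> F \<noteq> 0" using that c by simp
      then obtain a where "mcoeff F a \<noteq> 0" "size a = part_size \<kappa>" "set_mset a \<subseteq> {..<n}"
        by (rule vd_coeff_nz[OF _ l])
      then show ?thesis using d by metis
    qed
    then show ?thesis by blast
  qed
  have "finite {\<kappa>. part_length \<kappa> \<le> n \<and> c \<kappa> \<noteq> 0}" for n
  proof -
    from bound[of n] obtain d where "\<And>\<kappa>. part_length \<kappa> \<le> n \<Longrightarrow> c \<kappa> \<noteq> 0 \<Longrightarrow> part_size \<kappa> \<le> d" by blast
    then show ?thesis by (intro finite_subset[OF _ finite_part_size_le[of d]]) auto
  qed
  moreover have "mcoeff F m = (\<Sum>\<kappa> | part_size \<kappa> = size m. c \<kappa> * mcoeff (schur_fun \<kappa>) m)" for m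
  proof -
    obtain n where n: "set_mset m \<subseteq> {..<n}"
      using finite_nat_set_iff_bounded[of "set_mset m"] by auto
    from bound[of n] obtain d where d: "\<And>\<kappa>. part_length \<kappa> \<le> n \<Longrightarrow> c \<kappa> \<noteq> 0 \<Longrightarrow> part_size \<kappa> \<le> d" by blast
    define K where "K = {\<kappa>. part_length \<kappa> \<le> n \<and> part_size \<kappa> \<le> d}"
    have finK: "finite K" unfolding K_def by (rule finite_subset[OF _ finite_part_size_le[of d]]) auto
    have "restr {..<n} F * Vd id n = (\<Sum>\<kappa>\<in>K. mconst (c \<kappa>) * Alt 0 n (part \<kappa>))"
    proof (rule alternating_ext[of n])
      show "alternating n (restr {..<n} F * Vd id n)" by (rule alternating_restr_symm[OF sym])
      show "alternating n (\<Sum>\<kappa>\<in>K. mconst (c \<kappa>) * Alt 0 n (part \<kappa>))"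
        using alternating_Alt[of n 0] by (simp add: alternating_def perm_vars_mult perm_vars_sum sum_negf)
      show "supp {..<n} (restr {..<n} F * Vd id n)"
        by (intro supp_mult supp_restr supp_Vd) auto
      show "supp {..<n} (\<Sum>\<kappa>\<in>K. mconst (c \<kappa>) * Alt 0 n (part \<kappa>))"
        using supp_Alt[of n 0] by (simp add: supp_iff_restr restr_sum restr_mult)
      fix \<theta> assume t: "part_length \<theta> \<le> n"
      have "mcoeff (\<Sum>\<kappa>\<in>K. mconst (c \<kappa>) * Alt 0 n (part \<kappa>)) (dmon n \<theta>) =
          (\<Sum>\<kappa>\<in>K. if \<kappa> = \<theta> then c \<theta> else 0)"
        by (simp, rule sum.cong) (use t in \<open>auto simp: mcoeff_Alt_dmon K_def\<close>)
      also have "\<dots> = c \<theta>" using finK d[OF t] t by (subst sum.delta) (auto simp: K_def)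
      finally show "mcoeff (restr {..<n} F * Vd id n) (dmon n \<theta>) =
          mcoeff (\<Sum>\<kappa>\<in>K. mconst (c \<kappa>) * Alt 0 n (part \<kappa>)) (dmon n \<theta>)"
        using c[OF t] by (simp add: vd_coeff_restr)
    qed
    also have "\<dots> = (\<Sum>\<kappa>\<in>K. mconst (c \<kappa>) * restr {..<n} (schur_fun \<kappa>)) * Vd id n"
      unfolding sum_distrib_right
      by (rule sum.cong) (simp_all add: K_def restr_schur_mult_Vd mult.assoc)
    finally have "Vd id n * (restr {..<n} F - (\<Sum>\<kappa>\<in>K. mconst (c \<kappa>) * restr {..<n} (schur_fun \<kappa>))) = 0"
      by (simp add: algebra_simps)
    then have "restr {..<n} F - (\<Sum>\<kappa>\<in>K. mconst (c \<kappa>) * restr {..<n} (schur_fun \<kappa>)) = 0"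
      by (rule Vd_cancel[rotated]) simp
    then have "mcoeff (restr {..<n} F) m = mcoeff (\<Sum>\<kappa>\<in>K. mconst (c \<kappa>) * restr {..<n} (schur_fun \<kappa>)) m"
      by simp
    then have "mcoeff F m = (\<Sum>\<kappa>\<in>K. c \<kappa> * mcoeff (schur_fun \<kappa>) m)"
      using n by (simp add: mcoeff_restr)
    also have "\<dots> = (\<Sum>\<kappa>\<in>{\<kappa>. part_size \<kappa> = size m} \<union> K. c \<kappa> * mcoeff (schur_fun \<kappa>) m)"
    proof (rule sum.mono_neutral_left)
      show "\<forall>\<kappa>\<in>({\<kappa>. part_size \<kappa> = size m} \<union> K) - K. c \<kappa> * mcoeff (schur_fun \<kappa>) m = 0"
      proof
        fix \<kappa> assume "\<kappa> \<in> ({\<kappa>. part_size \<kappa> = size m} \<union> K) - K"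
        then have nK: "\<kappa> \<notin> K" by simp
        show "c \<kappa> * mcoeff (schur_fun \<kappa>) m = 0"
        proof (cases "part_length \<kappa> \<le> n")
          case True
          then have "c \<kappa> = 0" using nK d[OF True] unfolding K_def by blast
          then show ?thesis by simp
        next
          case False
          then have "mcoeff (restr {..<n} (schur_fun \<kappa>)) m = 0" by (simp add: restr_schur_eq_0)
          then show ?thesis using n by (simp add: mcoeff_restr)
        qed
      qed
    qed (use finK finite_part_size in auto)
    also have "\<dots> = (\<Sum>\<kappa> | part_size \<kappa> = size m. c \<kappa> * mcoeff (schur_fun \<kappa>) m)"
      by (rule sum.mono_neutral_right) (use finK finite_part_size schur_fun_hom[of _ m] in auto)
    finally show ?thesis .
  qed
  ultimately show ?thesis unfolding schur_expansion_def c_def[abs_def] by blast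
qed

text \<open>An intrinsic description of the completion, from which closure under products is
  immediate, whereas the expansion of a product is not at hand.\<close>

lemma Sym_hat_iff: "F \<in> Sym_hat \<longleftrightarrow> symm F \<and> levelwise_bounded F"
proof
  assume "symm F \<and> levelwise_bounded F"
  then show "F \<in> Sym_hat" unfolding Sym_hat_def using symm_levelwise_bounded_expansion by blast
next
  assume "F \<in> Sym_hat"
  then obtain c where c: "schur_expansion F c" unfolding Sym_hat_def by auto
  have F: "mcoeff F m = (\<Sum>lam | part_size lam = size m. c lam * mcoeff (schur_fun lam) m)" for m
    using c by (simp add: schur_expansion_def)
  have "symm F"
    unfolding symm_def by (intro allI mfps_eqI) (simp add: mcoeff_perm_vars F schur_fun_adj_sym)
  moreover have "levelwise_bounded F"
    unfolding levelwise_bounded_def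
  proof
    fix n
    let ?K = "{lam. part_length lam \<le> n \<and> c lam \<noteq> 0}"
    have fin: "finite ?K" using c by (simp add: schur_expansion_def)
    have "size m \<le> Max (insert 0 (part_size ` ?K))" if m: "set_mset m \<subseteq> {..<n}" "mcoeff F m \<noteq> 0" for m
    proof -
      from m(2) obtain lam where lam: "part_size lam = size m" "c lam * mcoeff (schur_fun lam) m \<noteq> 0"
        unfolding F by (elim sum.not_neutral_contains_not_neutral) auto
      have "part_length lam \<le> n"
      proof (rule ccontr)
        assume "\<not> ?thesis"
        then have "mcoeff (restr {..<n} (schur_fun lam)) m = 0" by (simp add: restr_schur_eq_0)
        then show False using m(1) lam(2) by (simp add: mcoeff_restr)
      qed
      then have "part_size lam \<in> insert 0 (part_size ` ?K)" using lam(2) by auto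
      then show ?thesis unfolding lam(1)[symmetric] by (intro Max_ge) (simp_all add: fin)
    qed
    then show "\<exists>d. \<forall>m. set_mset m \<subseteq> {..<n} \<longrightarrow> mcoeff F m \<noteq> 0 \<longrightarrow> size m \<le> d" by blast
  qed
  ultimately show "symm F \<and> levelwise_bounded F" by simp
qed

lemma schur_coeff_eq:
  assumes "F \<in> Sym_hat" "part_length \<kappa> \<le> n"
  shows "schur_coeff F \<kappa> = vd_coeff n \<kappa> F"
proof -
  have ex: "schur_expansion F (\<lambda>\<kappa>. vd_coeff (part_length \<kappa>) \<kappa> F)"
    using assms(1) by (simp add: Sym_hat_iff symm_levelwise_bounded_expansion)
  moreover have "c = (\<lambda>\<kappa>. vd_coeff (part_length \<kappa>) \<kappa> F)" if "schur_expansion F c" for c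
    using schur_expansion_coeff[OF that order_refl] by (rule ext)
  ultimately have "schur_coeff F = (\<lambda>\<kappa>. vd_coeff (part_length \<kappa>) \<kappa> F)"
    unfolding schur_coeff_def by (rule the_equality)
  then show ?thesis using vd_coeff_stable[OF assms(2)] by simp
qed

lemma schur_expansion_schur_coeff: "F \<in> Sym_hat \<Longrightarrow> schur_expansion F (schur_coeff F)"
  using symm_levelwise_bounded_expansion[of F] schur_coeff_eq[OF _ order_refl, of F]
  by (simp add: Sym_hat_iff) (metis (no_types, lifting) Sym_hat_iff ext)

section \<open>The Hall product\<close>

lemma symm_add: "symm f \<Longrightarrow> symm g \<Longrightarrow> symm (f + g)"
  and symm_diff: "symm f \<Longrightarrow> symm g \<Longrightarrow> symm (f - g)"
  and symm_mult: "symm f \<Longrightarrow> symm g \<Longrightarrow> symm (f * g)"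
  and symm_const: "symm (mconst c)"
  and symm_1: "symm 1"
  and symm_0: "symm 0"
  by (simp_all add: symm_def perm_vars_add perm_vars_diff perm_vars_mult)

lemma levelwise_bounded_add:
  assumes f: "levelwise_bounded f" and g: "levelwise_bounded g"
  shows "levelwise_bounded (f + g)" "levelwise_bounded (f - g)"
proof -
  have "\<exists>d. \<forall>m. set_mset m \<subseteq> {..<n} \<longrightarrow> mcoeff f m \<noteq> 0 \<or> mcoeff g m \<noteq> 0 \<longrightarrow> size m \<le> d" for n
  proof -
    from f obtain d where "\<And>m. set_mset m \<subseteq> {..<n} \<Longrightarrow> mcoeff f m \<noteq> 0 \<Longrightarrow> size m \<le> d"
      unfolding levelwise_bounded_def by metis
    moreover from g obtain e where "\<And>m. set_mset m \<subseteq> {..<n} \<Longrightarrow> mcoeff g m \<noteq> 0 \<Longrightarrow> size m \<le> e"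
      unfolding levelwise_bounded_def by metis
    ultimately show ?thesis by (intro exI[of _ "max d e"]) (simp add: le_max_iff_disj, blast)
  qed
  moreover have "mcoeff f m \<noteq> 0 \<or> mcoeff g m \<noteq> 0"
    if "mcoeff (f + g) m \<noteq> 0 \<or> mcoeff (f - g) m \<noteq> 0" for m
    using that by auto
  ultimately show "levelwise_bounded (f + g)" "levelwise_bounded (f - g)" unfolding levelwise_bounded_def by metis+
qed

lemma levelwise_bounded_mult:
  assumes f: "levelwise_bounded f" and g: "levelwise_bounded g"
  shows "levelwise_bounded (f * g)"
  unfolding levelwise_bounded_def
proof
  fix n
  from f obtain d where d: "\<And>m. set_mset m \<subseteq> {..<n} \<Longrightarrow> mcoeff f m \<noteq> 0 \<Longrightarrow> size m \<le> d"
    unfolding levelwise_bounded_def by metis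
  from g obtain e where e: "\<And>m. set_mset m \<subseteq> {..<n} \<Longrightarrow> mcoeff g m \<noteq> 0 \<Longrightarrow> size m \<le> e"
    unfolding levelwise_bounded_def by metis
  have "size m \<le> d + e" if m: "set_mset m \<subseteq> {..<n}" "mcoeff (f * g) m \<noteq> 0" for m
  proof -
    from m(2) obtain a b where ab: "m = a + b" "mcoeff f a \<noteq> 0" "mcoeff g b \<noteq> 0"
      by (rule mcoeff_mult_nz)
    then show ?thesis using d[of a] e[of b] m(1) by simp
  qed
  then show "\<exists>d. \<forall>m. set_mset m \<subseteq> {..<n} \<longrightarrow> mcoeff (f * g) m \<noteq> 0 \<longrightarrow> size m \<le> d" by blast
qed

lemma levelwise_bounded_const: "levelwise_bounded (mconst c)"
  unfolding levelwise_bounded_def by (intro allI exI[of _ 0]) (simp add: mcoeff_mconst)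

lemma Sym_hat_add: "f \<in> Sym_hat \<Longrightarrow> g \<in> Sym_hat \<Longrightarrow> f + g \<in> Sym_hat"
  and Sym_hat_diff: "f \<in> Sym_hat \<Longrightarrow> g \<in> Sym_hat \<Longrightarrow> f - g \<in> Sym_hat"
  and Sym_hat_mult: "f \<in> Sym_hat \<Longrightarrow> g \<in> Sym_hat \<Longrightarrow> f * g \<in> Sym_hat"
  and Sym_hat_const: "mconst c \<in> Sym_hat"
  by (auto simp: Sym_hat_iff symm_add symm_diff symm_mult symm_const levelwise_bounded_add levelwise_bounded_mult levelwise_bounded_const)

lemma Sym_hat_0: "0 \<in> Sym_hat"
  using Sym_hat_const[of 0] by simp

lemma Sym_hat_sum: "(\<And>i. i \<in> I \<Longrightarrow> f i \<in> Sym_hat) \<Longrightarrow> sum f I \<in> Sym_hat"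
  by (induction I rule: infinite_finite_induct) (auto intro: Sym_hat_add Sym_hat_0)

section \<open>Symmetric functions of bounded degree\<close>

definition degree_bounded :: "'a::comm_ring_1 mfps \<Rightarrow> bool" where
  "degree_bounded f \<longleftrightarrow> (\<exists>d. \<forall>m. mcoeff f m \<noteq> 0 \<longrightarrow> size m \<le> d)"

lemma degree_bounded_add: "degree_bounded f \<Longrightarrow> degree_bounded g \<Longrightarrow> degree_bounded (f + g)"
proof -
  assume "degree_bounded f" "degree_bounded g"
  then obtain d e where d: "\<And>m. mcoeff f m \<noteq> 0 \<Longrightarrow> size m \<le> d" and e: "\<And>m. mcoeff g m \<noteq> 0 \<Longrightarrow> size m \<le> e"
    unfolding degree_bounded_def by metis
  have "size m \<le> max d e" if "mcoeff (f + g) m \<noteq> 0" for m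
    using d[of m] e[of m] that by (cases "mcoeff f m = 0") auto
  then show "degree_bounded (f + g)" unfolding degree_bounded_def by blast
qed

lemma degree_bounded_mult: "degree_bounded f \<Longrightarrow> degree_bounded g \<Longrightarrow> degree_bounded (f * g)"
proof -
  assume "degree_bounded f" "degree_bounded g"
  then obtain d e where d: "\<And>m. mcoeff f m \<noteq> 0 \<Longrightarrow> size m \<le> d" and e: "\<And>m. mcoeff g m \<noteq> 0 \<Longrightarrow> size m \<le> e"
    unfolding degree_bounded_def by metis
  have "size m \<le> d + e" if "mcoeff (f * g) m \<noteq> 0" for m
  proof -
    from that obtain a b where "m = a + b" "mcoeff f a \<noteq> 0" "mcoeff g b \<noteq> 0" by (rule mcoeff_mult_nz)
    then show ?thesis using d[of a] e[of b] by simp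
  qed
  then show "degree_bounded (f * g)" unfolding degree_bounded_def by blast
qed

lemma degree_bounded_const: "degree_bounded (mconst c)"
  unfolding degree_bounded_def by (intro exI[of _ 0]) (simp add: mcoeff_mconst)

lemma degree_bounded_mmon: "degree_bounded (mmon a)"
  unfolding degree_bounded_def by (intro exI[of _ "size a"]) (auto simp: mcoeff_mmon)

lemma degree_bounded_1: "degree_bounded 1"
  using degree_bounded_mmon[of "{#}"] by simp

lemma degree_bounded_0: "degree_bounded 0"
  by (simp add: degree_bounded_def)

lemma degree_bounded_prod: "(\<And>i. i \<in> I \<Longrightarrow> degree_bounded (f i)) \<Longrightarrow> degree_bounded (prod f I)"
  by (induction I rule: infinite_finite_induct) (auto intro: degree_bounded_mult degree_bounded_1)

lemma degree_bounded_sum: "(\<And>i. i \<in> I \<Longrightarrow> degree_bounded (f i)) \<Longrightarrow> degree_bounded (sum f I)"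
  by (induction I rule: infinite_finite_induct) (auto intro: degree_bounded_add degree_bounded_0)

lemma degree_bounded_power: "degree_bounded f \<Longrightarrow> degree_bounded (f ^ k)"
  by (induction k) (auto intro: degree_bounded_mult degree_bounded_1)

lemma Sym_iff: "f \<in> Sym \<longleftrightarrow> symm f \<and> degree_bounded f"
proof
  assume f: "f \<in> Sym"
  then have "symm f" unfolding symm_def Sym_def
    by (intro allI mfps_eqI) (simp add: mcoeff_perm_vars)
  then show "symm f \<and> degree_bounded f" using f by (simp add: Sym_def degree_bounded_def)
next
  assume f: "symm f \<and> degree_bounded f"
  have "mcoeff f (image_mset \<pi> m) = mcoeff f m" if "bij \<pi>" for \<pi> m
    using f by (intro symmD) (auto intro: inj_on_subset[OF bij_is_inj[OF that]])
  then show "f \<in> Sym" using f by (auto simp: Sym_def degree_bounded_def)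
qed

lemma Sym_add: "f \<in> Sym \<Longrightarrow> g \<in> Sym \<Longrightarrow> f + g \<in> Sym"
  and Sym_mult: "f \<in> Sym \<Longrightarrow> g \<in> Sym \<Longrightarrow> f * g \<in> Sym"
  and Sym_const: "mconst c \<in> Sym"
  by (auto simp: Sym_iff symm_add symm_mult symm_const degree_bounded_add degree_bounded_mult degree_bounded_const)

lemma Sym_0: "0 \<in> Sym"
  using Sym_const[of 0] by simp

lemma Sym_sum: "(\<And>i. i \<in> I \<Longrightarrow> f i \<in> Sym) \<Longrightarrow> sum f I \<in> Sym"
  by (induction I rule: infinite_finite_induct) (auto intro: Sym_add Sym_0)

lemma Sym_imp_Sym_hat: "f \<in> Sym \<Longrightarrow> f \<in> Sym_hat"
  unfolding Sym_iff Sym_hat_iff degree_bounded_def levelwise_bounded_def by blast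

lemma schur_fun_Sym: "schur_fun \<kappa> \<in> Sym"
  unfolding Sym_iff degree_bounded_def using symm_schur_fun schur_fun_hom by (auto intro!: exI[of _ "part_size \<kappa>"])

lemma schur_coeff_add:
  "f \<in> Sym_hat \<Longrightarrow> g \<in> Sym_hat \<Longrightarrow> schur_coeff (f + g) \<kappa> = schur_coeff f \<kappa> + schur_coeff g \<kappa>"
  by (simp add: schur_coeff_eq[OF _ order_refl] Sym_hat_add vd_coeff_add)

lemma schur_coeff_const:
  "f \<in> Sym_hat \<Longrightarrow> schur_coeff (mconst c * f) \<kappa> = c * schur_coeff f \<kappa>"
  by (simp add: schur_coeff_eq[OF _ order_refl] Sym_hat_mult Sym_hat_const vd_coeff_const)

lemma schur_coeff_schur: "schur_coeff (schur_fun \<rho>) \<kappa> = (if \<rho> = \<kappa> then 1 else 0)"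
  by (simp add: schur_coeff_eq[OF Sym_imp_Sym_hat[OF schur_fun_Sym] order_refl] vd_coeff_schur)

lemma Sym_finite_coeffs:
  assumes "h \<in> Sym"
  shows "finite {\<kappa>. schur_coeff h \<kappa> \<noteq> 0}"
proof -
  from assms obtain d where d: "\<And>m. mcoeff h m \<noteq> 0 \<Longrightarrow> size m \<le> d" unfolding Sym_iff degree_bounded_def by blast
  have "part_size \<kappa> \<le> d" if "schur_coeff h \<kappa> \<noteq> 0" for \<kappa>
  proof -
    have "vd_coeff (part_length \<kappa>) \<kappa> h \<noteq> 0"
      using that schur_coeff_eq[OF Sym_imp_Sym_hat[OF assms] order_refl] by simp
    then obtain a where "mcoeff h a \<noteq> 0" "size a = part_size \<kappa>" by (rule vd_coeff_nz) simp
    then show ?thesis using d by metis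
  qed
  then show ?thesis by (intro finite_subset[OF _ finite_part_size_le[of d]]) auto
qed

lemma hall_eq:
  assumes "finite K" "\<And>\<kappa>. schur_coeff h \<kappa> \<noteq> 0 \<Longrightarrow> \<kappa> \<in> K"
  shows "hall F h = (\<Sum>\<kappa>\<in>K. schur_coeff F \<kappa> * schur_coeff h \<kappa>)"
  unfolding hall_def by (rule sum.mono_neutral_left) (use assms in auto)

lemma hall_add:
  assumes "h \<in> Sym" "h' \<in> Sym"
  shows "hall F (h + h') = hall F h + hall F h'"
proof -
  let ?K = "{\<kappa>. schur_coeff h \<kappa> \<noteq> 0} \<union> {\<kappa>. schur_coeff h' \<kappa> \<noteq> 0}"
  have fin: "finite ?K" using assms Sym_finite_coeffs by simp
  note add = schur_coeff_add[OF Sym_imp_Sym_hat[OF assms(1)] Sym_imp_Sym_hat[OF assms(2)]]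
  have "hall F (h + h') = (\<Sum>\<kappa>\<in>?K. schur_coeff F \<kappa> * schur_coeff (h + h') \<kappa>)"
    by (rule hall_eq[OF fin]) (auto simp: add)
  also have "\<dots> = (\<Sum>\<kappa>\<in>?K. schur_coeff F \<kappa> * schur_coeff h \<kappa>) + (\<Sum>\<kappa>\<in>?K. schur_coeff F \<kappa> * schur_coeff h' \<kappa>)"
    by (simp add: add distrib_left sum.distrib)
  also have "(\<Sum>\<kappa>\<in>?K. schur_coeff F \<kappa> * schur_coeff h \<kappa>) = hall F h" by (rule hall_eq[OF fin, symmetric]) auto
  also have "(\<Sum>\<kappa>\<in>?K. schur_coeff F \<kappa> * schur_coeff h' \<kappa>) = hall F h'" by (rule hall_eq[OF fin, symmetric]) auto
  finally show ?thesis .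
qed

lemma hall_const:
  assumes "h \<in> Sym"
  shows "hall F (mconst c * h) = c * hall F h"
proof -
  have fin: "finite {\<kappa>. schur_coeff h \<kappa> \<noteq> 0}" using assms by (rule Sym_finite_coeffs)
  have "hall F (mconst c * h) = (\<Sum>\<kappa>\<in>{\<kappa>. schur_coeff h \<kappa> \<noteq> 0}. schur_coeff F \<kappa> * schur_coeff (mconst c * h) \<kappa>)"
    by (rule hall_eq[OF fin]) (auto simp: schur_coeff_const Sym_imp_Sym_hat[OF assms])
  then show ?thesis
    by (simp add: hall_def schur_coeff_const Sym_imp_Sym_hat[OF assms] sum_distrib_left mult.left_commute)
qed

lemma hall_0: "hall F 0 = 0"
  using hall_const[OF Sym_0, of F 0] by simp

lemma hall_sum:
  assumes "\<And>i. i \<in> I \<Longrightarrow> h i \<in> Sym"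
  shows "hall F (\<Sum>i\<in>I. mconst (c i) * h i) = (\<Sum>i\<in>I. c i * hall F (h i))"
  using assms
proof (induction I rule: infinite_finite_induct)
  case (insert i I)
  have "(\<Sum>i\<in>I. mconst (c i) * h i) \<in> Sym" using insert by (intro Sym_sum Sym_mult Sym_const) auto
  moreover have "mconst (c i) * h i \<in> Sym" using insert by (intro Sym_mult Sym_const) auto
  ultimately show ?case using insert by (simp add: hall_add hall_const)
qed (simp_all add: hall_0)

lemma expansion_coeff:
  "F \<in> Sym_hat \<Longrightarrow> mcoeff F m = (\<Sum>\<kappa> | part_size \<kappa> = size m. schur_coeff F \<kappa> * mcoeff (schur_fun \<kappa>) m)"
  using schur_expansion_schur_coeff by (simp add: schur_expansion_def)

section \<open>Complete homogeneous functions\<close>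

definition hfun :: "nat \<Rightarrow> ratfun mfps" where
  "hfun k = Abs_mfps (\<lambda>m. if size m = k then 1 else 0)"

text \<open>Indexed by a monomial instead of by the partition of its exponents, so that pairing with
  it reads the coefficient of this very monomial.\<close>

definition hfun_mset :: "nat multiset \<Rightarrow> ratfun mfps" where
  "hfun_mset m = (\<Prod>i\<in>set_mset m. hfun (count m i))"

lemma mcoeff_hfun: "mcoeff (hfun k) m = (if size m = k then 1 else 0)"
  by (simp add: hfun_def)

lemma hfun_0: "hfun 0 = 1"
  by (rule mfps_eqI) (simp add: mcoeff_hfun mcoeff_one)

lemma hfun_Sym: "hfun k \<in> Sym"
  unfolding Sym_iff symm_def degree_bounded_def
  by (intro conjI allI mfps_eqI exI[of _ k]) (auto simp: mcoeff_perm_vars mcoeff_hfun)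

lemma hfun_mset_superset: "finite A \<Longrightarrow> set_mset m \<subseteq> A \<Longrightarrow> hfun_mset m = (\<Prod>i\<in>A. hfun (count m i))"
  unfolding hfun_mset_def by (rule prod.mono_neutral_left) (auto simp: not_in_iff hfun_0)

lemma Sym_prod: "(\<And>i. i \<in> I \<Longrightarrow> f i \<in> Sym) \<Longrightarrow> prod f I \<in> Sym"
  by (induction I rule: infinite_finite_induct) (auto intro: Sym_mult Sym_const[of 1, simplified])

lemma hfun_mset_Sym: "hfun_mset m \<in> Sym"
  unfolding hfun_mset_def by (rule Sym_prod) (rule hfun_Sym)

lemma hfun_mset_add_disjoint:
  assumes "set_mset a \<inter> set_mset b = {}"
  shows "hfun_mset (a + b) = hfun_mset a * hfun_mset b"
proof -
  have "hfun_mset (a + b) = (\<Prod>i\<in>set_mset a. hfun (count (a + b) i)) * (\<Prod>i\<in>set_mset b. hfun (count (a + b) i))"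
    unfolding hfun_mset_def set_mset_union using assms by (intro prod.union_disjoint) auto
  also have "(\<Prod>i\<in>set_mset a. hfun (count (a + b) i)) = hfun_mset a"
    unfolding hfun_mset_def by (rule prod.cong) (use assms in \<open>auto simp: disjoint_iff not_in_iff\<close>)
  also have "(\<Prod>i\<in>set_mset b. hfun (count (a + b) i)) = hfun_mset b"
    unfolding hfun_mset_def
  proof (rule prod.cong[OF refl])
    fix i assume "i \<in># b"
    then have "i \<notin># a" using assms by blast
    then show "hfun (count (a + b) i) = hfun (count b i)" by (simp add: not_in_iff)
  qed
  finally show ?thesis .
qed

text \<open>The Pieri rule, in the form adjoint to multiplication: the sign-reversing involution
  exchanges the exponents \<open>i\<close> and \<open>i + 1\<close> at the first place \<open>i\<close> where interlacing fails.\<close>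

lemma pieri:
  assumes l: "part_length \<kappa> \<le> n" and F: "symm F"
  shows "vd_coeff n \<kappa> (hfun k * F) =
    (\<Sum>\<theta> | part_le \<theta> \<kappa> \<and> hstrip \<kappa> \<theta> \<and> part_size \<kappa> - part_size \<theta> = k. vd_coeff n \<theta> F)"
proof -
  define D where "D = dmon n \<kappa>"
  define P where "P = F * Vd id n"
  define A where "A = {a. a \<subseteq># D \<and> size (D - a) = k}"
  \<comment> \<open>For a dominant monomial a this is the failure of the horizontal strip condition
    in rows i and i + 1; the shift by \<delta> turns \<open><\<close> into
    \<open>\<le>\<close>.\<close>
  define bad where "bad a i \<longleftrightarrow> Suc i < n \<and> count a i \<le> count D (Suc i)" for a i
  define i0 where "i0 a = (LEAST i. bad a i)" for a
  define \<phi> where "\<phi> a = image_mset (transpose (i0 a) (Suc (i0 a))) a" for a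
  have finA: "finite A" unfolding A_def by (rule finite_subset[OF _ finite_submultisets[of D]]) auto
  have Ddec: "count D (Suc i) < count D i" if "Suc i < n" for i
    using that part_antimono[of i "Suc i" \<kappa>] by (simp add: D_def count_dmon)
  have P: "mcoeff P (image_mset (transpose i (Suc i)) a) = - mcoeff P a" if "Suc i < n" for i a
  proof -
    have "perm_vars (transpose i (Suc i)) P = - P"
      using F alternating_Vd[where 'a = ratfun, of n] that unfolding P_def symm_def alternating_def
      by (simp add: perm_vars_mult)
    then show ?thesis by (metis mcoeff_perm_vars mcoeff_uminus)
  qed
  have "vd_coeff n \<kappa> (hfun k * F) = (\<Sum>a\<in>{a. a \<subseteq># D}. mcoeff P a * mcoeff (hfun k) (D - a))"
    by (simp add: vd_coeff_def D_def P_def mcoeff_mult[symmetric] ac_simps)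
  also have "\<dots> = (\<Sum>a\<in>A. mcoeff P a)"
    unfolding A_def mcoeff_hfun
    by (rule sum.mono_neutral_cong_right) (auto simp: finite_submultisets)
  also have "\<dots> = (\<Sum>a\<in>{a\<in>A. \<exists>i. bad a i}. mcoeff P a) + (\<Sum>a\<in>{a\<in>A. \<not> (\<exists>i. bad a i)}. mcoeff P a)"
    by (subst sum.union_disjoint[symmetric]) (use finA in \<open>auto intro!: sum.cong\<close>)
  also have "(\<Sum>a\<in>{a\<in>A. \<exists>i. bad a i}. mcoeff P a) = 0"
  proof -
    let ?B = "{a\<in>A. \<exists>i. bad a i}"
    have phi: "\<phi> a \<in> ?B" "\<phi> (\<phi> a) = a" "mcoeff P (\<phi> a) = - mcoeff P a" if a: "a \<in> ?B" for a
    proof -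
      have b: "bad a (i0 a)" using a unfolding i0_def by (auto intro: LeastI)
      then have i: "Suc (i0 a) < n" "count a (i0 a) \<le> count D (Suc (i0 a))" by (auto simp: bad_def)
      have aD: "a \<subseteq># D" using a by (simp add: A_def)
      have c: "count (\<phi> a) j = count a (transpose (i0 a) (Suc (i0 a)) j)" for j
        by (simp add: \<phi>_def count_image_transpose)
      have le: "count a j \<le> count D j" for j using aD by (rule mset_subset_eq_count)
      \<comment> \<open>The exponent moved to the earlier place is below the one of D there because
        D decreases; the exponent moved to the later place fits because of badness.\<close>
      have "count (\<phi> a) j \<le> count D j" for j
        using le[of j] le[of "Suc (i0 a)"] i(2) Ddec[OF i(1)] unfolding c
        by (cases "j = i0 a"; cases "j = Suc (i0 a)") auto
      then have "\<phi> a \<subseteq># D" by (rule mset_subset_eqI)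
      moreover have "size (\<phi> a) = size a" by (simp add: \<phi>_def)
      ultimately have pA: "\<phi> a \<in> A" using a by (auto simp: A_def size_Diff_submset)
      have b': "bad (\<phi> a) (i0 a)" using i(1) le[of "Suc (i0 a)"] by (simp add: bad_def c)
      \<comment> \<open>Badness at j depends only on the j-th exponent of a, which the exchange
        leaves alone for j before \<open>i0 a\<close>.\<close>
      have "i0 (\<phi> a) = i0 a"
        unfolding i0_def[of "\<phi> a"]
      proof (rule Least_equality[where P = "bad (\<phi> a)"], rule b')
        fix j assume "bad (\<phi> a) j"
        show "i0 a \<le> j"
        proof (rule ccontr)
          assume "\<not> i0 a \<le> j"
          then have "j < i0 a" by simp
          then have "bad a j" using \<open>bad (\<phi> a) j\<close> by (simp add: bad_def c)
          then show False using \<open>j < i0 a\<close> not_less_Least[of j "bad a"] unfolding i0_def by blast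
        qed
      qed
      then show "\<phi> (\<phi> a) = a"
        unfolding \<phi>_def[of "\<phi> a"] by (simp add: \<phi>_def multiset.map_comp o_def)
      show "\<phi> a \<in> ?B" using pA b' by blast
      show "mcoeff P (\<phi> a) = - mcoeff P a" unfolding \<phi>_def by (rule P[OF i(1)])
    qed
    have "(\<Sum>a\<in>?B. mcoeff P a) = (\<Sum>a\<in>?B. - mcoeff P a)"
      by (rule sum.reindex_bij_witness[of _ \<phi> \<phi>]) (use phi in auto)
    then have "(\<Sum>a\<in>?B. mcoeff P a) + (\<Sum>a\<in>?B. mcoeff P a) = 0" by (simp add: sum_negf)
    then show ?thesis by (rule double_eq_zero_ratfun)
  qed
  also have "0 + (\<Sum>a\<in>{a\<in>A. \<not> (\<exists>i. bad a i)}. mcoeff P a) =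
     (\<Sum>\<theta> | part_le \<theta> \<kappa> \<and> hstrip \<kappa> \<theta> \<and> part_size \<kappa> - part_size \<theta> = k. vd_coeff n \<theta> F)"
  proof -
    let ?G = "{a\<in>A. \<not> (\<exists>i. bad a i)}"
    let ?T = "{\<theta>. part_le \<theta> \<kappa> \<and> hstrip \<kappa> \<theta> \<and> part_size \<kappa> - part_size \<theta> = k}"
    have lT: "part_length \<theta> \<le> n" if "part_le \<theta> \<kappa>" for \<theta>
    proof (rule ccontr)
      assume "\<not> part_length \<theta> \<le> n"
      then have "0 < part \<theta> n" by (simp add: part_pos_iff)
      also have "\<dots> \<le> part \<kappa> n" using that by (simp add: part_le_def)
      finally show False using l by (simp add: part_pos_iff)
    qed
    have dm: "dmon n \<theta> \<in> ?G \<longleftrightarrow> \<theta> \<in> ?T" if t: "part_length \<theta> \<le> n" for \<theta>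
    proof -
      have "dmon n \<theta> \<subseteq># D \<longleftrightarrow> part_le \<theta> \<kappa>"
      proof
        assume s: "dmon n \<theta> \<subseteq># D"
        show "part_le \<theta> \<kappa>" unfolding part_le_def
        proof
          fix i
          show "part \<theta> i \<le> part \<kappa> i"
            using mset_subset_eq_count[OF s, of i] t
            by (cases "i < n") (simp_all add: D_def count_dmon part_eq_0)
        qed
      next
        assume le: "part_le \<theta> \<kappa>"
        show "dmon n \<theta> \<subseteq># D"
        proof (rule mset_subset_eqI)
          fix i
          show "count (dmon n \<theta>) i \<le> count D i"
            using le[unfolded part_le_def, rule_format, of i] by (simp add: D_def dmon_def diff_le_mono)
        qed
      qed
      moreover have "size (D - dmon n \<theta>) = part_size \<kappa> - part_size \<theta>" if "dmon n \<theta> \<subseteq># D"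
        using that size_dmon[OF t] size_dmon[OF l] by (simp add: size_Diff_submset D_def)
      moreover have "(\<exists>i. bad (dmon n \<theta>) i) \<longleftrightarrow> \<not> hstrip \<kappa> \<theta>"
      proof -
        have "bad (dmon n \<theta>) i \<longleftrightarrow> Suc i < n \<and> part \<theta> i < part \<kappa> (Suc i)" for i
          unfolding bad_def D_def by (auto simp: count_dmon)
        moreover have "part \<kappa> (Suc i) = 0" if "\<not> Suc i < n" for i using that l by (simp add: part_eq_0)
        ultimately show ?thesis unfolding hstrip_def by (metis not_le not_less_zero)
      qed
      ultimately show ?thesis by (auto simp: A_def)
    qed
    have "?G = dmon n ` ?T"
    proof (intro equalityI subsetI)
      fix a assume a: "a \<in> ?G"
      have aD: "count a i \<le> count D i" for i using a by (auto simp: A_def mset_subset_eq_count)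
      have "count a (Suc i) < count a i" if "Suc i < n" for i
        using a aD[of "Suc i"] that by (auto simp: bad_def not_le)
      moreover have "set_mset a \<subseteq> {..<n}"
        using a set_mset_dmon[of n \<kappa>] set_mset_mono[of a D] by (auto simp: A_def D_def)
      ultimately obtain \<theta> where t: "part_length \<theta> \<le> n" "a = dmon n \<theta>"
        using strict_counts_imp_dmon by blast
      then have "\<theta> \<in> ?T" using dm[OF t(1)] a by blast
      then show "a \<in> dmon n ` ?T" using t(2) by blast
    next
      fix a assume "a \<in> dmon n ` ?T"
      then obtain \<theta> where t: "\<theta> \<in> ?T" "a = dmon n \<theta>" by blast
      then have "part_length \<theta> \<le> n" using lT by blast
      then show "a \<in> ?G" using dm t by blast
    qed
    moreover have "inj_on (dmon n) ?T"
      by (rule inj_onI) (use dmon_inj lT in blast)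
    ultimately have "(\<Sum>a\<in>?G. mcoeff P a) = (\<Sum>\<theta>\<in>?T. mcoeff P (dmon n \<theta>))"
      by (simp only: sum.reindex o_def)
    then show ?thesis by (simp add: vd_coeff_def P_def)
  qed
  finally show ?thesis .
qed

lemma vd_coeff_one: "part_length \<kappa> \<le> n \<Longrightarrow> vd_coeff n \<kappa> 1 = (if \<kappa> = empty_part then 1 else 0)"
proof -
  have "restr {..<n} (schur_fun empty_part) = 1"
    using restr_schur_mult_Vd[of empty_part n] vandermonde[of n]
      Vd_cancel[of id n "restr {..<n} (schur_fun empty_part) - 1"]
    by (simp add: algebra_simps del: part_empty_part)
  then have "vd_coeff n \<kappa> 1 = vd_coeff n \<kappa> (schur_fun empty_part)"
    using vd_coeff_restr[of n \<kappa> 1] vd_coeff_restr[of n \<kappa> "schur_fun empty_part"] by simp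
  then show "part_length \<kappa> \<le> n \<Longrightarrow> ?thesis" by (simp add: vd_coeff_schur eq_commute)
qed

lemma mcoeff_mult_mmon:
  "mcoeff (f * mmon a) m = (if a \<subseteq># m then mcoeff f (m - a) else 0)"
  by (subst mult.commute) (rule mcoeff_mmon_mult)

lemma supp_spoly: "supp A (spoly lt A \<kappa> \<rho>)"
proof -
  have "set_mset (cont \<kappa> \<rho> T) \<subseteq> A" if "T \<in> ssyt lt A \<kappa> \<rho>" for T
    using ssyt_entry[OF that] by (auto simp: set_mset_cont)
  then show ?thesis unfolding supp_iff_restr spoly_def restr_sum by (intro sum.cong refl) (simp add: restr_mmon)
qed

text \<open>Both sides are Kostka numbers. Removing the last complete homogeneous factor by the
  Pieri rule removes a horizontal strip, and this strip is filled with the largest letter.\<close>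

lemma vd_coeff_prod_hfun:
  assumes "set_mset m \<subseteq> {..<N}" "part_length \<kappa> \<le> n"
  shows "vd_coeff n \<kappa> (\<Prod>i<N. hfun (count m i)) = mcoeff (spoly (<) {..<N} \<kappa> empty_part) m"
  using assms
proof (induction N arbitrary: m \<kappa>)
  case 0
  then show ?case by (simp add: vd_coeff_one spoly_empty mcoeff_one)
next
  case (Suc N)
  define k where "k = count m N"
  define m' where "m' = m - replicate_mset k N"
  define T where "T = {\<theta>. part_le \<theta> \<kappa> \<and> hstrip \<kappa> \<theta> \<and> part_size \<kappa> - part_size \<theta> = k}"
  have cm': "count m' i = (if i = N then 0 else count m i)" for i by (simp add: m'_def k_def)
  have sm': "set_mset m' \<subseteq> {..<N}"
  proof
    fix i assume "i \<in># m'"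
    then have "count m' i \<noteq> 0" by (simp add: not_in_iff[symmetric])
    then have "i \<noteq> N" "i \<in># m" by (auto simp: cm' not_in_iff split: if_splits)
    then show "i \<in> {..<N}" using Suc.prems(1) by fastforce
  qed
  have lT: "part_length \<theta> \<le> n" if "part_le \<theta> \<kappa>" for \<theta>
  proof (rule ccontr)
    assume "\<not> part_length \<theta> \<le> n"
    then have "0 < part \<theta> n" by (simp add: part_pos_iff)
    also have "\<dots> \<le> part \<kappa> n" using that by (simp add: part_le_def)
    finally show False using Suc.prems(2) by (simp add: part_pos_iff)
  qed
  have "(\<Prod>i<Suc N. hfun (count m i)) = hfun k * (\<Prod>i<N. hfun (count m' i))"
    by (simp add: k_def cm' mult.commute)
  then have "vd_coeff n \<kappa> (\<Prod>i<Suc N. hfun (count m i)) = (\<Sum>\<theta>\<in>T. vd_coeff n \<theta> (\<Prod>i<N. hfun (count m' i)))"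
    using pieri[OF Suc.prems(2), of "\<Prod>i<N. hfun (count m' i)" k] Sym_prod[of "{..<N}" "\<lambda>i. hfun (count m' i)"] hfun_Sym
    by (simp add: T_def Sym_iff)
  also have "\<dots> = (\<Sum>\<theta>\<in>T. mcoeff (spoly (<) {..<N} \<theta> empty_part) m')"
    by (rule sum.cong[OF refl], rule Suc.IH[OF sm']) (simp add: T_def lT)
  also have "\<dots> = (\<Sum>\<theta> | part_le \<theta> \<kappa>. mcoeff (sp (<) {..<N} \<theta> empty_part * sp (<) {N} \<kappa> \<theta>) m)"
  proof (rule sum.mono_neutral_cong_left)
    show "T \<subseteq> {\<theta>. part_le \<theta> \<kappa>}" by (auto simp: T_def)
    have c: "mcoeff (sp (<) {..<N} \<theta> empty_part * sp (<) {N} \<kappa> \<theta>) m =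
        (if hstrip \<kappa> \<theta> \<and> replicate_mset (part_size \<kappa> - part_size \<theta>) N \<subseteq># m
         then mcoeff (spoly (<) {..<N} \<theta> empty_part) (m - replicate_mset (part_size \<kappa> - part_size \<theta>) N)
         else (0 :: ratfun))" if "part_le \<theta> \<kappa>" for \<theta>
      using that by (simp add: sp_single sp_def[of _ _ _ empty_part] mcoeff_mult_mmon)
    have rep: "replicate_mset j N \<subseteq># m \<longleftrightarrow> j \<le> k" for j
      by (simp add: k_def count_le_replicate_mset_subset_eq)
    show "\<forall>\<theta>\<in>{\<theta>. part_le \<theta> \<kappa>} - T. mcoeff (sp (<) {..<N} \<theta> empty_part * sp (<) {N} \<kappa> \<theta>) m = (0 :: ratfun)"
    proof
      fix \<theta> assume t: "\<theta> \<in> {\<theta>. part_le \<theta> \<kappa>} - T"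
      let ?j = "part_size \<kappa> - part_size \<theta>"
      show "mcoeff (sp (<) {..<N} \<theta> empty_part * sp (<) {N} \<kappa> \<theta>) m = (0 :: ratfun)"
      proof (cases "hstrip \<kappa> \<theta> \<and> ?j \<le> k")
        case True
        then have "?j < k" using t by (auto simp: T_def)
        then have "N \<in># m - replicate_mset ?j N" by (simp add: k_def in_diff_count)
        then have "mcoeff (spoly (<) {..<N} \<theta> empty_part :: ratfun mfps) (m - replicate_mset ?j N) = 0"
          using supp_spoly[of "{..<N}" "(<)" \<theta> empty_part] unfolding supp_def by blast
        then show ?thesis using c t by simp
      next
        case False
        then show ?thesis using c t by (auto simp: rep)
      qed
    qed
    fix \<theta> assume "\<theta> \<in> T"
    then show "mcoeff (spoly (<) {..<N} \<theta> empty_part) m' =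
        (mcoeff (sp (<) {..<N} \<theta> empty_part * sp (<) {N} \<kappa> \<theta>) m :: ratfun)"
      using c by (simp add: T_def rep m'_def)
  qed (rule finite_part_le)
  also have "\<dots> = mcoeff (spoly (<) {..<Suc N} \<kappa> empty_part) m"
  proof -
    have A: "{..<Suc N} = {..<N} \<union> {N}" by auto
    have "spoly (<) {..<Suc N} \<kappa> empty_part = (sp (<) ({..<N} \<union> {N}) \<kappa> empty_part :: ratfun mfps)"
      by (simp add: sp_def A)
    also have "\<dots> = (\<Sum>\<theta> | part_le \<theta> \<kappa>. sp (<) {..<N} \<theta> empty_part * sp (<) {N} \<kappa> \<theta>)"
      by (rule sp_split) auto
    finally show ?thesis by simp
  qed
  finally show ?case .
qed

lemma schur_coeff_hfun_mset: "schur_coeff (hfun_mset m) \<kappa> = mcoeff (schur_fun \<kappa>) m"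
proof -
  obtain N where N: "set_mset m \<subseteq> {..<N}"
    using finite_nat_set_iff_bounded[of "set_mset m"] by auto
  have h: "hfun_mset m = (\<Prod>i<N. hfun (count m i))" by (rule hfun_mset_superset) (use N in auto)
  have "schur_coeff (hfun_mset m) \<kappa> = vd_coeff (part_length \<kappa>) \<kappa> (hfun_mset m)"
    by (rule schur_coeff_eq[OF Sym_imp_Sym_hat[OF hfun_mset_Sym] order_refl])
  also have "\<dots> = mcoeff (spoly (<) {..<N} \<kappa> empty_part) m"
    unfolding h by (rule vd_coeff_prod_hfun[OF N order_refl])
  also have "\<dots> = mcoeff (restr {..<N} (schur_fun \<kappa>)) m" by (simp add: restr_schur_fun)
  finally show ?thesis using N by (simp add: mcoeff_restr)
qed

text \<open>Complete homogeneous functions are dual to monomials. This is the bridge from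
  coefficient extraction to Hall products.\<close>

lemma hall_hfun_mset:
  assumes "F \<in> Sym_hat"
  shows "hall F (hfun_mset m) = mcoeff F m"
proof -
  have "hall F (hfun_mset m) = (\<Sum>\<kappa> | part_size \<kappa> = size m. schur_coeff F \<kappa> * schur_coeff (hfun_mset m) \<kappa>)"
    by (rule hall_eq[OF finite_part_size]) (use schur_fun_hom[of _ m] in \<open>auto simp: schur_coeff_hfun_mset\<close>)
  then show ?thesis by (simp add: schur_coeff_hfun_mset expansion_coeff[OF assms, of m])
qed

lemma Sym_eq_schur_sum:
  assumes "h \<in> Sym" "finite K" "\<And>\<kappa>. schur_coeff h \<kappa> \<noteq> 0 \<Longrightarrow> \<kappa> \<in> K"
  shows "h = (\<Sum>\<kappa>\<in>K. mconst (schur_coeff h \<kappa>) * schur_fun \<kappa>)"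
proof (rule mfps_eqI)
  fix m
  have "mcoeff h m = (\<Sum>\<kappa> | part_size \<kappa> = size m. schur_coeff h \<kappa> * mcoeff (schur_fun \<kappa>) m)"
    by (rule expansion_coeff[OF Sym_imp_Sym_hat[OF assms(1)]])
  also have "\<dots> = (\<Sum>\<kappa>\<in>{\<kappa>. part_size \<kappa> = size m} \<union> K. schur_coeff h \<kappa> * mcoeff (schur_fun \<kappa>) m)"
    by (rule sum.mono_neutral_left) (use assms(2) finite_part_size schur_fun_hom[of _ m] in auto)
  also have "\<dots> = (\<Sum>\<kappa>\<in>K. schur_coeff h \<kappa> * mcoeff (schur_fun \<kappa>) m)"
    by (rule sum.mono_neutral_right) (use assms finite_part_size in auto)
  finally show "mcoeff h m = mcoeff (\<Sum>\<kappa>\<in>K. mconst (schur_coeff h \<kappa>) * schur_fun \<kappa>) m" by simp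
qed

section \<open>Grothendieck polynomials\<close>

text \<open>Here each variable has its own factor, in contrast to the antisymmetrized form; this
  suits arguments about one variable at a time.\<close>

lemma Alt_leibniz:
  "Alt bt n \<alpha> = (\<Sum>p | p permutes {..<n}. of_int (sign p) *
     (\<Prod>i<n. mvar i ^ (\<alpha> (p i) + (n - 1 - p i)) * (1 + mconst bt * mvar i) ^ p i))"
proof -
  let ?e = "\<lambda>i j. mvar i ^ (\<alpha> j + (n - 1 - j)) * (1 + mconst bt * mvar i) ^ j :: ratfun mfps"
  have "Alt bt n \<alpha> = (\<Sum>p | p permutes {0..<n}. of_int (sign p) *
      (\<Prod>i = 0..<n. mat n n (\<lambda>(i, j). ?e i j) $$ (i, p i)))"
    unfolding Alt_def by (rule det_def') simp
  also have "\<dots> = (\<Sum>p | p permutes {..<n}. of_int (sign p) * (\<Prod>i<n. ?e i (p i)))"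
    unfolding atLeast0LessThan
  proof (rule sum.cong[OF refl])
    fix p assume "p \<in> {p. p permutes {..<n}}"
    then have "p i < n" if "i < n" for i using permutes_in_image[of p "{..<n}" i] that by simp
    then have "(\<Prod>i<n. mat n n (\<lambda>(i, j). ?e i j) $$ (i, p i)) = (\<Prod>i<n. ?e i (p i))"
      by (intro prod.cong) simp_all
    then show "of_int (sign p) * (\<Prod>i<n. mat n n (\<lambda>(i, j). ?e i j) $$ (i, p i)) =
        of_int (sign p) * (\<Prod>i<n. ?e i (p i))" by simp
  qed
  finally show ?thesis .
qed

lemma permutes_Suc_fixed: "{p. p permutes {..<Suc n} \<and> p n = n} = {p. p permutes {..<n}}"
proof (intro equalityI subsetI)
  fix p assume "p \<in> {p. p permutes {..<Suc n} \<and> p n = n}"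
  then have p: "p permutes {..<Suc n}" "p n = n" by simp_all
  have "p permutes {..<n}"
  proof (rule permutes_superset[OF p(1)])
    fix x assume "x \<in> {..<Suc n} - {..<n}"
    then have "x = n" by auto
    then show "p x = x" using p(2) by simp
  qed
  then show "p \<in> {p. p permutes {..<n}}" by simp
next
  fix p assume p: "p \<in> {p. p permutes {..<n}}"
  then have "p permutes {..<Suc n}" using permutes_subset[of p "{..<n}" "{..<Suc n}"] by auto
  moreover have "p n = n" using p permutes_not_in[of p "{..<n}" n] by simp
  ultimately show "p \<in> {p. p permutes {..<Suc n} \<and> p n = n}" by simp
qed

text \<open>In the row of the vanishing variable only the last column survives, with entry 1, since
  every other exponent is positive. The remaining rows lose one power of their variable
  each.\<close>

lemma restr_Alt_Suc:
  assumes l: "part_length lam \<le> n"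
  shows "restr {..<n} (Alt bt (Suc n) (part lam)) = Alt bt n (part lam) * mmon (vmon id n (\<lambda>_. 1))"
proof -
  let ?e = "\<lambda>n i j. mvar i ^ (part lam j + (n - 1 - j)) * (1 + mconst bt * mvar i) ^ j :: ratfun mfps"
  have int: "restr A (of_int c) = (of_int c :: ratfun mfps)" for A c
    by (induction c rule: int_induct[where k = 0]) (simp_all add: restr_add restr_diff)
  have "restr {..<n} (Alt bt (Suc n) (part lam)) = (\<Sum>p | p permutes {..<Suc n}. of_int (sign p) *
      ((\<Prod>i<n. ?e (Suc n) i (p i)) * (if p n = n then 1 else 0)))"
    unfolding Alt_leibniz restr_sum
  proof (rule sum.cong[OF refl])
    fix p assume "p \<in> {p. p permutes {..<Suc n}}"
    then have "p n \<le> n" using permutes_in_image[of p "{..<Suc n}" n] by simp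
    then have "restr {..<n} (?e (Suc n) n (p n)) = (if p n = n then 1 else 0)"
      using l by (auto simp: restr_mult restr_power restr_mvar restr_add part_eq_0 power_0_left)
    moreover have "restr {..<n} (?e (Suc n) i (p i)) = ?e (Suc n) i (p i)" if "i < n" for i
      using that by (simp add: restr_mult restr_power restr_mvar restr_add)
    ultimately show "restr {..<n} (of_int (sign p) * (\<Prod>i<Suc n. ?e (Suc n) i (p i))) =
        of_int (sign p) * ((\<Prod>i<n. ?e (Suc n) i (p i)) * (if p n = n then 1 else 0))"
      by (simp only: restr_mult restr_prod int prod.lessThan_Suc) (simp cong: prod.cong_simp)
  qed
  also have "\<dots> = (\<Sum>p\<in>{p. p permutes {..<Suc n} \<and> p n = n}. of_int (sign p) * (\<Prod>i<n. ?e (Suc n) i (p i)))"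
    by (rule sum.mono_neutral_cong_right) (auto simp: finite_permutations)
  also have "\<dots> = (\<Sum>p | p permutes {..<n}. of_int (sign p) * ((\<Prod>i<n. ?e n i (p i)) * (\<Prod>i<n. mvar i ^ 1)))"
    unfolding permutes_Suc_fixed prod.distrib[symmetric]
  proof (rule sum.cong[OF refl], rule arg_cong2[where f = "(*)"], rule refl, rule prod.cong[OF refl])
    fix p i assume "p \<in> {p. p permutes {..<n}}" "i \<in> {..<n}"
    then have "p i < n" using permutes_in_image[of p "{..<n}" i] by simp
    then have "part lam (p i) + (Suc n - 1 - p i) = part lam (p i) + (n - 1 - p i) + 1" by simp
    then show "?e (Suc n) i (p i) = ?e n i (p i) * mvar i ^ 1" by (simp only: power_add mult_ac)
  qed
  also have "\<dots> = Alt bt n (part lam) * (\<Prod>i<n. mvar i ^ 1)"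
    unfolding Alt_leibniz sum_distrib_right by (simp only: mult.assoc)
  also have "(\<Prod>i<n. mvar i ^ 1) = (mmon (vmon id n (\<lambda>_. 1)) :: ratfun mfps)"
    using prod_mvar_power[where 'a = ratfun, of id "\<lambda>_. 1" n] by simp
  finally show ?thesis .
qed

lemma degree_bounded_Alt: "degree_bounded (Alt bt n \<alpha>)"
proof -
  have int: "degree_bounded (of_int c * f)" if "degree_bounded f" for c and f :: "ratfun mfps"
    using that unfolding degree_bounded_def mcoeff_of_int_mult by (metis mult_zero_right)
  show ?thesis
    unfolding Alt_leibniz
    by (intro degree_bounded_sum int degree_bounded_prod degree_bounded_mult degree_bounded_power degree_bounded_add degree_bounded_1 degree_bounded_const)
      (simp_all add: mvar_eq_mmon degree_bounded_mmon)
qed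

definition Groth_coeff :: "partition \<Rightarrow> partition \<Rightarrow> ratfun" where
  "Groth_coeff lam \<kappa> = (let n = max (part_length lam) (part_length \<kappa>) in mcoeff (Alt beta n (part lam)) (dmon n \<kappa>))"

lemma Groth_coeff_eq:
  assumes "part_length lam \<le> n" "part_length \<kappa> \<le> n"
  shows "Groth_coeff lam \<kappa> = mcoeff (Alt beta n (part lam)) (dmon n \<kappa>)"
proof -
  have "mcoeff (Alt beta n (part lam)) (dmon n \<kappa>) = Groth_coeff lam \<kappa>"
    if "max (part_length lam) (part_length \<kappa>) \<le> n" for n
    using that
  proof (induction n rule: dec_induct)
    case base
    then show ?case by (simp add: Groth_coeff_def Let_def)
  next
    case (step n)
    then have l: "part_length lam \<le> n" "part_length \<kappa> \<le> n" by simp_all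
    have s: "set_mset (dmon (Suc n) \<kappa>) \<subseteq> {..<n}"
      using set_mset_vmon[of id n "\<lambda>_. 1"] set_mset_dmon[of n \<kappa>] by (simp add: dmon_Suc[OF l(2)])
    have "mcoeff (Alt beta (Suc n) (part lam)) (dmon (Suc n) \<kappa>) =
        mcoeff (restr {..<n} (Alt beta (Suc n) (part lam))) (dmon (Suc n) \<kappa>)"
      using s by (simp add: mcoeff_restr)
    also have "\<dots> = mcoeff (Alt beta n (part lam)) (dmon n \<kappa>)"
      by (simp add: restr_Alt_Suc[OF l(1)] mcoeff_mult_mmon dmon_Suc[OF l(2)])
    finally show ?case using step by simp
  qed
  then show ?thesis using assms by simp
qed

lemma Groth_coeff_low: "part_size \<kappa> \<le> part_size lam \<Longrightarrow> Groth_coeff lam \<kappa> = (if lam = \<kappa> then 1 else 0)"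
  unfolding Groth_coeff_def Let_def by (rule mcoeff_Alt_dmon) auto

text \<open>The explicit candidate for the definite description \<open>Groth\<close>, assembled from
  its Schur coefficients.\<close>

definition Groth_series :: "partition \<Rightarrow> ratfun mfps" where
  "Groth_series lam = Abs_mfps (\<lambda>m. \<Sum>\<kappa> | part_size \<kappa> = size m. Groth_coeff lam \<kappa> * mcoeff (schur_fun \<kappa>) m)"

lemma schur_expansion_Groth_series: "schur_expansion (Groth_series lam) (Groth_coeff lam)"
  unfolding schur_expansion_def
proof (intro conjI allI)
  fix n
  define N where "N = max n (part_length lam)"
  from degree_bounded_Alt[of beta N "part lam"] obtain d where d: "\<And>m. mcoeff (Alt beta N (part lam)) m \<noteq> 0 \<Longrightarrow> size m \<le> d"
    unfolding degree_bounded_def by blast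
  have "part_size \<kappa> \<le> d" if "part_length \<kappa> \<le> n" "Groth_coeff lam \<kappa> \<noteq> 0" for \<kappa>
  proof -
    have l: "part_length \<kappa> \<le> N" using that by (simp add: N_def)
    have "mcoeff (Alt beta N (part lam)) (dmon N \<kappa>) \<noteq> 0"
      using that(2) Groth_coeff_eq[of lam N \<kappa>] l by (simp add: N_def)
    then show ?thesis using d[of "dmon N \<kappa>"] size_dmon[OF l] by simp
  qed
  then show "finite {\<kappa>. part_length \<kappa> \<le> n \<and> Groth_coeff lam \<kappa> \<noteq> 0}"
    by (intro finite_subset[OF _ finite_part_size_le[of d]]) auto
qed (simp add: Groth_series_def)

lemma Groth_series_Sym_hat: "Groth_series lam \<in> Sym_hat"
  unfolding Sym_hat_def using schur_expansion_Groth_series by blast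

lemma restr_Groth_series:
  assumes l: "part_length lam \<le> n"
  shows "restr {..<n} (Groth_series lam) * Vd id n = Alt beta n (part lam)"
proof (rule alternating_ext[of n])
  show "alternating n (restr {..<n} (Groth_series lam) * Vd id n)"
    using Groth_series_Sym_hat by (intro alternating_restr_symm) (simp add: Sym_hat_iff)
  show "supp {..<n} (restr {..<n} (Groth_series lam) * Vd id n)"
    by (intro supp_mult supp_restr supp_Vd) auto
  fix \<theta> assume t: "part_length \<theta> \<le> n"
  then show "mcoeff (restr {..<n} (Groth_series lam) * Vd id n) (dmon n \<theta>) = mcoeff (Alt beta n (part lam)) (dmon n \<theta>)"
    using schur_expansion_coeff[OF schur_expansion_Groth_series t] Groth_coeff_eq[OF l t] by (simp add: vd_coeff_restr)
qed (rule alternating_Alt supp_Alt)+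

lemma mfps_eq_by_restr:
  assumes "\<And>n. N \<le> n \<Longrightarrow> restr {..<n} f = restr {..<n} g"
  shows "f = g"
proof (rule mfps_eqI)
  fix m :: "nat multiset"
  obtain n where n: "set_mset m \<subseteq> {..<n}"
    using finite_nat_set_iff_bounded[of "set_mset m"] by auto
  have "mcoeff (restr {..<max n N} f) m = mcoeff (restr {..<max n N} g) m" using assms by simp
  moreover have "set_mset m \<subseteq> {..<max n N}" using n by auto
  ultimately show "mcoeff f m = mcoeff g m" by (simp add: mcoeff_restr)
qed

lemma Groth_eq_Groth_series: "Groth lam = Groth_series lam"
  unfolding Groth_def restrict_vars_eq
proof (rule the_equality)
  have V: "(\<Prod>j<n. \<Prod>i<j. mvar i - mvar j) = (Vd id n :: ratfun mfps)" for n by (simp add: Vd_def)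
  show "Groth_series lam \<in> Sym_hat \<and> (\<forall>n\<ge>part_length lam. restr {..<n} (Groth_series lam) * (\<Prod>j<n. \<Prod>i<j. mvar i - mvar j) =
      det (mat n n (\<lambda>(i, j). mvar i ^ (part lam j + (n - 1 - j)) * (1 + mconst beta * mvar i) ^ j)))"
    unfolding V using Groth_series_Sym_hat restr_Groth_series by (simp add: Alt_def)
  fix f assume f: "f \<in> Sym_hat \<and> (\<forall>n\<ge>part_length lam. restr {..<n} f * (\<Prod>j<n. \<Prod>i<j. mvar i - mvar j) =
      det (mat n n (\<lambda>(i, j). mvar i ^ (part lam j + (n - 1 - j)) * (1 + mconst beta * mvar i) ^ j)))"
  show "f = Groth_series lam"
  proof (rule mfps_eq_by_restr[of "part_length lam"])
    fix n assume n: "part_length lam \<le> n"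
    have "restr {..<n} f * Vd id n = restr {..<n} (Groth_series lam) * Vd id n"
      using f n restr_Groth_series[OF n] unfolding V Alt_def by simp
    then have "Vd id n * (restr {..<n} f - restr {..<n} (Groth_series lam)) = 0" by (simp add: algebra_simps)
    then have "restr {..<n} f - restr {..<n} (Groth_series lam) = 0" by (rule Vd_cancel[rotated]) simp
    then show "restr {..<n} f = restr {..<n} (Groth_series lam)" by simp
  qed
qed

lemma Groth_Sym_hat: "Groth lam \<in> Sym_hat"
  by (simp add: Groth_eq_Groth_series Groth_series_Sym_hat)

lemma restr_Groth: "part_length lam \<le> n \<Longrightarrow> restr {..<n} (Groth lam) * Vd id n = Alt beta n (part lam)"
  by (simp add: Groth_eq_Groth_series restr_Groth_series)

lemma schur_coeff_Groth: "schur_coeff (Groth lam) \<kappa> = Groth_coeff lam \<kappa>"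
  using schur_expansion_coeff[OF schur_expansion_Groth_series order_refl, of lam \<kappa>]
  by (simp add: Groth_eq_Groth_series schur_coeff_eq[OF Groth_series_Sym_hat order_refl])

text \<open>In \<open>part_length lam\<close> variables every monomial of the determinant contains
  the last variable, while a dominant monomial of a shorter partition does not.\<close>

lemma Groth_coeff_length:
  assumes "part_length \<kappa> < part_length lam"
  shows "Groth_coeff lam \<kappa> = 0"
proof (rule ccontr)
  define n where "n = part_length lam"
  assume "Groth_coeff lam \<kappa> \<noteq> 0"
  then have "mcoeff (Alt beta n (part lam)) (dmon n \<kappa>) \<noteq> 0"
    using Groth_coeff_eq[of lam n \<kappa>] assms by (simp add: n_def)
  then obtain p where p: "p permutes {..<n}"
    and nz: "mcoeff (\<Prod>i<n. mvar i ^ (part lam (p i) + (n - 1 - p i)) * (1 + mconst beta * mvar i) ^ p i :: ratfun mfps) (dmon n \<kappa>) \<noteq> 0"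
    unfolding Alt_leibniz mcoeff_sum mcoeff_of_int_mult
    by (elim sum.not_neutral_contains_not_neutral) auto
  have pos: "0 < part lam (p i)" if "i < n" for i
    using permutes_in_image[OF p, of i] that part_pos_iff[of lam "p i"] by (simp add: n_def)
  have "(\<Prod>i<n. mvar i ^ (part lam (p i) + (n - 1 - p i)) * (1 + mconst beta * mvar i) ^ p i :: ratfun mfps) =
     mmon (vmon id n (\<lambda>i. part lam (p i) + (n - 1 - p i))) * (\<Prod>i<n. (1 + mconst beta * mvar i) ^ p i)"
    using prod_mvar_power[where 'a = ratfun, of id "\<lambda>i. part lam (p i) + (n - 1 - p i)" n]
    by (simp add: prod.distrib)
  then have "vmon id n (\<lambda>i. part lam (p i) + (n - 1 - p i)) \<subseteq># dmon n \<kappa>"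
    using nz by (auto simp: mcoeff_mmon_mult split: if_splits)
  then have "count (vmon id n (\<lambda>i. part lam (p i) + (n - 1 - p i))) (n - 1) \<le> count (dmon n \<kappa>) (n - 1)"
    by (rule mset_subset_eq_count)
  moreover have "0 < n" using assms by (simp add: n_def)
  moreover have "part \<kappa> (n - 1) = 0" using assms by (intro part_eq_0) (simp add: n_def)
  ultimately show False using pos[of "n - 1"] by (simp add: count_dmon)
qed

text \<open>The description of G is silent about so few variables, but partitions longer than the
  block of y variables have to be tested against the dual functional.\<close>

lemma restr_Groth_eq_0:
  assumes "n < part_length lam"
  shows "restr {..<n} (Groth lam) = 0"
proof (rule mfps_eqI)
  fix m
  have "mcoeff (Groth lam) m = 0" if m: "set_mset m \<subseteq> {..<n}"
    unfolding expansion_coeff[OF Groth_Sym_hat] schur_coeff_Groth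
  proof (rule sum.neutral, rule ballI)
    fix \<kappa>
    show "Groth_coeff lam \<kappa> * mcoeff (schur_fun \<kappa>) m = 0"
    proof (cases "part_length \<kappa> \<le> n")
      case True
      then show ?thesis using assms Groth_coeff_length by simp
    next
      case False
      then have "mcoeff (restr {..<n} (schur_fun \<kappa>)) m = 0" by (simp add: restr_schur_eq_0)
      then show ?thesis using m by (simp add: mcoeff_restr)
    qed
  qed
  then show "mcoeff (restr {..<n} (Groth lam)) m = mcoeff 0 m" by (simp add: mcoeff_restr)
qed

section \<open>Dual Grothendieck polynomials\<close>

text \<open>The geometric series 1/(1 + \<beta> x_i).\<close>

definition geo :: "nat \<Rightarrow> ratfun mfps" where
  "geo i = Abs_mfps (\<lambda>m. if set_mset m \<subseteq> {i} then (- beta) ^ size m else 0)"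

lemma mcoeff_geo: "mcoeff (geo i) m = (if set_mset m \<subseteq> {i} then (- beta) ^ size m else 0)"
  by (simp add: geo_def)

lemma geo_inverse: "(1 + mconst beta * mvar i) * geo i = 1"
proof (rule mfps_eqI)
  fix m
  have c: "mcoeff ((1 + mconst beta * mvar i) * geo i) m =
      mcoeff (geo i) m + beta * (if i \<in># m then mcoeff (geo i) (m - {#i#}) else 0)"
    by (simp add: distrib_right mult.assoc mcoeff_var_mult)
  show "mcoeff ((1 + mconst beta * mvar i) * geo i) m = mcoeff 1 m"
  proof (cases "i \<in># m")
    case True
    then obtain b where b: "m = add_mset i b" by (metis insert_DiffM)
    then show ?thesis unfolding c by (simp add: mcoeff_geo mcoeff_one)
  next
    case False
    then show ?thesis unfolding c using set_mset_eq_empty_iff[of m]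
      by (auto simp: mcoeff_geo mcoeff_one subset_singleton_iff)
  qed
qed

lemma supp_geo: "supp {i} (geo i)"
  by (simp add: supp_def mcoeff_geo)

lemma perm_vars_geo: "bij \<pi> \<Longrightarrow> perm_vars \<pi> (geo i) = geo (inv_into UNIV \<pi> i)"
proof (rule mfps_eqI)
  fix m :: "nat multiset"
  assume b: "bij \<pi>"
  have "\<pi> ` set_mset m \<subseteq> {i} \<longleftrightarrow> set_mset m \<subseteq> {inv_into UNIV \<pi> i}"
    using bij_inv_eq_iff[OF b, of _ i] by auto
  then show "mcoeff (perm_vars \<pi> (geo i)) m = mcoeff (geo (inv_into UNIV \<pi> i)) m"
    by (simp add: mcoeff_perm_vars mcoeff_geo)
qed

text \<open>The variables \<open>y\<^sub>0, \<dots>, y\<^sub>s\<^sub>-\<^sub>1\<close> are those with the indices \<open>n, \<dots>, n + s - 1\<close>.\<close>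

definition y_kernel :: "nat \<Rightarrow> nat \<Rightarrow> ratfun mfps" where
  "y_kernel n s = Vd (\<lambda>i. n + i) s * (\<Prod>i<s. geo (n + i) ^ i)"

definition y_exponent :: "nat \<Rightarrow> nat \<Rightarrow> partition \<Rightarrow> nat multiset" where
  "y_exponent n s \<mu> = vmon (\<lambda>i. n + i) s (\<lambda>i. part \<mu> i + (s - 1 - i))"

text \<open>The symmetric function that represents the extraction functional:
  \<open>hfun_mset a\<close> picks the coefficient at a, and the sum convolves with the
  kernel.\<close>

definition y_dual :: "nat \<Rightarrow> nat \<Rightarrow> partition \<Rightarrow> ratfun mfps" where
  "y_dual n s \<mu> = (\<Sum>a | a \<subseteq># y_exponent n s \<mu>. mconst (mcoeff (y_kernel n s) (y_exponent n s \<mu> - a)) * hfun_mset a)"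

lemma y_dual_Sym: "y_dual n s \<mu> \<in> Sym"
  unfolding y_dual_def by (intro Sym_sum Sym_mult Sym_const hfun_mset_Sym)

lemma hall_y_dual: "F \<in> Sym_hat \<Longrightarrow> hall F (y_dual n s \<mu>) = mcoeff (F * y_kernel n s) (y_exponent n s \<mu>)"
  unfolding y_dual_def mcoeff_mult
  by (subst hall_sum) (simp_all add: hfun_mset_Sym hall_hfun_mset mult.commute)

lemma supp_mono: "supp A f \<Longrightarrow> A \<subseteq> B \<Longrightarrow> supp B f"
  unfolding supp_def by blast

lemma supp_prod: "(\<And>i. i \<in> I \<Longrightarrow> supp A (f i)) \<Longrightarrow> supp A (prod f I)"
  by (simp add: supp_iff_restr restr_prod)

lemma supp_power: "supp A f \<Longrightarrow> supp A (f ^ k)"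
  by (simp add: supp_iff_restr restr_power)

lemma supp_y_kernel: "supp {n..<n + s} (y_kernel n s)"
  unfolding y_kernel_def
  by (intro supp_mult supp_Vd supp_prod supp_power supp_mono[OF supp_geo]) auto

lemma mcoeff_mult_separate:
  assumes f: "supp X f" and g: "supp Y g" and XY: "X \<inter> Y = {}"
    and A: "set_mset A \<subseteq> X" and B: "set_mset B \<subseteq> Y"
  shows "mcoeff (f * g) (A + B) = mcoeff f A * mcoeff g B"
proof -
  have "mcoeff (f * g) (B + A) = (\<Sum>a\<in>{a. a \<subseteq># A}. mcoeff f a * mcoeff g (B + (A - a)))"
  proof (rule mult_disjoint_vars)
    show "set_mset B \<inter> X = {}" using B XY by blast
  qed (use f in \<open>auto simp: supp_def\<close>)
  also have "\<dots> = (\<Sum>a\<in>{a. a \<subseteq># A}. if a = A then mcoeff f A * mcoeff g B else 0)"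
  proof (rule sum.cong[OF refl])
    fix a assume a: "a \<in> {a. a \<subseteq># A}"
    show "mcoeff f a * mcoeff g (B + (A - a)) = (if a = A then mcoeff f A * mcoeff g B else 0)"
    proof (cases "a = A")
      case False
      then have "A - a \<noteq> {#}"
        using a subset_mset.antisym[of a A] by (auto simp: Diff_eq_empty_iff_mset)
      then obtain x where x: "x \<in># A - a" by blast
      then have "x \<in> X" using A by (auto dest: in_diffD)
      then have "x \<notin> Y" using XY by blast
      then have "mcoeff g (B + (A - a)) = 0" using g x unfolding supp_def by (metis UnCI set_mset_union subsetD)
      then show ?thesis using False by simp
    qed simp
  qed
  also have "\<dots> = mcoeff f A * mcoeff g B" by (subst sum.delta) (simp_all add: finite_submultisets)
  finally show ?thesis by (simp add: add.commute)
qed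

lemma mcoeff_prod_separate:
  assumes "inj_on v {..<s}" "\<And>i. i < s \<Longrightarrow> supp {v i} (f i)"
  shows "mcoeff (\<Prod>i<s. f i) (vmon v s a) = (\<Prod>i<s. mcoeff (f i) (replicate_mset (a i) (v i)))"
  using assms
proof (induction s)
  case 0
  then show ?case by (simp add: vmon_def mcoeff_one)
next
  case (Suc s)
  have inj: "inj_on v {..<s}" by (rule inj_on_subset[OF Suc.prems(1)]) auto
  have "v s \<notin> v ` {..<s}"
  proof
    assume "v s \<in> v ` {..<s}"
    then obtain i where "i < s" "v s = v i" by auto
    then show False using inj_onD[OF Suc.prems(1), of s i] by simp
  qed
  moreover have "supp (v ` {..<s}) (f i)" if "i < s" for i
    by (rule supp_mono[OF Suc.prems(2)]) (use that in auto)
  ultimately have "mcoeff ((\<Prod>i<s. f i) * f s) (vmon v s a + replicate_mset (a s) (v s)) =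
      mcoeff (\<Prod>i<s. f i) (vmon v s a) * mcoeff (f s) (replicate_mset (a s) (v s))"
    by (intro mcoeff_mult_separate[where X = "v ` {..<s}" and Y = "{v s}"] supp_prod set_mset_vmon)
      (use Suc.prems(2) in auto)
  then show ?case using Suc.IH[OF inj] Suc.prems(2) by (simp add: vmon_def)
qed

lemma mcoeff_linear_power:
  "mcoeff ((1 + mconst c * mvar i) ^ k) m \<noteq> 0 \<Longrightarrow> size m \<le> k"
proof (induction k arbitrary: m)
  case 0
  then show ?case by (auto simp: mcoeff_one split: if_splits)
next
  case (Suc k)
  then have "mcoeff ((1 + mconst c * mvar i) * (1 + mconst c * mvar i) ^ k) m \<noteq> 0" by simp
  then obtain a b where ab: "m = a + b" "mcoeff (1 + mconst c * mvar i) a \<noteq> 0"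
    "mcoeff ((1 + mconst c * mvar i) ^ k) b \<noteq> 0" by (rule mcoeff_mult_nz)
  have "size a \<le> 1" using ab(2) by (auto simp: mcoeff_one mvar_eq_mmon mcoeff_mmon split: if_splits)
  then show ?case using Suc.IH[OF ab(3)] ab(1) by simp
qed

lemma geo_power_cancel:
  "i \<le> q \<Longrightarrow> (1 + mconst beta * mvar x) ^ q * geo x ^ i = (1 + mconst beta * mvar x) ^ (q - i)"
proof -
  assume "i \<le> q"
  then have "(1 + mconst beta * mvar x) ^ q = (1 + mconst beta * mvar x) ^ (q - i) * (1 + mconst beta * mvar x) ^ i"
    unfolding power_add[symmetric] by simp
  then have "(1 + mconst beta * mvar x) ^ q * geo x ^ i =
     (1 + mconst beta * mvar x) ^ (q - i) * ((1 + mconst beta * mvar x) * geo x) ^ i"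
    by (simp add: power_mult_distrib mult.assoc)
  then show ?thesis by (simp add: geo_inverse)
qed

text \<open>The matrix of one-variable coefficients has no nonvanishing transversal except, for
  \<open>\<mu> = lam\<close>, the diagonal: a nonvanishing transversal \<open>p\<close> cannot have a minimal \<open>i\<close> with
  \<open>p i < i\<close>.\<close>

lemma Alt_y_kernel_pairing:
  assumes l: "part_length lam \<le> s" "part_length \<mu> \<le> s"
  shows "mcoeff (Alt beta s (part lam) * (\<Prod>i<s. geo i ^ i)) (dmon s \<mu>) = (if lam = \<mu> then 1 else 0)"
proof -
  define D where "D i = part \<mu> i + (s - 1 - i)" for i
  define e where "e p i = part lam (p i) + (s - 1 - p i)" for p :: "nat \<Rightarrow> nat" and i
  define W where "W p i = mvar i ^ e p i * ((1 + mconst beta * mvar i) ^ p i * geo i ^ i)" for p i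
  have coef: "mcoeff (W p i) (replicate_mset (D i) i) = (if e p i \<le> D i
      then mcoeff ((1 + mconst beta * mvar i) ^ p i * geo i ^ i) (replicate_mset (D i - e p i) i) else 0)" for p i
  proof -
    have "replicate_mset (D i) i - replicate_mset (e p i) i = replicate_mset (D i - e p i) i"
      by (rule multiset_eqI) simp
    then show ?thesis
      by (simp add: W_def mvar_power_eq_mmon mcoeff_mmon_mult count_le_replicate_mset_subset_eq[symmetric])
  qed
  have nz1: "e p i \<le> D i" if "mcoeff (W p i) (replicate_mset (D i) i) \<noteq> 0" for p i
    using that by (auto simp: coef split: if_splits)
  have nz2: "D i - e p i \<le> p i - i" if "mcoeff (W p i) (replicate_mset (D i) i) \<noteq> 0" "i \<le> p i" for p i
    using that mcoeff_linear_power[of beta i "p i - i" "replicate_mset (D i - e p i) i"]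
    by (auto simp: coef geo_power_cancel split: if_splits)
  have id: "p = id \<and> lam = \<mu>"
    if p: "p permutes {..<s}" and nz: "\<And>i. i < s \<Longrightarrow> mcoeff (W p i) (replicate_mset (D i) i) \<noteq> 0" for p
  proof -
    have ps: "p i < s" if "i < s" for i using permutes_in_image[OF p, of i] that by simp
    \<comment> \<open>If i \<le> p i, the geometric factors cancel and leave a polynomial of degree
      p i - i, which bounds the exponent from above; if p i < i, an infinite series is left and only
      the lower bound holds.\<close>
    have up: "part \<mu> i \<le> part lam (p i)" if "i < s" "i \<le> p i" for i
      using nz1[OF nz[OF that(1)]] nz2[OF nz[OF that(1)] that(2)] that ps[OF that(1)]
      unfolding D_def e_def by linarith
    have dn: "part lam (p i) < part \<mu> i" if "i < s" "p i < i" for i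
      using nz1[OF nz[OF that(1)]] that unfolding D_def e_def by linarith
    have ge: "i \<le> p i" if "i < s" for i
      using that
    proof (induction i rule: less_induct)
      case (less i)
      show ?case
      proof (rule ccontr)
        assume "\<not> i \<le> p i"
        then have lt: "p i < i" by simp
        then have ps': "p i < s" using less.prems by simp
        have "part \<mu> (p i) \<le> part lam (p (p i))" by (rule up[OF ps' less.IH[OF lt ps']])
        also have "\<dots> \<le> part lam (p i)" by (rule part_antimono[OF less.IH[OF lt ps']])
        also have "\<dots> < part \<mu> i" by (rule dn[OF less.prems lt])
        also have "\<dots> \<le> part \<mu> (p i)" using lt by (intro part_antimono) simp
        finally show False by simp
      qed
    qed
    then have pid: "p = id" by (intro permutes_natset_ge[OF p]) simp
    have "lam = \<mu>"
    proof (rule partition_eqI)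
      fix i
      show "part lam i = part \<mu> i"
      proof (cases "i < s")
        case True
        have "part \<mu> i \<le> part lam i" using up[OF True] pid by simp
        moreover have "part lam i \<le> part \<mu> i" using nz1[OF nz[OF True]] pid by (simp add: D_def e_def)
        ultimately show ?thesis by simp
      next
        case False
        then show ?thesis using l by (simp add: part_eq_0)
      qed
    qed
    then show ?thesis using pid by simp
  qed
  have "mcoeff (Alt beta s (part lam) * (\<Prod>i<s. geo i ^ i)) (dmon s \<mu>) =
      (\<Sum>p | p permutes {..<s}. of_int (sign p) * mcoeff (\<Prod>i<s. W p i) (dmon s \<mu>))"
    unfolding Alt_leibniz sum_distrib_right mcoeff_sum mult.assoc mcoeff_of_int_mult prod.distrib[symmetric]
    by (simp only: W_def e_def)
  also have "\<dots> = (\<Sum>p | p permutes {..<s}. of_int (sign p) * (\<Prod>i<s. mcoeff (W p i) (replicate_mset (D i) i)))"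
  proof (rule sum.cong[OF refl], rule arg_cong2[where f = "(*)"], rule refl)
    fix p assume "p \<in> {p. p permutes {..<s}}"
    have "supp {i} (W p i)" for i
    proof -
      have "supp {i} (mvar i :: ratfun mfps)" "supp {i} (1 + mconst beta * mvar i :: ratfun mfps)"
        by (simp_all add: supp_iff_restr restr_add restr_mult restr_mvar)
      then show ?thesis unfolding W_def by (intro supp_mult supp_power supp_geo)
    qed
    then have "mcoeff (\<Prod>i<s. W p i) (vmon id s D) = (\<Prod>i<s. mcoeff (W p i) (replicate_mset (D i) (id i)))"
      by (intro mcoeff_prod_separate) simp_all
    then show "mcoeff (\<Prod>i<s. W p i) (dmon s \<mu>) = (\<Prod>i<s. mcoeff (W p i) (replicate_mset (D i) i))"
      by (simp add: dmon_def D_def[abs_def])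
  qed
  also have "\<dots> = (\<Sum>p | p permutes {..<s}. if p = id then (if lam = \<mu> then 1 else 0) else 0)"
  proof (rule sum.cong[OF refl])
    fix p assume "p \<in> {p. p permutes {..<s}}"
    then have p: "p permutes {..<s}" by simp
    show "of_int (sign p) * (\<Prod>i<s. mcoeff (W p i) (replicate_mset (D i) i)) =
        (if p = id then (if lam = \<mu> then 1 else (0 :: ratfun)) else 0)"
    proof (cases "p = id \<and> lam = \<mu>")
      case True
      then have "e p i = D i" for i by (simp add: D_def e_def)
      then have "mcoeff (W p i) (replicate_mset (D i) i) = 1" for i
        using True by (simp add: coef geo_power_cancel mcoeff_one)
      then show ?thesis using True by simp
    next
      case False
      then obtain i where "i < s" "mcoeff (W p i) (replicate_mset (D i) i) = 0" using id[OF p] by blast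
      then have "(\<Prod>i<s. mcoeff (W p i) (replicate_mset (D i) i)) = 0" by (intro prod_zero) auto
      then show ?thesis using False by auto
    qed
  qed
  also have "\<dots> = (if lam = \<mu> then 1 else 0)"
    by (subst sum.delta) (simp_all add: permutes_id finite_permutations)
  finally show ?thesis .
qed

text \<open>G is symmetric, so the y variables may be moved to the first s places. Every remaining
  factor then lives in s variables, and G times the Vandermonde product becomes the determinant, or
  0 if \<open>lam\<close> is too long.\<close>

lemma hall_Groth_y_dual:
  assumes l: "part_length \<mu> \<le> s"
  shows "hall (Groth lam) (y_dual n s \<mu>) = (if lam = \<mu> then 1 else 0)"
proof -
  have inj: "inj_on (\<lambda>i. n + i) {..<s}" by simp
  obtain p where p: "p permutes {..<n + s}" "\<And>i. i \<in> {..<s} \<Longrightarrow> p i = n + i"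
    by (rule finite_inj_extends_permutes[OF _ _ inj, of "{..<n + s}"]) auto
  have bij: "bij p" by (rule permutes_bij[OF p(1)])
  have pinv: "inv_into UNIV p (n + i) = i" if "i < s" for i
    using p(2)[of i] that bij by (metis bij_inv_eq_iff lessThan_iff)
  have M: "y_exponent n s \<mu> = image_mset p (dmon s \<mu>)"
  proof -
    have "image_mset p (vmon id t a) = vmon (\<lambda>i. n + i) t a" if "t \<le> s" for t a
      using that by (induction t) (simp_all add: vmon_def p(2) )
    then show ?thesis by (simp add: y_exponent_def dmon_def)
  qed
  have "perm_vars p (Vd (\<lambda>i. n + i) s) = (Vd id s :: ratfun mfps)"
    unfolding Vd_def by (simp add: perm_vars_prod perm_vars_diff perm_vars_mvar bij pinv)
  then have K: "perm_vars p (y_kernel n s) = Vd id s * (\<Prod>i<s. geo i ^ i)"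
    unfolding y_kernel_def by (simp add: perm_vars_mult perm_vars_prod perm_vars_power perm_vars_geo bij pinv)
  have symG: "symm (Groth lam)" using Groth_Sym_hat by (simp add: Sym_hat_iff)
  have G: "perm_vars p (Groth lam) = Groth lam"
    by (rule mfps_eqI) (simp add: mcoeff_perm_vars symmD[OF symG] inj_on_subset[OF bij_is_inj[OF bij]])
  have "hall (Groth lam) (y_dual n s \<mu>) = mcoeff (perm_vars p (Groth lam * y_kernel n s)) (dmon s \<mu>)"
    by (simp add: hall_y_dual[OF Groth_Sym_hat] M mcoeff_perm_vars)
  also have "\<dots> = mcoeff (restr {..<s} (Groth lam * (Vd id s * (\<Prod>i<s. geo i ^ i)))) (dmon s \<mu>)"
    using set_mset_dmon[of s \<mu>] by (simp add: perm_vars_mult[OF bij] G K mcoeff_restr)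
  also have "restr {..<s} (Groth lam * (Vd id s * (\<Prod>i<s. geo i ^ i))) =
     restr {..<s} (Groth lam) * Vd id s * (\<Prod>i<s. geo i ^ i)"
  proof -
    have "supp {..<s} (Vd id s * (\<Prod>i<s. geo i ^ i))"
      by (intro supp_mult supp_Vd supp_prod supp_power supp_mono[OF supp_geo]) auto
    then show ?thesis by (simp only: restr_mult[of _ "Groth lam"] supp_iff_restr mult.assoc)
  qed
  also have "mcoeff \<dots> (dmon s \<mu>) = (if lam = \<mu> then 1 else 0)"
  proof (cases "part_length lam \<le> s")
    case True
    then show ?thesis using Alt_y_kernel_pairing[OF True l] by (simp add: restr_Groth)
  next
    case False
    then show ?thesis using l by (auto simp: restr_Groth_eq_0)
  qed
  finally show ?thesis .
qed

text \<open>G is its Schur function plus terms of higher degree. For a difference d \<noteq> 0,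
  pairing with G of a partition of maximal size in d therefore reads off a single nonzero
  coefficient.\<close>

lemma Sym_eqI_Groth:
  assumes g: "g \<in> Sym" "g' \<in> Sym" and eq: "\<And>lam. hall (Groth lam) g = hall (Groth lam) g'"
  shows "g = g'"
proof (rule ccontr)
  assume ne: "g \<noteq> g'"
  define d where "d = g + mconst (-1) * g'"
  have "d = g - g'" by (simp add: d_def mconst_uminus)
  then have d0: "d \<noteq> 0" using ne by simp
  have dS: "d \<in> Sym" unfolding d_def by (intro Sym_add Sym_mult Sym_const g)
  have hd: "hall (Groth lam) d = 0" for lam
    unfolding d_def by (simp add: hall_add hall_const g Sym_mult Sym_const eq)
  let ?K = "{\<kappa>. schur_coeff d \<kappa> \<noteq> 0}"
  have fin: "finite ?K" by (rule Sym_finite_coeffs[OF dS])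
  have "?K \<noteq> {}"
  proof
    assume e: "?K = {}"
    have "d = (\<Sum>\<kappa>\<in>?K. mconst (schur_coeff d \<kappa>) * schur_fun \<kappa>)" by (rule Sym_eq_schur_sum[OF dS fin]) simp
    then show False using d0 unfolding e by simp
  qed
  then obtain \<kappa> where k: "\<kappa> \<in> ?K" "\<And>\<kappa>'. \<kappa>' \<in> ?K \<Longrightarrow> part_size \<kappa>' \<le> part_size \<kappa>"
  proof -
    have "Max (part_size ` ?K) \<in> part_size ` ?K"
      using fin \<open>?K \<noteq> {}\<close> by (intro Max_in finite_imageI) (auto simp only: image_is_empty)
    then obtain \<kappa> where "\<kappa> \<in> ?K" "Max (part_size ` ?K) = part_size \<kappa>" by blast
    moreover have "part_size \<kappa>' \<le> Max (part_size ` ?K)" if "\<kappa>' \<in> ?K" for \<kappa>'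
      by (rule Max_ge[OF finite_imageI[OF fin] imageI[OF that]])
    ultimately show ?thesis using that by metis
  qed
  have "hall (Groth \<kappa>) d = (\<Sum>\<kappa>'\<in>?K. Groth_coeff \<kappa> \<kappa>' * schur_coeff d \<kappa>')"
    unfolding hall_def schur_coeff_Groth ..
  also have "\<dots> = (\<Sum>\<kappa>'\<in>?K. if \<kappa>' = \<kappa> then schur_coeff d \<kappa> else 0)"
    by (rule sum.cong[OF refl]) (use k(2) in \<open>auto simp: Groth_coeff_low\<close>)
  also have "\<dots> = schur_coeff d \<kappa>" using k(1) fin by (subst sum.delta) auto
  finally show False using hd k(1) by simp
qed

text \<open>Uniqueness makes \<open>y_dual\<close> independent of n and of s, provided that s \<ge>
  \<open>part_length \<mu>\<close>; later both are adapted to the monomial at hand.\<close>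

lemma dual_Groth_eq:
  assumes l: "part_length \<mu> \<le> s"
  shows "dual_Groth \<mu> = y_dual n s \<mu>"
  unfolding dual_Groth_def
  by (rule the_equality) (auto simp: y_dual_Sym hall_Groth_y_dual[OF l] intro: Sym_eqI_Groth)

section \<open>Skew Grothendieck polynomials\<close>

lemma mset_diff_diff: "a \<subseteq># M \<Longrightarrow> M - (M - a) = (a :: 'b multiset)"
  by (rule multiset_eqI) (simp add: mset_subset_eq_count)

text \<open>As m involves only x and the functional only y, the complete homogeneous products
  combine without merging exponents, so x- and y-coefficients are extracted at once.\<close>

lemma hall_y_dual_hfun_mset:
  assumes G: "G \<in> Sym_hat" and m: "set_mset m \<subseteq> {..<n}"
  shows "hall G (y_dual n s \<mu> * hfun_mset m) = mcoeff (G * y_kernel n s) (y_exponent n s \<mu> + m)"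
proof -
  let ?M = "y_exponent n s \<mu>"
  have Ms: "set_mset ?M \<subseteq> {n..<n + s}"
    unfolding y_exponent_def by (rule order_trans[OF set_mset_vmon]) auto
  have prod: "hfun_mset a * hfun_mset m = hfun_mset (a + m)" if "a \<subseteq># ?M" for a
  proof (rule hfun_mset_add_disjoint[symmetric])
    show "set_mset a \<inter> set_mset m = {}" using Ms m set_mset_mono[OF that] by fastforce
  qed
  have "hall G (y_dual n s \<mu> * hfun_mset m) = hall G (\<Sum>a | a \<subseteq># ?M. mconst (mcoeff (y_kernel n s) (?M - a)) * hfun_mset (a + m))"
    unfolding y_dual_def sum_distrib_right mult.assoc
    by (intro arg_cong[where f = "hall G"] sum.cong refl) (simp add: prod)
  also have "\<dots> = (\<Sum>a | a \<subseteq># ?M. mcoeff (y_kernel n s) (?M - a) * mcoeff G (a + m))"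
    by (subst hall_sum) (simp_all add: hfun_mset_Sym hall_hfun_mset G)
  also have "\<dots> = (\<Sum>b | b \<subseteq># ?M. mcoeff (y_kernel n s) b * mcoeff G (m + (?M - b)))"
    by (rule sum.reindex_bij_witness[of _ "\<lambda>b. ?M - b" "\<lambda>b. ?M - b"])
      (auto simp: mset_diff_diff add.commute)
  also have "\<dots> = mcoeff (y_kernel n s * G) (m + ?M)"
    by (rule mult_disjoint_vars[symmetric, where A = "{n..<n + s}"])
      (use supp_y_kernel m in \<open>fastforce simp: supp_def\<close>)+
  finally show ?thesis by (simp add: ac_simps)
qed

text \<open>The candidate \<open>p\<close> has the Schur coefficients dictated by adjointness. Being
  in the completion is not automatic: it comes from writing its coefficients in n variables as
  coefficients of G in n + s variables, convolved with the kernel.\<close>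

lemma perp_y_dual:
  assumes l: "part_length \<mu> \<le> s" and G: "G \<in> Sym_hat"
  shows "perp (dual_Groth \<mu>) G \<in> Sym_hat"
    and "mcoeff (perp (dual_Groth \<mu>) G) m = hall G (dual_Groth \<mu> * hfun_mset m)"
proof -
  define g where "g = dual_Groth \<mu>"
  have gS: "g \<in> Sym" using dual_Groth_eq[OF l, of 0] y_dual_Sym by (simp add: g_def)
  define c where "c \<kappa> = hall G (g * schur_fun \<kappa>)" for \<kappa>
  define p where "p = Abs_mfps (\<lambda>m. \<Sum>\<kappa> | part_size \<kappa> = size m. c \<kappa> * mcoeff (schur_fun \<kappa>) m)"
  have p: "mcoeff p m = (\<Sum>\<kappa> | part_size \<kappa> = size m. c \<kappa> * mcoeff (schur_fun \<kappa>) m)" for m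
    by (simp add: p_def)
  have lin: "hall G (g * (\<Sum>\<kappa>\<in>K. mconst (a \<kappa>) * schur_fun \<kappa>)) = (\<Sum>\<kappa>\<in>K. a \<kappa> * c \<kappa>)" for K a
  proof -
    have "hall G (g * (\<Sum>\<kappa>\<in>K. mconst (a \<kappa>) * schur_fun \<kappa>)) =
        hall G (\<Sum>\<kappa>\<in>K. mconst (a \<kappa>) * (g * schur_fun \<kappa>))"
      by (simp add: sum_distrib_left mult.left_commute)
    also have "\<dots> = (\<Sum>\<kappa>\<in>K. a \<kappa> * c \<kappa>)"
      unfolding c_def by (rule hall_sum) (intro Sym_mult gS schur_fun_Sym)
    finally show ?thesis .
  qed
  have pm: "mcoeff p m = hall G (g * hfun_mset m)" for m
  proof -
    have "hfun_mset m = (\<Sum>\<kappa> | part_size \<kappa> = size m. mconst (schur_coeff (hfun_mset m) \<kappa>) * schur_fun \<kappa>)"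
      by (rule Sym_eq_schur_sum[OF hfun_mset_Sym finite_part_size])
        (use schur_fun_hom[of _ m] in \<open>auto simp: schur_coeff_hfun_mset\<close>)
    then have "hall G (g * hfun_mset m) = (\<Sum>\<kappa> | part_size \<kappa> = size m. schur_coeff (hfun_mset m) \<kappa> * c \<kappa>)"
      using lin by metis
    then show ?thesis by (simp add: p schur_coeff_hfun_mset mult.commute)
  qed
  have "symm p"
    unfolding symm_def by (intro allI mfps_eqI) (simp add: mcoeff_perm_vars p schur_fun_adj_sym)
  moreover have "levelwise_bounded p"
    unfolding levelwise_bounded_def
  proof
    fix n
    \<comment> \<open>For each n the y variables are placed right after the first n
      variables.\<close>
    have gn: "g = y_dual n s \<mu>" by (simp add: g_def dual_Groth_eq[OF l])
    have "levelwise_bounded G" using G by (simp add: Sym_hat_iff)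
    then obtain d where d: "\<And>m. set_mset m \<subseteq> {..<n + s} \<Longrightarrow> mcoeff G m \<noteq> 0 \<Longrightarrow> size m \<le> d"
      unfolding levelwise_bounded_def by metis
    have Ms: "set_mset (y_exponent n s \<mu>) \<subseteq> {n..<n + s}"
      unfolding y_exponent_def by (rule order_trans[OF set_mset_vmon]) auto
    have "size m \<le> d" if m: "set_mset m \<subseteq> {..<n}" "mcoeff p m \<noteq> 0" for m
    proof -
      have "mcoeff (G * y_kernel n s) (y_exponent n s \<mu> + m) \<noteq> 0"
        using m(2) pm[of m] hall_y_dual_hfun_mset[OF G m(1), of s \<mu>] by (simp add: gn)
      then obtain a b where ab: "y_exponent n s \<mu> + m = a + b" "mcoeff G a \<noteq> 0" "mcoeff (y_kernel n s) b \<noteq> 0"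
        by (rule mcoeff_mult_nz)
      have bs: "set_mset b \<subseteq> {n..<n + s}" using ab(3) supp_y_kernel[of n s] by (simp add: supp_def)
      have "count m x \<le> count a x" for x
      proof (cases "x < n")
        case True
        then have "x \<notin># b" "x \<notin># y_exponent n s \<mu>" using bs Ms by fastforce+
        then have "count (y_exponent n s \<mu>) x = 0" "count b x = 0" by (simp_all add: not_in_iff)
        moreover have "count (y_exponent n s \<mu>) x + count m x = count a x + count b x"
          using arg_cong[OF ab(1), of "\<lambda>m. count m x"] by simp
        ultimately show ?thesis by simp
      next
        case False
        then have "x \<notin># m" using m(1) by auto
        then show ?thesis by (simp add: not_in_iff)
      qed
      then have "size m \<le> size a" by (intro size_mset_mono mset_subset_eqI)
      also have "set_mset a \<subseteq> set_mset (y_exponent n s \<mu> + m)" using ab(1) by simp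
      then have "set_mset a \<subseteq> {..<n + s}" using Ms m(1) by fastforce
      then have "size a \<le> d" by (rule d) (rule ab(2))
      finally show ?thesis .
    qed
    then show "\<exists>d. \<forall>m. set_mset m \<subseteq> {..<n} \<longrightarrow> mcoeff p m \<noteq> 0 \<longrightarrow> size m \<le> d" by blast
  qed
  ultimately have pS: "p \<in> Sym_hat" by (simp add: Sym_hat_iff)
  have pc: "schur_coeff p \<kappa> = c \<kappa>" for \<kappa>
    unfolding schur_coeff_eq[OF pS order_refl] by (rule vd_coeff_of_expansion[OF p order_refl, symmetric])
  have ph: "hall p h = hall G (g * h)" if h: "h \<in> Sym" for h
  proof -
    let ?K = "{\<kappa>. schur_coeff h \<kappa> \<noteq> 0}"
    have "h = (\<Sum>\<kappa>\<in>?K. mconst (schur_coeff h \<kappa>) * schur_fun \<kappa>)"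
      by (rule Sym_eq_schur_sum[OF h Sym_finite_coeffs[OF h]]) simp
    then have "hall G (g * h) = (\<Sum>\<kappa>\<in>?K. schur_coeff h \<kappa> * c \<kappa>)" using lin by metis
    then show ?thesis by (simp add: hall_def pc mult.commute)
  qed
  have "perp g G = p"
    unfolding perp_def
  proof (rule the_equality)
    show "p \<in> Sym_hat \<and> (\<forall>h\<in>Sym. hall p h = hall G (g * h))" using pS ph by blast
    fix q assume q: "q \<in> Sym_hat \<and> (\<forall>h\<in>Sym. hall q h = hall G (g * h))"
    show "q = p"
    proof (rule mfps_eqI)
      fix m
      show "mcoeff q m = mcoeff p m" using q hfun_mset_Sym[of m] hall_hfun_mset[of q m] pm[of m] by simp
    qed
  qed
  then show "perp (dual_Groth \<mu>) G \<in> Sym_hat"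
    and "mcoeff (perp (dual_Groth \<mu>) G) m = hall G (dual_Groth \<mu> * hfun_mset m)"
    using pS pm by (simp_all add: g_def)
qed

lemma skew_Groth_Sym_hat: "skew_Groth lam \<mu> \<in> Sym_hat"
  unfolding skew_Groth_def by (rule perp_y_dual[OF order_refl Groth_Sym_hat])

lemma skew_Groth_coeff:
  assumes "part_length \<mu> \<le> s" "set_mset m \<subseteq> {..<n}"
  shows "mcoeff (skew_Groth lam \<mu>) m = mcoeff (Groth lam * y_kernel n s) (y_exponent n s \<mu> + m)"
proof -
  have "mcoeff (skew_Groth lam \<mu>) m = hall (Groth lam) (dual_Groth \<mu> * hfun_mset m)"
    unfolding skew_Groth_def by (rule perp_y_dual(2)[OF assms(1) Groth_Sym_hat])
  also have "\<dots> = mcoeff (Groth lam * y_kernel n s) (y_exponent n s \<mu> + m)"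
    unfolding dual_Groth_eq[OF assms(1), of n] by (rule hall_y_dual_hfun_mset[OF Groth_Sym_hat assms(2)])
  finally show ?thesis .
qed

section \<open>Multiplication in the removed variables\<close>

lemma vmon_upd_mem:
  assumes "inj_on v {..<s}" "k < s" "0 < a k"
  shows "vmon v s a = add_mset (v k) (vmon v s (a(k := a k - 1)))"
proof -
  have "vmon v s b = replicate_mset (b k) (v k) + (\<Sum>i\<in>{..<s} - {k}. replicate_mset (b i) (v i))" for b
    unfolding vmon_def using assms(2) by (subst sum.remove[of _ k]) auto
  from this[of a] this[of "a(k := a k - 1)"] assms(3) show ?thesis
    by (cases "a k") simp_all
qed

lemma image_transpose_vmon:
  assumes inj: "inj_on v {..<s}" and k: "Suc k < s"
  shows "image_mset (transpose (v k) (v (Suc k))) (vmon v s a) = vmon v s (a \<circ> transpose k (Suc k))"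
proof -
  have tv: "transpose (v k) (v (Suc k)) (v i) = v (transpose k (Suc k) i)" if "i < s" for i
    using inj_onD[OF inj, of i k] inj_onD[OF inj, of i "Suc k"] that k by (auto simp: transpose_def)
  have img: "image_mset f (\<Sum>i\<in>I. g i) = (\<Sum>i\<in>I. image_mset f (g i))" for f and g :: "nat \<Rightarrow> nat multiset" and I
    by (induction I rule: infinite_finite_induct) simp_all
  have "image_mset (transpose (v k) (v (Suc k))) (vmon v s a) =
      (\<Sum>i<s. replicate_mset (a i) (v (transpose k (Suc k) i)))"
    unfolding vmon_def by (simp add: img tv)
  also have "\<dots> = (\<Sum>i<s. replicate_mset (a (transpose k (Suc k) i)) (v i))"
    by (rule sum.reindex_bij_witness[of _ "transpose k (Suc k)" "transpose k (Suc k)"])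
      (use k in \<open>auto simp: transpose_def\<close>)
  finally show ?thesis by (simp add: vmon_def)
qed

text \<open>Coefficient extraction at the exponents \<open>Mx + j - \<gamma> j\<close> of the variables
  \<open>n + s - 1 - j\<close>, where \<open>\<gamma>\<close> is the reversed complement of a partition: decreasing a partition
  increases \<open>\<gamma>\<close>, so that the lemma on straightening applies to the operators \<open>U\<^sub>i\<close> as well.\<close>

definition y_coeff :: "nat \<Rightarrow> nat \<Rightarrow> nat \<Rightarrow> nat multiset \<Rightarrow> ratfun mfps \<Rightarrow> (nat \<Rightarrow> nat) \<Rightarrow> ratfun" where
  "y_coeff n s Mx m Q \<gamma> = (if \<forall>j<s. \<gamma> j \<le> Mx + j
     then mcoeff (Q * y_kernel n s) (m + vmon (\<lambda>j. n + (s - 1 - j)) s (\<lambda>j. Mx + j - \<gamma> j)) else 0)"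

context
  fixes n s Mx :: nat and m :: "nat multiset" and Q :: "ratfun mfps"
  assumes m: "set_mset m \<subseteq> {..<n}" and Q: "symm Q"
begin

private abbreviation (input) "Y \<equiv> \<lambda>j. n + (s - 1 - j)"

private abbreviation (input) "W0 \<equiv> y_coeff n s Mx m Q"

private lemma inj_Y: "inj_on Y {..<s}"
  by (rule inj_onI) auto

private lemma count_Y: "j < s \<Longrightarrow> count (m + vmon Y s a) (Y j) = a j"
proof -
  assume j: "j < s"
  have "Y j \<notin># m" using m by auto
  then have "count m (Y j) = 0" by (simp only: not_in_iff)
  then show ?thesis using count_vmon[OF inj_Y j, of a] by simp
qed

text \<open>The kernel has one more factor 1/(1 + \<beta> y) for \<open>Y k\<close> than for
  \<open>Y (Suc k)\<close>. Multiplying by (1 + \<beta> y)/(1 + \<beta> y) for the latter equalises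
  them at the price of a factor 1 + \<beta> y, which is the shape of \<open>Alt_relation\<close>;
  the rest, \<open>R\<close>, is antisymmetric because of the Vandermonde factor.\<close>

lemma y_coeff_relation:
  assumes k: "Suc k < s" and pos: "1 \<le> \<alpha> (Suc k)"
  shows "W0 \<alpha> + W0 (\<alpha>(k := \<alpha> (Suc k) - 1, Suc k := \<alpha> k + 1)) =
     - beta * (W0 (\<alpha>(k := \<alpha> k + 1)) + W0 (\<alpha>(k := \<alpha> (Suc k), Suc k := \<alpha> k + 1)))"
proof -
  let ?\<tau> = "transpose (Y k) (Y (Suc k))"
  define P where "P = (\<Prod>j\<in>{..<s} - {k, Suc k}. geo (Y j) ^ (s - 1 - j))"
  define R where "R = Q * Vd (\<lambda>i. n + i) s * P * (geo (Y k) * geo (Y (Suc k))) ^ (s - 1 - k)"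
  have kk: "s - 1 - k = Suc (s - 1 - Suc k)" using k by simp
  have "(\<Prod>i<s. geo (n + i) ^ i) = (\<Prod>j<s. geo (Y j) ^ (s - 1 - j))"
    by (rule prod.reindex_bij_witness[of _ "\<lambda>j. s - 1 - j" "\<lambda>j. s - 1 - j"]) auto
  also have "\<dots> = geo (Y k) ^ (s - 1 - k) * geo (Y (Suc k)) ^ (s - 1 - Suc k) * P"
    unfolding P_def by (rule prod_two[OF k])
  also have "geo (Y (Suc k)) ^ (s - 1 - Suc k) =
      geo (Y (Suc k)) ^ (s - 1 - Suc k) * ((1 + mconst beta * mvar (Y (Suc k))) * geo (Y (Suc k)))"
    by (simp only: geo_inverse mult_1_right)
  also have "geo (Y k) ^ (s - 1 - k) * \<dots> * P =
      P * (geo (Y k) * geo (Y (Suc k))) ^ (s - 1 - k) * (1 + mconst beta * mvar (Y (Suc k)))"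
    unfolding kk power_mult_distrib power_Suc by (simp only: mult_ac)
  finally have QK: "Q * y_kernel n s = R + mconst beta * (mvar (Y (Suc k)) * R)"
    unfolding y_kernel_def R_def by (simp add: algebra_simps)
  have inv\<tau>: "inv_into UNIV ?\<tau> = ?\<tau>" by (rule inv_transpose_eq)
  have "perm_vars ?\<tau> P = P"
    unfolding P_def
    by (subst perm_vars_prod, simp, rule prod.cong[OF refl])
      (use k in \<open>auto simp: perm_vars_power perm_vars_geo inv\<tau> transpose_def\<close>)
  moreover have "perm_vars ?\<tau> (geo (Y k) * geo (Y (Suc k))) = geo (Y k) * geo (Y (Suc k))"
    by (simp add: perm_vars_mult perm_vars_geo inv\<tau> mult.commute)
  moreover have "perm_vars ?\<tau> (Vd (\<lambda>i. n + i) s) = - (Vd (\<lambda>i. n + i) s :: ratfun mfps)"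
  proof -
    have "Y k = n + Suc (s - 1 - Suc k)" using k by simp
    then have "?\<tau> = transpose (n + (s - 1 - Suc k)) (n + Suc (s - 1 - Suc k))"
      by (metis transpose_commute)
    then show ?thesis using perm_vars_Vd[where 'a = ratfun, of "\<lambda>i. n + i" s "s - 1 - Suc k"] k by simp
  qed
  moreover have "perm_vars ?\<tau> Q = Q"
    by (rule mfps_eqI) (simp add: mcoeff_perm_vars symmD[OF Q] inj_on_subset[OF bij_is_inj[OF bij_transpose]])
  ultimately have R: "perm_vars ?\<tau> R = - R"
    unfolding R_def by (simp add: perm_vars_mult perm_vars_power)
  \<comment> \<open>Integer exponents, with value 0 as soon as one is negative, make both the
    lowering by one and the exchange of exponents unconditional.\<close>
  define c where "c e = (if \<forall>j<s. 0 \<le> e j then mcoeff R (m + vmon Y s (\<lambda>j. nat (e j))) else 0)"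
    for e :: "nat \<Rightarrow> int"
  have c_swap: "c (e \<circ> transpose k (Suc k)) = - c e" for e
  proof -
    have all: "(\<forall>j<s. 0 \<le> (e \<circ> transpose k (Suc k)) j) \<longleftrightarrow> (\<forall>j<s. 0 \<le> e j)"
    proof -
      have "transpose k (Suc k) j < s" if "j < s" for j using that k by (auto simp: transpose_def)
      then show ?thesis by (metis comp_apply transpose_involutory)
    qed
    have "?\<tau> x = x" if "x \<in># m" for x using m that by (auto simp: transpose_def)
    then have "image_mset ?\<tau> m = image_mset (\<lambda>x. x) m" by (rule image_mset_cong)
    then have "image_mset ?\<tau> m = m" by simp
    moreover have "image_mset ?\<tau> (vmon Y s a) = vmon Y s (a \<circ> transpose k (Suc k))" for a
      by (rule image_transpose_vmon[OF inj_Y k])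
    ultimately have "mcoeff R (m + vmon Y s ((\<lambda>j. nat (e j)) \<circ> transpose k (Suc k))) =
        mcoeff (perm_vars ?\<tau> R) (m + vmon Y s (\<lambda>j. nat (e j)))" by (simp add: mcoeff_perm_vars)
    then have eq: "mcoeff R (m + vmon Y s (\<lambda>j. nat ((e \<circ> transpose k (Suc k)) j))) =
        - mcoeff R (m + vmon Y s (\<lambda>j. nat (e j)))" by (simp only: R mcoeff_uminus o_def)
    show ?thesis
    proof (cases "\<forall>j<s. 0 \<le> e j")
      case True
      show ?thesis unfolding c_def all if_P[OF True] by (rule eq)
    next
      case False
      show ?thesis unfolding c_def all if_not_P[OF False] by simp
    qed
  qed
  have w: "W0 \<gamma> = c e + beta * c (e(Suc k := e (Suc k) - 1))"
    if e: "\<And>j. j < s \<Longrightarrow> e j = int (Mx + j) - int (\<gamma> j)" for \<gamma> e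
  proof (cases "\<forall>j<s. \<gamma> j \<le> Mx + j")
    case True
    let ?a = "\<lambda>j. Mx + j - \<gamma> j" and ?x = "Y (Suc k)"
    have e0: "\<forall>j<s. 0 \<le> e j"
    proof (intro allI impI)
      fix j assume j: "j < s"
      then have "\<gamma> j \<le> Mx + j" using True by blast
      then show "0 \<le> e j" using e[OF j] by simp
    qed
    have ne: "nat (e j) = ?a j" if "j < s" for j
      unfolding e[OF that] by linarith
    have vm: "vmon Y s (\<lambda>j. nat (e j)) = vmon Y s ?a"
      unfolding vmon_def by (rule sum.cong[OF refl]) (simp only: lessThan_iff ne)
    have c1: "c e = mcoeff R (m + vmon Y s ?a)" using e0 vm by (simp add: c_def)
    have w: "W0 \<gamma> = mcoeff R (m + vmon Y s ?a) +
       beta * (if ?x \<in># m + vmon Y s ?a then mcoeff R (m + vmon Y s ?a - {#?x#}) else 0)"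
      unfolding y_coeff_def QK if_P[OF True] mcoeff_add mcoeff_mconst_mult mcoeff_var_mult ..
    have mem: "?x \<in># m + vmon Y s ?a \<longleftrightarrow> 0 < ?a (Suc k)"
      using count_Y[OF k, of ?a] by (metis count_greater_zero_iff)
    have "(if ?x \<in># m + vmon Y s ?a then mcoeff R (m + vmon Y s ?a - {#?x#}) else 0) =
        c (e(Suc k := e (Suc k) - 1))"
    proof (cases "0 < ?a (Suc k)")
      case pos: True
      have e1: "\<forall>j<s. 0 \<le> (e(Suc k := e (Suc k) - 1)) j" using pos e0 e[OF k] by auto
      have "vmon Y s (\<lambda>j. nat ((e(Suc k := e (Suc k) - 1)) j)) = vmon Y s (?a(Suc k := ?a (Suc k) - 1))"
        unfolding vmon_def
      proof (rule sum.cong[OF refl])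
        fix j assume "j \<in> {..<s}"
        then have "nat ((e(Suc k := e (Suc k) - 1)) j) = (?a(Suc k := ?a (Suc k) - 1)) j"
          using ne[of j] ne[OF k] by (cases "j = Suc k") auto
        then show "replicate_mset (nat ((e(Suc k := e (Suc k) - 1)) j)) (Y j) =
            replicate_mset ((?a(Suc k := ?a (Suc k) - 1)) j) (Y j)" by (rule arg_cong)
      qed
      then have "c (e(Suc k := e (Suc k) - 1)) = mcoeff R (m + vmon Y s (?a(Suc k := ?a (Suc k) - 1)))"
        unfolding c_def if_P[OF e1] by (rule arg_cong)
      moreover have "m + vmon Y s ?a - {#?x#} = m + vmon Y s (?a(Suc k := ?a (Suc k) - 1))"
        using vmon_upd_mem[OF inj_Y k, of ?a] pos by simp
      ultimately show ?thesis using mem pos by (simp only: if_True)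
    next
      case False
      then have "\<not> 0 \<le> (e(Suc k := e (Suc k) - 1)) (Suc k)" using e[OF k] True k by auto
      then have "\<not> (\<forall>j<s. 0 \<le> (e(Suc k := e (Suc k) - 1)) j)" using k by blast
      then have "c (e(Suc k := e (Suc k) - 1)) = 0" unfolding c_def by (simp only: if_False)
      then show ?thesis using mem False by (simp only: if_False)
    qed
    then show ?thesis using w c1 by simp
  next
    case False
    then obtain j where j: "j < s" "Mx + j < \<gamma> j" by (auto simp: not_le)
    then have neg: "\<not> 0 \<le> e j" "\<not> 0 \<le> (e(Suc k := e (Suc k) - 1)) j" using e[OF j(1)] by auto
    then have "\<not> (\<forall>j<s. 0 \<le> e j)" "\<not> (\<forall>j<s. 0 \<le> (e(Suc k := e (Suc k) - 1)) j)" using j(1) by blast+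
    then have "c e = 0" "c (e(Suc k := e (Suc k) - 1)) = 0" unfolding c_def by (simp_all only: if_False)
    moreover have "W0 \<gamma> = 0" using False unfolding y_coeff_def by (simp only: if_False)
    ultimately show ?thesis by simp
  qed
  define e0 where "e0 j = int (Mx + j) - int (\<alpha> j)" for j
  define d where "d p q = c (e0(k := p, Suc k := q))" for p q
  define p where "p = e0 k"
  define q where "q = e0 (Suc k)"
  have d_swap: "d q p = - d p q" for p q
  proof -
    have "(e0(k := p, Suc k := q)) \<circ> transpose k (Suc k) = e0(k := q, Suc k := p)"
      by (rule ext) (auto simp: transpose_def)
    then show ?thesis using c_swap[of "e0(k := p, Suc k := q)"] by (simp add: d_def)
  qed
  have wd: "W0 \<gamma> = d x y + beta * d x (y - 1)"
    if "\<And>j. j < s \<Longrightarrow> j \<noteq> k \<Longrightarrow> j \<noteq> Suc k \<Longrightarrow> \<gamma> j = \<alpha> j"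
      "x = int (Mx + k) - int (\<gamma> k)" "y = int (Mx + Suc k) - int (\<gamma> (Suc k))" for \<gamma> x y
    unfolding d_def by (subst w[of "e0(k := x, Suc k := y)"]) (use that in \<open>auto simp: e0_def\<close>)
  have "W0 \<alpha> = d p q + beta * d p (q - 1)"
    by (rule wd) (simp_all add: p_def q_def e0_def)
  moreover have "W0 (\<alpha>(k := \<alpha> (Suc k) - 1, Suc k := \<alpha> k + 1)) = d q p + beta * d q (p - 1)"
    by (rule wd) (use pos in \<open>simp_all add: p_def q_def e0_def of_nat_diff\<close>)
  moreover have "W0 (\<alpha>(k := \<alpha> k + 1)) = d (p - 1) q + beta * d (p - 1) (q - 1)"
    by (rule wd) (simp_all add: p_def q_def e0_def)
  moreover have "W0 (\<alpha>(k := \<alpha> (Suc k), Suc k := \<alpha> k + 1)) = d (q - 1) p + beta * d (q - 1) (p - 1)"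
    by (rule wd) (simp_all add: p_def q_def e0_def)
  ultimately show ?thesis
    using d_swap[of p q] d_swap[of p "q - 1"] d_swap[of "p - 1" q] d_swap[of "p - 1" "q - 1"]
    by (simp add: algebra_simps)
qed

text \<open>A monomial factor in y lowers the exponents to be extracted from the rest, and thus
  raises \<gamma> by the content of the tableau.\<close>

lemma mcoeff_tableau_y_coeff:
  assumes T: "T \<in> ssyt (<) {..<s} \<kappa> \<rho>" and g: "\<And>j. j < s \<Longrightarrow> \<gamma> j \<le> Mx + j"
  shows "mcoeff (mmon (image_mset Y (cont \<kappa> \<rho> T)) * (Q * y_kernel n s)) (m + vmon Y s (\<lambda>j. Mx + j - \<gamma> j)) =
    W0 (\<lambda>t. \<gamma> t + col_weight \<kappa> \<rho> (part \<kappa> 0) T t)"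
proof -
  let ?w = "\<lambda>t. col_weight \<kappa> \<rho> (part \<kappa> 0) T t"
  let ?a = "\<lambda>j. Mx + j - \<gamma> j"
  let ?M = "m + vmon Y s ?a"
  have cs: "set_mset (cont \<kappa> \<rho> T) \<subseteq> {..<s}" using ssyt_entry[OF T] by (auto simp: set_mset_cont)
  have "cont \<kappa> \<rho> T = vmon id s ?w"
    by (intro multiset_eqI) (use cs in \<open>auto simp: count_cont[symmetric] not_in_iff[symmetric]\<close>)
  moreover have "image_mset Y (vmon id t a) = vmon Y t a" for t a
    by (induction t) (simp_all add: vmon_def)
  ultimately have C: "image_mset Y (cont \<kappa> \<rho> T) = vmon Y s ?w" by simp
  have cw: "count (vmon Y s ?w) (Y j) = ?w j" if "j < s" for j by (rule count_vmon[OF inj_Y that])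
  have sub: "vmon Y s ?w \<subseteq># ?M \<longleftrightarrow> (\<forall>j<s. ?w j \<le> ?a j)"
  proof
    assume "vmon Y s ?w \<subseteq># ?M"
    then have le: "count (vmon Y s ?w) (Y j) \<le> count ?M (Y j)" for j by (rule mset_subset_eq_count)
    show "\<forall>j<s. ?w j \<le> ?a j"
    proof (intro allI impI)
      fix j assume "j < s"
      then show "?w j \<le> ?a j" using le[of j] by (simp only: cw count_Y)
    qed
  next
    assume le: "\<forall>j<s. ?w j \<le> ?a j"
    show "vmon Y s ?w \<subseteq># ?M"
    proof (rule mset_subset_eqI)
      fix x
      show "count (vmon Y s ?w) x \<le> count ?M x"
      proof (cases "x \<in># vmon Y s ?w")
        case True
        then obtain j where "j < s" "x = Y j" using set_mset_vmon[of Y s ?w] by auto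
        then show ?thesis using le cw[of j] count_Y[of j ?a] by simp
      qed (simp add: not_in_iff)
    qed
  qed
  have cond: "(\<forall>j<s. ?w j \<le> ?a j) \<longleftrightarrow> (\<forall>j<s. \<gamma> j + ?w j \<le> Mx + j)"
  proof -
    have "?w j \<le> ?a j \<longleftrightarrow> \<gamma> j + ?w j \<le> Mx + j" if "j < s" for j using g[OF that] by linarith
    then show ?thesis by blast
  qed
  have diff: "?M - vmon Y s ?w = m + vmon Y s (\<lambda>j. Mx + j - (\<gamma> j + ?w j))" if le: "\<forall>j<s. ?w j \<le> ?a j"
  proof -
    have "vmon Y s ?a = vmon Y s ?w + vmon Y s (\<lambda>j. Mx + j - (\<gamma> j + ?w j))"
      unfolding vmon_def sum.distrib[symmetric]
    proof (rule sum.cong[OF refl])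
      fix j assume "j \<in> {..<s}"
      then have "?a j = ?w j + (Mx + j - (\<gamma> j + ?w j))" using spec[OF le, of j] g[of j] by simp
      then show "replicate_mset (?a j) (Y j) = replicate_mset (?w j) (Y j) + replicate_mset (Mx + j - (\<gamma> j + ?w j)) (Y j)"
        by (intro multiset_eqI) simp
    qed
    then show ?thesis by simp
  qed
  show ?thesis
    unfolding C mcoeff_mmon_mult sub y_coeff_def cond[symmetric] using diff by (simp cong: if_cong)
qed

end

section \<open>Change of alphabet and complements in a box\<close>

lemma ssyt_rename_in:
  assumes f: "\<And>a b. a \<in> A \<Longrightarrow> b \<in> A \<Longrightarrow> lt a b \<Longrightarrow> lt' (f a) (f b)" "f ` A \<subseteq> A'"
    and T: "T \<in> ssyt lt A \<kappa> \<rho>"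
  shows "restrict (f \<circ> T) (skew_cells \<kappa> \<rho>) \<in> ssyt lt' A' \<kappa> \<rho>"
  unfolding ssyt_def
proof (intro CollectI conjI allI impI)
  have e: "T p \<in> A" if "p \<in> skew_cells \<kappa> \<rho>" for p by (rule ssyt_entry[OF T that])
  show "restrict (f \<circ> T) (skew_cells \<kappa> \<rho>) \<in> skew_cells \<kappa> \<rho> \<rightarrow>\<^sub>E A'" using e f(2) by auto
  fix i j j' assume a: "(i, j) \<in> skew_cells \<kappa> \<rho> \<and> (i, j') \<in> skew_cells \<kappa> \<rho> \<and> j < j'"
  then have "lt (T (i, j)) (T (i, j')) \<or> T (i, j) = T (i, j')" using T unfolding ssyt_def by blast
  then show "lt' (restrict (f \<circ> T) (skew_cells \<kappa> \<rho>) (i, j)) (restrict (f \<circ> T) (skew_cells \<kappa> \<rho>) (i, j')) \<or>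
     restrict (f \<circ> T) (skew_cells \<kappa> \<rho>) (i, j) = restrict (f \<circ> T) (skew_cells \<kappa> \<rho>) (i, j')"
    using a e f(1) by auto
next
  have e: "T p \<in> A" if "p \<in> skew_cells \<kappa> \<rho>" for p by (rule ssyt_entry[OF T that])
  fix i i' j assume a: "(i, j) \<in> skew_cells \<kappa> \<rho> \<and> (i', j) \<in> skew_cells \<kappa> \<rho> \<and> i < i'"
  then have "lt (T (i, j)) (T (i', j))" using ssyt_col[OF T] by blast
  then show "lt' (restrict (f \<circ> T) (skew_cells \<kappa> \<rho>) (i, j)) (restrict (f \<circ> T) (skew_cells \<kappa> \<rho>) (i', j))"
    using a e f(1) by auto
qed

lemma sum_ssyt_rename:
  assumes f: "\<And>a b. a \<in> A \<Longrightarrow> b \<in> A \<Longrightarrow> lt a b \<Longrightarrow> lt' (f a) (f b)" "f ` A \<subseteq> A'"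
    and g: "\<And>a b. a \<in> A' \<Longrightarrow> b \<in> A' \<Longrightarrow> lt' a b \<Longrightarrow> lt (g a) (g b)" "g ` A' \<subseteq> A"
    and gf: "\<And>a. a \<in> A \<Longrightarrow> g (f a) = a" and fg: "\<And>a. a \<in> A' \<Longrightarrow> f (g a) = a"
  shows "(\<Sum>T\<in>ssyt lt' A' \<kappa> \<rho>. h T) = (\<Sum>T\<in>ssyt lt A \<kappa> \<rho>. h (restrict (f \<circ> T) (skew_cells \<kappa> \<rho>)))"
proof -
  let ?X = "skew_cells \<kappa> \<rho>"
  have inv: "restrict (f' \<circ> restrict (g' \<circ> T) ?X) ?X = T"
    if "T \<in> ssyt lt'' B \<kappa> \<rho>" "\<And>a. a \<in> B \<Longrightarrow> f' (g' a) = a" for T lt'' B f' g'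
  proof
    fix p
    show "restrict (f' \<circ> restrict (g' \<circ> T) ?X) ?X p = T p"
    proof (cases "p \<in> ?X")
      case True
      then show ?thesis using ssyt_entry[OF that(1) True] that(2) by simp
    next
      case False
      then show ?thesis using that(1) by (cases p) (auto simp: ssyt_def PiE_iff extensional_def)
    qed
  qed
  show ?thesis
  proof (rule sum.reindex_bij_witness[of _ "\<lambda>T. restrict (f \<circ> T) ?X" "\<lambda>T. restrict (g \<circ> T) ?X"])
    fix T assume T: "T \<in> ssyt lt' A' \<kappa> \<rho>"
    show eq: "restrict (f \<circ> restrict (g \<circ> T) ?X) ?X = T" by (rule inv[OF T]) (rule fg)
    show "restrict (g \<circ> T) ?X \<in> ssyt lt A \<kappa> \<rho>" by (rule ssyt_rename_in[where lt = lt' and A = A' and f = g, OF _ g(2) T]) (rule g(1))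
    show "h (restrict (f \<circ> restrict (g \<circ> T) ?X) ?X) = h T" by (simp only: eq)
  next
    fix T assume T: "T \<in> ssyt lt A \<kappa> \<rho>"
    show "restrict (g \<circ> restrict (f \<circ> T) ?X) ?X = T" by (rule inv[OF T]) (rule gf)
    show "restrict (f \<circ> T) ?X \<in> ssyt lt' A' \<kappa> \<rho>" by (rule ssyt_rename_in[where lt = lt and A = A and f = f, OF _ f(2) T]) (rule f(1))
  qed
qed

lemma column_word_rename:
  "column_word \<kappa> \<rho> (restrict (f \<circ> T) (skew_cells \<kappa> \<rho>)) = map f (column_word \<kappa> \<rho> T)"
  unfolding column_word_def map_concat map_map
  by (intro arg_cong[where f = concat] map_cong refl) (auto simp: o_def)

lemma cont_rename: "cont \<kappa> \<rho> (restrict (f \<circ> T) (skew_cells \<kappa> \<rho>)) = image_mset f (cont \<kappa> \<rho> T)"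
  unfolding cont_def multiset.map_comp by (rule image_mset_cong) simp

text \<open>The complement in a box with s rows of length \<open>Mx\<close>, turned by half a turn
  so that it is a partition again.\<close>

definition rev_compl :: "nat \<Rightarrow> nat \<Rightarrow> (nat \<Rightarrow> nat) \<Rightarrow> nat \<Rightarrow> nat" where
  "rev_compl Mx s l = (\<lambda>j. if j < s then Mx - l (s - 1 - j) else 0)"

lemma finite_rev_compl: "finite {i. rev_compl Mx s l i \<noteq> 0}"
  by (rule finite_subset[of _ "{..<s}"]) (auto simp: rev_compl_def split: if_splits)

lemma prefix_min_le: "i \<le> j \<Longrightarrow> prefix_min l j \<le> l i"
  unfolding prefix_min_def by (rule Min_le) auto

lemma prefix_min_in: "\<exists>i\<le>j. prefix_min l j = l i"
proof -
  have "Min (l ` {..j}) \<in> l ` {..j}" by (rule Min_in) auto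
  then obtain i where "i \<in> {..j}" "Min (l ` {..j}) = l i" by blast
  then show ?thesis unfolding prefix_min_def by blast
qed

text \<open>The half-turn exchanges prefixes with tails and the complement exchanges minima with
  maxima; this is why \<open>U\<close> is \<open>u\<close> in disguise.\<close>

lemma tail_max_rev_compl: "tail_max (rev_compl Mx s l) = rev_compl Mx s (prefix_min l)"
proof
  fix j
  show "tail_max (rev_compl Mx s l) j = rev_compl Mx s (prefix_min l) j"
  proof (cases "j < s")
    case True
    show ?thesis
    proof (rule antisym)
      show "tail_max (rev_compl Mx s l) j \<le> rev_compl Mx s (prefix_min l) j"
        unfolding tail_max_le_iff[OF finite_rev_compl]
      proof (intro allI impI)
        fix j' assume "j \<le> j'"
        then show "rev_compl Mx s l j' \<le> rev_compl Mx s (prefix_min l) j"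
          using prefix_min_le[of "s - 1 - j'" "s - 1 - j" l] True by (simp add: rev_compl_def diff_le_mono2)
      qed
      obtain i where i: "i \<le> s - 1 - j" "prefix_min l (s - 1 - j) = l i" using prefix_min_in by blast
      then have "rev_compl Mx s (prefix_min l) j = rev_compl Mx s l (s - 1 - i)" using True by (simp add: rev_compl_def)
      also have "\<dots> \<le> tail_max (rev_compl Mx s l) j" by (rule tail_max_ge[OF finite_rev_compl]) (use i(1) True in simp)
      finally show "rev_compl Mx s (prefix_min l) j \<le> tail_max (rev_compl Mx s l) j" .
    qed
  next
    case False
    then show ?thesis using tail_max_zero[of s "rev_compl Mx s l" j] by (simp add: rev_compl_def)
  qed
qed

lemma seq_size_rev_compl:
  assumes "\<And>i. l i \<le> Mx" "\<And>i. s \<le> i \<Longrightarrow> l i = 0"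
  shows "seq_size (rev_compl Mx s l) + seq_size l = s * Mx"
proof -
  have "seq_size (rev_compl Mx s l) = (\<Sum>j<s. rev_compl Mx s l j)" by (rule seq_size_eq_sum) (simp add: rev_compl_def)
  also have "\<dots> = (\<Sum>i<s. Mx - l i)"
    by (rule sum.reindex_bij_witness[of _ "\<lambda>i. s - 1 - i" "\<lambda>i. s - 1 - i"]) (auto simp: rev_compl_def)
  finally have "seq_size (rev_compl Mx s l) + seq_size l = (\<Sum>i<s. (Mx - l i) + l i)"
    using seq_size_eq_sum[of s l, OF assms(2)] by (simp add: sum.distrib)
  also have "\<dots> = s * Mx" using assms(1) by simp
  finally show ?thesis .
qed

section \<open>The operators on the module of pairs\<close>

lemma lookup_scale: "Poly_Mapping.lookup (Poly_Mapping.map ((*) c) v) k = c * Poly_Mapping.lookup v k"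
  for c :: "'b::comm_ring_1"
  by (simp add: Poly_Mapping.map.rep_eq when_def)

lemma lookup_sum: "Poly_Mapping.lookup (sum f A) k = (\<Sum>a\<in>A. Poly_Mapping.lookup (f a) k)"
  by (induction A rule: infinite_finite_induct) (simp_all add: lookup_add)

lemma lookup_lin_ext:
  assumes "finite B" "Poly_Mapping.keys v \<subseteq> B"
  shows "Poly_Mapping.lookup (lin_ext f v) k =
    (\<Sum>b\<in>B. Poly_Mapping.lookup v b * Poly_Mapping.lookup (f b) k)"
  unfolding lin_ext_def lookup_sum lookup_scale
  by (rule sum.mono_neutral_left) (use assms in \<open>auto simp: in_keys_iff\<close>)

lemma lin_ext_add: "lin_ext f (v + w) = lin_ext f v + lin_ext f w"
proof (rule poly_mapping_eqI)
  fix k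
  let ?B = "Poly_Mapping.keys v \<union> Poly_Mapping.keys w"
  have "Poly_Mapping.keys (v + w) \<subseteq> ?B" by (rule Poly_Mapping.keys_add)
  then show "Poly_Mapping.lookup (lin_ext f (v + w)) k = Poly_Mapping.lookup (lin_ext f v + lin_ext f w) k"
    by (simp add: lookup_add lookup_lin_ext[of ?B] distrib_right sum.distrib)
qed

lemma lin_ext_zero: "lin_ext f 0 = 0"
  by (simp add: lin_ext_def)

lemma lin_ext_single: "lin_ext f (Poly_Mapping.single b c) = Poly_Mapping.map ((*) c) (f b)"
proof (rule poly_mapping_eqI)
  fix k
  have "Poly_Mapping.keys (Poly_Mapping.single b c) \<subseteq> {b}" by (simp add: keys_single)
  then show "Poly_Mapping.lookup (lin_ext f (Poly_Mapping.single b c)) k =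
      Poly_Mapping.lookup (Poly_Mapping.map ((*) c) (f b)) k"
    by (simp add: lookup_lin_ext[of "{b}"] lookup_scale)
qed

lemma scale_single: "Poly_Mapping.map ((*) c) (Poly_Mapping.single b d) = Poly_Mapping.single b (c * d)"
  for c :: "'b::comm_ring_1"
  by (rule poly_mapping_eqI) (simp add: lookup_scale lookup_single when_def)

lemma U_pair_zero: "U_pair i 0 = 0"
  by (simp add: U_pair_def lin_ext_zero)

lemma word_op_Cons: "word_op X (i # w) v = X i (word_op X w v)"
  by (simp add: word_op_def)

lemma word_op_Nil: "word_op X [] v = v"
  by (simp add: word_op_def)

lemma word_op_U_add: "word_op U_pair w (v + v') = word_op U_pair w v + word_op U_pair w v'"
  by (induction w) (simp_all add: word_op_Nil word_op_Cons U_pair_def lin_ext_add)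

lemma word_op_U_zero: "word_op U_pair w 0 = 0"
  by (induction w) (simp_all add: word_op_Nil word_op_Cons U_pair_zero)

lemma word_op_U_sum: "word_op U_pair w (sum f A) = (\<Sum>a\<in>A. word_op U_pair w (f a))"
  by (induction A rule: infinite_finite_induct) (simp_all add: word_op_U_add word_op_U_zero)

lemma u_pair_single: "u_pair i (Poly_Mapping.single (lam, \<mu>) c) =
    Poly_Mapping.map ((*) c) (lin_ext (\<lambda>\<kappa>. basis_vec (\<kappa>, \<mu>)) (u_op i (basis_vec lam)))"
  unfolding u_pair_def lin_ext_single by simp

lemma U_pair_single: "U_pair i (Poly_Mapping.single (lam, \<mu>) c) =
    Poly_Mapping.map ((*) c) (lin_ext (\<lambda>\<kappa>. basis_vec (lam, \<kappa>)) (U_op i (basis_vec \<mu>)))"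
  unfolding U_pair_def lin_ext_single by simp

definition uword :: "nat list \<Rightarrow> partition \<Rightarrow> partition" where
  "uword w lam = Abs_partition (uact w (part lam))"

lemma part_uword: "part (uword w lam) = uact w (part lam)"
  unfolding uword_def
  by (rule Abs_partition_inverse) (simp add: antimono_uact antimono_part finite_part finite_support_uact del: neq0_conv)

lemma word_op_u:
  "word_op u_pair w (Poly_Mapping.single (lam, \<mu>) c) =
     Poly_Mapping.single (uword w lam, \<mu>) (c * (- beta0) ^ uexp w (part lam))"
proof (induction w)
  case Nil
  have "uword [] lam = lam" by (rule partition_eqI) (simp add: part_uword)
  then show ?case by (simp add: word_op_Nil)
next
  case (Cons i w)
  let ?l = "bump i (uact w (part lam))"
  have u: "u_op i (Poly_Mapping.single (uword w lam) 1) =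
     Poly_Mapping.single (uword (i # w) lam) ((- beta0) ^ (seq_size (tail_max ?l) - seq_size ?l))"
  proof -
    have "uword (i # w) lam = Abs_partition (tail_max ?l)" by (simp add: uword_def)
    then show ?thesis
      unfolding u_op_def lin_ext_single by (simp add: scale_single Let_def part_uword bump_def)
  qed
  show ?case
    unfolding word_op_Cons Cons u_pair_single basis_vec_def u lin_ext_single
    by (simp add: scale_single power_add mult.assoc)
qed

text \<open>Applying \<open>U\<close> either kills a pair, in which case the sequence on the side of the reversed
  complement has left the box, or it acts on the complement as \<open>u\<close>.\<close>

lemma word_op_U:
  assumes w: "set w \<subseteq> {..<s}" and l: "part_length \<mu> \<le> s" and M: "\<And>i. part \<mu> i \<le> Mx"
  defines "w' \<equiv> map (\<lambda>i. s - 1 - i) w" and "g \<equiv> rev_compl Mx s (part \<mu>)"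
  shows "(\<exists>\<mu>'. word_op U_pair w (Poly_Mapping.single (lam, \<mu>) c) =
        Poly_Mapping.single (lam, \<mu>') (c * (- beta0) ^ uexp w' g) \<and>
      uact w' g = rev_compl Mx s (part \<mu>') \<and> part_length \<mu>' \<le> s \<and> (\<forall>i. part \<mu>' i \<le> Mx)) \<or>
    (word_op U_pair w (Poly_Mapping.single (lam, \<mu>) c) = 0 \<and> Mx < uact w' g 0)"
  using w unfolding w'_def
proof (induction w)
  case Nil
  then show ?case using l M by (auto simp: word_op_Nil g_def)
next
  case (Cons i w)
  let ?w = "map (\<lambda>i. s - 1 - i) w"
  have isl: "i < s" using Cons.prems by simp
  have fing: "finite {j. g j \<noteq> 0}" unfolding g_def by (rule finite_rev_compl)
  have finb: "finite {j. bump (s - 1 - i) (uact ?w g) j \<noteq> 0}"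
    by (rule finite_support_bump[OF finite_support_uact[OF fing]])
  from Cons consider
    (alive) \<mu>' where "word_op U_pair w (Poly_Mapping.single (lam, \<mu>) c) =
        Poly_Mapping.single (lam, \<mu>') (c * (- beta0) ^ uexp ?w g)"
      "uact ?w g = rev_compl Mx s (part \<mu>')" "part_length \<mu>' \<le> s" "\<And>i. part \<mu>' i \<le> Mx"
  | (dead) "word_op U_pair w (Poly_Mapping.single (lam, \<mu>) c) = 0" "Mx < uact ?w g 0"
    by auto
  then show ?case
  proof cases
    case dead
    have "uact ?w g 0 \<le> bump (s - 1 - i) (uact ?w g) 0" by (simp add: bump_def)
    also have "\<dots> \<le> tail_max (bump (s - 1 - i) (uact ?w g)) 0" by (rule tail_max_ge[OF finb]) simp
    finally have "Mx < uact (map (\<lambda>i. s - 1 - i) (i # w)) g 0" using dead(2) by simp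
    moreover have "word_op U_pair (i # w) (Poly_Mapping.single (lam, \<mu>) c) = 0"
      by (simp add: word_op_Cons dead(1) U_pair_zero)
    ultimately show ?thesis by blast
  next
    case alive
    have red: "word_op U_pair (i # w) (Poly_Mapping.single (lam, \<mu>) c) =
        Poly_Mapping.map ((*) (c * (- beta0) ^ uexp ?w g))
          (lin_ext (\<lambda>\<kappa>. basis_vec (lam, \<kappa>)) (U_op i (Poly_Mapping.single \<mu>' 1)))"
      unfolding word_op_Cons alive(1) U_pair_single basis_vec_def ..
    show ?thesis
    proof (cases "part \<mu>' i = 0")
      case True
      have "U_op i (Poly_Mapping.single \<mu>' 1) = 0"
        unfolding U_op_def lin_ext_single using True by (simp add: poly_mapping_eqI lookup_scale)
      then have "word_op U_pair (i # w) (Poly_Mapping.single (lam, \<mu>) c) = 0"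
        unfolding red by (intro poly_mapping_eqI) (simp add: lin_ext_zero lookup_scale)
      moreover have "s - 1 - (s - 1 - i) = i" using isl by simp
      \<comment> \<open>An empty row has a full complement, so raising it leaves the box, and entry
        0 of the tail maximum records this for good.\<close>
      then have "bump (s - 1 - i) (uact ?w g) (s - 1 - i) = Suc Mx"
        unfolding bump_def fun_upd_same alive(2) rev_compl_def using True isl by simp
      then have "Suc Mx \<le> tail_max (bump (s - 1 - i) (uact ?w g)) 0"
        using tail_max_ge[OF finb, of 0 "s - 1 - i"] by simp
      then have "Mx < uact (map (\<lambda>i. s - 1 - i) (i # w)) g 0" by simp
      ultimately show ?thesis by blast
    next
      case False
      define ll where "ll = (part \<mu>')(i := part \<mu>' i - 1)"
      define \<mu>'' where "\<mu>'' = Abs_partition (prefix_min ll)"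
      have finl: "finite {j. ll j \<noteq> 0}" unfolding ll_def by (rule finite_support_upd[OF finite_part])
      have p: "part \<mu>'' = prefix_min ll" unfolding \<mu>''_def by (rule part_prefix_min(1)[OF finl])
      have llM: "ll j \<le> Mx" for j using alive(4)[of j] alive(4)[of i] by (auto simp: ll_def)
      have ll0: "ll j = 0" if "s \<le> j" for j using that alive(3) isl by (simp add: ll_def part_eq_0)
      have pm: "prefix_min ll j \<le> ll j" for j by (rule prefix_min_le) simp
      have pmM: "prefix_min ll j \<le> Mx" for j using pm[of j] llM[of j] by simp
      have pm0: "prefix_min ll j = 0" if "s \<le> j" for j using pm[of j] ll0[OF that] by simp
      have b: "bump (s - 1 - i) (uact ?w g) = rev_compl Mx s ll"
      proof
        fix j
        show "bump (s - 1 - i) (uact ?w g) j = rev_compl Mx s ll j"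
        proof (cases "j = s - 1 - i")
          case True
          have "s - 1 - i < s" "s - 1 - (s - 1 - i) = i" using isl by auto
          then show ?thesis
            unfolding True bump_def fun_upd_same alive(2) rev_compl_def ll_def using False alive(4)[of i] by simp
        next
          case jn: False
          then have "s - 1 - j \<noteq> i" if "j < s" using that isl by auto
          then show ?thesis unfolding bump_def fun_upd_other[OF jn] alive(2) rev_compl_def ll_def by simp
        qed
      qed
      have t: "tail_max (bump (s - 1 - i) (uact ?w g)) = rev_compl Mx s (part \<mu>'')"
        unfolding b tail_max_rev_compl p ..
      \<comment> \<open>The sizes of a sequence and of its complement add up to the area of the box,
        so the loss under prefix minima is the gain under tail maxima and the powers of - \<beta>
        agree.\<close>
      have sz: "seq_size (rev_compl Mx s ll) + seq_size ll = s * Mx"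
        "seq_size (rev_compl Mx s (prefix_min ll)) + seq_size (prefix_min ll) = s * Mx"
        by (auto intro!: seq_size_rev_compl llM ll0 pmM pm0)
      have e: "seq_size ll - seq_size (prefix_min ll) =
          seq_size (tail_max (bump (s - 1 - i) (uact ?w g))) - seq_size (bump (s - 1 - i) (uact ?w g))"
        unfolding t unfolding p b
        using sz part_prefix_min(3)[OF finl] by linarith
      have U: "U_op i (Poly_Mapping.single \<mu>' 1) =
          Poly_Mapping.single \<mu>'' ((- beta0) ^ (seq_size ll - seq_size (prefix_min ll)))"
        unfolding U_op_def lin_ext_single using False
        by (simp add: scale_single Let_def ll_def \<mu>''_def)
      define w0 where "w0 = ?w"
      have "word_op U_pair (i # w) (Poly_Mapping.single (lam, \<mu>) c) =
          Poly_Mapping.single (lam, \<mu>'') (c * (- beta0) ^ uexp (map (\<lambda>i. s - 1 - i) (i # w)) g)"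
        unfolding red U e list.map(2) w0_def[symmetric]
        by (simp add: lin_ext_single basis_vec_def scale_single power_add mult.assoc)
      moreover have "uact (map (\<lambda>i. s - 1 - i) (i # w)) g = rev_compl Mx s (part \<mu>'')"
        using t by (simp only: list.map(2) uact.simps)
      moreover have "part_length \<mu>'' \<le> s"
      proof (rule ccontr)
        assume "\<not> part_length \<mu>'' \<le> s"
        then have "0 < part \<mu>'' s" by (simp add: part_pos_iff)
        then show False using pm0[of s] by (simp add: p)
      qed
      ultimately show ?thesis using pmM p by auto
    qed
  qed
qed

subsection \<open>Evaluation\<close>

lemma of_rat_poly_mult:
  "map_poly of_rat (p * q) = map_poly of_rat p * (map_poly of_rat q :: complex poly)"
  by (rule poly_eqI) (simp add: coeff_map_poly coeff_mult of_rat_sum of_rat_mult)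

lemma of_rat_poly_add:
  "map_poly of_rat (p + q) = map_poly of_rat p + (map_poly of_rat q :: complex poly)"
  by (rule poly_eqI) (simp add: coeff_map_poly of_rat_add)

lemma embed_mult: "rat_poly_embed (p * q) = rat_poly_embed p * rat_poly_embed q"
  by (simp add: rat_poly_embed_def of_rat_poly_mult)

lemma embed_add: "rat_poly_embed (p + q) = rat_poly_embed p + rat_poly_embed q"
  by (simp add: rat_poly_embed_def of_rat_poly_add)

lemma embed_0 [simp]: "rat_poly_embed 0 = 0"
  by (simp add: rat_poly_embed_def Zero_fract_def)

lemma embed_1 [simp]: "rat_poly_embed 1 = 1"
  by (simp add: rat_poly_embed_def One_fract_def)

lemma embed_uminus: "rat_poly_embed (- p) = - rat_poly_embed p"
  using embed_add[of p "- p"] by (simp add: eq_neg_iff_add_eq_0 add.commute)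

lemma embed_power: "rat_poly_embed (p ^ k) = rat_poly_embed p ^ k"
  by (induction k) (simp_all add: embed_mult)

lemma embed_beta0: "rat_poly_embed beta0 = beta"
  by (simp add: rat_poly_embed_def beta0_def beta_def map_poly_pCons)

lemma skew_Groth_map_eq:
  assumes "finite B" "Poly_Mapping.keys v \<subseteq> B"
  shows "skew_Groth_map v =
    (\<Sum>p\<in>B. mconst (rat_poly_embed (Poly_Mapping.lookup v p)) * skew_Groth (fst p) (snd p))"
  unfolding skew_Groth_map_def case_prod_unfold prod.collapse
  by (rule sum.mono_neutral_left) (use assms in \<open>auto simp: in_keys_iff\<close>)

lemma skew_Groth_map_add: "skew_Groth_map (v + w) = skew_Groth_map v + skew_Groth_map w"
proof -
  let ?B = "Poly_Mapping.keys v \<union> Poly_Mapping.keys w"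
  have "Poly_Mapping.keys (v + w) \<subseteq> ?B" by (rule Poly_Mapping.keys_add)
  then show ?thesis
    by (simp add: skew_Groth_map_eq[of ?B] lookup_add embed_add mconst_add distrib_right sum.distrib)
qed

lemma skew_Groth_map_0: "skew_Groth_map 0 = 0"
  by (simp add: skew_Groth_map_def)

lemma skew_Groth_map_sum: "skew_Groth_map (sum f A) = (\<Sum>a\<in>A. skew_Groth_map (f a))"
  by (induction A rule: infinite_finite_induct) (simp_all add: skew_Groth_map_add skew_Groth_map_0)

lemma skew_Groth_map_scale:
  "skew_Groth_map (Poly_Mapping.map ((*) c) v) = mconst (rat_poly_embed c) * skew_Groth_map v"
proof -
  have "Poly_Mapping.keys (Poly_Mapping.map ((*) c) v) \<subseteq> Poly_Mapping.keys v"
    by (auto simp: in_keys_iff lookup_scale)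
  then show ?thesis
    by (simp add: skew_Groth_map_eq[of "Poly_Mapping.keys v"] lookup_scale embed_mult mconst_mult
        sum_distrib_left mult.assoc)
qed

lemma skew_Groth_map_single:
  "skew_Groth_map (Poly_Mapping.single (lam, \<mu>) c) = mconst (rat_poly_embed c) * skew_Groth lam \<mu>"
proof -
  have "Poly_Mapping.keys (Poly_Mapping.single (lam, \<mu>) c) \<subseteq> {(lam, \<mu>)}" by (simp add: keys_single)
  then show ?thesis by (simp add: skew_Groth_map_eq[of "{(lam, \<mu>)}"])
qed

lemma skew_Groth_map_Sym_hat: "skew_Groth_map v \<in> Sym_hat"
  unfolding skew_Groth_map_def case_prod_unfold
  by (intro Sym_hat_sum Sym_hat_mult Sym_hat_const skew_Groth_Sym_hat)

lemma vmon_rev: "vmon (\<lambda>j. n + (s - 1 - j)) s a = vmon (\<lambda>i. n + i) s (\<lambda>i. a (s - 1 - i))"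
  unfolding vmon_def
  by (rule sum.reindex_bij_witness[of _ "\<lambda>i. s - 1 - i" "\<lambda>j. s - 1 - j"]) auto

lemma y_coeff_rev_compl:
  assumes M: "\<And>i. part \<mu> i \<le> Mx"
  shows "y_coeff n s Mx m Q (rev_compl Mx s (part \<mu>)) = mcoeff (Q * y_kernel n s) (y_exponent n s \<mu> + m)"
proof -
  have c1: "\<forall>j<s. rev_compl Mx s (part \<mu>) j \<le> Mx + j" by (simp add: rev_compl_def trans_le_add1)
  have c2: "vmon (\<lambda>j. n + (s - 1 - j)) s (\<lambda>j. Mx + j - rev_compl Mx s (part \<mu>) j) = y_exponent n s \<mu>"
    unfolding vmon_rev y_exponent_def vmon_def
  proof (rule sum.cong[OF refl])
    fix i assume "i \<in> {..<s}"
    then have "Mx + (s - 1 - i) - rev_compl Mx s (part \<mu>) (s - 1 - i) = part \<mu> i + (s - 1 - i)"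
      using M[of i] by (simp add: rev_compl_def)
    then show "replicate_mset (Mx + (s - 1 - i) - rev_compl Mx s (part \<mu>) (s - 1 - i)) (n + i) =
        replicate_mset (part \<mu> i + (s - 1 - i)) (n + i)" by (rule arg_cong)
  qed
  show ?thesis unfolding y_coeff_def if_P[OF c1] c2 by (simp only: add.commute)
qed

text \<open>If \<open>U\<close> kills the pair, entry 0 of the sequence exceeds \<open>Mx\<close>,
  and \<open>y_coeff\<close> vanishes by its condition at j = 0, which is tested only when s >
  0.\<close>

lemma U_word_value:
  assumes w: "set w \<subseteq> {..<s}" and l: "part_length \<mu> \<le> s" and M: "\<And>i. part \<mu> i \<le> Mx"
    and m: "set_mset m \<subseteq> {..<n}" and s: "0 < s"
  shows "mcoeff (skew_Groth_map (word_op U_pair w (Poly_Mapping.single (lam, \<mu>) c))) m =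
    rat_poly_embed c * ((- beta) ^ uexp (map (\<lambda>i. s - 1 - i) w) (rev_compl Mx s (part \<mu>)) *
      y_coeff n s Mx m (Groth lam) (uact (map (\<lambda>i. s - 1 - i) w) (rev_compl Mx s (part \<mu>))))"
  using word_op_U[OF w l M, of lam c]
proof (elim disjE exE conjE)
  fix \<mu>'
  assume a: "word_op U_pair w (Poly_Mapping.single (lam, \<mu>) c) =
        Poly_Mapping.single (lam, \<mu>') (c * (- beta0) ^ uexp (map (\<lambda>i. s - 1 - i) w) (rev_compl Mx s (part \<mu>)))"
    "uact (map (\<lambda>i. s - 1 - i) w) (rev_compl Mx s (part \<mu>)) = rev_compl Mx s (part \<mu>')"
    "part_length \<mu>' \<le> s" "\<forall>i. part \<mu>' i \<le> Mx"
  have W: "y_coeff n s Mx m (Groth lam) (rev_compl Mx s (part \<mu>')) = mcoeff (skew_Groth lam \<mu>') m"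
    unfolding skew_Groth_coeff[OF a(3) m] by (rule y_coeff_rev_compl) (use a(4) in blast)
  show ?thesis
    unfolding a(1,2) W
    by (simp only: skew_Groth_map_single embed_mult embed_power embed_uminus embed_beta0 mult.assoc
        mcoeff_mconst_mult)
next
  assume a: "word_op U_pair w (Poly_Mapping.single (lam, \<mu>) c) = 0"
    "Mx < uact (map (\<lambda>i. s - 1 - i) w) (rev_compl Mx s (part \<mu>)) 0"
  have "\<not> (\<forall>j<s. uact (map (\<lambda>i. s - 1 - i) w) (rev_compl Mx s (part \<mu>)) j \<le> Mx + j)"
  proof
    assume "\<forall>j<s. uact (map (\<lambda>i. s - 1 - i) w) (rev_compl Mx s (part \<mu>)) j \<le> Mx + j"
    then have "uact (map (\<lambda>i. s - 1 - i) w) (rev_compl Mx s (part \<mu>)) 0 \<le> Mx + 0" using s by blast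
    then show False using a(2) by simp
  qed
  then have "y_coeff n s Mx m (Groth lam) (uact (map (\<lambda>i. s - 1 - i) w) (rev_compl Mx s (part \<mu>))) = 0"
    unfolding y_coeff_def by (simp only: if_False)
  then show ?thesis by (simp add: a(1) skew_Groth_map_0)
qed

lemma antimono_rev_compl: "(\<And>i. part \<mu> i \<le> Mx) \<Longrightarrow> antimono (rev_compl Mx s (part \<mu>))"
  by (rule decseq_SucI) (use part_antimono[of _ _ \<mu>] in \<open>auto simp: rev_compl_def intro: diff_le_mono2\<close>)

text \<open>Reversing the alphabet turns the tableaux for \<open>>\<close> into ordinary ones, so
  \<open>straightening_nc_schur\<close> applies to the functional \<open>y_coeff\<close>; a second
  renaming matches the words with those of the \<open>U\<close> operators.\<close>

theorem schur_y_multiplication: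
  assumes le: "part_le \<rho> \<kappa>" and l: "part_length \<mu> \<le> s" and m: "set_mset m \<subseteq> {..<n}"
  shows "mcoeff (spoly (>) {n..<n + s} \<kappa> \<rho> * (Groth lam * y_kernel n s)) (y_exponent n s \<mu> + m) * rat_poly_embed c =
    mcoeff (skew_Groth_map (nc_schur_U s \<kappa> \<rho> (Poly_Mapping.single (lam, \<mu>) c))) m"
proof (cases "s = 0")
  case True
  \<comment> \<open>Without y variables there is at most the empty tableau, with the empty
    word.\<close>
  have ss: "ssyt (>) {} \<kappa> \<rho> = (if skew_cells \<kappa> \<rho> = {} then {\<lambda>_. undefined} else {})"
    by (auto simp: ssyt_def)
  show ?thesis
  proof (cases "skew_cells \<kappa> \<rho> = {}")
    case e: True
    have "column_word \<kappa> \<rho> T = []" for T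
      using set_cols_from[of \<kappa> \<rho> T 0] e by (simp add: column_word_eq)
    moreover have "cont \<kappa> \<rho> T = {#}" for T using e by (simp add: cont_def)
    ultimately show ?thesis
      using True e ss skew_Groth_coeff[OF l m, of lam]
      by (simp add: spoly_def nc_schur_U_def word_op_Nil skew_Groth_map_single mult.commute)
  next
    case False
    then show ?thesis using True ss by (simp add: spoly_def nc_schur_U_def skew_Groth_map_0)
  qed
next
  case False
  then have s: "0 < s" by simp
  define Mx where "Mx = part \<mu> 0"
  have M: "part \<mu> i \<le> Mx" for i unfolding Mx_def by (rule part_antimono) simp
  define g where "g = rev_compl Mx s (part \<mu>)"
  let ?w = "y_coeff n s Mx m (Groth lam)"
  let ?X = "ssyt (<) {..<s} \<kappa> \<rho>"
  let ?rv = "\<lambda>i. s - 1 - i" and ?Y = "\<lambda>j. n + (s - 1 - j)"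
  have symG: "symm (Groth lam)" using Groth_Sym_hat by (simp add: Sym_hat_iff)
  have gM: "g j \<le> Mx + j" for j by (simp add: g_def rev_compl_def trans_le_add1)
  have MMg: "y_exponent n s \<mu> = vmon ?Y s (\<lambda>j. Mx + j - g j)"
    unfolding vmon_rev y_exponent_def vmon_def
  proof (rule sum.cong[OF refl])
    fix i assume "i \<in> {..<s}"
    then have "Mx + (s - 1 - i) - g (s - 1 - i) = part \<mu> i + (s - 1 - i)"
      using M[of i] by (simp add: rev_compl_def g_def)
    then show "replicate_mset (part \<mu> i + (s - 1 - i)) (n + i) =
        replicate_mset (Mx + (s - 1 - i) - g (s - 1 - i)) (n + i)" by simp
  qed
  have "spoly (>) {n..<n + s} \<kappa> \<rho> = (\<Sum>T\<in>?X. mmon (image_mset ?Y (cont \<kappa> \<rho> T)) :: ratfun mfps)"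
    unfolding spoly_def
    by (subst sum_ssyt_rename[where A = "{..<s}" and lt = "(<)" and f = ?Y and g = "\<lambda>j. s - 1 - (j - n)"])
      (auto simp: cont_rename)
  then have "mcoeff (spoly (>) {n..<n + s} \<kappa> \<rho> * (Groth lam * y_kernel n s)) (y_exponent n s \<mu> + m) =
     (\<Sum>T\<in>?X. mcoeff (mmon (image_mset ?Y (cont \<kappa> \<rho> T)) * (Groth lam * y_kernel n s)) (m + vmon ?Y s (\<lambda>j. Mx + j - g j)))"
    by (simp only: sum_distrib_right mcoeff_sum MMg add.commute)
  also have "\<dots> = (\<Sum>T\<in>?X. ?w (\<lambda>t. g t + col_weight \<kappa> \<rho> (part \<kappa> 0) T t))"
  proof (rule sum.cong[OF refl])
    fix T assume T: "T \<in> ?X"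
    show "mcoeff (mmon (image_mset ?Y (cont \<kappa> \<rho> T)) * (Groth lam * y_kernel n s)) (m + vmon ?Y s (\<lambda>j. Mx + j - g j)) =
        ?w (\<lambda>t. g t + col_weight \<kappa> \<rho> (part \<kappa> 0) T t)"
      by (rule mcoeff_tableau_y_coeff[OF m symG T gM])
  qed
  also have "\<dots> = (\<Sum>T\<in>?X. (- beta) ^ uexp (column_word \<kappa> \<rho> T) g * ?w (uact (column_word \<kappa> \<rho> T) g))"
  proof (rule straightening_nc_schur[OF _ double_eq_zero_ratfun le])
    show "antimono g" unfolding g_def by (rule antimono_rev_compl[OF M])
    show "g i = 0" if "s \<le> i" for i using that by (simp add: g_def rev_compl_def)
  qed (rule y_coeff_relation[OF m symG])
  finally have L: "mcoeff (spoly (>) {n..<n + s} \<kappa> \<rho> * (Groth lam * y_kernel n s)) (y_exponent n s \<mu> + m) =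
      (\<Sum>T\<in>?X. (- beta) ^ uexp (column_word \<kappa> \<rho> T) g * ?w (uact (column_word \<kappa> \<rho> T) g))" .
  have "mcoeff (skew_Groth_map (nc_schur_U s \<kappa> \<rho> (Poly_Mapping.single (lam, \<mu>) c))) m =
     (\<Sum>T\<in>ssyt (>) {..<s} \<kappa> \<rho>.
        mcoeff (skew_Groth_map (word_op U_pair (column_word \<kappa> \<rho> T) (Poly_Mapping.single (lam, \<mu>) c))) m)"
    by (simp only: nc_schur_U_def skew_Groth_map_sum mcoeff_sum)
  also have "\<dots> = (\<Sum>T\<in>?X.
        mcoeff (skew_Groth_map (word_op U_pair (map ?rv (column_word \<kappa> \<rho> T)) (Poly_Mapping.single (lam, \<mu>) c))) m)"
    by (subst sum_ssyt_rename[where A = "{..<s}" and lt = "(<)" and f = ?rv and g = ?rv])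
      (auto simp: column_word_rename)
  also have "\<dots> = (\<Sum>T\<in>?X. rat_poly_embed c * ((- beta) ^ uexp (column_word \<kappa> \<rho> T) g * ?w (uact (column_word \<kappa> \<rho> T) g)))"
  proof (rule sum.cong[OF refl])
    fix T assume T: "T \<in> ?X"
    have cw: "set (column_word \<kappa> \<rho> T) \<subseteq> {..<s}"
      using set_cols_from[of \<kappa> \<rho> T 0] ssyt_entry[OF T] by (auto simp: column_word_eq)
    have rr: "map ?rv (map ?rv (column_word \<kappa> \<rho> T)) = column_word \<kappa> \<rho> T"
      unfolding map_map by (rule map_idI) (use cw in auto)
    have "set (map ?rv (column_word \<kappa> \<rho> T)) \<subseteq> {..<s}" using s by auto
    from U_word_value[OF this l M m s, of lam c, unfolded rr, folded g_def]
    show "mcoeff (skew_Groth_map (word_op U_pair (map ?rv (column_word \<kappa> \<rho> T)) (Poly_Mapping.single (lam, \<mu>) c))) m =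
       rat_poly_embed c * ((- beta) ^ uexp (column_word \<kappa> \<rho> T) g * ?w (uact (column_word \<kappa> \<rho> T) g))" .
  qed
  finally show ?thesis unfolding L by (simp only: sum_distrib_left mult.commute)
qed

section \<open>The product with a Schur function\<close>

lemma uword_length:
  assumes "part_length lam \<le> r" "set w \<subseteq> {..<r}"
  shows "part_length (uword w lam) \<le> r"
proof (rule ccontr)
  assume "\<not> ?thesis"
  then have "0 < uact w (part lam) r" using part_pos_iff[of "uword w lam" r] by (simp add: part_uword)
  moreover have "uact w (part lam) r = 0"
    by (rule uact_zero[of r]) (use assms in \<open>auto simp: part_eq_0\<close>)
  ultimately show False by simp
qed

text \<open>\<open>schur_mult_Alt\<close> divided by the Vandermonde product. Letters below r never
  create a part beyond row r, so all partitions that arise are short enough for the determinantal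
  formula.\<close>

lemma schur_mult_Groth:
  assumes l: "part_length lam \<le> r"
  shows "restr {..<r} (schur_fun \<kappa>) * restr {..<r} (Groth lam) =
    (\<Sum>T\<in>ssyt (<) {..<r} \<kappa> empty_part. mconst ((- beta) ^ uexp (column_word \<kappa> empty_part T) (part lam)) *
       restr {..<r} (Groth (uword (column_word \<kappa> empty_part T) lam)))"
    (is "?L = ?R")
proof -
  let ?S = "ssyt (<) {..<r} \<kappa> empty_part" and ?w = "column_word \<kappa> empty_part"
  have G: "Alt beta r (uact (?w T) (part lam)) = restr {..<r} (Groth (uword (?w T) lam)) * Vd id r"
    if T: "T \<in> ?S" for T
  proof -
    have "set (?w T) \<subseteq> {..<r}"
      using set_cols_from[of \<kappa> empty_part T 0] ssyt_entry[OF T] by (auto simp: column_word_eq)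
    then have "part_length (uword (?w T) lam) \<le> r" by (rule uword_length[OF l])
    then show ?thesis by (simp add: restr_Groth part_uword)
  qed
  have "?L * Vd id r = restr {..<r} (schur_fun \<kappa>) * Alt beta r (part lam)"
    by (simp add: restr_Groth[OF l] mult.assoc)
  also have "\<dots> = ?R * Vd id r"
    unfolding schur_mult_Alt[OF l] sum_distrib_right
    by (rule sum.cong[OF refl]) (simp add: G mconst_power mconst_uminus mult.assoc)
  finally have "Vd id r * (?L - ?R) = 0" by (simp only: right_diff_distrib mult.commute diff_self)
  then have "?L - ?R = 0" by (rule Vd_cancel[rotated]) simp
  then show ?thesis by simp
qed

lemma nc_schur_U_sum: "nc_schur_U s \<kappa> \<rho> (sum f A) = (\<Sum>a\<in>A. nc_schur_U s \<kappa> \<rho> (f a))"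
  unfolding nc_schur_U_def word_op_U_sum by (rule sum.swap)

text \<open>The restricted factor contains x only and hence passes through the extraction in
  y.\<close>

lemma mcoeff_mult_skew_Groth:
  assumes l: "part_length \<mu> \<le> s" and m: "set_mset m \<subseteq> {..<n}"
  shows "mcoeff (f * skew_Groth lam \<mu>) m =
    mcoeff (restr {..<n} f * (Groth lam * y_kernel n s)) (y_exponent n s \<mu> + m)"
proof -
  have Ms: "set_mset (y_exponent n s \<mu>) \<inter> {..<n} = {}"
    using set_mset_vmon[of "\<lambda>i. n + i" s] unfolding y_exponent_def by fastforce
  have "mcoeff (restr {..<n} f * (Groth lam * y_kernel n s)) (y_exponent n s \<mu> + m) =
     (\<Sum>a\<in>{a. a \<subseteq># m}. mcoeff (restr {..<n} f) a * mcoeff (Groth lam * y_kernel n s) (y_exponent n s \<mu> + (m - a)))"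
    by (rule mult_disjoint_vars[OF _ Ms]) (auto simp: mcoeff_restr split: if_splits)
  also have "\<dots> = (\<Sum>a\<in>{a. a \<subseteq># m}. mcoeff f a * mcoeff (skew_Groth lam \<mu>) (m - a))"
  proof (rule sum.cong[OF refl])
    fix a assume a: "a \<in> {a. a \<subseteq># m}"
    then have "set_mset a \<subseteq> {..<n}" using m set_mset_mono[of a m] by auto
    moreover have "set_mset (m - a) \<subseteq> {..<n}" using m set_mset_mono[of "m - a" m] by auto
    ultimately show "mcoeff (restr {..<n} f) a * mcoeff (Groth lam * y_kernel n s) (y_exponent n s \<mu> + (m - a)) =
        mcoeff f a * mcoeff (skew_Groth lam \<mu>) (m - a)"
      by (simp add: mcoeff_restr skew_Groth_coeff[OF l])
  qed
  finally show ?thesis by (simp add: mcoeff_mult)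
qed

text \<open>The coefficient lies in the first n + s variables, so every factor may be truncated to
  them, and there the product with G is the action of exactly n + s operators \<open>u\<close>. The
  y-factor is evaluated afterwards, for each resulting partition separately.\<close>

lemma schur_mult_skew_Groth_coeff:
  assumes r: "part_length lam \<le> n + s" and l: "part_length \<mu> \<le> s" and m: "set_mset m \<subseteq> {..<n}"
  shows "mcoeff (schur_fun \<nu> * skew_Groth lam \<mu>) m =
    mcoeff (skew_Groth_map (nc_super_schur (n + s) s \<nu> (basis_vec (lam, \<mu>)))) m"
proof -
  let ?K = "y_kernel n s" and ?N = "y_exponent n s \<mu> + m" and ?r = "n + s"
  let ?k = "\<lambda>\<kappa>. part_size \<nu> - part_size \<kappa>"
  let ?w = "\<lambda>\<kappa> T. column_word \<kappa> empty_part T"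
  let ?S = "\<lambda>\<kappa>. ssyt (<) {..<?r} \<kappa> empty_part"
  let ?Y = "\<lambda>\<kappa>. spoly (>) {n..<?r} (conj_part \<nu>) (conj_part \<kappa>) :: ratfun mfps"
  have N: "set_mset ?N \<subseteq> {..<?r}"
    using set_mset_vmon[of "\<lambda>i. n + i" s] m unfolding y_exponent_def by fastforce
  have summand: "mcoeff (?Y \<kappa> * restr {..<?r} (schur_fun \<kappa>) * (Groth lam * ?K)) ?N =
      mcoeff (skew_Groth_map (nc_schur_U s (conj_part \<nu>) (conj_part \<kappa>)
        (nc_schur_u ?r \<kappa> empty_part (basis_vec (lam, \<mu>))))) m" if k: "part_le \<kappa> \<nu>" for \<kappa>
  proof -
    let ?e = "\<lambda>T. uexp (?w \<kappa> T) (part lam)" and ?G = "\<lambda>T. Groth (uword (?w \<kappa> T) lam)"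
    have "mcoeff (?Y \<kappa> * restr {..<?r} (schur_fun \<kappa>) * (Groth lam * ?K)) ?N =
        mcoeff (restr {..<?r} (?Y \<kappa> * restr {..<?r} (schur_fun \<kappa>) * (Groth lam * ?K))) ?N"
      using N by (simp only: mcoeff_restr if_True)
    also have "restr {..<?r} (?Y \<kappa> * restr {..<?r} (schur_fun \<kappa>) * (Groth lam * ?K)) =
        (restr {..<?r} (schur_fun \<kappa>) * restr {..<?r} (Groth lam)) * (restr {..<?r} (?Y \<kappa>) * restr {..<?r} ?K)"
      by (simp only: restr_mult restr_restr Int_absorb mult_ac)
    also have "\<dots> = (\<Sum>T\<in>?S \<kappa>. mconst ((- beta) ^ ?e T) * restr {..<?r} (?Y \<kappa> * (?G T * ?K)))"
      unfolding schur_mult_Groth[OF r] sum_distrib_right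
      by (rule sum.cong[OF refl]) (simp only: restr_mult mult_ac)
    also have "mcoeff \<dots> ?N = (\<Sum>T\<in>?S \<kappa>. (- beta) ^ ?e T * mcoeff (?Y \<kappa> * (?G T * ?K)) ?N)"
      unfolding mcoeff_sum mcoeff_mconst_mult
      by (rule sum.cong[OF refl]) (use N in \<open>simp only: mcoeff_restr if_True\<close>)
    also have "\<dots> = (\<Sum>T\<in>?S \<kappa>. mcoeff (skew_Groth_map (nc_schur_U s (conj_part \<nu>) (conj_part \<kappa>)
        (Poly_Mapping.single (uword (?w \<kappa> T) lam, \<mu>) ((- beta0) ^ ?e T)))) m)"
    proof (rule sum.cong[OF refl])
      fix T
      have "part_le (conj_part \<kappa>) (conj_part \<nu>)" using k by simp
      from schur_y_multiplication[OF this l m, of "uword (?w \<kappa> T) lam" "(- beta0) ^ ?e T"]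
      show "(- beta) ^ ?e T * mcoeff (?Y \<kappa> * (?G T * ?K)) ?N =
         mcoeff (skew_Groth_map (nc_schur_U s (conj_part \<nu>) (conj_part \<kappa>)
        (Poly_Mapping.single (uword (?w \<kappa> T) lam, \<mu>) ((- beta0) ^ ?e T)))) m"
        by (simp only: embed_power embed_uminus embed_beta0 mult.commute)
    qed
    also have "\<dots> = mcoeff (skew_Groth_map (nc_schur_U s (conj_part \<nu>) (conj_part \<kappa>)
        (nc_schur_u ?r \<kappa> empty_part (basis_vec (lam, \<mu>))))) m"
      by (simp only: nc_schur_u_def basis_vec_def word_op_u mult_1_left nc_schur_U_sum
          skew_Groth_map_sum mcoeff_sum)
    finally show ?thesis .
  qed
  have sgn: "(-1) ^ k * f = mconst ((-1) ^ k) * f" for k and f :: "ratfun mfps"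
    by (simp add: mconst_power mconst_uminus)
  have emb: "rat_poly_embed ((-1) ^ k) = (-1) ^ k" for k
    by (simp add: embed_power embed_uminus)
  have "mcoeff (schur_fun \<nu> * skew_Groth lam \<mu>) m =
      mcoeff (restr {..<n} (schur_fun \<nu>) * (Groth lam * ?K)) ?N"
    by (rule mcoeff_mult_skew_Groth[OF l m])
  also have "\<dots> = (\<Sum>\<kappa> | part_le \<kappa> \<nu>. (-1) ^ ?k \<kappa> *
      mcoeff (?Y \<kappa> * restr {..<?r} (schur_fun \<kappa>) * (Groth lam * ?K)) ?N)"
    unfolding schur_super_expansion[of n \<nu> s] sum_distrib_right mcoeff_sum
    by (rule sum.cong[OF refl]) (simp only: sgn mult.assoc mcoeff_mconst_mult)
  also have "\<dots> = (\<Sum>\<kappa> | part_le \<kappa> \<nu>. (-1) ^ ?k \<kappa> *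
      mcoeff (skew_Groth_map (nc_schur_U s (conj_part \<nu>) (conj_part \<kappa>)
        (nc_schur_u ?r \<kappa> empty_part (basis_vec (lam, \<mu>))))) m)"
    by (rule sum.cong[OF refl]) (simp only: summand mem_Collect_eq)
  also have "\<dots> = mcoeff (skew_Groth_map (nc_super_schur ?r s \<nu> (basis_vec (lam, \<mu>)))) m"
    unfolding nc_super_schur_def skew_Groth_map_sum mcoeff_sum skew_Groth_map_scale emb
      mcoeff_mconst_mult ..
  finally show ?thesis .
qed

theorem proposition7p4:
  fixes lam \<mu> \<nu> :: partition and r s :: nat
  assumes "part_le \<mu> lam"
    and "part_length lam \<le> r"
    and "part_length \<mu> \<le> s"
  shows "schur_fun \<nu> * skew_Groth lam \<mu>
           - skew_Groth_map (nc_super_schur r s \<nu> (basis_vec (lam, \<mu>))) \<in> I_hat (int r - int s)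
       \<and> (\<forall>n::nat. int n \<le> int r - int s \<longrightarrow>
            restrict_vars n (schur_fun \<nu>) * restrict_vars n (skew_Groth lam \<mu>)
              = restrict_vars n (skew_Groth_map (nc_super_schur r s \<nu> (basis_vec (lam, \<mu>)))))"
proof -
  let ?L = "schur_fun \<nu> * skew_Groth lam \<mu>"
  let ?R = "skew_Groth_map (nc_super_schur r s \<nu> (basis_vec (lam, \<mu>)))"
  have eq: "restr {..<n} ?L = restr {..<n} ?R" if n: "int n \<le> int r - int s" for n
  proof (rule mfps_eqI)
    fix m
    \<comment> \<open>The splitting always uses r - s variables x, so that x and y together are the
      r variables belonging to the operators \<open>u\<close>; a smaller n only restricts the
      monomials that are compared.\<close>
    define k where "k = r - s"
    have k: "r = k + s" "n \<le> k" using n by (auto simp: k_def)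
    have "mcoeff ?L m = mcoeff ?R m" if "set_mset m \<subseteq> {..<n}"
      unfolding k(1) by (rule schur_mult_skew_Groth_coeff) (use assms k that in auto)
    then show "mcoeff (restr {..<n} ?L) m = mcoeff (restr {..<n} ?R) m" by (simp add: mcoeff_restr)
  qed
  have "?L - ?R \<in> Sym_hat"
    by (intro Sym_hat_diff Sym_hat_mult skew_Groth_Sym_hat skew_Groth_map_Sym_hat
        Sym_imp_Sym_hat schur_fun_Sym)
  moreover have "restr {..<nat (int r - int s)} (?L - ?R) = 0" if "0 \<le> int r - int s"
    using eq[of "nat (int r - int s)"] that by (simp add: restr_diff)
  ultimately have "?L - ?R \<in> I_hat (int r - int s)" by (simp add: I_hat_def restrict_vars_eq)
  moreover have "restrict_vars n (schur_fun \<nu>) * restrict_vars n (skew_Groth lam \<mu>) = restrict_vars n ?R"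
    if "int n \<le> int r - int s" for n
    using eq[OF that] by (simp add: restrict_vars_eq restr_mult)
  ultimately show ?thesis by blast
qed

end
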